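(* Let $f$ be a bounded simple ordered graph parameter. Then the following are equivalent: (1) $f$ is naturally estimable. (2) For every convergent sequence $\{G_n\}_{n\in\mathbb{N}}$ of simple ordered graphs with $|V(G_n)|\to\infty$, the sequence of numbers $\{f(G_n)\}_{n\in\mathbb{N}}$ is convergent. (3) There exists a functional $\hat f:\mathcal{W}\to\mathbb{R}$ such that: (a) $\hat f$ is continuous with respect to $d_\triangle$; (b) for every $\varepsilon>0$ there is $k=k(\varepsilon)$ such that for every simple ordered graph $G$ with $|V(G)|\ge k$ it holds that $\left|\hat f(W_G)-f(G)\right|\le\varepsilon$.
   Context: A simple ordered graph on $n$ vertices is a symmetric function $G:[n]^2\to\{0,1\}$ with $G(i,i)=0$; ordered graphs are isomorphic only if equal. A simple ordered graph parameter is a real-valued function $f$ on simple ordered graphs. It is naturally estimable if for every $\varepsilon>0$ and $\delta>0$ there is a positive integer $k=k(\varepsilon,\delta)$ such that: if $G$ is a simple ordered graph with at least $k$ nodes and $G|_{\mathbf{k}}$ is the (ordered) subgraph of $G$ induced by a uniformly random set of exactly $k$ nodes of $G$ (with inherited order), then $\Pr[|f(G)-f(G|_{\mathbf{k}})|>\varepsilon]<\delta$. For a simple ordered graph $F$ on $k$ vertices and a simple ordered graph $G$, $t(F,G)$ is the probability that, if $k$ vertices of $G$ are picked uniformly and independently (repetitions allowed) and sorted as $x_1\le\cdots\le x_k$, then $F(i,j)=G(x_i,x_j)$ for all $i,j\in[k]$. A sequence $\{G_n\}$ is convergent if $|V(G_n)|\to\infty$ and $t(F,G_n)$ converges for every simple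 ordered graph $F$. An orderon is a (Lebesgue) measurable function $W:([0,1]^2)^2\to[0,1]$ with $W(u,v)=W(v,u)$; $\mathcal{W}$ is the set of all orderons. For a graph $G$ on $[n]$, $W_G((x,a),(y,b))=G(Q_n(x),Q_n(y))$ with $Q_n(x)=\lceil nx\rceil$ for $x>0$, $Q_n(0)=1$. The cut-shift distance is $d_\triangle(W,U)=\inf_{f}\left(\mathrm{Shift}(f)+\|W-U^f\|_\square\right)$ over bijections $f$ of $[0,1]^2$ such that $f$ and $f^{-1}$ are Lebesgue measure preserving, where $U^f(u,v)=U(f(u),f(v))$, $\mathrm{Shift}(f)=\sup_{(x,a)}|x-\pi_1(f(x,a))|$, $\pi_1(y,b)=y$, and $\|X\|_\square=\sup_{S,T\subseteq[0,1]^2}|\int_{S\times T}X|$ over measurable $S,T$. *)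

theory Defs
  imports "HOL-Probability.Probability"
begin

text \<open>
  The vertex set is \<open>{1..n}\<close> with \<open>n \<ge> 1\<close>. The adjacency relation is required to be
  false outside of \<open>{1..n}\<close>, so that HOL equality of graphs is equality of functions on
  \<open>{1..n} \<times> {1..n}\<close>; this is the only notion of isomorphism of ordered graphs.
\<close>

typedef ordered_graph =
  "{(n :: nat, E :: nat \<Rightarrow> nat \<Rightarrow> bool). 1 \<le> n \<and>
     (\<forall>i j. E i j \<longrightarrow> i \<in> {1..n} \<and> j \<in> {1..n}) \<and>
     (\<forall>i j. E i j = E j i) \<and> (\<forall>i. \<not> E i i)}"
  by (rule exI[of _ "(1, \<lambda>_ _. False)"]) auto

definition num_vertices :: "ordered_graph \<Rightarrow> nat" where
  "num_vertices G = fst (Rep_ordered_graph G)"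

definition adj :: "ordered_graph \<Rightarrow> nat \<Rightarrow> nat \<Rightarrow> bool" where
  "adj G = snd (Rep_ordered_graph G)"

text \<open>
  The element of \<open>S\<close> at position \<open>i - 1\<close> of the increasing enumeration becomes vertex \<open>i\<close>.
  Only finite nonempty \<open>S\<close> is meaningful, see \<open>Rep_induced\<close> below.
\<close>

definition induced :: "ordered_graph \<Rightarrow> nat set \<Rightarrow> ordered_graph" where
  "induced G S = Abs_ordered_graph (card S, \<lambda>i j. i \<in> {1..card S} \<and> j \<in> {1..card S} \<and>
     adj G (sorted_list_of_set S ! (i - 1)) (sorted_list_of_set S ! (j - 1)))"

lemma adj_sym: "adj G i j = adj G j i"
  and adj_irrefl: "\<not> adj G i i"
  and adj_vertices: "adj G i j \<Longrightarrow> i \<in> {1..num_vertices G} \<and> j \<in> {1..num_vertices G}"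
  and num_vertices_ge_1: "1 \<le> num_vertices G"
  using Rep_ordered_graph[of G] unfolding adj_def num_vertices_def by (auto split: prod.splits)

lemma Rep_induced:
  assumes "finite S" "S \<noteq> {}"
  shows "Rep_ordered_graph (induced G S) = (card S, \<lambda>i j. i \<in> {1..card S} \<and> j \<in> {1..card S} \<and>
     adj G (sorted_list_of_set S ! (i - 1)) (sorted_list_of_set S ! (j - 1)))"
  unfolding induced_def
proof (rule Abs_ordered_graph_inverse)
  have "1 \<le> card S"
    using assms by (simp add: Suc_leI card_gt_0_iff)
  then show "(card S, \<lambda>i j. i \<in> {1..card S} \<and> j \<in> {1..card S} \<and>
     adj G (sorted_list_of_set S ! (i - 1)) (sorted_list_of_set S ! (j - 1)))
     \<in> {(n, E). 1 \<le> n \<and> (\<forall>i j. E i j \<longrightarrow> i \<in> {1..n} \<and> j \<in> {1..n}) \<and>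
       (\<forall>i j. E i j = E j i) \<and> (\<forall>i. \<not> E i i)}"
    by (auto simp: adj_irrefl adj_sym)
qed

lemma num_vertices_induced: "finite S \<Longrightarrow> S \<noteq> {} \<Longrightarrow> num_vertices (induced G S) = card S"
  by (simp add: num_vertices_def Rep_induced)

lemma adj_induced:
  "finite S \<Longrightarrow> S \<noteq> {} \<Longrightarrow> i \<in> {1..card S} \<Longrightarrow> j \<in> {1..card S} \<Longrightarrow>
    adj (induced G S) i j =
      adj G (sorted_list_of_set S ! (i - 1)) (sorted_list_of_set S ! (j - 1))"
  by (simp add: adj_def Rep_induced)

definition random_subset :: "ordered_graph \<Rightarrow> nat \<Rightarrow> nat set pmf" where
  "random_subset G k = pmf_of_set {S. S \<subseteq> {1..num_vertices G} \<and> card S = k}"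

definition naturally_estimable :: "(ordered_graph \<Rightarrow> real) \<Rightarrow> bool" where
  "naturally_estimable f \<longleftrightarrow>
     (\<forall>\<epsilon>>0. \<forall>\<delta>>0. \<exists>k\<ge>1. \<forall>G. num_vertices G \<ge> k \<longrightarrow>
        measure_pmf.prob (random_subset G k) {S. \<bar>f G - f (induced G S)\<bar> > \<epsilon>} < \<delta>)"

definition subgraph_density :: "ordered_graph \<Rightarrow> ordered_graph \<Rightarrow> real" where
  "subgraph_density F G =
     measure_pmf.prob (replicate_pmf (num_vertices F) (pmf_of_set {1..num_vertices G}))
       {xs. \<forall>i\<in>{1..num_vertices F}. \<forall>j\<in>{1..num_vertices F}.
              adj F i j = adj G (sort xs ! (i - 1)) (sort xs ! (j - 1))}"

definition graph_seq_convergent :: "(nat \<Rightarrow> ordered_graph) \<Rightarrow> bool" where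
  "graph_seq_convergent G \<longleftrightarrow>
     filterlim (\<lambda>n. num_vertices (G n)) at_top sequentially \<and>
     (\<forall>F. convergent (\<lambda>n. subgraph_density F (G n)))"

type_synonym point = "real \<times> real"

definition unit_square :: "point set" where
  "unit_square = {0..1} \<times> {0..1}"

text \<open>
  The extensional function space makes equality of orderons equality of functions on
  \<open>unit_square \<times> unit_square\<close> (everywhere, not just almost everywhere).
\<close>

definition orderons :: "(point \<times> point \<Rightarrow> real) set" where
  "orderons = {W \<in> unit_square \<times> unit_square \<rightarrow>\<^sub>E {0..1}.
     W \<in> borel_measurable (lebesgue_on (unit_square \<times> unit_square)) \<and>
     (\<forall>u\<in>unit_square. \<forall>v\<in>unit_square. W (u, v) = W (v, u))}"

definition quant :: "nat \<Rightarrow> real \<Rightarrow> nat" where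
  "quant n x = (if x > 0 then nat \<lceil>real n * x\<rceil> else 1)"

definition graph_orderon :: "ordered_graph \<Rightarrow> point \<times> point \<Rightarrow> real" where
  "graph_orderon G = (\<lambda>((x, a), (y, b))\<in>unit_square \<times> unit_square.
     of_bool (adj G (quant (num_vertices G) x) (quant (num_vertices G) y)))"

definition measure_preserving_map :: "'a measure \<Rightarrow> ('a \<Rightarrow> 'a) \<Rightarrow> bool" where
  "measure_preserving_map M f \<longleftrightarrow>
     f \<in> measurable M M \<and> (\<forall>A\<in>sets M. emeasure M (f -` A \<inter> space M) = emeasure M A)"

definition mp_bijections :: "(point \<Rightarrow> point) set" where
  "mp_bijections = {f. bij_betw f unit_square unit_square \<and>
     measure_preserving_map (lebesgue_on unit_square) f \<and>
     measure_preserving_map (lebesgue_on unit_square) (inv_into unit_square f)}"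

definition shift :: "(point \<Rightarrow> point) \<Rightarrow> real" where
  "shift f = (SUP p\<in>unit_square. \<bar>fst p - fst (f p)\<bar>)"

definition cut_norm :: "(point \<times> point \<Rightarrow> real) \<Rightarrow> real" where
  "cut_norm X =
     (SUP (S, T)\<in>sets (lebesgue_on unit_square) \<times> sets (lebesgue_on unit_square).
        \<bar>LINT z:S \<times> T|lebesgue. X z\<bar>)"

definition cut_shift_dist ::
  "(point \<times> point \<Rightarrow> real) \<Rightarrow> (point \<times> point \<Rightarrow> real) \<Rightarrow> real" where
  "cut_shift_dist W U =
     (INF f\<in>mp_bijections. shift f + cut_norm (\<lambda>(u, v). W (u, v) - U (f u, f v)))"

text \<open>\<^const>\<open>cut_shift_dist\<close> is only a pseudometric, so continuity is stated with balls.\<close>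

definition cut_shift_continuous :: "((point \<times> point \<Rightarrow> real) \<Rightarrow> real) \<Rightarrow> bool" where
  "cut_shift_continuous h \<longleftrightarrow>
     (\<forall>W\<in>orderons. \<forall>\<epsilon>>0. \<exists>\<delta>>0. \<forall>U\<in>orderons. cut_shift_dist W U < \<delta> \<longrightarrow> \<bar>h W - h U\<bar> < \<epsilon>)"

end

theory Submission
  imports Defs "HOL-Library.Diagonal_Subsequence" "HOL-Combinatorics.Multiset_Permutations" "HOL-Library.Disjoint_Sets"
begin

text \<open>
  Estimability passes to convergence because the value of an estimable parameter at a large graph
  is nearly its average over random induced subgraphs of a fixed size, a fixed linear combination of
  subgraph densities (\<open>estimable_imp_convergent\<close>). Conversely, suppose that for every sample size
  \<open>k\<close> some graph has a non-negligible proportion of bad samples. Tuple averages of a graph are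
  reproduced by random subsets of size \<open>k\<close> up to a variance of order \<open>1/k\<close>, so a bad sample can be
  chosen that is typical for countably many such averages at once (\<open>typical_bad_sample\<close>). Taking
  subgraph densities as averages contradicts convergence (\<open>convergent_imp_estimable\<close>).

  Ordered densities extend to orderons as integrals of products over pairs of points, one factor for
  adjacency and one for the order of the positions. Replacing factors one at a time changes the integral
  by at most a cut norm, and a rearrangement of small shift changes the order of positions only on a
  narrow band. Hence densities are Lipschitz in the cut-shift distance, and a parameter which is
  uniformly approximated by combinations of densities extends continuously
  (\<open>estimable_imp_continuous_extension\<close>).

  For the remaining implication, from a continuous extension to estimability, continuity holds only
  pointwise, so compactness is needed: a limit orderon common to bad graphs and to their bad samples.
  A weak regularity argument gives each graph nested partitions into \<open>4 ^ r\<close> classes whose step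
  averages approximate it in four-cycle density (\<open>weak_regularity_labels\<close>). Along a subsequence, the
  step values and the distributions of the labels along the vertex order converge. Labels with the
  limit distribution exist on the square (\<open>nested_labels_exist\<close>), the limit step functions on them
  are nested averages and converge in mean to an orderon (\<open>graph_limit_orderon\<close>), and measure
  preserving bijections that permute small cells within narrow vertical strips match the labels of
  the graphs to those of the orderon, so that the graphs converge to it in the cut-shift distance
  (\<open>labelled_graphs_converge\<close>). Label distributions and four-cycle densities are averages over short
  tuples. A typical bad sample therefore inherits the limit data of its graph and converges to the same
  orderon, where continuity contradicts badness (\<open>continuous_extension_imp_estimable\<close>).
\<close>

section \<open>Averages over tuples and random subsets\<close>

text \<open>Unlike \<open>n_lists\<close>-style enumerations, tuples are a set of lists, so that sampling with repetition is a plain average.\<close>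

definition tuples :: "'a set => nat => 'a list set" where
 "tuples V j = {xs. set xs \<subseteq> V & length xs = j}"

definition distinct_tuples :: "'a set => nat => 'a list set" where
 "distinct_tuples V j = {xs \<in> tuples V j. distinct xs}"

definition tuple_avg :: "'a set => nat => ('a list => real) => real" where
 "tuple_avg V j g = (\<Sum>xs\<in>tuples V j. g xs) / real (card V) ^ j"

definition subsets_of_card :: "'a set => nat => 'a set set" where
 "subsets_of_card V k = {S. S \<subseteq> V & card S = k}"

definition subset_avg :: "'a set => nat => ('a set => real) => real" where
 "subset_avg V k phi = (\<Sum>S\<in>subsets_of_card V k. phi S) / real (card V choose k)"

lemma finite_tuples: "finite V ==> finite (tuples V j)"
 unfolding tuples_def by (rule finite_lists_length_eq)

lemma finite_distinct_tuples: "finite V ==> finite (distinct_tuples V j)"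
 unfolding distinct_tuples_def by (simp add: finite_tuples)

lemma card_tuples: "finite V ==> card (tuples V j) = card V ^ j"
 unfolding tuples_def by (rule card_lists_length_eq)

lemma tuples_0: "tuples V 0 = {[]}"
 by (auto simp: tuples_def)

lemma tuples_Suc: "tuples V (Suc j) = (%(x, xs). x # xs) ` (V \<times> tuples V j)"
 by (auto simp: tuples_def image_iff length_Suc_conv)

lemma sum_tuples_Suc:
 "(\<Sum>xs\<in>tuples V (Suc j). g xs) = (\<Sum>x\<in>V. \<Sum>xs\<in>tuples V j. g (x # xs))"
proof -
 have "inj_on (%(x, xs). x # xs) (V \<times> tuples V j)" by (auto simp: inj_on_def)
 then show ?thesis
  unfolding tuples_Suc sum.cartesian_product by (subst sum.reindex) (auto simp: case_prod_beta)
qed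

lemma finite_subsets_of_card: "finite V ==> finite (subsets_of_card V k)"
 unfolding subsets_of_card_def by simp

lemma card_subsets_of_card: "finite V ==> card (subsets_of_card V k) = card V choose k"
 unfolding subsets_of_card_def by (rule n_subsets)

lemma tuple_avg_abs_le:
 assumes V: "finite V" and g: "!!xs. xs \<in> tuples V j ==> \<bar>g xs\<bar> <= 1"
 shows "\<bar>tuple_avg V j g\<bar> <= 1"
proof -
 have "\<bar>\<Sum>xs\<in>tuples V j. g xs\<bar> <= (\<Sum>xs\<in>tuples V j. 1)"
  by (rule order_trans[OF sum_abs]) (rule sum_mono, rule g)
 then have "\<bar>\<Sum>xs\<in>tuples V j. g xs\<bar> <= real (card V) ^ j"
  by (simp add: card_tuples V)
 then show ?thesis unfolding tuple_avg_def
  by (cases "real (card V) ^ j = 0") (auto simp: abs_divide divide_le_eq_1)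
qed

text \<open>A tuple with a repetition has some pair of equal positions, and each pair leaves at most \<open>card V ^ (j - 1)\<close> tuples.\<close>

lemma card_nondistinct_tuples_le:
 assumes V: "finite V"
 shows "card {xs \<in> tuples V j. \<not> distinct xs} * card V <= j\<^sup>2 * card V ^ j"
proof (induction j)
 case 0 then show ?case by (simp add: tuples_0)
next
 case (Suc j)
 let ?B = "{xs \<in> tuples V j. \<not> distinct xs}"
 have "{xs \<in> tuples V (Suc j). \<not> distinct xs} \<subseteq>
   (%(x, xs). x # xs) ` (V \<times> ?B) \<union> (\<Union>xs\<in>tuples V j. (%x. x # xs) ` set xs)"
  by (fastforce simp: tuples_Suc image_iff)
 then have "card {xs \<in> tuples V (Suc j). \<not> distinct xs} \<le>
   card ((%(x, xs). x # xs) ` (V \<times> ?B)) + card (\<Union>xs\<in>tuples V j. (%x. x # xs) ` set xs)"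
  by (intro order_trans[OF card_mono card_Un_le]) (auto simp: V finite_tuples)
 also have "card ((%(x, xs). x # xs) ` (V \<times> ?B)) <= card V * card ?B"
  using card_image_le[of "V \<times> ?B" "%(x, xs). x # xs"] by (simp add: V finite_tuples card_cartesian_product)
 also have "card (\<Union>xs\<in>tuples V j. (%x. x # xs) ` set xs) <= (\<Sum>xs\<in>tuples V j. card ((%x. x # xs) ` set xs))"
  by (rule card_UN_le) (simp add: V finite_tuples)
 also have "... <= (\<Sum>xs\<in>tuples V j. j)"
  by (rule sum_mono) (metis (mono_tags, lifting) card_image_le card_length List.finite_set mem_Collect_eq order_trans tuples_def)
 also have "... = j * card V ^ j" by (simp add: card_tuples V)
 finally have "card {xs \<in> tuples V (Suc j). \<not> distinct xs} * card V
   <= (card V * card ?B + j * card V ^ j) * card V" by simp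
 also have "... <= card V * (j\<^sup>2 * card V ^ j) + j * card V ^ j * card V"
  using mult_left_mono[OF Suc.IH, of "card V"] by (simp add: algebra_simps)
 also have "... <= (Suc j)\<^sup>2 * card V ^ Suc j"
  by (simp add: algebra_simps power2_eq_square)
 finally show ?case .
qed

text \<open>The proportion by which averages over injective tuples and averages over all tuples differ in normalization.\<close>

definition distinct_frac :: "'a set => nat => real" where
 "distinct_frac V j = real (card (distinct_tuples V j)) / real (card V) ^ j"

lemma distinct_frac_bounds:
 assumes V: "finite V" "V ~= {}"
 shows "1 - real j ^ 2 / real (card V) <= distinct_frac V j" "distinct_frac V j <= 1"
proof -
 let ?B = "{xs \<in> tuples V j. \<not> distinct xs}"
 have c: "card V > 0" using V by (simp add: card_gt_0_iff)
 have "tuples V j = distinct_tuples V j \<union> ?B" "distinct_tuples V j \<inter> ?B = {}"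
  by (auto simp: distinct_tuples_def)
 then have "card (tuples V j) = card (distinct_tuples V j) + card ?B"
  using card_Un_disjoint[of "distinct_tuples V j" ?B] V finite_tuples[OF V(1)] finite_distinct_tuples[OF V(1)] by simp
 then have e: "real (card V) ^ j = real (card (distinct_tuples V j)) + real (card ?B)"
  using card_tuples[OF V(1), of j] by (metis of_nat_add of_nat_power)
 have b: "real (card ?B) * real (card V) <= real j ^ 2 * real (card V) ^ j"
  using card_nondistinct_tuples_le[OF V(1), of j] by (metis of_nat_mono of_nat_mult of_nat_power)
 show "distinct_frac V j <= 1" unfolding distinct_frac_def using e by (intro divide_le_eq_1[THEN iffD2]) auto
 have "real (card ?B) / real (card V) ^ j <= real j ^ 2 / real (card V)"
  using b c by (simp add: field_simps)
 moreover have "distinct_frac V j = 1 - real (card ?B) / real (card V) ^ j"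
 proof -
  have "real (card (distinct_tuples V j)) = real (card V) ^ j - real (card ?B)" using e by simp
  then show ?thesis unfolding distinct_frac_def using c by (simp add: diff_divide_distrib)
 qed
 ultimately show "1 - real j ^ 2 / real (card V) <= distinct_frac V j" by linarith
qed

lemma distinct_frac_cong:
 assumes "finite A" "finite B" "card A = card B"
 shows "distinct_frac A j = distinct_frac B j"
proof -
 obtain h where h: "bij_betw h A B" using finite_same_card_bij[OF assms] by blast
 have "bij_betw (map h) (distinct_tuples A j) (distinct_tuples B j)"
 proof (rule bij_betwI[where g = "map (inv_into A h)"])
  show "map h \<in> distinct_tuples A j \<rightarrow> distinct_tuples B j"
   using h by (fastforce simp: distinct_tuples_def tuples_def distinct_map bij_betw_def intro: inj_on_subset)
  show "map (inv_into A h) \<in> distinct_tuples B j \<rightarrow> distinct_tuples A j"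
   using bij_betw_inv_into[OF h] by (fastforce simp: distinct_tuples_def tuples_def distinct_map bij_betw_def intro: inj_on_subset)
  show "map (inv_into A h) (map h x) = x" if "x \<in> distinct_tuples A j" for x
   using that h by (auto simp: distinct_tuples_def tuples_def bij_betw_def intro!: map_idI)
  show "map h (map (inv_into A h) y) = y" if "y \<in> distinct_tuples B j" for y
   using that h by (auto simp: distinct_tuples_def tuples_def bij_betw_def f_inv_into_f intro!: map_idI)
 qed
 then show ?thesis unfolding distinct_frac_def using assms(3) bij_betw_same_card by metis
qed

lemma tuple_avg_distinct:
 assumes V: "finite V" "V ~= {}" and g: "!!xs. xs \<in> tuples V j ==> \<bar>g xs\<bar> <= 1"
 shows "\<bar>tuple_avg V j g - (\<Sum>xs\<in>distinct_tuples V j. g xs) / real (card V) ^ j\<bar> <= real j ^ 2 / real (card V)"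
proof -
 let ?B = "{xs \<in> tuples V j. \<not> distinct xs}"
 have c: "card V > 0" using V by (simp add: card_gt_0_iff)
 have t: "tuples V j = distinct_tuples V j \<union> ?B" "distinct_tuples V j \<inter> ?B = {}"
  by (auto simp: distinct_tuples_def)
 have "(\<Sum>xs\<in>tuples V j. g xs) = (\<Sum>xs\<in>distinct_tuples V j. g xs) + (\<Sum>xs\<in>?B. g xs)"
  by (subst t(1), subst sum.union_disjoint) (use V finite_tuples[OF V(1)] finite_distinct_tuples[OF V(1)] t(2) in auto)
 then have "tuple_avg V j g - (\<Sum>xs\<in>distinct_tuples V j. g xs) / real (card V) ^ j = (\<Sum>xs\<in>?B. g xs) / real (card V) ^ j"
  by (simp add: tuple_avg_def add_divide_distrib)
 moreover have "\<bar>\<Sum>xs\<in>?B. g xs\<bar> <= (\<Sum>xs\<in>?B. 1)"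
  by (rule order_trans[OF sum_abs]) (rule sum_mono, use g in auto)
 moreover have "real (card ?B) / real (card V) ^ j <= real j ^ 2 / real (card V)"
 proof -
  have b: "real (card ?B) * real (card V) <= real j ^ 2 * real (card V) ^ j"
   using card_nondistinct_tuples_le[OF V(1), of j] by (metis of_nat_mono of_nat_mult of_nat_power)
  show ?thesis using b c by (simp add: field_simps)
 qed
 ultimately show ?thesis
  by (simp add: abs_divide) (meson divide_right_mono order_trans of_nat_0_le_iff zero_le_power)
qed

lemma card_supersets_of_card:
 assumes V: "finite V" "T \<subseteq> V" "card T <= k"
 shows "card {S \<in> subsets_of_card V k. T \<subseteq> S} = (card V - card T) choose (k - card T)"
proof -
 have fT: "finite T" using V finite_subset by blast
 have "bij_betw (%S. S - T) {S \<in> subsets_of_card V k. T \<subseteq> S} (subsets_of_card (V - T) (k - card T))"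
 proof (rule bij_betwI[where g = "%S. S \<union> T"])
  show "(%S. S - T) \<in> {S \<in> subsets_of_card V k. T \<subseteq> S} \<rightarrow> subsets_of_card (V - T) (k - card T)"
   by (auto simp: subsets_of_card_def card_Diff_subset fT)
  show "(%S. S \<union> T) \<in> subsets_of_card (V - T) (k - card T) \<rightarrow> {S \<in> subsets_of_card V k. T \<subseteq> S}"
  proof
   fix S assume "S \<in> subsets_of_card (V - T) (k - card T)"
   then have S: "S \<subseteq> V - T" "card S = k - card T" by (auto simp: subsets_of_card_def)
   have "finite S" using S(1) V(1) by (meson finite_Diff finite_subset)
   then have "card (S \<union> T) = card S + card T" by (rule card_Un_disjoint[OF _ fT]) (use S in auto)
   then show "S \<union> T \<in> {S \<in> subsets_of_card V k. T \<subseteq> S}" using S V by (auto simp: subsets_of_card_def)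
  qed
 qed (auto simp: subsets_of_card_def)
 then have "card {S \<in> subsets_of_card V k. T \<subseteq> S} = card (subsets_of_card (V - T) (k - card T))"
  by (rule bij_betw_same_card)
 then show ?thesis using V fT by (simp add: card_subsets_of_card card_Diff_subset)
qed

text \<open>Double counting: every injective tuple lies in the same number of subsets of a given size.\<close>

lemma subset_avg_distinct:
 assumes V: "finite V" and k: "1 <= k" "k <= card V"
 obtains \<kappa> where "\<kappa> * real (card (distinct_tuples V j)) = distinct_frac {1..k} j"
  "!!g. subset_avg V k (%S. (\<Sum>xs\<in>distinct_tuples S j. g xs) / real k ^ j) = \<kappa> * (\<Sum>xs\<in>distinct_tuples V j. g xs)"
proof -
 define c where "c = (if j <= k then (card V - j) choose (k - j) else 0)"
 define \<kappa> where "\<kappa> = real c / real k ^ j / real (card V choose k)"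
 have fin: "finite S" if "S \<in> subsets_of_card V k" for S
  using that V by (auto simp: subsets_of_card_def intro: finite_subset)
 have cc: "card {S \<in> subsets_of_card V k. xs \<in> distinct_tuples S j} = c" if xs: "xs \<in> distinct_tuples V j" for xs
 proof -
  have cx: "card (set xs) = j" using xs by (auto simp: distinct_tuples_def tuples_def distinct_card)
  have e: "{S \<in> subsets_of_card V k. xs \<in> distinct_tuples S j} = {S \<in> subsets_of_card V k. set xs \<subseteq> S}"
   using xs by (auto simp: distinct_tuples_def tuples_def)
  show ?thesis
  proof (cases "j <= k")
   case True
   then show ?thesis unfolding e c_def
    using card_supersets_of_card[OF V, of "set xs" k] xs cx by (auto simp: distinct_tuples_def tuples_def)
  next
   case False
   have "\<not> set xs \<subseteq> S" if "S \<in> subsets_of_card V k" for S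
    using card_mono[OF fin[OF that], of "set xs"] cx False that by (auto simp: subsets_of_card_def)
   then have "{S \<in> subsets_of_card V k. set xs \<subseteq> S} = {}" by blast
   then show ?thesis using False unfolding e c_def by (simp only: card.empty if_False)
  qed
 qed
 have main: "subset_avg V k (%S. (\<Sum>xs\<in>distinct_tuples S j. g xs) / real k ^ j) = \<kappa> * (\<Sum>xs\<in>distinct_tuples V j. g xs)" for g
 proof -
  have "(\<Sum>S\<in>subsets_of_card V k. (\<Sum>xs\<in>distinct_tuples S j. g xs) / real k ^ j)
    = (\<Sum>S\<in>subsets_of_card V k. (\<Sum>xs | xs \<in> distinct_tuples V j & xs \<in> distinct_tuples S j. g xs)) / real k ^ j"
   unfolding sum_divide_distrib[symmetric]
   by (intro arg_cong2[where f = "(/)"] sum.cong refl) (auto simp: subsets_of_card_def distinct_tuples_def tuples_def)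
  also have "(\<Sum>S\<in>subsets_of_card V k. (\<Sum>xs | xs \<in> distinct_tuples V j & xs \<in> distinct_tuples S j. g xs))
    = (\<Sum>xs\<in>distinct_tuples V j. (\<Sum>S | S \<in> subsets_of_card V k & xs \<in> distinct_tuples S j. g xs))"
   by (rule sum.swap_restrict) (use V finite_subsets_of_card finite_distinct_tuples in auto)
  also have "... = (\<Sum>xs\<in>distinct_tuples V j. real c * g xs)"
   by (intro sum.cong refl) (simp add: cc)
  finally show ?thesis
   unfolding subset_avg_def \<kappa>_def by (simp add: sum_distrib_left[symmetric])
 qed
 have "subset_avg V k (%S. (\<Sum>xs\<in>distinct_tuples S j. 1) / real k ^ j) = subset_avg V k (%S. distinct_frac {1..k} j)"
 proof -
  have "real (card (distinct_tuples S j)) / real k ^ j = distinct_frac {1..k} j" if "S \<in> subsets_of_card V k" for S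
   using distinct_frac_cong[of S "{1..k}" j] fin[OF that] that by (simp add: subsets_of_card_def distinct_frac_def)
  then show ?thesis unfolding subset_avg_def by simp
 qed
 also have "... = distinct_frac {1..k} j"
  unfolding subset_avg_def using k by (simp add: card_subsets_of_card V)
 finally have "\<kappa> * real (card (distinct_tuples V j)) = distinct_frac {1..k} j"
  using main[of "%_. 1"] by simp
 with main show ?thesis using that by blast
qed

lemma subset_avg_diff: "subset_avg V k (%S. a S - b S) = subset_avg V k a - subset_avg V k b"
 and subset_avg_add: "subset_avg V k (%S. a S + b S) = subset_avg V k a + subset_avg V k b"
 and subset_avg_cmult: "subset_avg V k (%S. c * a S) = c * subset_avg V k a"
 by (simp_all add: subset_avg_def sum_subtractf sum.distrib diff_divide_distrib add_divide_distrib sum_distrib_left)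

lemma subset_avg_cong: "(!!S. S \<subseteq> V ==> card S = k ==> a S = b S) ==> subset_avg V k a = subset_avg V k b"
 unfolding subset_avg_def subsets_of_card_def by (intro arg_cong2[where f = "(/)"] sum.cong refl) auto

lemma subset_avg_const: "finite V ==> k <= card V ==> subset_avg V k (%_. c) = c"
 by (simp add: subset_avg_def card_subsets_of_card)

lemma subset_avg_mono:
 assumes "!!S. S \<subseteq> V ==> card S = k ==> a S <= b S"
 shows "subset_avg V k a <= subset_avg V k b"
 unfolding subset_avg_def by (intro divide_right_mono sum_mono) (use assms in \<open>auto simp: subsets_of_card_def\<close>)

lemma subset_avg_abs_le:
 assumes "finite V" "k <= card V" "!!S. S \<subseteq> V ==> card S = k ==> \<bar>a S\<bar> <= c"
 shows "\<bar>subset_avg V k a\<bar> <= c"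
proof -
 have "subset_avg V k a <= subset_avg V k (%_. c)"
  by (rule subset_avg_mono) (rule abs_le_D1[OF assms(3)])
 moreover have "subset_avg V k (%_. -c) <= subset_avg V k a"
  by (rule subset_avg_mono) (use assms(3) in \<open>metis abs_le_D2 minus_le_iff\<close>)
 ultimately show ?thesis using assms(1,2) by (simp add: subset_avg_const abs_le_iff)
qed

text \<open>Averages over injective tuples are preserved exactly in expectation by sampling a subset, and repeated entries contribute only order \<open>1/k\<close>.\<close>

lemma sampling_mean:
 assumes V: "finite V" and k: "1 <= k" "k <= card V"
  and g: "!!xs. xs \<in> tuples V j ==> \<bar>g xs\<bar> <= 1"
 shows "\<bar>subset_avg V k (%S. tuple_avg S j g) - tuple_avg V j g\<bar> <= 3 * real j ^ 2 / real k"
proof -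
 obtain \<kappa> where \<kappa>: "\<kappa> * real (card (distinct_tuples V j)) = distinct_frac {1..k} j"
  and E: "!!g. subset_avg V k (%S. (\<Sum>xs\<in>distinct_tuples S j. g xs) / real k ^ j) = \<kappa> * (\<Sum>xs\<in>distinct_tuples V j. g xs)"
  using subset_avg_distinct[OF V k] by blast
 have Vne: "V ~= {}" using k by auto
 have cV: "card V > 0" using k by simp
 let ?e = "real j ^ 2 / real k"
 let ?D = "\<Sum>xs\<in>distinct_tuples V j. g xs"
 have eV: "real j ^ 2 / real (card V) <= ?e" using k by (intro divide_left_mono) auto
 have "\<bar>subset_avg V k (%S. tuple_avg S j g - (\<Sum>xs\<in>distinct_tuples S j. g xs) / real k ^ j)\<bar> <= ?e"
 proof (rule subset_avg_abs_le[OF V k(2)])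
  fix S assume S: "S \<subseteq> V" "card S = k"
  have "finite S" "S ~= {}" using S V k by (auto intro: finite_subset)
  then show "\<bar>tuple_avg S j g - (\<Sum>xs\<in>distinct_tuples S j. g xs) / real k ^ j\<bar> <= ?e"
   using tuple_avg_distinct[of S j g] S g by (auto simp: tuples_def)
 qed
 then have 1: "\<bar>subset_avg V k (%S. tuple_avg S j g) - \<kappa> * ?D\<bar> <= ?e"
  by (simp add: subset_avg_diff E)
 have 2: "\<bar>tuple_avg V j g - ?D / real (card V) ^ j\<bar> <= ?e"
  using tuple_avg_distinct[OF V Vne, of j g] g eV by fastforce
 have "\<kappa> * ?D - ?D / real (card V) ^ j = (\<kappa> - 1 / real (card V) ^ j) * ?D" by (simp add: algebra_simps)
 then have "\<bar>\<kappa> * ?D - ?D / real (card V) ^ j\<bar> = \<bar>\<kappa> - 1 / real (card V) ^ j\<bar> * \<bar>?D\<bar>" by (simp add: abs_mult)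
 also have "... <= \<bar>\<kappa> - 1 / real (card V) ^ j\<bar> * real (card (distinct_tuples V j))"
 proof (rule mult_left_mono)
  have "\<bar>?D\<bar> <= (\<Sum>xs\<in>distinct_tuples V j. 1)"
   by (rule order_trans[OF sum_abs]) (rule sum_mono, use g in \<open>auto simp: distinct_tuples_def\<close>)
  then show "\<bar>?D\<bar> <= real (card (distinct_tuples V j))" by simp
 qed simp
 also have "... = \<bar>(\<kappa> - 1 / real (card V) ^ j) * real (card (distinct_tuples V j))\<bar>" by (simp add: abs_mult)
 also have "... = \<bar>distinct_frac {1..k} j - distinct_frac V j\<bar>"
  using \<kappa> by (simp add: left_diff_distrib distinct_frac_def)
 also have "... <= ?e"
  using distinct_frac_bounds[of "{1..k}" j] distinct_frac_bounds[OF V Vne, of j] k eV by (auto simp: abs_le_iff)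
 finally have 3: "\<bar>\<kappa> * ?D - ?D / real (card V) ^ j\<bar> <= ?e" .
 have "3 * real j ^ 2 / real k = ?e + ?e + ?e" by simp
 then show ?thesis using 1 2 3 by linarith
qed

lemma tuple_avg_mult:
 assumes "finite V"
 shows "tuple_avg V i g * tuple_avg V j h = tuple_avg V (i + j) (%xs. g (take i xs) * h (drop i xs))"
proof -
 have "bij_betw (%(xs, ys). xs @ ys) (tuples V i \<times> tuples V j) (tuples V (i + j))"
  by (rule bij_betwI[where g = "%xs. (take i xs, drop i xs)"])
   (auto simp: tuples_def dest: in_set_takeD in_set_dropD)
 then have "(\<Sum>xs\<in>tuples V (i + j). g (take i xs) * h (drop i xs)) =
   (\<Sum>(xs, ys)\<in>tuples V i \<times> tuples V j. g (take i (xs @ ys)) * h (drop i (xs @ ys)))"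
  by (subst sum.reindex_bij_betw[symmetric]) (auto simp: case_prod_beta)
 also have "... = (\<Sum>(xs, ys)\<in>tuples V i \<times> tuples V j. g xs * h ys)"
  by (intro sum.cong) (auto simp: tuples_def)
 also have "... = (\<Sum>xs\<in>tuples V i. g xs) * (\<Sum>xs\<in>tuples V j. h xs)"
  by (simp add: sum_product sum.cartesian_product)
 finally show ?thesis by (simp add: tuple_avg_def power_add)
qed

text \<open>The square of a tuple average is a tuple average of twice the length, so the bound on the mean also controls the second moment.\<close>

lemma sampling_variance:
 assumes V: "finite V" and k: "1 <= k" "k <= card V"
  and g: "!!xs. xs \<in> tuples V j ==> \<bar>g xs\<bar> <= 1"
 shows "subset_avg V k (%S. (tuple_avg S j g - tuple_avg V j g)\<^sup>2) <= 18 * real j ^ 2 / real k"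
proof -
 let ?a = "tuple_avg V j g" and ?h = "%xs. g (take j xs) * g (drop j xs)"
 have h: "\<bar>?h xs\<bar> <= 1" if "xs \<in> tuples V (j + j)" for xs
 proof -
  have "take j xs \<in> tuples V j" "drop j xs \<in> tuples V j" using that
   by (auto simp: tuples_def dest: in_set_takeD in_set_dropD)
  then show ?thesis using g[of "take j xs"] g[of "drop j xs"] by (simp add: abs_mult mult_le_one)
 qed
 have "subset_avg V k (%S. (tuple_avg S j g - ?a)\<^sup>2) = subset_avg V k (%S. (tuple_avg S (j + j) ?h - 2 * ?a * tuple_avg S j g) + ?a\<^sup>2)"
 proof (rule subset_avg_cong)
  fix S assume "S \<subseteq> V" "card S = k"
  then have "finite S" using V finite_subset by blast
  then have "(tuple_avg S j g)\<^sup>2 = tuple_avg S (j + j) ?h" by (simp add: power2_eq_square tuple_avg_mult)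
  then show "(tuple_avg S j g - ?a)\<^sup>2 = (tuple_avg S (j + j) ?h - 2 * ?a * tuple_avg S j g) + ?a\<^sup>2"
   by (simp add: power2_diff)
 qed
 also have "... = subset_avg V k (%S. tuple_avg S (j + j) ?h) - 2 * ?a * subset_avg V k (%S. tuple_avg S j g) + ?a\<^sup>2"
  by (simp add: subset_avg_add subset_avg_diff subset_avg_cmult subset_avg_const V k)
 also have "... = (subset_avg V k (%S. tuple_avg S (j + j) ?h) - tuple_avg V (j + j) ?h)
   - 2 * ?a * (subset_avg V k (%S. tuple_avg S j g) - ?a)"
  using tuple_avg_mult[OF V, of j g j g] by (simp add: power2_eq_square algebra_simps)
 also have "... <= 3 * real (j + j) ^ 2 / real k + 2 * (3 * real j ^ 2 / real k)"
 proof -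
  have 1: "\<bar>subset_avg V k (%S. tuple_avg S (j + j) ?h) - tuple_avg V (j + j) ?h\<bar> <= 3 * real (j + j) ^ 2 / real k"
   by (rule sampling_mean[OF V k]) (rule h)
  have 2: "\<bar>subset_avg V k (%S. tuple_avg S j g) - ?a\<bar> <= 3 * real j ^ 2 / real k"
   by (rule sampling_mean[OF V k g])
  have "\<bar>2 * ?a * (subset_avg V k (%S. tuple_avg S j g) - ?a)\<bar> <= 2 * 1 * (3 * real j ^ 2 / real k)"
   unfolding abs_mult by (intro mult_mono) (use 2 tuple_avg_abs_le[OF V g] in auto)
  with 1 show ?thesis by linarith
 qed
 also have "... = 18 * real j ^ 2 / real k" by (simp add: power2_eq_square field_simps)
 finally show ?thesis .
qed

text \<open>Bad subsets keep probability at least \<open>\<delta>\<close>, whereas by Chebyshev any fixed number of statistics is close to its mean with probability tending to \<open>1\<close>. The number of statistics controlled may grow slowly with \<open>k\<close>, so one sequence of bad subsets is typical for all of countably many statistics.\<close>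

lemma typical_bad_sample:
 fixes n :: "nat => nat" and len :: "nat => nat" and g :: "nat => nat => nat list => real"
 assumes n: "!!k. 1 <= k ==> k <= n k" and \<delta>: "\<delta> > 0"
  and bad: "!!k. 1 <= k ==> subset_avg {1..n k} k (%S. of_bool (bad k S)) \<ge> \<delta>"
  and g: "!!k j xs. 1 <= k ==> xs \<in> tuples {1..n k} (len j) ==> \<bar>g k j xs\<bar> <= 1"
 obtains S where "!!k. 1 <= k ==> S k \<subseteq> {1..n k} & card (S k) = k & bad k (S k)"
  "!!j. (%k. tuple_avg (S k) (len j) (g k j) - tuple_avg {1..n k} (len j) (g k j)) \<longlonglongrightarrow> 0"
proof -
 define w where "w j = (1/2) ^ j / (1 + 18 * real (len j) ^ 2)" for j
 have w: "w j > 0" for j unfolding w_def by (intro divide_pos_pos) (auto intro: add_pos_nonneg)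
 define D where "D k S j = (tuple_avg S (len j) (g k j) - tuple_avg {1..n k} (len j) (g k j))\<^sup>2" for k S j
 define Z where "Z k S = (\<Sum>j\<le>k. w j * D k S j)" for k S
 have D0: "D k S j \<ge> 0" for k S j by (simp add: D_def)
 have Z0: "Z k S \<ge> 0" for k S unfolding Z_def by (intro sum_nonneg mult_nonneg_nonneg D0 less_imp_le[OF w])
 have "\<exists>S. S \<subseteq> {1..n k} & card S = k & bad k S & Z k S <= 3 / (\<delta> * real k)" if k: "1 <= k" for k
 proof (rule ccontr)
  assume neg: "\<not> ?thesis"
  have kn: "k <= card {1..n k}" using n[OF k] by simp
  let ?t = "3 / (\<delta> * real k)"
  have t: "?t > 0" using \<delta> k by simp
  have "subset_avg {1..n k} k (%S. ?t * of_bool (bad k S)) <= subset_avg {1..n k} k (Z k)"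
   by (rule subset_avg_mono) (use neg Z0 in \<open>force simp: of_bool_def not_le less_imp_le\<close>)
  then have "?t * \<delta> <= subset_avg {1..n k} k (Z k)"
   using mult_left_mono[OF bad[OF k] less_imp_le[OF t]] unfolding subset_avg_cmult by linarith
  also have "subset_avg {1..n k} k (Z k) = (\<Sum>j\<le>k. w j * subset_avg {1..n k} k (%S. D k S j))"
   unfolding Z_def subset_avg_def by (subst sum.swap) (simp add: sum_distrib_left sum_divide_distrib)
  also have "... <= (\<Sum>j\<le>k. (1/2) ^ j * (1 / real k))"
  proof (rule sum_mono)
   fix j
   have "subset_avg {1..n k} k (%S. D k S j) <= 18 * real (len j) ^ 2 / real k"
    unfolding D_def by (rule sampling_variance) (use k kn g[OF k] in auto)
   also have "... <= (1 + 18 * real (len j) ^ 2) / real k" by (intro divide_right_mono) auto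
   finally have "w j * subset_avg {1..n k} k (%S. D k S j) <= w j * ((1 + 18 * real (len j) ^ 2) / real k)"
    by (rule mult_left_mono) (simp add: less_imp_le[OF w])
   also have "... = (1/2) ^ j * (1 / real k)"
   proof -
    have "x / A * (A / y) = x * (1 / y)" if "A > 0" for x y A :: real using that by simp
    moreover have "1 + 18 * real (len j) ^ 2 > 0" by (intro add_pos_nonneg) auto
    ultimately show ?thesis unfolding w_def by blast
   qed
   finally show "w j * subset_avg {1..n k} k (%S. D k S j) <= (1/2) ^ j * (1 / real k)" .
  qed
  also have "... = (\<Sum>j\<le>k. (1/2) ^ j) * (1 / real k)" by (rule sum_distrib_right[symmetric])
  also have "... <= 2 * (1 / real k)"
  proof (rule mult_right_mono)
   show "(\<Sum>j\<le>k. (1/2) ^ j) <= (2::real)" 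
    unfolding sum_gp0 by simp
  qed simp
  finally show False using \<delta> k by (simp add: field_simps)
 qed
 then obtain S where S: "!!k. 1 <= k ==> S k \<subseteq> {1..n k} & card (S k) = k & bad k (S k) & Z k (S k) <= 3 / (\<delta> * real k)"
  by metis
 have "(%k. tuple_avg (S k) (len j) (g k j) - tuple_avg {1..n k} (len j) (g k j)) \<longlonglongrightarrow> 0" for j
 proof -
  have "(%k. D k (S k) j) \<longlonglongrightarrow> 0"
  proof (rule tendsto_sandwich[OF _ _ tendsto_const])
   show "\<forall>\<^sub>F k in sequentially. 0 <= D k (S k) j" by (simp add: D0)
   show "\<forall>\<^sub>F k in sequentially. D k (S k) j <= 3 / (\<delta> * w j) * (1 / real k)"
    using eventually_ge_at_top[of "max 1 j"]
   proof eventually_elim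
    case (elim k)
    have "w j * D k (S k) j <= Z k (S k)"
     unfolding Z_def by (rule member_le_sum) (use elim D0 w in \<open>auto intro!: mult_nonneg_nonneg simp: less_imp_le\<close>)
    also have "... <= 3 / (\<delta> * real k)" using S[of k] elim by auto
    finally show ?case using w[of j] \<delta> elim by (simp add: field_simps)
   qed
   show "(%k. 3 / (\<delta> * w j) * (1 / real k)) \<longlonglongrightarrow> 0"
    by (rule tendsto_mult_right_zero) (rule lim_1_over_n)
  qed
  then have "(%k. sqrt (D k (S k) j)) \<longlonglongrightarrow> sqrt 0" by (rule tendsto_real_sqrt)
  then show ?thesis by (simp add: D_def tendsto_rabs_zero_iff)
 qed
 with S that show ?thesis by blast
qed

lemma diagonal_convergent_subsequence:
 fixes c :: "nat => nat => real"
 assumes "!!n j. \<bar>c n j\<bar> <= B j"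
 obtains \<sigma> :: "nat => nat" where "strict_mono \<sigma>" "!!j. convergent (%n. c (\<sigma> n) j)"
proof -
 interpret subseqs "%j s. convergent (%n. c (s n) j)"
 proof
  fix j and s :: "nat => nat"
  have "Bseq (%n. c (s n) j)" by (rule BseqI'[of _ "B j"]) (use assms in auto)
  then have "bounded (range (%n. c (s n) j))" by (simp add: Bseq_eq_bounded)
  then obtain l r where "strict_mono r" "((%n. c (s n) j) \<circ> r) \<longlonglongrightarrow> l"
   using bounded_imp_convergent_subsequence by blast
  then show "\<exists>r'. strict_mono r' & convergent (%n. c ((s \<circ> r') n) j)" by (auto simp: o_def convergent_def)
 qed
 have "convergent (%n. c (diagseq n) j)" for j
 proof -
  have "convergent (%n. c ((diagseq \<circ> ((+) (Suc j))) n) j)"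
  proof (rule diagseq_holds)
   fix r s :: "nat => nat" and i
   assume "strict_mono r" "convergent (%n. c (s n) i)"
   then show "convergent (%n. c ((s \<circ> r) n) i)"
    using LIMSEQ_subseq_LIMSEQ[of "%n. c (s n) i" _ r] by (auto simp: convergent_def o_def)
  qed
  then obtain l where "(%n. c (diagseq (n + Suc j)) j) \<longlonglongrightarrow> l" by (auto simp: convergent_def o_def add.commute)
  then have "(%n. c (diagseq n) j) \<longlonglongrightarrow> l" by (rule LIMSEQ_offset)
  then show ?thesis by (auto simp: convergent_def)
 qed
 with subseq_diagseq that show ?thesis by blast
qed

section \<open>Estimability and convergent sequences of ordered graphs\<close>

text \<open>Reduces the probabilities in the definition of subgraph densities to counting.\<close>

lemma replicate_pmf_uniform:
 assumes "finite V" "V ~= {}"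
 shows "replicate_pmf k (pmf_of_set V) = pmf_of_set (tuples V k)"
proof (induction k)
 case 0 then show ?case by (simp add: tuples_0 pmf_of_set_singleton)
next
 case (Suc k)
 have ne: "tuples V k ~= {}" using card_tuples[OF assms(1), of k] assms by (metis card.empty card_0_eq power_not_zero)
 have "replicate_pmf (Suc k) (pmf_of_set V) = map_pmf (%(x, xs). x # xs) (pair_pmf (pmf_of_set V) (pmf_of_set (tuples V k)))"
  by (simp add: pair_pmf_def map_bind_pmf Suc.IH)
 also have "pair_pmf (pmf_of_set V) (pmf_of_set (tuples V k)) = pmf_of_set (V \<times> tuples V k)"
  by (rule pmf_eqI) (auto simp: pmf_pair pmf_of_set assms ne finite_tuples card_cartesian_product indicator_def)
 also have "map_pmf (%(x, xs). x # xs) ... = pmf_of_set ((%(x, xs). x # xs) ` (V \<times> tuples V k))"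
  by (rule map_pmf_of_set_inj) (use assms ne finite_tuples in \<open>auto simp: inj_on_def\<close>)
 finally show ?case by (simp only: tuples_Suc)
qed

text \<open>The event whose probability is the subgraph density: the sorted tuple induces the given graph, loops at repeated vertices being non-edges.\<close>

definition matches :: "ordered_graph => ordered_graph => nat list => bool" where
 "matches F G xs \<longleftrightarrow> (\<forall>i\<in>{1..num_vertices F}. \<forall>j\<in>{1..num_vertices F}.
   adj F i j = adj G (sort xs ! (i - 1)) (sort xs ! (j - 1)))"

lemma subgraph_density_tuple_avg:
 "subgraph_density F G = tuple_avg {1..num_vertices G} (num_vertices F) (%xs. of_bool (matches F G xs))"
proof -
 let ?V = "{1..num_vertices G}" and ?T = "tuples {1..num_vertices G} (num_vertices F)"
 have V: "finite ?V" "?V ~= {}" using num_vertices_ge_1[of G] by auto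
 have ne: "?T ~= {}" using card_tuples[OF V(1), of "num_vertices F"] V by (metis card.empty card_0_eq power_not_zero)
 have "subgraph_density F G = real (card (?T \<inter> {xs. matches F G xs})) / real (card ?T)"
  unfolding subgraph_density_def replicate_pmf_uniform[OF V] matches_def
  by (rule measure_pmf_of_set) (use ne finite_tuples in auto)
 also have "real (card (?T \<inter> {xs. matches F G xs})) = (\<Sum>xs\<in>?T. of_bool (matches F G xs))"
  by (simp add: finite_tuples Int_def)
 also have "real (card ?T) = real (card ?V) ^ num_vertices F" by (simp add: card_tuples V)
 finally show ?thesis by (simp add: tuple_avg_def)
qed

lemma ordered_graph_eqI:
 assumes "num_vertices G = num_vertices H" "!!i j. adj G i j = adj H i j"
 shows "G = H"
proof -
 have "Rep_ordered_graph G = Rep_ordered_graph H"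
  using assms unfolding num_vertices_def adj_def by (auto intro!: prod_eqI)
 then show ?thesis by (simp add: Rep_ordered_graph_inject)
qed

lemma adj_False_outside: "i \<notin> {1..num_vertices G} \<or> j \<notin> {1..num_vertices G} ==> \<not> adj G i j"
 using adj_vertices by blast

lemma finite_graphs_of_size: "finite {F. num_vertices F = k}"
proof -
 have "inj_on (%F. {(i, j). adj F i j}) {F. num_vertices F = k}"
  by (rule inj_onI) (auto intro!: ordered_graph_eqI simp: set_eq_iff)
 moreover have "(%F. {(i, j). adj F i j}) ` {F. num_vertices F = k} \<subseteq> Pow ({1..k} \<times> {1..k})"
  using adj_vertices by fastforce
 ultimately show ?thesis
  by (meson finite_Pow_iff finite_SigmaI finite_atLeastAtMost finite_imageD finite_subset)
qed

lemma countable_ordered_graphs: "countable (UNIV :: ordered_graph set)"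
proof -
 have "(UNIV :: ordered_graph set) = (\<Union>k. {F. num_vertices F = k})" by auto
 then show ?thesis by (metis countable_UN countableI_type countable_finite finite_graphs_of_size)
qed

lemma matches_distinct_iff:
 assumes "distinct xs" "length xs = num_vertices F"
 shows "matches F G xs \<longleftrightarrow> induced G (set xs) = F"
proof -
 have c: "card (set xs) = num_vertices F" using assms by (simp add: distinct_card)
 have ne: "set xs ~= {}" using c num_vertices_ge_1[of F] by auto
 have s: "sorted_list_of_set (set xs) = sort xs"
  by (simp add: sorted_list_of_set_sort_remdups distinct_remdups_id assms(1))
 show ?thesis
 proof
  assume m: "matches F G xs"
  show "induced G (set xs) = F"
  proof (rule ordered_graph_eqI)
   show nv: "num_vertices (induced G (set xs)) = num_vertices F"
    using c ne by (simp add: num_vertices_induced)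
   fix i j show "adj (induced G (set xs)) i j = adj F i j"
   proof (cases "i \<in> {1..num_vertices F} & j \<in> {1..num_vertices F}")
    case True then show ?thesis using m adj_induced[of "set xs" i j G] c ne s by (auto simp: matches_def)
   next
    case False then show ?thesis using adj_False_outside[of i F j] adj_False_outside[of i "induced G (set xs)" j] nv by auto
   qed
  qed
 next
  assume e: "induced G (set xs) = F"
  then show "matches F G xs" using adj_induced[of "set xs" _ _ G] c ne s by (auto simp: matches_def)
 qed
qed

lemma sum_distinct_tuples_set:
 assumes V: "finite V"
 shows "(\<Sum>xs\<in>distinct_tuples V k. h (set xs)) = fact k * (\<Sum>S\<in>subsets_of_card V k. h S :: real)"
proof -
 have "(\<Sum>xs\<in>distinct_tuples V k. h (set xs)) =
   (\<Sum>S\<in>subsets_of_card V k. \<Sum>xs | xs \<in> distinct_tuples V k & set xs = S. h (set xs))"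
  by (rule sum.group[symmetric])
   (use V finite_distinct_tuples finite_subsets_of_card in \<open>auto simp: distinct_tuples_def tuples_def subsets_of_card_def distinct_card\<close>)
 also have "... = (\<Sum>S\<in>subsets_of_card V k. fact k * h S)"
 proof (intro sum.cong refl)
  fix S assume S: "S \<in> subsets_of_card V k"
  then have fS: "finite S" using V by (auto simp: subsets_of_card_def intro: finite_subset)
  have "{xs. xs \<in> distinct_tuples V k & set xs = S} = permutations_of_set S"
   using S by (auto simp: distinct_tuples_def tuples_def subsets_of_card_def permutations_of_set_def distinct_card)
  then show "(\<Sum>xs | xs \<in> distinct_tuples V k & set xs = S. h (set xs)) = fact k * h S"
   using S fS by (simp add: permutations_of_set_def[symmetric] subsets_of_card_def)
    (subst sum.cong[OF refl, of _ _ "%_. h S"], auto simp: permutations_of_set_def[symmetric] permutations_of_setD)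
 qed
 finally show ?thesis by (simp add: sum_distrib_left)
qed

lemma subgraph_density_subset_avg:
 assumes k: "k = num_vertices F" "k <= num_vertices G"
 shows "\<bar>subgraph_density F G - subset_avg {1..num_vertices G} k (%S. of_bool (induced G S = F))\<bar>
  <= 2 * real k ^ 2 / real (num_vertices G)"
proof -
 let ?V = "{1..num_vertices G}" and ?n = "num_vertices G"
 let ?a = "subset_avg {1..num_vertices G} k (%S. of_bool (induced G S = F) :: real)"
 have V: "finite ?V" "?V ~= {}" using num_vertices_ge_1[of G] by auto
 have "(\<Sum>xs\<in>distinct_tuples ?V k. of_bool (matches F G xs)) = (\<Sum>xs\<in>distinct_tuples ?V k. of_bool (induced G (set xs) = F) :: real)"
  by (intro sum.cong refl) (auto simp: distinct_tuples_def tuples_def matches_distinct_iff k)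
 also have "... = fact k * (\<Sum>S\<in>subsets_of_card ?V k. of_bool (induced G S = F))"
  by (rule sum_distinct_tuples_set[OF V(1)])
 also have "... = fact k * real (?n choose k) * ?a"
  using k by (simp add: subset_avg_def)
 also have "fact k * real (?n choose k) = real (card (distinct_tuples ?V k))"
  using sum_distinct_tuples_set[OF V(1), where h = "%_. 1" and k = k] by (simp add: card_subsets_of_card)
 finally have "(\<Sum>xs\<in>distinct_tuples ?V k. of_bool (matches F G xs)) / real (card ?V) ^ k = distinct_frac ?V k * ?a"
  by (simp add: distinct_frac_def)
 then have 1: "\<bar>subgraph_density F G - distinct_frac ?V k * ?a\<bar> <= real k ^ 2 / real ?n"
  using tuple_avg_distinct[OF V, of k "%xs. of_bool (matches F G xs)"] k(1) by (simp add: subgraph_density_tuple_avg)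
 have a: "\<bar>?a\<bar> <= 1" by (rule subset_avg_abs_le) (use k in auto)
 have "\<bar>distinct_frac ?V k * ?a - ?a\<bar> = \<bar>distinct_frac ?V k - 1\<bar> * \<bar>?a\<bar>"
  by (simp add: abs_mult[symmetric] algebra_simps)
 also have "... <= (real k ^ 2 / real ?n) * 1"
  by (intro mult_mono a) (use distinct_frac_bounds[OF V, of k] in auto)
 finally show ?thesis using 1 by simp
qed

lemma prob_random_subset:
 assumes "k <= num_vertices G"
 shows "measure_pmf.prob (random_subset G k) {S. P S} = subset_avg {1..num_vertices G} k (%S. of_bool (P S))"
proof -
 let ?A = "subsets_of_card {1..num_vertices G} k"
 have c: "card ?A = num_vertices G choose k" by (simp add: card_subsets_of_card)
 have ne: "?A ~= {}" using c assms by (metis card.empty zero_less_binomial less_numeral_extra(3))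
 have "measure_pmf.prob (random_subset G k) {S. P S} = real (card (?A \<inter> {S. P S})) / real (card ?A)"
  unfolding random_subset_def subsets_of_card_def[symmetric] by (rule measure_pmf_of_set) (use ne in \<open>auto simp: finite_subsets_of_card\<close>)
 then show ?thesis unfolding subset_avg_def c card_atLeastAtMost by (simp add: finite_subsets_of_card Int_def)
qed

lemma subset_avg_by_graph:
 assumes k: "1 <= k" "k <= num_vertices G"
 shows "subset_avg {1..num_vertices G} k (%S. f (induced G S)) =
   (\<Sum>F | num_vertices F = k. f F * subset_avg {1..num_vertices G} k (%S. of_bool (induced G S = F)))"
proof -
 have "subset_avg {1..num_vertices G} k (%S. f (induced G S)) =
   subset_avg {1..num_vertices G} k (%S. \<Sum>F | num_vertices F = k. f F * of_bool (induced G S = F))"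
 proof (rule subset_avg_cong)
  fix S assume S: "S \<subseteq> {1..num_vertices G}" "card S = k"
  then have "num_vertices (induced G S) = k" using k num_vertices_induced[of S G] by (metis card.empty finite_atLeastAtMost finite_subset not_one_le_zero)
  then have "(\<Sum>F | num_vertices F = k. f F * of_bool (induced G S = F)) = (\<Sum>F\<in>{induced G S}. f F)"
   by (intro sum.mono_neutral_cong_right) (auto simp: finite_graphs_of_size)
  then show "f (induced G S) = (\<Sum>F | num_vertices F = k. f F * of_bool (induced G S = F))" by simp
 qed
 also have "... = (\<Sum>F | num_vertices F = k. f F * subset_avg {1..num_vertices G} k (%S. of_bool (induced G S = F)))"
  unfolding subset_avg_def by (subst sum.swap) (simp add: sum_distrib_left sum_divide_distrib)
 finally show ?thesis .
qed

text \<open>For an estimable parameter the value at a large graph is, up to small error, its average over random induced subgraphs of a fixed size, and that average is a fixed linear combination of subgraph densities.\<close>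

lemma estimable_density_approx:
 assumes est: "naturally_estimable f" and B: "!!G. \<bar>f G\<bar> <= B" and eps: "eps > 0"
 obtains k n\<^sub>0 where "!!G. n\<^sub>0 <= num_vertices G ==>
   \<bar>f G - (\<Sum>F | num_vertices F = k. f F * subgraph_density F G)\<bar> <= eps"
proof -
 have B0: "B \<ge> 0" using B abs_ge_zero order_trans by blast
 define \<delta> where "\<delta> = eps / (6 * (B + 1))"
 have \<delta>: "\<delta> > 0" using eps B0 by (simp add: \<delta>_def)
 obtain k where k: "1 <= k" and P: "!!G. k <= num_vertices G ==>
   measure_pmf.prob (random_subset G k) {S. \<bar>f G - f (induced G S)\<bar> > eps / 3} < \<delta>"
  using est eps \<delta> unfolding naturally_estimable_def by (metis zero_less_divide_iff zero_less_numeral)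
 define N where "N = real (card {F. num_vertices F = k})"
 obtain n0 where n0: "6 * B * N * real k ^ 2 / eps <= real n0" using real_arch_simple by blast
 show ?thesis
 proof (rule that[of "max n0 k" k])
  fix G assume G: "max n0 k <= num_vertices G"
  let ?n = "num_vertices G"
  let ?p = "%F. subset_avg {1..?n} k (%S. of_bool (induced G S = F))"
  have kn: "k <= ?n" using G by simp
  have "\<bar>subset_avg {1..?n} k (%S. f G - f (induced G S))\<bar> <= subset_avg {1..?n} k (%S. eps / 3 + 2 * B * of_bool (\<bar>f G - f (induced G S)\<bar> > eps / 3))"
  proof -
   have le: "\<bar>f G - f H\<bar> <= eps / 3 + 2 * B * of_bool (\<bar>f G - f H\<bar> > eps / 3)" for H
    using B[of G] B[of H] eps by (auto simp: of_bool_def)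
   have "subset_avg {1..?n} k (%S. f G - f (induced G S)) <= subset_avg {1..?n} k (%S. eps / 3 + 2 * B * of_bool (\<bar>f G - f (induced G S)\<bar> > eps / 3))"
    by (rule subset_avg_mono) (use le abs_le_D1 in blast)
   moreover have "subset_avg {1..?n} k (%S. (-1) * (f G - f (induced G S))) <= subset_avg {1..?n} k (%S. eps / 3 + 2 * B * of_bool (\<bar>f G - f (induced G S)\<bar> > eps / 3))"
    by (rule subset_avg_mono) (use le abs_le_D2 in fastforce)
   ultimately show ?thesis unfolding subset_avg_cmult by linarith
  qed
  also have "... = eps / 3 + 2 * B * subset_avg {1..?n} k (%S. of_bool (\<bar>f G - f (induced G S)\<bar> > eps / 3))"
   using kn by (simp add: subset_avg_add subset_avg_cmult subset_avg_const)
  also have "... <= eps / 3 + 2 * B * \<delta>"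
   using P[OF kn] B0 unfolding prob_random_subset[OF kn] by (intro add_left_mono mult_left_mono) auto
  also have "... <= eps / 3 + eps / 3"
   using B0 eps unfolding \<delta>_def by (intro add_left_mono) (simp add: field_simps)
  finally have 1: "\<bar>f G - subset_avg {1..?n} k (%S. f (induced G S))\<bar> <= 2 * eps / 3"
   using kn by (simp add: subset_avg_diff subset_avg_const)
  have "\<bar>(\<Sum>F | num_vertices F = k. f F * ?p F) - (\<Sum>F | num_vertices F = k. f F * subgraph_density F G)\<bar>
    = \<bar>\<Sum>F | num_vertices F = k. f F * (?p F - subgraph_density F G)\<bar>"
   by (simp add: sum_subtractf right_diff_distrib)
  also have "... <= (\<Sum>F | num_vertices F = k. B * (2 * real k ^ 2 / real ?n))"
  proof (rule order_trans[OF sum_abs], rule sum_mono)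
   fix F assume "F \<in> {F. num_vertices F = k}"
   then have "\<bar>?p F - subgraph_density F G\<bar> <= 2 * real k ^ 2 / real ?n"
    using subgraph_density_subset_avg[of k F G] kn by (auto simp: abs_minus_commute)
   then show "\<bar>f F * (?p F - subgraph_density F G)\<bar> <= B * (2 * real k ^ 2 / real ?n)"
    unfolding abs_mult by (intro mult_mono B) (use B0 in auto)
  qed
  also have "... = 2 * B * N * real k ^ 2 / real ?n" by (simp add: N_def)
  also have "... <= eps / 3"
  proof -
   have "6 * B * N * real k ^ 2 / eps <= real ?n" using n0 G by linarith
   then show ?thesis using eps num_vertices_ge_1[of G] by (simp add: field_simps)
  qed
  finally have 2: "\<bar>subset_avg {1..?n} k (%S. f (induced G S)) - (\<Sum>F | num_vertices F = k. f F * subgraph_density F G)\<bar> <= eps / 3"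
   unfolding subset_avg_by_graph[OF k kn] .
  show "\<bar>f G - (\<Sum>F | num_vertices F = k. f F * subgraph_density F G)\<bar> <= eps"
   using 1 2 by linarith
 qed
qed

lemma estimable_imp_convergent:
 assumes est: "naturally_estimable f" and B: "!!G. \<bar>f G\<bar> <= B" and G: "graph_seq_convergent G"
 shows "convergent (%n. f (G n))"
proof -
 have lim: "filterlim (%n. num_vertices (G n)) at_top sequentially"
  and dens: "!!F. convergent (%n. subgraph_density F (G n))"
  using G by (auto simp: graph_seq_convergent_def)
 have "Cauchy (%n. f (G n))"
 proof (rule metric_CauchyI)
  fix e :: real assume e: "e > 0"
  obtain k n0 where a: "!!H. n0 <= num_vertices H ==> \<bar>f H - (\<Sum>F | num_vertices F = k. f F * subgraph_density F H)\<bar> <= e / 4"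
   using estimable_density_approx[OF est B, of "e / 4"] e by (metis zero_less_divide_iff zero_less_numeral)
  define A where "A n = (\<Sum>F | num_vertices F = k. f F * subgraph_density F (G n))" for n
  have "convergent A" unfolding A_def by (intro convergent_sum convergent_mult dens convergent_const)
  then have "Cauchy A" by (rule convergent_Cauchy)
  then obtain M where M: "!!m n. m \<ge> M ==> n \<ge> M ==> dist (A m) (A n) < e / 4"
   using metric_CauchyD[of A "e / 4"] e by auto
  obtain M' where M': "!!n. n \<ge> M' ==> n0 <= num_vertices (G n)"
   using lim by (auto simp: filterlim_at_top eventually_sequentially)
  show "\<exists>M. \<forall>m\<ge>M. \<forall>n\<ge>M. dist (f (G m)) (f (G n)) < e"
  proof (intro exI allI impI)
   fix m n assume "m \<ge> max M M'" "n \<ge> max M M'"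
   then have "\<bar>f (G m) - A m\<bar> <= e / 4" "\<bar>f (G n) - A n\<bar> <= e / 4" "\<bar>A m - A n\<bar> < e / 4"
    using a[OF M'] M[of m n] by (auto simp: A_def dist_real_def)
   then show "dist (f (G m)) (f (G n)) < e" using e unfolding dist_real_def by linarith
  qed
 qed
 then show ?thesis by (simp add: Cauchy_convergent_iff)
qed

lemma sort_map_strict_mono_on:
 fixes h :: "nat => nat"
 assumes "strict_mono_on A h" "set xs \<subseteq> A"
 shows "sort (map h xs) = map h (sort xs)"
proof (rule properties_for_sort)
 show "mset (map h (sort xs)) = mset (map h xs)" by simp
 have "sorted_wrt (%x y. h x <= h y) (sort xs)"
  by (rule sorted_wrt_mono_rel[of _ "(\<le>)"]) (use assms in \<open>auto intro: strict_mono_on_leD\<close>)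
 then show "sorted (map h (sort xs))" by (simp add: sorted_wrt_map)
qed

lemma subgraph_density_induced:
 assumes S: "finite S" "S ~= {}"
 shows "subgraph_density F (induced G S) = tuple_avg S (num_vertices F) (%xs. of_bool (matches F G xs))"
proof -
 let ?k = "card S" and ?j = "num_vertices F"
 define e where "e i = sorted_list_of_set S ! (i - 1)" for i
 have len: "length (sorted_list_of_set S) = ?k" by simp
 have mono: "strict_mono_on {1..?k} e"
  using S by (auto simp: strict_mono_on_def e_def intro!: sorted_wrt_nth_less[OF strict_sorted_list_of_set])
 have img: "e ` {1..?k} = S"
 proof -
  have "{1..?k} = Suc ` {0..<?k}" by (auto simp: image_Suc_atLeastLessThan)
  then have "e ` {1..?k} = (%i. sorted_list_of_set S ! i) ` {0..<?k}" by (simp only: image_image e_def diff_Suc_1)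
  also have "... = S" using S by (simp add: nth_image)
  finally show ?thesis .
 qed
 have inj: "inj_on e {1..?k}" using mono by (rule strict_mono_on_imp_inj_on)
 have bij: "bij_betw (map e) (tuples {1..?k} ?j) (tuples S ?j)"
 proof (rule bij_betwI[where g = "map (inv_into {1..?k} e)"])
  show "map e \<in> tuples {1..?k} ?j \<rightarrow> tuples S ?j" using img by (fastforce simp: tuples_def)
  show "map (inv_into {1..?k} e) \<in> tuples S ?j \<rightarrow> tuples {1..?k} ?j"
   using img by (fastforce simp: tuples_def intro: inv_into_into)
  show "map (inv_into {1..?k} e) (map e xs) = xs" if "xs \<in> tuples {1..?k} ?j" for xs
   using that inj by (auto simp: tuples_def inv_into_f_f subset_iff intro!: map_idI)
  show "map e (map (inv_into {1..?k} e) ys) = ys" if "ys \<in> tuples S ?j" for ys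
   using that img by (auto simp: tuples_def f_inv_into_f subset_iff intro!: map_idI)
 qed
 have m: "matches F (induced G S) xs = matches F G (map e xs)" if xs: "xs \<in> tuples {1..?k} ?j" for xs
 proof -
  have s: "sort (map e xs) = map e (sort xs)"
   by (rule sort_map_strict_mono_on[OF mono]) (use xs in \<open>auto simp: tuples_def\<close>)
  have l: "length (sort xs) = ?j" using xs by (simp add: tuples_def)
  have "adj (induced G S) (sort xs ! (i - 1)) (sort xs ! (j - 1)) = adj G (sort (map e xs) ! (i - 1)) (sort (map e xs) ! (j - 1))"
   if "i \<in> {1..?j}" "j \<in> {1..?j}" for i j
  proof -
   have il: "i - 1 < length (sort xs)" "j - 1 < length (sort xs)" using that l by auto
   then have "sort xs ! (i - 1) \<in> {1..?k}" "sort xs ! (j - 1) \<in> {1..?k}"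
    using xs nth_mem[OF il(1)] nth_mem[OF il(2)] unfolding tuples_def set_sort by blast+
   then show ?thesis unfolding s using il adj_induced[OF S] by (simp add: e_def)
  qed
  then show ?thesis unfolding matches_def by auto
 qed
 have "num_vertices (induced G S) = ?k" by (rule num_vertices_induced[OF S])
 then have "subgraph_density F (induced G S) = (\<Sum>xs\<in>tuples {1..?k} ?j. of_bool (matches F G (map e xs))) / real ?k ^ ?j"
  unfolding subgraph_density_tuple_avg tuple_avg_def by (intro arg_cong2[where f = "(/)"] sum.cong) (auto simp: m)
 also have "(\<Sum>xs\<in>tuples {1..?k} ?j. of_bool (matches F G (map e xs)) :: real) = (\<Sum>xs\<in>tuples S ?j. of_bool (matches F G xs))"
  by (rule sum.reindex_bij_betw[OF bij])
 finally show ?thesis by (simp add: tuple_avg_def)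
qed

text \<open>Failure of estimability gives bad graphs for every sample size; the graphs may be taken one for each size because the sample size is a lower bound for the number of vertices.\<close>

lemma not_estimable_witness:
 assumes "\<not> naturally_estimable f"
 obtains eps \<delta> G where "eps > 0" "\<delta> > 0" "!!k. 1 <= k ==> k <= num_vertices (G k)"
  "!!k. 1 <= k ==> \<delta> <= subset_avg {1..num_vertices (G k)} k (%S. of_bool (\<bar>f (G k) - f (induced (G k) S)\<bar> > eps))"
proof -
 obtain eps \<delta> where ed: "eps > 0" "\<delta> > 0" and "\<forall>k\<ge>1. \<exists>G. k <= num_vertices G &
   \<not> measure_pmf.prob (random_subset G k) {S. \<bar>f G - f (induced G S)\<bar> > eps} < \<delta>"
  using assms unfolding naturally_estimable_def by blast
 then obtain G where "\<forall>k\<ge>1. k <= num_vertices (G k) &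
   \<not> measure_pmf.prob (random_subset (G k) k) {S. \<bar>f (G k) - f (induced (G k) S)\<bar> > eps} < \<delta>"
  by metis
 then have "k <= num_vertices (G k)"
  "\<delta> <= subset_avg {1..num_vertices (G k)} k (%S. of_bool (\<bar>f (G k) - f (induced (G k) S)\<bar> > eps))" if "1 <= k" for k
  using prob_random_subset[of k "G k" "%S. \<bar>f (G k) - f (induced (G k) S)\<bar> > eps"] that by (metis not_less)+
 with ed show ?thesis by (rule that)
qed

text \<open>A bad sample that is typical for all subgraph densities has asymptotically the same densities as the graph it is drawn from. Interleaving the graphs with their bad samples gives a convergent sequence on which the parameter oscillates.\<close>

lemma convergent_imp_estimable:
 assumes conv: "!!G. graph_seq_convergent G ==> convergent (%n. f (G n))"
 shows "naturally_estimable f"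
proof (rule ccontr)
 assume "\<not> naturally_estimable f"
 then obtain eps \<delta> G where ed: "eps > 0" "\<delta> > 0" and G: "!!k. 1 <= k ==> k <= num_vertices (G k)"
  and bad: "!!k. 1 <= k ==> \<delta> <= subset_avg {1..num_vertices (G k)} k (%S. of_bool (\<bar>f (G k) - f (induced (G k) S)\<bar> > eps))"
  using not_estimable_witness by blast
 define F where "F = from_nat_into (UNIV :: ordered_graph set)"
 have F: "\<exists>j. F j = H" for H
  unfolding F_def using from_nat_into_surj[OF countable_ordered_graphs, of H] by auto
 obtain S where S: "!!k. 1 <= k ==> S k \<subseteq> {1..num_vertices (G k)} & card (S k) = k & \<bar>f (G k) - f (induced (G k) (S k))\<bar> > eps"
  and Sd: "!!j. (%k. tuple_avg (S k) (num_vertices (F j)) (%xs. of_bool (matches (F j) (G k) xs))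
    - tuple_avg {1..num_vertices (G k)} (num_vertices (F j)) (%xs. of_bool (matches (F j) (G k) xs))) \<longlonglongrightarrow> 0"
 proof (rule typical_bad_sample[where n = "%k. num_vertices (G k)" and \<delta> = \<delta> and
    bad = "%k S. \<bar>f (G k) - f (induced (G k) S)\<bar> > eps" and
    g = "%k j xs. of_bool (matches (F j) (G k) xs)" and len = "%j. num_vertices (F j)"])
 qed (use G ed bad in auto)
 define H where "H k = induced (G k) (S k)" for k
 have fS: "finite (S k)" "S k ~= {}" if "1 <= k" for k
  using S[OF that] that by (auto intro: finite_subset)
 have nH: "num_vertices (H k) = k" if "1 <= k" for k
  using S[OF that] fS[OF that] by (simp add: H_def num_vertices_induced)
 have dH: "(%k. subgraph_density F' (H k) - subgraph_density F' (G k)) \<longlonglongrightarrow> 0" for F'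
 proof -
  obtain j where j: "F j = F'" using F by blast
  show ?thesis
  proof (rule Lim_transform_eventually[OF Sd[of j]])
   show "\<forall>\<^sub>F k in sequentially. tuple_avg (S k) (num_vertices (F j)) (%xs. of_bool (matches (F j) (G k) xs))
    - tuple_avg {1..num_vertices (G k)} (num_vertices (F j)) (%xs. of_bool (matches (F j) (G k) xs))
    = subgraph_density F' (H k) - subgraph_density F' (G k)"
    using eventually_ge_at_top[of 1]
    by eventually_elim (simp only: H_def j subgraph_density_induced[OF fS] subgraph_density_tuple_avg[of F' "G _"])
  qed
 qed
 have "\<bar>subgraph_density (F j) (G (Suc k))\<bar> <= 1" for k j
  unfolding subgraph_density_tuple_avg by (rule tuple_avg_abs_le) auto
 then obtain \<sigma> where \<sigma>: "strict_mono \<sigma>" "!!j. convergent (%n. subgraph_density (F j) (G (Suc (\<sigma> n))))"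
  by (rule diagonal_convergent_subsequence[where B = "%_. 1" and c = "%k j. subgraph_density (F j) (G (Suc k))"]) blast
 define \<rho> where "\<rho> n = Suc (\<sigma> n)" for n
 have \<rho>: "strict_mono \<rho>" using \<sigma>(1) by (simp add: \<rho>_def strict_mono_def)
 have \<rho>1: "1 <= \<rho> n" "n <= \<rho> n" for n using seq_suble[OF \<sigma>(1), of n] by (auto simp: \<rho>_def)
 define A where "A n = (if even n then G (\<rho> (n div 2)) else H (\<rho> (n div 2)))" for n
 have "graph_seq_convergent A"
  unfolding graph_seq_convergent_def
 proof (intro conjI allI)
  show "filterlim (%n. num_vertices (A n)) at_top sequentially"
  proof (rule filterlim_at_top_mono[of "%n. n div 2"])
   show "filterlim (%n::nat. n div 2) at_top sequentially"
   proof -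
    have "Z <= n div 2" if "2 * Z <= n" for Z n :: nat using that by simp
    then show ?thesis unfolding filterlim_at_top eventually_sequentially by blast
   qed
   show "\<forall>\<^sub>F n in sequentially. n div 2 <= num_vertices (A n)"
   proof (rule always_eventually, rule allI)
    fix n
    show "n div 2 <= num_vertices (A n)"
     using G[OF \<rho>1(1)] nH[OF \<rho>1(1)] \<rho>1(2)[of "n div 2"] order_trans unfolding A_def by (cases "even n") fastforce+
   qed
  qed
 next
  fix F'
  obtain l where l: "(%n. subgraph_density F' (G (\<rho> n))) \<longlonglongrightarrow> l"
   using \<sigma>(2) F[of F'] unfolding convergent_def \<rho>_def by metis
  have "(%n. subgraph_density F' (H (\<rho> n)) - subgraph_density F' (G (\<rho> n))) \<longlonglongrightarrow> 0"
   using LIMSEQ_subseq_LIMSEQ[OF dH[of F'] \<rho>] by (simp add: o_def)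
  from tendsto_add[OF this l] have l': "(%n. subgraph_density F' (H (\<rho> n))) \<longlonglongrightarrow> l" by simp
  have "(%n. subgraph_density F' (A n)) \<longlonglongrightarrow> l"
   by (rule limseq_even_odd) (use l l' in \<open>simp_all add: A_def\<close>)
  then show "convergent (%n. subgraph_density F' (A n))" by (auto simp: convergent_def)
 qed
 then obtain l where l: "(%n. f (A n)) \<longlonglongrightarrow> l" using conv by (auto simp: convergent_def)
 have "(%n. f (A (2 * n))) \<longlonglongrightarrow> l" "(%n. f (A (2 * n + 1))) \<longlonglongrightarrow> l"
  using LIMSEQ_subseq_LIMSEQ[OF l, of "%n. 2 * n"] LIMSEQ_subseq_LIMSEQ[OF l, of "%n. 2 * n + 1"]
  by (simp_all add: strict_mono_def o_def)
 then have "(%n. f (A (2 * n)) - f (A (2 * n + 1))) \<longlonglongrightarrow> 0" using tendsto_diff by fastforce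
 then have "(%n. f (G (\<rho> n)) - f (H (\<rho> n))) \<longlonglongrightarrow> 0" by (simp add: A_def)
 then have "\<forall>\<^sub>F n in sequentially. \<bar>f (G (\<rho> n)) - f (H (\<rho> n))\<bar> < eps"
  using ed(1) by (auto simp: tendsto_iff dist_real_def)
 then obtain n where "\<bar>f (G (\<rho> n)) - f (H (\<rho> n))\<bar> < eps" by (auto simp: eventually_sequentially)
 then show False using S[OF \<rho>1(1), of n] by (simp add: H_def)
qed

section \<open>Integration on the square and kernels up to null sets\<close>

abbreviation square :: "point measure" where "square \<equiv> lebesgue_on unit_square"

text \<open>Cut norms are integrals over the completed four-dimensional measure. The product of the two completed planar measures is smaller but sufficient, since every measurable kernel agrees with one of its measurable functions almost everywhere.\<close>

abbreviation square2 :: "(point \<times> point) measure" where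
 "square2 \<equiv> square \<Otimes>\<^sub>M square"

lemma unit_square_cbox: "unit_square = cbox (0, 0) (1, 1)"
 by (auto simp: unit_square_def cbox_Pair_eq)

lemma unit_square_borel: "unit_square \<in> sets borel"
 by (simp add: unit_square_cbox)

lemma unit_square_lebesgue [simp]: "unit_square \<in> sets lebesgue"
 using unit_square_borel by simp

lemma emeasure_unit_square: "emeasure lebesgue unit_square = 1"
 unfolding unit_square_cbox by (simp add: emeasure_lborel_cbox_eq Basis_prod_def)

interpretation square: prob_space square
 by (rule prob_spaceI) (simp add: emeasure_restrict_space emeasure_unit_square)

interpretation square2: pair_prob_space square square ..

lemma sets_square_iff: "A \<in> sets square \<longleftrightarrow> A \<in> sets lebesgue & A \<subseteq> unit_square"
 by (auto simp: sets_restrict_space_iff)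

lemma space_square2: "space square2 = unit_square \<times> unit_square"
 by (simp add: space_pair_measure)

lemma null_sets_lborel_Times:
 assumes "N \<in> null_sets (lborel :: point measure)"
 shows "N \<times> UNIV \<in> null_sets (lborel :: (point \<times> point) measure)"
  "UNIV \<times> N \<in> null_sets (lborel :: (point \<times> point) measure)"
proof -
 have "N \<times> UNIV \<in> null_sets (lborel \<Otimes>\<^sub>M (lborel :: point measure))"
  using assms by (auto simp: null_sets_def lborel.emeasure_pair_measure_Times)
 then show "N \<times> UNIV \<in> null_sets (lborel :: (point \<times> point) measure)" by (simp add: lborel_prod)
 have "UNIV \<times> N \<in> null_sets ((lborel :: point measure) \<Otimes>\<^sub>M lborel)"
  using assms by (auto simp: null_sets_def lborel.emeasure_pair_measure_Times)
 then show "UNIV \<times> N \<in> null_sets (lborel :: (point \<times> point) measure)" by (simp add: lborel_prod)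
qed

lemma lebesgue_Times:
 fixes A B :: "point set"
 assumes "A \<in> sets lebesgue" "B \<in> sets lebesgue"
 shows "A \<times> B \<in> sets lebesgue" "emeasure lebesgue (A \<times> B) = emeasure lebesgue A * emeasure lebesgue B"
proof -
 obtain S N N' where A: "A = S \<union> N" "N \<subseteq> N'" "N' \<in> null_sets lborel" "S \<in> sets lborel"
  using sets_completionE[OF assms(1)] by blast
 obtain T K K' where B: "B = T \<union> K" "K \<subseteq> K'" "K' \<in> null_sets lborel" "T \<in> sets lborel"
  using sets_completionE[OF assms(2)] by blast
 have null: "(N' \<times> UNIV) \<union> (UNIV \<times> K') \<in> null_sets (lborel :: (point \<times> point) measure)"
  using null_sets_lborel_Times[OF A(3)] null_sets_lborel_Times[OF B(3)] by blast
 have ST: "S \<times> T \<in> sets (lborel :: (point \<times> point) measure)"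
  using A(4) B(4) lborel_prod by (metis pair_measureI)
 show AB: "A \<times> B \<in> sets lebesgue"
  by (rule sets_completionI[OF _ _ null ST, of _ "A \<times> B - S \<times> T"]) (use A B in auto)
 have "emeasure lebesgue (A \<times> B) = emeasure lebesgue (S \<times> T)"
 proof (rule emeasure_eq_AE)
  have "AE z in lebesgue. z \<notin> (N' \<times> UNIV) \<union> (UNIV \<times> K')"
   using null AE_completion AE_not_in by blast
  then show "AE z in lebesgue. z \<in> A \<times> B \<longleftrightarrow> z \<in> S \<times> T"
   by eventually_elim (use A B in auto)
 qed (use AB ST in auto)
 also have "... = emeasure (lborel \<Otimes>\<^sub>M lborel) (S \<times> T)" using ST by (simp add: lborel_prod)
 also have "... = emeasure lborel S * emeasure lborel T"
  by (rule lborel.emeasure_pair_measure_Times) (use A B in auto)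
 also have "emeasure lborel S = emeasure lebesgue A"
 proof -
  have "emeasure lebesgue A = emeasure lebesgue S"
  proof (rule emeasure_eq_AE)
   have "AE z in lebesgue. z \<notin> N'" using A(3) AE_completion AE_not_in by blast
   then show "AE z in lebesgue. z \<in> A \<longleftrightarrow> z \<in> S" by eventually_elim (use A in auto)
  qed (use assms A in auto)
  then show ?thesis using A(4) by simp
 qed
 also have "emeasure lborel T = emeasure lebesgue B"
 proof -
  have "emeasure lebesgue B = emeasure lebesgue T"
  proof (rule emeasure_eq_AE)
   have "AE z in lebesgue. z \<notin> K'" using B(3) AE_completion AE_not_in by blast
   then show "AE z in lebesgue. z \<in> B \<longleftrightarrow> z \<in> T" by eventually_elim (use B in auto)
  qed (use assms B in auto)
  then show ?thesis using B(4) by simp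
 qed
 finally show "emeasure lebesgue (A \<times> B) = emeasure lebesgue A * emeasure lebesgue B" .
qed

abbreviation hypercube :: "(point \<times> point) measure" where
 "hypercube \<equiv> lebesgue_on (unit_square \<times> unit_square)"

lemma hypercube_lebesgue [simp]: "unit_square \<times> unit_square \<in> sets lebesgue"
 by (rule lebesgue_Times) simp_all

lemma id_measurable_hypercube_square2: "(%z. z) \<in> measurable hypercube square2"
proof (rule measurable_pair)
 show "fst \<circ> (%z. z) \<in> measurable hypercube square"
 proof (rule measurableI)
  fix A assume "A \<in> sets square"
  then have A: "A \<in> sets lebesgue" "A \<subseteq> unit_square" by (auto simp: sets_square_iff)
  have "(fst \<circ> (%z. z)) -` A \<inter> space hypercube = A \<times> unit_square" using A(2) by auto
  then show "(fst \<circ> (%z. z)) -` A \<inter> space hypercube \<in> sets hypercube"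
   using lebesgue_Times(1)[OF A(1) unit_square_lebesgue] A(2) by (auto simp: sets_restrict_space_iff)
 qed auto
 show "snd \<circ> (%z. z) \<in> measurable hypercube square"
 proof (rule measurableI)
  fix A assume "A \<in> sets square"
  then have A: "A \<in> sets lebesgue" "A \<subseteq> unit_square" by (auto simp: sets_square_iff)
  have "(snd \<circ> (%z. z)) -` A \<inter> space hypercube = unit_square \<times> A" using A(2) by auto
  then show "(snd \<circ> (%z. z)) -` A \<inter> space hypercube \<in> sets hypercube"
   using lebesgue_Times(1)[OF unit_square_lebesgue A(1)] A(2) by (auto simp: sets_restrict_space_iff)
 qed auto
qed

lemma square2_eq_distr: "square2 = distr hypercube square2 (%z. z)"
proof (rule pair_measure_eqI)
 fix A B assume "A \<in> sets square" and "B \<in> sets square"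
 then have AB: "A \<times> B \<in> sets square2" by (rule pair_measureI)
 from \<open>A \<in> sets square\<close> \<open>B \<in> sets square\<close> have A: "A \<in> sets lebesgue" "A \<subseteq> unit_square"
  and B: "B \<in> sets lebesgue" "B \<subseteq> unit_square" by (auto simp: sets_square_iff)
 have sub: "A \<times> B \<subseteq> unit_square \<times> unit_square" using A B by blast
 have "emeasure (distr hypercube square2 (%z. z)) (A \<times> B) = emeasure hypercube ((%z. z) -` (A \<times> B) \<inter> space hypercube)"
  by (rule emeasure_distr[OF id_measurable_hypercube_square2 AB])
 also have "(%z. z) -` (A \<times> B) \<inter> space hypercube = A \<times> B" using sub by auto
 also have "emeasure hypercube (A \<times> B) = emeasure lebesgue (A \<times> B)"
  by (rule emeasure_restrict_space) (use sub in auto)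
 also have "... = emeasure lebesgue A * emeasure lebesgue B"
  by (rule lebesgue_Times[OF A(1) B(1)])
 also have "emeasure lebesgue A = emeasure square A"
  by (rule emeasure_restrict_space[symmetric]) (use A in auto)
 also have "emeasure lebesgue B = emeasure square B"
  by (rule emeasure_restrict_space[symmetric]) (use B in auto)
 finally show "emeasure square A * emeasure square B = emeasure (distr hypercube square2 (%z. z)) (A \<times> B)" ..
next
 show "sigma_finite_measure square" by (rule square.sigma_finite_measure_axioms)
 show "sigma_finite_measure square" by (rule square.sigma_finite_measure_axioms)
 show "sets square2 = sets (distr hypercube square2 (%z. z))" by (rule sets_distr[symmetric])
qed

lemma measurable_hypercube: "X \<in> measurable square2 N ==> X \<in> measurable hypercube N"
 by (rule measurable_compose[OF id_measurable_hypercube_square2])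

lemma integral_hypercube:
 fixes X :: "_ => real"
 assumes "X \<in> borel_measurable square2"
 shows "integral\<^sup>L hypercube X = integral\<^sup>L square2 X"
proof -
 have "integral\<^sup>L square2 X = integral\<^sup>L (distr hypercube square2 (%z. z)) X"
  using square2_eq_distr by (rule arg_cong)
 then show ?thesis by (simp only: integral_distr[OF id_measurable_hypercube_square2 assms])
qed

lemma borel_measurable_square2: "borel_measurable borel \<subseteq> borel_measurable square2"
proof
 fix g :: "point \<times> point => 'c::topological_space" assume g: "g \<in> borel_measurable borel"
 have b: "(%u. u) \<in> measurable square (borel :: point measure)"
  by (rule measurable_restrict_space1) (auto intro: measurable_completion)
 have "(%z. (fst z, snd z)) \<in> measurable square2 (borel \<Otimes>\<^sub>M borel)"
  by (intro measurable_Pair measurable_compose[OF measurable_fst b] measurable_compose[OF measurable_snd b])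
 then have "(%z. z) \<in> measurable square2 borel" by (simp add: borel_prod)
 from measurable_compose[OF this g] show "g \<in> borel_measurable square2" by simp
qed

lemma AE_hypercube_iff: "(AE z in hypercube. P z) \<longleftrightarrow> (AE z in square2. P z)"
proof
 assume "AE z in hypercube. P z"
 then have "AE z in lebesgue. z \<in> unit_square \<times> unit_square \<longrightarrow> P z"
  by (subst (asm) AE_restrict_space_iff) auto
 then have "AE z in lborel. z \<in> unit_square \<times> unit_square \<longrightarrow> P z"
  by (simp add: AE_completion_iff)
 then obtain N where N: "{z. \<not> (z \<in> unit_square \<times> unit_square \<longrightarrow> P z)} \<subseteq> N" "N \<in> null_sets lborel"
  by (auto simp: eventually_ae_filter)
 have ind: "indicator N \<in> borel_measurable square2"
  using borel_measurable_square2 N(2) by (auto simp: null_sets_def)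
 have Nm: "N \<inter> space square2 \<in> sets square2"
 proof -
  have "{z \<in> space square2. indicator N z = (1::real)} \<in> sets square2"
   by (rule borel_measurable_eq) (use ind in auto)
  moreover have "{z \<in> space square2. indicator N z = (1::real)} = N \<inter> space square2" by (auto simp: indicator_def)
  ultimately show ?thesis by simp
 qed
 have "emeasure square2 (N \<inter> space square2) = emeasure hypercube (N \<inter> space square2)"
 proof -
  have "emeasure (distr hypercube square2 (%z. z)) (N \<inter> space square2) = emeasure hypercube ((%z. z) -` (N \<inter> space square2) \<inter> space hypercube)"
   by (rule emeasure_distr[OF id_measurable_hypercube_square2 Nm])
  moreover have "(%z. z) -` (N \<inter> space square2) \<inter> space hypercube = N \<inter> space square2"
   unfolding space_square2 space_lebesgue_on by blast
  ultimately show ?thesis using square2_eq_distr by metis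
 qed
 also have "... = emeasure lebesgue (N \<inter> space square2)"
  by (rule emeasure_restrict_space) (auto simp: space_square2)
 also have "... <= emeasure lebesgue N"
  by (rule emeasure_mono) (use N(2) in auto)
 also have "... = 0" using N(2) by (auto simp: null_sets_def)
 finally have "N \<inter> space square2 \<in> null_sets square2" using Nm by (auto simp: null_sets_def)
 then show "AE z in square2. P z"
  by (rule AE_I') (use N(1) in \<open>auto simp: space_square2\<close>)
next
 assume "AE z in square2. P z"
 then have "AE z in distr hypercube square2 (%z. z). P z" using square2_eq_distr by metis
 then show "AE z in hypercube. P z"
  by (rule AE_distrD[OF id_measurable_hypercube_square2])
qed

lemma borel_measurable_lebesgue_on_AE:
 fixes f g :: "'a::euclidean_space => real"
 assumes S: "S \<in> sets lebesgue" and f: "f \<in> borel_measurable (lebesgue_on S)"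
  and ae: "AE x in lebesgue_on S. f x = g x"
 shows "g \<in> borel_measurable (lebesgue_on S)"
proof -
 have "AE x in lborel. x \<in> S \<longrightarrow> f x = g x"
  using ae S by (simp add: AE_restrict_space_iff AE_completion_iff)
 then obtain N where N: "{x. \<not> (x \<in> S \<longrightarrow> f x = g x)} \<subseteq> N" "N \<in> null_sets lborel"
  by (auto simp: eventually_ae_filter)
 have sub: "B \<in> sets (lebesgue_on S)" if "B \<subseteq> N \<inter> S" for B
  using null_sets_completion[OF N(2), of B] that S by (auto simp: sets_restrict_space_iff)
 show ?thesis
 proof (rule measurableI)
  fix A :: "real set" assume A: "A \<in> sets borel"
  have "g -` A \<inter> space (lebesgue_on S) = ((f -` A \<inter> space (lebesgue_on S)) - N \<inter> S) \<union> (g -` A \<inter> N \<inter> S)"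
   using N(1) by auto
  moreover have "f -` A \<inter> space (lebesgue_on S) \<in> sets (lebesgue_on S)"
   using f A by (rule measurable_sets)
  ultimately show "g -` A \<inter> space (lebesgue_on S) \<in> sets (lebesgue_on S)"
   using sub[of "N \<inter> S"] sub[of "g -` A \<inter> N \<inter> S"] by auto
 qed simp
qed

lemma weighted_measurable:
 fixes K :: "_ => real"
 assumes "K \<in> borel_measurable square2" "a \<in> borel_measurable square" "b \<in> borel_measurable square"
 shows "(%z. a (fst z) * b (snd z) * K z) \<in> borel_measurable square2"
 by (intro borel_measurable_times measurable_compose[OF measurable_fst assms(2)]
  measurable_compose[OF measurable_snd assms(3)] assms(1))

text \<open>A representative defined and bounded everywhere, which makes Fubini arguments free of exceptional sets.\<close>

definition kernel_version :: "(point \<times> point => real) => (point \<times> point => real) => bool" where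
 "kernel_version W K \<longleftrightarrow> K \<in> borel_measurable square2 & (\<forall>z. 0 <= K z & K z <= 1) & (AE z in square2. W z = K z)"

lemma orderon_kernel_version:
 assumes "W \<in> orderons"
 obtains K where "kernel_version W K"
proof -
 let ?Q = "unit_square \<times> unit_square"
 have W: "W \<in> borel_measurable hypercube" "!!z. z \<in> ?Q ==> 0 <= W z & W z <= 1"
  using assms unfolding orderons_def by (auto simp: PiE_iff)
 have "(%z. if z \<in> ?Q then W z else 0) \<in> borel_measurable lebesgue"
  by (rule borel_measurable_if_I[OF W(1)]) simp
 from completion_ex_borel_measurable_real[OF this]
 obtain g where g: "g \<in> borel_measurable lborel" and ae: "AE z in lborel. (if z \<in> ?Q then W z else 0) = g z" by blast
 define K where "K z = max 0 (min 1 (g z))" for z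
 have "g \<in> borel_measurable square2" using g borel_measurable_square2 by auto
 then have "K \<in> borel_measurable square2" unfolding K_def by measurable
 moreover have "\<forall>z. 0 <= K z & K z <= 1" by (simp add: K_def)
 moreover have "AE z in hypercube. W z = K z"
 proof (subst AE_restrict_space_iff)
  show "AE z in lebesgue. z \<in> ?Q \<longrightarrow> W z = K z"
   using AE_completion[OF ae]
  proof eventually_elim
   case (elim z)
   then show ?case using W(2)[of z] unfolding K_def by (metis max.absorb2 min.absorb2)
  qed
 qed simp
 ultimately show ?thesis using that by (simp add: kernel_version_def AE_hypercube_iff)
qed

lemma integral_Times_eq_square2:
 fixes X K :: "point \<times> point => real"
 assumes K: "K \<in> borel_measurable square2" and ae: "AE z in square2. X z = K z"
  and S: "S \<in> sets square" and T: "T \<in> sets square"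
 shows "(LINT z:S \<times> T|lebesgue. X z) = (\<integral>z. indicator S (fst z) * indicator T (snd z) * K z \<partial>square2)"
proof -
 have sub: "S \<times> T \<subseteq> unit_square \<times> unit_square" using S T by (auto simp: sets_square_iff)
 let ?g = "%z. indicator S (fst z) * indicator T (snd z) * K z"
 have g: "?g \<in> borel_measurable square2"
  by (rule weighted_measurable[OF K]) (use S T in auto)
 have "(LINT z:S \<times> T|lebesgue. X z) = (\<integral>z. indicator (S \<times> T) z * X z \<partial>lebesgue)"
  by (simp add: set_lebesgue_integral_def)
 also have "... = (\<integral>z. indicator (unit_square \<times> unit_square) z *\<^sub>R (indicator (S \<times> T) z * X z) \<partial>lebesgue)"
  by (intro Bochner_Integration.integral_cong) (use sub in \<open>auto simp: indicator_def\<close>)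
 also have "... = (\<integral>z. indicator (S \<times> T) z * X z \<partial>hypercube)"
  by (rule integral_restrict_space[symmetric]) simp
 also have "... = (\<integral>z. ?g z \<partial>hypercube)"
 proof (rule integral_cong_AE)
  have ae': "AE z in hypercube. ?g z = indicator (S \<times> T) z * X z"
   using ae unfolding AE_hypercube_iff by eventually_elim (auto simp: indicator_def)
  show gm: "?g \<in> borel_measurable hypercube" by (rule measurable_hypercube[OF g])
  show "(%z. indicator (S \<times> T) z * X z) \<in> borel_measurable hypercube"
   by (rule borel_measurable_lebesgue_on_AE[OF hypercube_lebesgue gm ae'])
  show "AE z in hypercube. indicator (S \<times> T) z * X z = ?g z" using ae' by eventually_elim simp
 qed
 finally show ?thesis by (simp add: integral_hypercube[OF g])
qed

lemma abs_integral_square2_le: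
 fixes B :: real
 assumes "f \<in> borel_measurable square2" "!!z. \<bar>f z\<bar> <= B"
 shows "integrable square2 f" "\<bar>integral\<^sup>L square2 f\<bar> <= B"
proof -
 show i: "integrable square2 f"
  by (rule square2.integrable_const_bound[of _ B]) (use assms in auto)
 have "\<bar>integral\<^sup>L square2 f\<bar> <= (\<integral>z. B \<partial>square2)"
  by (rule order_trans[OF integral_abs_bound]) (intro integral_mono integrable_abs i, use assms in auto)
 then show "\<bar>integral\<^sup>L square2 f\<bar> <= B" by (simp add: square2.prob_space)
qed

lemma cut_norm_upper:
 fixes B :: real
 assumes K: "K \<in> borel_measurable square2" "!!z. \<bar>K z\<bar> <= B" and ae: "AE z in square2. X z = K z"
  and S: "S \<in> sets square" and T: "T \<in> sets square"
 shows "\<bar>\<integral>z. indicator S (fst z) * indicator T (snd z) * K z \<partial>square2\<bar> <= cut_norm X"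
proof -
 have bdd: "\<bar>LINT z:S \<times> T|lebesgue. X z\<bar> <= B" if "S \<in> sets square" "T \<in> sets square" for S T
  unfolding integral_Times_eq_square2[OF K(1) ae that]
 proof (rule abs_integral_square2_le)
  show "(%z. indicator S (fst z) * indicator T (snd z) * K z) \<in> borel_measurable square2"
   by (rule weighted_measurable[OF K(1)]) (use that in auto)
  show "\<bar>indicator S (fst z) * indicator T (snd z) * K z\<bar> <= B" for z
   using K(2)[of z] by (auto simp: indicator_def)
 qed
 show ?thesis unfolding integral_Times_eq_square2[OF K(1) ae S T, symmetric] cut_norm_def
  by (rule cSUP_upper2[of _ _ "(S, T)"]) (use S T bdd in \<open>auto intro!: bdd_aboveI2[of _ _ B]\<close>)
qed

lemma cut_norm_least:
 assumes K: "K \<in> borel_measurable square2" and ae: "AE z in square2. X z = K z"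
  and le: "!!S T. S \<in> sets square ==> T \<in> sets square ==>
   \<bar>\<integral>z. indicator S (fst z) * indicator T (snd z) * K z \<partial>square2\<bar> <= c"
 shows "cut_norm X <= c"
 unfolding cut_norm_def
 by (rule cSUP_least) (use le in \<open>auto simp: integral_Times_eq_square2[OF K ae] intro!: exI[of _ "{}"]\<close>)

text \<open>The integral is affine in the weight, so it is extremal at the indicators of the sets where the other factor is positive or negative.\<close>

lemma abs_integral_mult_le_sets:
 fixes phi a :: "'a => real"
 assumes phi: "integrable M phi" and a: "a \<in> borel_measurable M" "!!x. 0 <= a x & a x <= 1"
  and c: "!!S. S \<in> sets M ==> \<bar>\<integral>x. indicator S x * phi x \<partial>M\<bar> <= c"
 shows "\<bar>\<integral>x. a x * phi x \<partial>M\<bar> <= c"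
proof -
 have m[measurable]: "phi \<in> borel_measurable M" "a \<in> borel_measurable M" using phi a by auto
 let ?P = "{x \<in> space M. phi x > 0}" and ?N = "{x \<in> space M. phi x < 0}"
 have i: "integrable M (%x. a x * phi x)"
  by (rule Bochner_Integration.integrable_bound[OF phi]) (use a in \<open>auto simp: abs_mult mult_left_le_one_le\<close>)
 have iS: "integrable M (%x. indicator S x * phi x)" if "S \<in> sets M" for S
  using integrable_mult_indicator[OF that phi] by simp
 have P: "?P \<in> sets M" and N: "?N \<in> sets M" by measurable
 have "(\<integral>x. a x * phi x \<partial>M) <= (\<integral>x. indicator ?P x * phi x \<partial>M)"
 proof (rule integral_mono[OF i iS[OF P]])
  fix x assume "x \<in> space M"
  then show "a x * phi x <= indicator ?P x * phi x"
   using a(2)[of x] by (cases "phi x > 0") (auto simp: mult_left_le_one_le mult_nonneg_nonpos)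
 qed
 moreover have "(\<integral>x. indicator ?N x * phi x \<partial>M) <= (\<integral>x. a x * phi x \<partial>M)"
 proof (rule integral_mono[OF iS[OF N] i])
  fix x assume "x \<in> space M"
  moreover have "phi x <= a x * phi x" if "phi x < 0" using that a(2)[of x] mult_right_mono_neg[of "a x" 1 "phi x"] by auto
  ultimately show "indicator ?N x * phi x <= a x * phi x"
   using a(2)[of x] by (cases "phi x < 0") auto
 qed
 ultimately show ?thesis using c[OF P] c[OF N] by linarith
qed

text \<open>Bounds for indicator rectangles extend to product weights, one coordinate at a time.\<close>

lemma abs_integral_square2_weights_le:
 fixes B c :: real
 assumes K: "K \<in> borel_measurable square2" "!!z. \<bar>K z\<bar> <= B"
  and c: "!!S T. S \<in> sets square ==> T \<in> sets square ==>
   \<bar>\<integral>z. indicator S (fst z) * indicator T (snd z) * K z \<partial>square2\<bar> <= c"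
  and a: "a \<in> borel_measurable square" "!!u. 0 <= a u & a u <= 1"
  and b: "b \<in> borel_measurable square" "!!v. 0 <= b v & b v <= 1"
 shows "\<bar>\<integral>z. a (fst z) * b (snd z) * K z \<partial>square2\<bar> <= c"
proof -
 have B: "B \<ge> 0" using K(2) abs_ge_zero order_trans by blast
 have iK: "integrable square2 (%z. f (fst z) * g (snd z) * K z)"
  if "f \<in> borel_measurable square" "g \<in> borel_measurable square" and "!!u. 0 <= f u & f u <= 1" "!!u. 0 <= g u & g u <= 1"
  for f g :: "point => real"
 proof (rule abs_integral_square2_le)
  show "(%z. f (fst z) * g (snd z) * K z) \<in> borel_measurable square2"
   by (rule weighted_measurable[OF K(1) that(1,2)])
  show "\<bar>f (fst z) * g (snd z) * K z\<bar> <= B" for z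
  proof -
   have "f (fst z) * g (snd z) <= 1" "0 <= f (fst z) * g (snd z)" using that(3)[of "fst z"] that(4)[of "snd z"] by (auto intro: mult_le_one)
   then have "\<bar>f (fst z) * g (snd z)\<bar> * \<bar>K z\<bar> <= 1 * B" using K(2)[of z] B by (intro mult_mono) auto
   then show ?thesis by (simp only: abs_mult[symmetric] mult_1)
  qed
 qed
 have i1: "integrable square (%u. \<integral>v. g v * K (u, v) \<partial>square)"
  if "g \<in> borel_measurable square" and "!!u. 0 <= g u & g u <= 1" for g :: "point => real"
  using square2.integrable_fst'[OF iK[of "%_. 1" g]] that by simp
 have f1: "(\<integral>z. f (fst z) * g (snd z) * K z \<partial>square2) = (\<integral>u. f u * (\<integral>v. g v * K (u, v) \<partial>square) \<partial>square)"
  if "f \<in> borel_measurable square" "g \<in> borel_measurable square" "!!u. 0 <= f u & f u <= 1" "!!u. 0 <= g u & g u <= 1" for f g :: "point => real"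
  using square2.integral_fst'[OF iK[OF that]] by (simp add: mult.assoc)
 have i2: "integrable square (%v. \<integral>u. f u * K (u, v) \<partial>square)"
  if "f \<in> borel_measurable square" and "!!u. 0 <= f u & f u <= 1" for f :: "point => real"
  using square2.integrable_snd[of "%u v. f u * K (u, v)"] iK[of f "%_. 1"] that by (simp add: case_prod_beta')
 have f2: "(\<integral>z. f (fst z) * g (snd z) * K z \<partial>square2) = (\<integral>v. g v * (\<integral>u. f u * K (u, v) \<partial>square) \<partial>square)"
  if "f \<in> borel_measurable square" "g \<in> borel_measurable square" "!!u. 0 <= f u & f u <= 1" "!!u. 0 <= g u & g u <= 1" for f g :: "point => real"
 proof -
  have "(\<integral>v. (\<integral>u. f u * g v * K (u, v) \<partial>square) \<partial>square) = (\<integral>z. f (fst z) * g (snd z) * K z \<partial>square2)"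
   using square2.integral_snd[of "%u v. f u * g v * K (u, v)"] iK[OF that] by (simp add: case_prod_beta')
  moreover have "(\<integral>u. f u * g v * K (u, v) \<partial>square) = g v * (\<integral>u. f u * K (u, v) \<partial>square)" for v
  proof -
   have "(%u. f u * g v * K (u, v)) = (%u. g v * (f u * K (u, v)))" by (auto simp: fun_eq_iff)
   then show ?thesis by (simp only: integral_mult_right_zero)
  qed
  ultimately show ?thesis by (simp only:)
 qed
 have ind: "0 <= (indicator A u :: real) & indicator A u <= (1 :: real)" for A and u :: point by (simp add: indicator_def)
 have 1: "\<bar>\<integral>z. a (fst z) * indicator T (snd z) * K z \<partial>square2\<bar> <= c" if T: "T \<in> sets square" for T
 proof -
  have "\<bar>\<integral>u. a u * (\<integral>v. indicator T v * K (u, v) \<partial>square) \<partial>square\<bar> <= c"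
  proof (rule abs_integral_mult_le_sets[OF i1 a])
   fix S assume S: "S \<in> sets square"
   show "\<bar>\<integral>u. indicator S u * (\<integral>v. indicator T v * K (u, v) \<partial>square) \<partial>square\<bar> <= c"
    using c[OF S T] unfolding f1[OF borel_measurable_indicator[OF S] borel_measurable_indicator[OF T] ind ind] .
  qed (use T in \<open>auto simp: indicator_def\<close>)
  then show ?thesis unfolding f1[OF a(1) borel_measurable_indicator[OF T] a(2) ind] .
 qed
 have "\<bar>\<integral>v. b v * (\<integral>u. a u * K (u, v) \<partial>square) \<partial>square\<bar> <= c"
 proof (rule abs_integral_mult_le_sets[OF i2[OF a] b])
  fix T assume T: "T \<in> sets square"
  show "\<bar>\<integral>v. indicator T v * (\<integral>u. a u * K (u, v) \<partial>square) \<partial>square\<bar> <= c"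
   using 1[OF T] by (subst (asm) f2[OF a(1) borel_measurable_indicator[OF T] a(2) ind])
 qed
 then show ?thesis by (subst f2[OF a(1) b(1) a(2) b(2)])
qed

lemma mp_bijection_measurable: "f \<in> mp_bijections ==> f \<in> measurable square square"
 by (auto simp: mp_bijections_def measure_preserving_map_def)

lemma mp_bijection_distr: "f \<in> mp_bijections ==> distr square square f = square"
 by (rule measure_eqI) (simp_all add: emeasure_distr mp_bijections_def measure_preserving_map_def)

lemma mp_bijection_distr2:
 assumes "f \<in> mp_bijections"
 shows "(%z. (f (fst z), f (snd z))) \<in> measurable square2 square2"
  "distr square2 square2 (%z. (f (fst z), f (snd z))) = square2"
proof -
 note [measurable] = mp_bijection_measurable[OF assms]
 show "(%z. (f (fst z), f (snd z))) \<in> measurable square2 square2" by measurable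
 show "distr square2 square2 (%z. (f (fst z), f (snd z))) = square2"
 proof -
  have "(%(x, y). (f x, f y)) = (%z. (f (fst z), f (snd z)))" by auto
  then show ?thesis
   using pair_measure_distr[OF mp_bijection_measurable[OF assms] mp_bijection_measurable[OF assms]]
   by (simp only: mp_bijection_distr[OF assms] square.sigma_finite_measure_axioms)
 qed
qed

lemma kernel_version_pullback:
 assumes "kernel_version U K" "f \<in> mp_bijections"
 shows "kernel_version (%(u, v). U (f u, f v)) (%z. K (f (fst z), f (snd z)))"
proof -
 note m = mp_bijection_distr2[OF assms(2)]
 have K: "K \<in> borel_measurable square2" "\<forall>z. 0 <= K z & K z <= 1" "AE z in square2. U z = K z"
  using assms(1) by (auto simp: kernel_version_def)
 have "AE z in square2. U (f (fst z), f (snd z)) = K (f (fst z), f (snd z))"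
  using AE_distrD[OF m(1), where P = "%z. U z = K z"] K(3) unfolding m(2) by blast
 moreover have "0 <= K (f (fst z), f (snd z)) & K (f (fst z), f (snd z)) <= 1" for z
  by (rule K(2)[rule_format])
 ultimately show ?thesis
  using measurable_compose[OF m(1) K(1)] unfolding kernel_version_def case_prod_beta by (intro conjI allI) blast+
qed

section \<open>The counting lemma\<close>

interpretation PiM_square: product_sigma_finite "%_::nat. square" ..

lemma integral_square_const: "(\<integral>u. c \<partial>square) = (c :: real)"
 by (simp only: lebesgue_integral_const square.prob_space scaleR_one)

lemma prob_space_PiM_square: "prob_space (PiM I (%_::nat. square))"
 by (rule prob_space_PiM) (rule square.prob_space_axioms)

lemma integrable_PiM_square_bounded:
 fixes f :: "_ => real"
 assumes "f \<in> borel_measurable (PiM I (%_::nat. square))" "!!x. \<bar>f x\<bar> <= B"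
 shows "integrable (PiM I (%_::nat. square)) f"
proof -
 interpret PI: prob_space "PiM I (%_::nat. square)" by (rule prob_space_PiM_square)
 show ?thesis by (rule PI.integrable_const_bound[of _ B]) (use assms in auto)
qed

lemma component_pair_measurable:
 assumes "p \<in> I" "q \<in> I" "K \<in> borel_measurable square2"
 shows "(%x. K (x p, x q)) \<in> borel_measurable (PiM I (%_::nat. square))"
 by (rule measurable_compose[OF measurable_Pair assms(3)]) (use assms in \<open>auto intro: measurable_component_singleton\<close>)

lemma prod_unit_interval:
 fixes g :: "'a => real"
 assumes "!!e. e \<in> A ==> 0 <= g e & g e <= 1"
 shows "0 <= prod g A & prod g A <= 1"
 using assms by (auto intro: prod_nonneg prod_le_1)

text \<open>Replacing the kernel on one edge: freezing all other variables makes the remaining factors a product of a weight in each of the two variables of the edge, so the error is at most the cut norm.\<close>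

lemma counting_step:
 fixes L :: "nat \<times> nat => point \<times> point => real"
 assumes I: "finite I" "i \<in> I" "j \<in> I" "i ~= j"
  and P: "finite P" "P \<subseteq> I \<times> I" "!!p q. (p, q) \<in> P ==> \<not> ({i, j} \<subseteq> {p, q})"
  and L: "!!e. e \<in> P ==> L e \<in> borel_measurable square2" "!!e z. e \<in> P ==> 0 <= L e z & L e z <= 1"
  and X: "X \<in> borel_measurable square2" "!!z. \<bar>X z\<bar> <= 1"
  and \<eta>: "!!a b. a \<in> borel_measurable square ==> b \<in> borel_measurable square ==>
    (!!u. 0 <= a u & a u <= 1) ==> (!!u. 0 <= b u & b u <= 1) ==>
    \<bar>\<integral>z. a (fst z) * b (snd z) * X z \<partial>square2\<bar> <= \<eta>"
 shows "\<bar>\<integral>x. X (x i, x j) * (\<Prod>e\<in>P. L e (x (fst e), x (snd e))) \<partial>PiM I (%_. square)\<bar> <= \<eta>"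
proof -
 let ?M = "%J. PiM J (%_::nat. square)"
 define J where "J = I - {i, j}"
 have J: "finite J" "i \<notin> J" "j \<notin> J" "i \<notin> insert j J" "I = insert i (insert j J)"
  using I by (auto simp: J_def)
 define G where "G x = X (x i, x j) * (\<Prod>e\<in>P. L e (x (fst e), x (snd e)))" for x
 have Lp: "0 <= (\<Prod>e\<in>P. L e (x (fst e), x (snd e))) & (\<Prod>e\<in>P. L e (x (fst e), x (snd e))) <= 1" for x
  by (rule prod_unit_interval) (rule L(2))
 have Gb: "\<bar>G x\<bar> <= 1" for x
 proof -
  have "\<bar>X (x i, x j)\<bar> * \<bar>\<Prod>e\<in>P. L e (x (fst e), x (snd e))\<bar> <= 1 * 1"
   by (rule mult_mono) (use X(2) Lp[of x] in auto)
  then show ?thesis by (simp add: G_def abs_mult)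
 qed
 have Gm: "G \<in> borel_measurable (?M I)"
  unfolding G_def
  by (intro borel_measurable_times borel_measurable_prod component_pair_measurable) (use I P L X in auto)
 have m1: "(%(x, u). G (x(i := u))) \<in> borel_measurable (?M (insert j J) \<Otimes>\<^sub>M square)"
 proof -
  have "(%(x, u). x(i := u)) \<in> measurable (?M (insert j J) \<Otimes>\<^sub>M square) (?M I)"
   unfolding J(5) by (rule measurable_add_dim)
  from measurable_compose[OF this Gm] show ?thesis by (simp add: case_prod_beta')
 qed
 define H where "H x = (\<integral>u. G (x(i := u)) \<partial>square)" for x
 have Hm: "H \<in> borel_measurable (?M (insert j J))"
  unfolding H_def by (rule square.borel_measurable_lebesgue_integral[OF m1])
 have Hb: "\<bar>H x\<bar> <= 1" for x
 proof (cases "integrable square (%u. G (x(i := u)))")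
  case True
  have "\<bar>H x\<bar> <= (\<integral>u. 1 \<partial>square)"
   unfolding H_def by (rule order_trans[OF integral_abs_bound]) (intro integral_mono integrable_abs True, use Gb in auto)
  then show ?thesis by (simp only: integral_square_const)
 qed (simp add: H_def not_integrable_integral_eq)
 have "integral\<^sup>L (?M I) G = (\<integral>x. H x \<partial>?M (insert j J))"
 proof -
  have "integrable (?M (insert i (insert j J))) G"
   using integrable_PiM_square_bounded[OF Gm Gb] unfolding J(5)[symmetric] .
  from PiM_square.product_integral_insert[OF _ J(4) this] show ?thesis
   unfolding H_def using J(1,5) by (metis finite_insert)
 qed
 also have "... = (\<integral>x. (\<integral>v. H (x(j := v)) \<partial>square) \<partial>?M J)"
  by (rule PiM_square.product_integral_insert[OF J(1,3)]) (rule integrable_PiM_square_bounded[OF Hm Hb])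
 finally have eq: "integral\<^sup>L (?M I) G = (\<integral>x. (\<integral>v. H (x(j := v)) \<partial>square) \<partial>?M J)" .
 have inner: "\<bar>\<integral>v. H (x(j := v)) \<partial>square\<bar> <= \<eta>" if x: "x \<in> space (?M J)" for x
 proof -
  define A where "A = {e \<in> P. fst e = i \<or> snd e = i}"
  define B where "B = P - A"
  define a where "a u = (\<Prod>e\<in>A. L e ((x(i := u)) (fst e), (x(i := u)) (snd e)))" for u
  define b where "b v = (\<Prod>e\<in>B. L e ((x(j := v)) (fst e), (x(j := v)) (snd e)))" for v
  have AB: "A \<subseteq> P" "B \<subseteq> P" "finite A" "finite B" "A \<union> B = P" "A \<inter> B = {}"
   using P(1) by (auto simp: A_def B_def)
  have Aj: "fst e ~= j & snd e ~= j" if "e \<in> A" for e using that P(3)[of "fst e" "snd e"] I(4) by (auto simp: A_def)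
  have Bi: "fst e ~= i & snd e ~= i" if "e \<in> B" for e using that by (auto simp: A_def B_def)
  have cm: "(%u. (x(k := u)) p) \<in> measurable square square" if "p \<in> I" "p ~= l" "{k, l} = {i, j}" for k l p
  proof (cases "p = k")
   case False
   then have "p \<in> J" using that by (auto simp: J_def)
   then have "x p \<in> space square" using x by (auto simp: space_PiM PiE_iff)
   then show ?thesis using False by simp
  qed simp
  have am: "a \<in> borel_measurable square"
   unfolding a_def
  proof (rule borel_measurable_prod)
   fix e assume e: "e \<in> A"
   have "(%u. ((x(i := u)) (fst e), (x(i := u)) (snd e))) \<in> measurable square square2"
    by (rule measurable_Pair; rule cm[of _ j]) (use e AB Aj[OF e] P(2) in auto)
   then show "(%u. L e ((x(i := u)) (fst e), (x(i := u)) (snd e))) \<in> borel_measurable square"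
    by (rule measurable_compose) (rule L(1), use e AB in blast)
  qed
  have bm: "b \<in> borel_measurable square"
   unfolding b_def
  proof (rule borel_measurable_prod)
   fix e assume e: "e \<in> B"
   have "(%u. ((x(j := u)) (fst e), (x(j := u)) (snd e))) \<in> measurable square square2"
    by (rule measurable_Pair; rule cm[of _ i]) (use e AB Bi[OF e] P(2) in auto)
   then show "(%u. L e ((x(j := u)) (fst e), (x(j := u)) (snd e))) \<in> borel_measurable square"
    by (rule measurable_compose) (rule L(1), use e AB in blast)
  qed
  have ab: "0 <= a u & a u <= 1" for u unfolding a_def by (rule prod_unit_interval) (use L AB in blast)
  have bb: "0 <= b u & b u <= 1" for u unfolding b_def by (rule prod_unit_interval) (use L AB in blast)
  have split: "G (x(j := v, i := u)) = a u * b v * X (u, v)" for u v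
  proof -
   have 1: "(\<Prod>e\<in>A. L e ((x(j := v, i := u)) (fst e), (x(j := v, i := u)) (snd e))) = a u"
    unfolding a_def using Aj by (intro prod.cong) auto
   have 2: "(\<Prod>e\<in>B. L e ((x(j := v, i := u)) (fst e), (x(j := v, i := u)) (snd e))) = b v"
    unfolding b_def using Bi by (intro prod.cong) auto
   have "(\<Prod>e\<in>P. L e ((x(j := v, i := u)) (fst e), (x(j := v, i := u)) (snd e))) = a u * b v"
    unfolding 1[symmetric] 2[symmetric] AB(5)[symmetric] by (rule prod.union_disjoint[OF AB(3,4,6)])
   then show ?thesis using I(4) by (simp add: G_def)
  qed
  have wm: "(%z. a (fst z) * b (snd z) * X z) \<in> borel_measurable square2"
   by (rule weighted_measurable[OF X(1) am bm])
  have wb: "\<bar>a (fst z) * b (snd z) * X z\<bar> <= 1" for z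
  proof -
   have "a (fst z) * b (snd z) <= 1" using ab[of "fst z"] bb[of "snd z"] by (simp add: mult_le_one)
   moreover have "0 <= a (fst z) * b (snd z)" using ab[of "fst z"] bb[of "snd z"] by simp
   ultimately have "\<bar>a (fst z) * b (snd z)\<bar> * \<bar>X z\<bar> <= 1 * 1" using X(2)[of z] by (intro mult_mono) auto
   then show ?thesis by (simp only: abs_mult mult_1)
  qed
  have "(\<integral>v. H (x(j := v)) \<partial>square) = (\<integral>v. (\<integral>u. a u * b v * X (u, v) \<partial>square) \<partial>square)"
   by (simp only: H_def split)
  also have "... = (\<integral>z. a (fst z) * b (snd z) * X z \<partial>square2)"
  proof -
   have "(%(u, v). a u * b v * X (u, v)) = (%z. a (fst z) * b (snd z) * X z)" by auto
   then show ?thesis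
    using square2.integral_snd[of "%u v. a u * b v * X (u, v)"] abs_integral_square2_le(1)[OF wm wb] by metis
  qed
  finally show ?thesis using \<eta>[OF am bm ab bb] by simp
 qed
 interpret PJ: prob_space "?M J" by (rule prob_space_PiM_square)
 have \<eta>0: "0 <= \<eta>" using \<eta>[of "%_. 0" "%_. 0"] by simp
 have "\<bar>\<integral>x. (\<integral>v. H (x(j := v)) \<partial>square) \<partial>?M J\<bar> <= \<eta>"
 proof (cases "integrable (?M J) (%x. \<integral>v. H (x(j := v)) \<partial>square)")
  case True
  have "\<bar>\<integral>x. (\<integral>v. H (x(j := v)) \<partial>square) \<partial>?M J\<bar> <= (\<integral>x. \<eta> \<partial>?M J)"
   by (rule order_trans[OF integral_abs_bound]) (intro integral_mono integrable_abs True, use inner in auto)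
  then show ?thesis by (simp add: PJ.prob_space)
 qed (simp add: not_integrable_integral_eq \<eta>0)
 then show ?thesis unfolding eq[symmetric] G_def .
qed

definition pair_product :: "nat set => (nat \<times> nat => point \<times> point => real) => real" where
 "pair_product I K = (\<integral>x. (\<Prod>e\<in>{(p, q). p \<in> I & q \<in> I & p < q}. K e (x (fst e), x (snd e))) \<partial>PiM I (%_. square))"

text \<open>Telescoping over the edges, one replacement at a time.\<close>

lemma counting_lemma:
 assumes I: "finite I"
  and K: "!!e. K e \<in> borel_measurable square2" "!!e z. 0 <= K e z & K e z <= 1"
  and L: "!!e. L e \<in> borel_measurable square2" "!!e z. 0 <= L e z & L e z <= 1"
  and \<eta>: "!!e a b. a \<in> borel_measurable square ==> b \<in> borel_measurable square ==>
    (!!u. 0 <= a u & a u <= 1) ==> (!!u. 0 <= b u & b u <= 1) ==>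
    \<bar>\<integral>z. a (fst z) * b (snd z) * (K e z - L e z) \<partial>square2\<bar> <= \<eta>"
 shows "\<bar>pair_product I K - pair_product I L\<bar> <= (real (card I))\<^sup>2 * \<eta>"
proof -
 define P where "P = {(p, q). p \<in> I & q \<in> I & p < q}"
 have P: "P \<subseteq> I \<times> I" "finite P" "!!p q. (p, q) \<in> P ==> p < q"
  using I by (auto simp: P_def intro: finite_subset[of _ "I \<times> I"])
 define mix where "mix D e = (if e \<in> D then L e else K e)" for D e
 have mixm: "mix D e \<in> borel_measurable square2" "0 <= mix D e z & mix D e z <= 1" for D e z
  using K L by (auto simp: mix_def)
 let ?M = "PiM I (%_::nat. square)"
 let ?\<Pi> = "%Q N x. \<Prod>e\<in>Q. N e (x (fst e), x (snd e))"
 have int: "integrable ?M (?\<Pi> P (mix D))" for D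
 proof (rule integrable_PiM_square_bounded)
  show "?\<Pi> P (mix D) \<in> borel_measurable ?M"
   by (intro borel_measurable_prod component_pair_measurable mixm) (use P in auto)
  show "\<bar>?\<Pi> P (mix D) x\<bar> <= 1" for x
   using prod_unit_interval[of P "%e. mix D e (x (fst e), x (snd e))"] mixm(2) by auto
 qed
 have \<eta>0: "0 <= \<eta>" using \<eta>[of "%_. 0" "%_. 0"] by simp
 have "\<bar>pair_product I K - pair_product I (mix D)\<bar> <= real (card D) * \<eta>" if "D \<subseteq> P" for D
  using finite_subset[OF that P(2)] that
 proof (induction D rule: finite_induct)
  case empty
  have "mix {} = K" by (simp add: mix_def fun_eq_iff)
  then show ?case by simp
 next
  case (insert e D)
  have e: "e \<in> P" "fst e \<in> I" "snd e \<in> I" "fst e < snd e" using insert.prems P by auto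
  have split: "?\<Pi> P (mix D') x = mix D' e (x (fst e), x (snd e)) * ?\<Pi> (P - {e}) (mix D') x" for D' x
   by (rule prod.remove[OF P(2) e(1)])
  have same: "?\<Pi> (P - {e}) (mix (insert e D)) x = ?\<Pi> (P - {e}) (mix D) x" for x
   by (intro prod.cong) (auto simp: mix_def)
  have "pair_product I (mix D) - pair_product I (mix (insert e D)) =
   (\<integral>x. ?\<Pi> P (mix D) x - ?\<Pi> P (mix (insert e D)) x \<partial>?M)"
   unfolding pair_product_def P_def[symmetric] by (rule Bochner_Integration.integral_diff[symmetric, OF int int])
  also have "... = (\<integral>x. (K e (x (fst e), x (snd e)) - L e (x (fst e), x (snd e))) * ?\<Pi> (P - {e}) (mix D) x \<partial>?M)"
   unfolding split same using insert.hyps by (simp add: mix_def left_diff_distrib)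
  finally have eq: "pair_product I (mix D) - pair_product I (mix (insert e D)) =
   (\<integral>x. (K e (x (fst e), x (snd e)) - L e (x (fst e), x (snd e))) * ?\<Pi> (P - {e}) (mix D) x \<partial>?M)" .
  have "\<bar>\<integral>x. (%z. K e z - L e z) (x (fst e), x (snd e)) * ?\<Pi> (P - {e}) (mix D) x \<partial>?M\<bar> <= \<eta>"
  proof (rule counting_step)
   show "fst e ~= snd e" using e(4) by simp
   show "\<not> {fst e, snd e} \<subseteq> {p, q}" if "(p, q) \<in> P - {e}" for p q
    using that P(3)[of p q] e(4) by (cases e) auto
   show "\<bar>K e z - L e z\<bar> <= 1" for z using K(2)[of e z] L(2)[of e z] by (simp add: abs_le_iff)
  qed (use I e P K L mixm \<eta> in auto)
  then have "\<bar>pair_product I (mix D) - pair_product I (mix (insert e D))\<bar> <= \<eta>" unfolding eq by simp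
  moreover have "\<bar>pair_product I K - pair_product I (mix D)\<bar> <= real (card D) * \<eta>" using insert by simp
  ultimately show ?case using insert.hyps by (simp add: algebra_simps)
 qed
 from this[OF subset_refl] have "\<bar>pair_product I K - pair_product I (mix P)\<bar> <= real (card P) * \<eta>" .
 moreover have "pair_product I (mix P) = pair_product I L"
  unfolding pair_product_def P_def[symmetric] by (intro Bochner_Integration.integral_cong refl prod.cong) (simp add: mix_def)
 moreover have "real (card P) * \<eta> <= (real (card I))\<^sup>2 * \<eta>"
 proof (rule mult_right_mono[OF _ \<eta>0])
  have "card P <= card (I \<times> I)" by (rule card_mono) (use P I in auto)
  then show "real (card P) <= (real (card I))\<^sup>2"
   unfolding card_cartesian_product power2_eq_square by (metis of_nat_le_iff of_nat_mult)
 qed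
 ultimately show ?thesis by linarith
qed

lemma pair_product_pullback:
 assumes I: "finite I" and f: "f \<in> mp_bijections" and K: "!!e. K e \<in> borel_measurable square2"
 shows "pair_product I (%e z. K e (f (fst z), f (snd z))) = pair_product I K"
proof -
 let ?M = "PiM I (%_::nat. square)" and ?g = "%x. \<lambda>i\<in>I. f (x i)"
 have fm: "f \<in> measurable square square" by (rule mp_bijection_measurable[OF f])
 have gm: "?g \<in> measurable ?M ?M"
  by (rule measurable_restrict) (rule measurable_compose[OF _ fm], rule measurable_component_singleton)
 have "distr ?M ?M ?g = ?M"
 proof (rule PiM_square.PiM_eqI[OF I])
  fix A assume A: "!!i. i \<in> I ==> A i \<in> sets square"
  have "emeasure (distr ?M ?M ?g) (Pi\<^sub>E I A) = emeasure ?M (?g -` Pi\<^sub>E I A \<inter> space ?M)"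
   by (rule emeasure_distr[OF gm]) (intro sets_PiM_I_finite I A)
  also have "?g -` Pi\<^sub>E I A \<inter> space ?M = Pi\<^sub>E I (%i. f -` A i \<inter> space square)"
   by (auto simp: space_PiM PiE_iff restrict_def extensional_def)
  also have "emeasure ?M ... = (\<Prod>i\<in>I. emeasure square (f -` A i \<inter> space square))"
   by (rule PiM_square.emeasure_PiM[OF I]) (rule measurable_sets[OF fm A])
  also have "... = (\<Prod>i\<in>I. emeasure square (A i))"
   by (intro prod.cong refl) (use f A in \<open>auto simp: mp_bijections_def measure_preserving_map_def\<close>)
  finally show "emeasure (distr ?M ?M ?g) (Pi\<^sub>E I A) = (\<Prod>i\<in>I. emeasure square (A i))" .
 qed simp
 let ?P = "{(p, q). p \<in> I & q \<in> I & p < q}"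
 let ?h = "%x. \<Prod>e\<in>?P. K e (x (fst e), x (snd e))"
 have hm: "?h \<in> borel_measurable ?M"
  by (intro borel_measurable_prod component_pair_measurable K) auto
 have "integral\<^sup>L ?M ?h = integral\<^sup>L (distr ?M ?M ?g) ?h" by (simp only: \<open>distr ?M ?M ?g = ?M\<close>)
 also have "... = (\<integral>x. ?h (?g x) \<partial>?M)" by (rule integral_distr[OF gm hm])
 also have "... = (\<integral>x. (\<Prod>e\<in>?P. K e (f (x (fst e)), f (x (snd e)))) \<partial>?M)"
  by (intro Bochner_Integration.integral_cong refl prod.cong) auto
 finally show ?thesis unfolding pair_product_def by simp
qed

section \<open>Ordered densities are Lipschitz in the cut-shift distance\<close>

lemma fst_measurable_square: "fst \<in> borel_measurable square" "snd \<in> borel_measurable square"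
proof -
 have "(%u. u) \<in> measurable square (borel :: point measure)"
  by (rule measurable_restrict_space1) (auto intro: measurable_completion)
 then have "(%u. u) \<in> measurable square (borel \<Otimes>\<^sub>M borel :: point measure)" by (simp only: borel_prod)
 from measurable_compose[OF this measurable_fst] measurable_compose[OF this measurable_snd]
 show "fst \<in> borel_measurable square" "snd \<in> borel_measurable square" by (simp_all only: id_apply)
qed

lemma position_measurable:
 "(%z. fst (fst z)) \<in> borel_measurable square2" "(%z. fst (snd z)) \<in> borel_measurable square2"
 by (rule measurable_compose[OF measurable_fst fst_measurable_square(1)],
   rule measurable_compose[OF measurable_snd fst_measurable_square(1)])

lemma band_measurable: "(%z. of_bool (\<bar>fst (fst z) - fst (snd z)\<bar> <= s) :: real) \<in> borel_measurable square2"
proof -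
 note [measurable] = position_measurable
 have "(%z. indicator {z \<in> space square2. \<bar>fst (fst z) - fst (snd z)\<bar> <= s} z :: real) \<in> borel_measurable square2"
  by (intro borel_measurable_indicator) measurable
 then show ?thesis by (rule measurable_cong[THEN iffD1, rotated]) (simp add: indicator_def)
qed

text \<open>For fixed first point the band is a vertical strip of width at most twice the shift.\<close>

lemma integral_band_le:
 assumes s: "0 <= s"
 shows "(\<integral>z. of_bool (\<bar>fst (fst z) - fst (snd z)\<bar> <= s) \<partial>square2) <= 2 * s"
proof -
 let ?g = "%z. of_bool (\<bar>fst (fst z) - fst (snd z)\<bar> <= s) :: real"
 have i: "integrable square2 ?g"
  by (rule abs_integral_square2_le(1)[OF band_measurable, of _ 1]) simp
 have inner: "(\<integral>v. of_bool (\<bar>t - fst v\<bar> <= s) \<partial>square) <= 2 * s" for t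
 proof -
  let ?A = "{v \<in> space square. \<bar>t - fst v\<bar> <= s}"
  note [measurable] = fst_measurable_square
  have A: "?A \<in> sets square" by measurable
  have "emeasure square ?A = emeasure lebesgue ?A"
   by (rule emeasure_restrict_space) auto
  also have "... <= emeasure lebesgue (cbox (t - s, 0) (t + s, 1 :: real))"
  proof (rule emeasure_mono)
   show "?A \<subseteq> cbox (t - s, 0) (t + s, 1)" by (auto simp: unit_square_def cbox_Pair_eq)
   show "cbox (t - s, 0) (t + s, 1 :: real) \<in> sets lebesgue" by simp
  qed
  also have "... = ennreal (2 * s)"
   using s by (simp add: emeasure_lborel_cbox_eq Basis_prod_def)
  finally have "emeasure square ?A <= ennreal (2 * s)" .
  then have "measure square ?A <= 2 * s" unfolding measure_def using s by (intro enn2real_leI) simp_all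
  moreover have "(\<integral>v. of_bool (\<bar>t - fst v\<bar> <= s) \<partial>square) = (\<integral>v. indicator ?A v \<partial>square :: real)"
   by (intro Bochner_Integration.integral_cong) (auto simp: indicator_def)
  moreover have "(\<integral>v. indicator ?A v \<partial>square) = measure square (?A \<inter> space square)"
   by (rule Bochner_Integration.integral_indicator)
  moreover have "?A \<inter> space square = ?A" by blast
  ultimately show ?thesis by (simp only:)
 qed
 have "integral\<^sup>L square2 ?g = (\<integral>u. (\<integral>v. of_bool (\<bar>fst u - fst v\<bar> <= s) \<partial>square) \<partial>square)"
  using square2.integral_fst'[OF i, symmetric] by (simp only: fst_conv snd_conv)
 also have "... <= (\<integral>u. 2 * s \<partial>square)"
 proof (rule integral_mono)
  show "integrable square (%u. \<integral>v. of_bool (\<bar>fst u - fst v\<bar> <= s) \<partial>square :: real)"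
   using square2.integrable_fst'[OF i] by (simp only: fst_conv snd_conv)
 next
  show "integrable square (%u. 2 * s)" by (rule square.integrable_const)
 qed (rule inner)
 finally show ?thesis by (simp only: integral_square_const)
qed

lemma abs_integral_band_le:
 fixes D :: "_ => real"
 assumes D: "D \<in> borel_measurable square2"
  and le: "!!z. z \<in> space square2 ==> \<bar>D z\<bar> <= of_bool (\<bar>fst (fst z) - fst (snd z)\<bar> <= s)" and s: "0 <= s"
 shows "\<bar>integral\<^sup>L square2 D\<bar> <= 2 * s"
proof -
 have i: "integrable square2 (%z. of_bool (\<bar>fst (fst z) - fst (snd z)\<bar> <= s) :: real)"
  by (rule abs_integral_square2_le(1)[OF band_measurable, of _ 1]) simp
 have iD: "integrable square2 D"
 proof (rule Bochner_Integration.integrable_bound[OF i D], rule AE_I2)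
  fix z assume "z \<in> space square2"
  from le[OF this] show "norm (D z) <= norm (of_bool (\<bar>fst (fst z) - fst (snd z)\<bar> <= s) :: real)" by simp
 qed
 have "\<bar>integral\<^sup>L square2 D\<bar> <= (\<integral>z. of_bool (\<bar>fst (fst z) - fst (snd z)\<bar> <= s) \<partial>square2)"
  by (rule order_trans[OF integral_abs_bound]) (intro integral_mono integrable_abs iD i le)
 then show ?thesis using integral_band_le[OF s] by linarith
qed

abbreviation before :: "point \<times> point => real" where
 "before z \<equiv> of_bool (fst (fst z) < fst (snd z))"

lemma before_measurable: "before \<in> borel_measurable square2"
proof -
 note [measurable] = position_measurable
 have "(%z. indicator {z \<in> space square2. fst (fst z) < fst (snd z)} z :: real) \<in> borel_measurable square2"
  by (intro borel_measurable_indicator) measurable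
 then show ?thesis by (rule measurable_cong[THEN iffD1, rotated]) (simp add: indicator_def)
qed

lemma floor_grid_before:
 assumes m: "1 <= m" and x: "0 <= x" "x <= 1"
 shows "(\<Sum>p\<le>m. of_bool (\<lfloor>real m * x\<rfloor> = int p) * of_bool (real p + 1 <= real m * y)) = (of_bool (of_int \<lfloor>real m * x\<rfloor> + 1 <= real m * y) :: real)"
  and "\<bar>of_bool (x < y) - of_bool (of_int \<lfloor>real m * x\<rfloor> + 1 <= real m * y) :: real\<bar> <= of_bool (\<bar>x - y\<bar> <= 1 / real m)"
proof -
 define q where "q = nat \<lfloor>real m * x\<rfloor>"
 have q: "int q = \<lfloor>real m * x\<rfloor>" using x by (simp add: q_def)
 have "real m * x <= real m" using x m by (simp add: mult_left_le)
 then have "\<lfloor>real m * x\<rfloor> <= int m" by (simp add: floor_le_iff)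
 then have qm: "q <= m" using q by linarith
 have "(\<Sum>p\<le>m. of_bool (\<lfloor>real m * x\<rfloor> = int p) * of_bool (real p + 1 <= real m * y)) = (\<Sum>p\<in>{q}. of_bool (real p + 1 <= real m * y) :: real)"
  by (rule sum.mono_neutral_cong_right) (use qm q in auto)
 then show "(\<Sum>p\<le>m. of_bool (\<lfloor>real m * x\<rfloor> = int p) * of_bool (real p + 1 <= real m * y)) = (of_bool (of_int \<lfloor>real m * x\<rfloor> + 1 <= real m * y) :: real)"
  using q by (metis (no_types, lifting) of_int_of_nat_eq sum.empty sum.insert finite.emptyI empty_iff add.right_neutral)
 have 1: "x < y" if "of_int \<lfloor>real m * x\<rfloor> + 1 <= real m * y"
 proof -
  have "real m * x < real m * y" using that by linarith
  then show ?thesis using m by simp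
 qed
 have 2: "\<bar>x - y\<bar> <= 1 / real m" if "x < y" "\<not> of_int \<lfloor>real m * x\<rfloor> + 1 <= real m * y"
 proof -
  have "real m * (y - x) <= 1" using that(2) by (simp add: algebra_simps) linarith
  then show ?thesis using m that(1) by (simp add: field_simps)
 qed
 show "\<bar>of_bool (x < y) - of_bool (of_int \<lfloor>real m * x\<rfloor> + 1 <= real m * y) :: real\<bar> <= of_bool (\<bar>x - y\<bar> <= 1 / real m)"
  using 1 2 by (cases "x < y"; cases "of_int \<lfloor>real m * x\<rfloor> + 1 <= real m * y") auto
qed

text \<open>The order relation of positions is close in the cut sense to its image under a map of small shift, because they differ only on a band around the diagonal.\<close>

lemma abs_integral_before_le:
 fixes c :: real
 assumes X: "X \<in> borel_measurable square2" "!!z. \<bar>X z\<bar> <= 1"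
  and c: "!!S T. S \<in> sets square ==> T \<in> sets square ==>
   \<bar>\<integral>z. indicator S (fst z) * indicator T (snd z) * X z \<partial>square2\<bar> <= c"
  and a: "a \<in> borel_measurable square" "!!u. 0 <= a u & a u <= 1"
  and b: "b \<in> borel_measurable square" "!!v. 0 <= b v & b v <= 1" and m: "1 <= m"
 shows "\<bar>\<integral>z. a (fst z) * b (snd z) * (before z * X z) \<partial>square2\<bar> <= (real m + 1) * c + 2 / real m"
proof -
 define alpha where "alpha p u = (of_bool (\<lfloor>real m * fst u\<rfloor> = int p) :: real)" for p and u :: point
 define \<beta> where "\<beta> p v = (of_bool (real p + 1 <= real m * fst v) :: real)" for p and v :: point
 have alpha: "alpha p \<in> borel_measurable square" for p
 proof -
  note [measurable] = fst_measurable_square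
  have "(%u. indicator {u \<in> space square. \<lfloor>real m * fst u\<rfloor> = int p} u :: real) \<in> borel_measurable square"
   by (intro borel_measurable_indicator) measurable
  then show ?thesis unfolding alpha_def by (rule measurable_cong[THEN iffD1, rotated]) (simp add: indicator_def)
 qed
 have \<beta>: "\<beta> p \<in> borel_measurable square" for p
 proof -
  note [measurable] = fst_measurable_square
  have "(%u. indicator {u \<in> space square. real p + 1 <= real m * fst u} u :: real) \<in> borel_measurable square"
   by (intro borel_measurable_indicator) measurable
  then show ?thesis unfolding \<beta>_def by (rule measurable_cong[THEN iffD1, rotated]) (simp add: indicator_def)
 qed
 let ?t = "%p z. (a (fst z) * alpha p (fst z)) * (b (snd z) * \<beta> p (snd z)) * X z"
 define R where "R z = a (fst z) * b (snd z) * (before z * X z) - (\<Sum>p\<le>m. ?t p z)" for z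
 have aalpha: "(%u. a u * alpha p u) \<in> borel_measurable square" "0 <= a u * alpha p u & a u * alpha p u <= 1" for p u
  by (rule borel_measurable_times[OF a(1) alpha]) (use a(2)[of u] in \<open>simp add: alpha_def\<close>)
 have b\<beta>: "(%u. b u * \<beta> p u) \<in> borel_measurable square" "0 <= b u * \<beta> p u & b u * \<beta> p u <= 1" for p u
  by (rule borel_measurable_times[OF b(1) \<beta>]) (use b(2)[of u] in \<open>simp add: \<beta>_def\<close>)
 have tm: "?t p \<in> borel_measurable square2" for p by (rule weighted_measurable[OF X(1) aalpha(1) b\<beta>(1)])
 have tle: "\<bar>integral\<^sup>L square2 (?t p)\<bar> <= c" for p
  by (rule abs_integral_square2_weights_le[OF X c aalpha b\<beta>])
 have ab: "0 <= a (fst z) * b (snd z) & a (fst z) * b (snd z) <= 1" for z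
  using a(2)[of "fst z"] b(2)[of "snd z"] by (simp add: mult_le_one)
 have ti: "integrable square2 (?t p)" for p
 proof (rule abs_integral_square2_le(1)[OF tm])
  show "\<bar>?t p z\<bar> <= 1" for z
  proof -
   have "\<bar>(a (fst z) * alpha p (fst z)) * (b (snd z) * \<beta> p (snd z))\<bar> * \<bar>X z\<bar> <= 1 * 1"
    using aalpha(2)[of "fst z" p] b\<beta>(2)[of "snd z" p] X(2)[of z] by (intro mult_mono) (auto simp: mult_le_one)
   then show ?thesis by (simp only: abs_mult mult_1)
  qed
 qed
 have bXm: "(%z. before z * X z) \<in> borel_measurable square2" by (intro borel_measurable_times before_measurable X)
 have m0: "(%z. a (fst z) * b (snd z) * (before z * X z)) \<in> borel_measurable square2"
  by (rule weighted_measurable[OF bXm a(1) b(1)])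
 have Rm: "R \<in> borel_measurable square2" unfolding R_def by (intro borel_measurable_diff m0 borel_measurable_sum tm)
 have i0: "integrable square2 (%z. a (fst z) * b (snd z) * (before z * X z))"
 proof (rule abs_integral_square2_le(1)[OF m0])
  show "\<bar>a (fst z) * b (snd z) * (before z * X z)\<bar> <= 1" for z
  proof -
   have "\<bar>a (fst z) * b (snd z)\<bar> * \<bar>before z * X z\<bar> <= 1 * 1"
    using ab[of z] X(2)[of z] by (intro mult_mono) auto
   then show ?thesis by (simp only: abs_mult mult_1)
  qed
 qed
 have "\<bar>integral\<^sup>L square2 R\<bar> <= 2 * (1 / real m)"
 proof (rule abs_integral_band_le[OF Rm])
  fix z assume z: "z \<in> space square2"
  then have "fst z \<in> unit_square" by (auto simp: space_square2)
  then have x: "0 <= fst (fst z)" "fst (fst z) <= 1" by (auto simp: unit_square_def)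
  let ?x = "fst (fst z)" and ?y = "fst (snd z)"
  have "(\<Sum>p\<le>m. ?t p z) = a (fst z) * b (snd z) * X z * (\<Sum>p\<le>m. of_bool (\<lfloor>real m * ?x\<rfloor> = int p) * of_bool (real p + 1 <= real m * ?y))"
   unfolding sum_distrib_left by (rule sum.cong) (auto simp: alpha_def \<beta>_def)
  also have "... = a (fst z) * b (snd z) * X z * of_bool (of_int \<lfloor>real m * ?x\<rfloor> + 1 <= real m * ?y)"
   by (subst floor_grid_before(1)[OF m x]) (rule refl)
  finally have "R z = (a (fst z) * b (snd z) * X z) * (of_bool (?x < ?y) - of_bool (of_int \<lfloor>real m * ?x\<rfloor> + 1 <= real m * ?y))"
   unfolding R_def right_diff_distrib by (simp only: mult_ac)
  moreover have "\<bar>a (fst z) * b (snd z) * X z\<bar> <= 1"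
  proof -
   have "\<bar>a (fst z) * b (snd z)\<bar> * \<bar>X z\<bar> <= 1 * 1" using ab[of z] X(2)[of z] by (intro mult_mono) auto
   then show ?thesis by (simp only: abs_mult mult_1)
  qed
  ultimately have "\<bar>R z\<bar> <= 1 * \<bar>of_bool (?x < ?y) - of_bool (of_int \<lfloor>real m * ?x\<rfloor> + 1 <= real m * ?y)\<bar>"
   by (simp only: abs_mult mult_right_mono[OF _ abs_ge_zero])
  also have "... <= of_bool (\<bar>?x - ?y\<bar> <= 1 / real m)"
   using floor_grid_before(2)[OF m x, of ?y] by simp
  finally show "\<bar>R z\<bar> <= of_bool (\<bar>?x - ?y\<bar> <= 1 / real m)" .
 qed simp
 moreover have "integral\<^sup>L square2 R = (\<integral>z. a (fst z) * b (snd z) * (before z * X z) \<partial>square2) - (\<integral>z. (\<Sum>p\<le>m. ?t p z) \<partial>square2)"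
  unfolding R_def by (rule Bochner_Integration.integral_diff[OF i0 Bochner_Integration.integrable_sum[OF ti]])
 moreover have "(\<integral>z. (\<Sum>p\<le>m. ?t p z) \<partial>square2) = (\<Sum>p\<le>m. integral\<^sup>L square2 (?t p))"
  by (rule Bochner_Integration.integral_sum[OF ti])
 moreover have "\<bar>\<Sum>p\<le>m. integral\<^sup>L square2 (?t p)\<bar> <= (\<Sum>p\<le>m. c)"
  by (rule order_trans[OF sum_abs]) (intro sum_mono tle)
 moreover have "(\<Sum>p\<le>m. c) = (real m + 1) * c" by simp
 ultimately show ?thesis by linarith
qed

text \<open>For a pair \<open>i < j\<close> the factor demands that the positions be in increasing order and that adjacency be as prescribed, which turns ordered densities into products over pairs.\<close>

definition ordered_kernel :: "ordered_graph => (point \<times> point => real) => nat \<times> nat => point \<times> point => real" where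
 "ordered_kernel F K e z = before z * (if adj F (fst e) (snd e) then K z else 1 - K z)"

definition kernel_density :: "ordered_graph => (point \<times> point => real) => real" where
 "kernel_density F K = fact (num_vertices F) * pair_product {1..num_vertices F} (ordered_kernel F K)"

lemma ordered_kernel_measurable:
 assumes "K \<in> borel_measurable square2"
 shows "ordered_kernel F K e \<in> borel_measurable square2"
 unfolding ordered_kernel_def using assms before_measurable
 by (cases "adj F (fst e) (snd e)") (auto intro!: borel_measurable_times borel_measurable_diff)

lemma ordered_kernel_bounds:
 assumes "!!z. 0 <= K z & K z <= 1"
 shows "0 <= ordered_kernel F K e z & ordered_kernel F K e z <= 1"
 unfolding ordered_kernel_def using assms[of z] by auto

lemma mult_abs_le_1: "0 <= x ==> x <= 1 ==> \<bar>x * y\<bar> <= \<bar>y :: real\<bar>"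
 by (simp add: abs_mult mult_left_le_one_le)

text \<open>Both the adjacency factors and the order factors move by the cut-shift distance, so the counting lemma applies to their products.\<close>

lemma kernel_density_diff_le:
 assumes K: "kernel_version W K" and L: "kernel_version U L" and f: "f \<in> mp_bijections" and m: "1 <= m"
 shows "\<bar>kernel_density F K - kernel_density F L\<bar> <= fact (num_vertices F) * (real (num_vertices F))\<^sup>2 *
  (4 * shift f + (real m + 1) * cut_norm (%(u, v). W (u, v) - U (f u, f v)) + 2 / real m)"
proof -
 let ?k = "num_vertices F" and ?s = "shift f" and ?c = "cut_norm (%(u, v). W (u, v) - U (f u, f v))"
 define L' where "L' z = L (f (fst z), f (snd z))" for z
 have Kp: "K \<in> borel_measurable square2" "!!z. 0 <= K z & K z <= 1" "AE z in square2. W z = K z"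
  using K by (auto simp only: kernel_version_def)
 have Lp: "L \<in> borel_measurable square2" "!!z. 0 <= L z & L z <= 1"
  using L by (auto simp only: kernel_version_def)
 have "kernel_version (%(u, v). U (f u, f v)) L'"
  using kernel_version_pullback[OF L f] unfolding L'_def .
 then have L'p: "L' \<in> borel_measurable square2" "!!z. 0 <= L' z & L' z <= 1" "AE z in square2. (%(u, v). U (f u, f v)) z = L' z"
  by (auto simp only: kernel_version_def)
 define X where "X z = K z - L' z" for z
 have X: "X \<in> borel_measurable square2" "\<bar>X z\<bar> <= 1" for z
  unfolding X_def by (rule borel_measurable_diff[OF Kp(1) L'p(1)]) (use Kp(2)[of z] L'p(2)[of z] in linarith)
 have cX: "\<bar>\<integral>z. indicator S (fst z) * indicator T (snd z) * X z \<partial>square2\<bar> <= ?c" if "S \<in> sets square" "T \<in> sets square" for S T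
 proof (rule cut_norm_upper[OF X _ that])
  show "AE z in square2. (case z of (u, v) => W (u, v) - U (f u, f v)) = X z"
   using Kp(3) L'p(3) by eventually_elim (auto simp: X_def)
 qed
 have sh: "\<bar>fst p - fst (f p)\<bar> <= ?s" if "p \<in> unit_square" for p
  unfolding shift_def
 proof (rule cSUP_upper[OF that])
  have "\<bar>fst p - fst (f p)\<bar> <= 1" if "p \<in> unit_square" for p
  proof -
   have "f p \<in> unit_square" using f that by (auto simp: mp_bijections_def bij_betw_def)
   then show ?thesis using that by (auto simp: unit_square_def)
  qed
  then show "bdd_above ((%p. \<bar>fst p - fst (f p)\<bar>) ` unit_square)" by (auto intro!: bdd_aboveI[of _ 1])
 qed
 have s0: "0 <= ?s" using sh[of "(0, 0)"] by (auto simp: unit_square_def intro: order_trans[OF abs_ge_zero])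
 have fm: "f \<in> measurable square square" by (rule mp_bijection_measurable[OF f])
 define N where "N e z = ordered_kernel F L e (f (fst z), f (snd z))" for e z
 have Nm: "N e \<in> borel_measurable square2" for e
  unfolding N_def by (rule measurable_compose[OF mp_bijection_distr2(1)[OF f] ordered_kernel_measurable[OF Lp(1)]])
 have N01: "0 <= N e z & N e z <= 1" for e z unfolding N_def by (rule ordered_kernel_bounds[OF Lp(2)])
 have "\<bar>pair_product {1..?k} (ordered_kernel F K) - pair_product {1..?k} N\<bar> <= (real (card {1..?k}))\<^sup>2 * (4 * ?s + (real m + 1) * ?c + 2 / real m)"
 proof (rule counting_lemma)
  fix e a b assume a: "a \<in> borel_measurable square" "!!u. 0 <= a u & a u <= (1 :: real)"
   and b: "b \<in> borel_measurable square" "!!u. 0 <= b u & b u <= (1 :: real)"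
  define \<sigma> where "\<sigma> = (if adj F (fst e) (snd e) then 1 else - 1 :: real)"
  define D where "D z = a (fst z) * b (snd z) * (before z * (if adj F (fst e) (snd e) then L' z else 1 - L' z) - N e z)" for z
  have ab: "0 <= a (fst z) * b (snd z) & a (fst z) * b (snd z) <= 1" for z
   using a(2)[of "fst z"] b(2)[of "snd z"] by (simp add: mult_le_one)
  have om: "(%z. before z * (if adj F (fst e) (snd e) then L' z else 1 - L' z)) \<in> borel_measurable square2"
   using ordered_kernel_measurable[OF L'p(1)] unfolding ordered_kernel_def .
  have Dm: "D \<in> borel_measurable square2"
   unfolding D_def by (rule weighted_measurable[OF borel_measurable_diff[OF om Nm] a(1) b(1)])
  have D1: "\<bar>D z\<bar> <= 1" for z
  proof -
   have "\<bar>before z * (if adj F (fst e) (snd e) then L' z else 1 - L' z) - N e z\<bar> <= 1"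
    using N01[of e z] L'p(2)[of z] by (auto simp: abs_le_iff)
   then show ?thesis unfolding D_def using mult_abs_le_1 ab order_trans by meson
  qed
  have Dle: "\<bar>integral\<^sup>L square2 D\<bar> <= 2 * (2 * ?s)"
  proof (rule abs_integral_band_le[OF Dm])
   fix z assume "z \<in> space square2"
   then have z: "fst z \<in> unit_square" "snd z \<in> unit_square" by (auto simp: space_square2)
   show "\<bar>D z\<bar> <= of_bool (\<bar>fst (fst z) - fst (snd z)\<bar> <= 2 * ?s)"
   proof (cases "\<bar>fst (fst z) - fst (snd z)\<bar> <= 2 * ?s")
    case True then show ?thesis using D1 by simp
   next
    case False
    then have "(fst (fst z) < fst (snd z)) = (fst (f (fst z)) < fst (f (snd z)))"
     using sh[OF z(1)] sh[OF z(2)] by linarith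
    then have "D z = 0" by (simp add: D_def N_def ordered_kernel_def L'_def)
    then show ?thesis by simp
   qed
  qed (use s0 in simp)
  have X\<sigma>: "\<bar>\<integral>z. a (fst z) * b (snd z) * (before z * X z) \<partial>square2\<bar> <= (real m + 1) * ?c + 2 / real m"
   by (rule abs_integral_before_le[OF X cX a b m])
  have bXm: "(%z. before z * X z) \<in> borel_measurable square2" by (intro borel_measurable_times before_measurable X)
  have E: "a (fst z) * b (snd z) * (ordered_kernel F K e z - N e z) = \<sigma> * (a (fst z) * b (snd z) * (before z * X z)) + D z" for z
   unfolding ordered_kernel_def D_def X_def \<sigma>_def by (cases "adj F (fst e) (snd e)") (auto simp: algebra_simps)
  have i1: "integrable square2 (%z. a (fst z) * b (snd z) * (before z * X z))"
  proof (rule abs_integral_square2_le(1)[OF weighted_measurable[OF bXm a(1) b(1)]])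
   show "\<bar>a (fst z) * b (snd z) * (before z * X z)\<bar> <= 1" for z
   proof -
    have "\<bar>before z * X z\<bar> <= 1" using X(2)[of z] by simp
    then show ?thesis using mult_abs_le_1 ab order_trans by meson
   qed
  qed
  have i2: "integrable square2 D" by (rule abs_integral_square2_le(1)[OF Dm D1])
  have "(\<integral>z. a (fst z) * b (snd z) * (ordered_kernel F K e z - N e z) \<partial>square2) =
    \<sigma> * (\<integral>z. a (fst z) * b (snd z) * (before z * X z) \<partial>square2) + integral\<^sup>L square2 D"
   unfolding E using i1 i2 by (subst Bochner_Integration.integral_add) (simp_all only: integrable_mult_right integral_mult_right_zero)
  moreover have "\<bar>\<sigma> * (\<integral>z. a (fst z) * b (snd z) * (before z * X z) \<partial>square2)\<bar> <= (real m + 1) * ?c + 2 / real m"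
   using X\<sigma> by (simp add: \<sigma>_def abs_mult)
  ultimately show "\<bar>\<integral>z. a (fst z) * b (snd z) * (ordered_kernel F K e z - N e z) \<partial>square2\<bar> <= 4 * ?s + (real m + 1) * ?c + 2 / real m"
   using Dle by linarith
 qed (simp, rule ordered_kernel_measurable[OF Kp(1)], rule ordered_kernel_bounds[OF Kp(2)], rule Nm, rule N01)
 moreover have "pair_product {1..?k} N = pair_product {1..?k} (ordered_kernel F L)"
  unfolding N_def by (rule pair_product_pullback[OF _ f ordered_kernel_measurable[OF Lp(1)]]) simp
 ultimately have "\<bar>pair_product {1..?k} (ordered_kernel F K) - pair_product {1..?k} (ordered_kernel F L)\<bar>
   <= (real ?k)\<^sup>2 * (4 * ?s + (real m + 1) * ?c + 2 / real m)" by simp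
 from mult_left_mono[OF this, of "fact ?k"]
 show ?thesis unfolding kernel_density_def by (simp add: right_diff_distrib[symmetric] abs_mult mult.assoc)
qed

section \<open>Graphs as orderons and the continuous extension\<close>

lemma kernel_versionD:
 assumes "kernel_version W K"
 shows "K \<in> borel_measurable square2" "0 <= K z & K z <= 1" "AE z in square2. W z = K z"
 using assms[unfolded kernel_version_def, THEN conjunct1] assms[unfolded kernel_version_def, THEN conjunct2, THEN conjunct1, THEN spec]
  assms[unfolded kernel_version_def, THEN conjunct2, THEN conjunct2] by - assumption+

lemma shift_nonneg:
 assumes "f \<in> mp_bijections"
 shows "0 <= shift f" and "!!p. p \<in> unit_square ==> \<bar>fst p - fst (f p)\<bar> <= shift f"
proof -
 show sh: "\<bar>fst p - fst (f p)\<bar> <= shift f" if "p \<in> unit_square" for p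
  unfolding shift_def
 proof (rule cSUP_upper[OF that])
  have "\<bar>fst p - fst (f p)\<bar> <= 1" if "p \<in> unit_square" for p
  proof -
   have "f p \<in> unit_square" using assms that by (auto simp: mp_bijections_def bij_betw_def)
   then show ?thesis using that by (auto simp: unit_square_def)
  qed
  then show "bdd_above ((%p. \<bar>fst p - fst (f p)\<bar>) ` unit_square)" by (auto intro!: bdd_aboveI[of _ 1])
 qed
 show "0 <= shift f" using sh[of "(0, 0)"] by (auto simp: unit_square_def intro: order_trans[OF abs_ge_zero])
qed

lemma cut_norm_nonneg:
 assumes "kernel_version W K" "kernel_version U L" "f \<in> mp_bijections"
 shows "0 <= cut_norm (%(u, v). W (u, v) - U (f u, f v))"
proof -
 have L: "kernel_version (%(u, v). U (f u, f v)) (%z. L (f (fst z), f (snd z)))"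
  by (rule kernel_version_pullback[OF assms(2,3)])
 let ?X = "%z. K z - L (f (fst z), f (snd z))"
 have "\<bar>\<integral>z. indicator {} (fst z) * indicator {} (snd z) * ?X z \<partial>square2\<bar> <= cut_norm (%(u, v). W (u, v) - U (f u, f v))"
 proof (rule cut_norm_upper[where B = 1])
  show "?X \<in> borel_measurable square2"
   by (rule borel_measurable_diff[OF kernel_versionD(1)[OF assms(1)] kernel_versionD(1)[OF L]])
  show "\<bar>?X z\<bar> <= 1" for z
   using kernel_versionD(2)[OF assms(1), of z] kernel_versionD(2)[OF L, of z] by linarith
  show "AE z in square2. (case z of (u, v) => W (u, v) - U (f u, f v)) = ?X z"
   using kernel_versionD(3)[OF assms(1)] kernel_versionD(3)[OF L]
  proof eventually_elim
   case (elim z)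
   then show ?case by (simp only: case_prod_beta prod.collapse)
  qed
 qed (rule sets.empty_sets)+
 then show ?thesis by linarith
qed

lemma id_mp_bijection: "id \<in> mp_bijections"
proof -
 have inv: "inv_into unit_square id u = u" if "u \<in> unit_square" for u :: point
  using inv_into_f_f[of id unit_square u] that by simp
 have 1: "measure_preserving_map square id"
  unfolding measure_preserving_map_def
 proof (intro conjI ballI)
  fix A assume "A \<in> sets square"
  then have "id -` A \<inter> space square = A" by (auto simp: sets_square_iff)
  then show "emeasure square (id -` A \<inter> space square) = emeasure square A" by (simp only:)
 qed (simp add: id_def)
 moreover have "measure_preserving_map square (inv_into unit_square id)"
  unfolding measure_preserving_map_def
 proof (intro conjI ballI)
  show "inv_into unit_square id \<in> measurable square square"
   by (rule measurable_cong[THEN iffD2, of _ _ "%u. u"]) (use inv in simp_all)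
  fix A assume "A \<in> sets square"
  then have "inv_into unit_square id -` A \<inter> space square = A" using inv by (auto simp: sets_square_iff)
  then show "emeasure square (inv_into unit_square id -` A \<inter> space square) = emeasure square A" by (simp only:)
 qed
 ultimately show ?thesis by (simp add: mp_bijections_def)
qed

lemma cut_shift_dist_less_witness:
 assumes "W \<in> orderons" "U \<in> orderons" "cut_shift_dist W U < \<delta>"
 obtains f where "f \<in> mp_bijections" "shift f + cut_norm (%(u, v). W (u, v) - U (f u, f v)) < \<delta>"
proof -
 obtain K L where "kernel_version W K" "kernel_version U L" using orderon_kernel_version assms(1,2) by metis
 then have "0 <= shift f + cut_norm (%(u, v). W (u, v) - U (f u, f v))" if "f \<in> mp_bijections" for f
  using cut_norm_nonneg[of W K U L f] shift_nonneg(1)[OF that] that by simp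
 then have "bdd_below ((%f. shift f + cut_norm (%(u, v). W (u, v) - U (f u, f v))) ` mp_bijections)"
  by (auto intro!: bdd_belowI[of _ 0])
 then have "\<exists>f\<in>mp_bijections. shift f + cut_norm (%(u, v). W (u, v) - U (f u, f v)) < \<delta>"
  using assms(3) id_mp_bijection unfolding cut_shift_dist_def by (subst (asm) cINF_less_iff) auto
 then show ?thesis using that by blast
qed

lemma kernel_density_unique:
 assumes "kernel_version W K" "kernel_version W L"
 shows "kernel_density F K = kernel_density F L"
proof -
 note K = kernel_versionD[OF assms(1)] and L = kernel_versionD[OF assms(2)]
 have "\<bar>pair_product {1..num_vertices F} (ordered_kernel F K) - pair_product {1..num_vertices F} (ordered_kernel F L)\<bar>
   <= (real (card {1..num_vertices F}))\<^sup>2 * 0"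
 proof (rule counting_lemma)
  fix e and a b :: "point => real"
  have "AE z in square2. a (fst z) * b (snd z) * (ordered_kernel F K e z - ordered_kernel F L e z) = 0"
   using K(3) L(3)
  proof eventually_elim
   case (elim z)
   have "K z = L z" by (rule trans[OF sym[OF elim(1)] elim(2)])
   then show ?case by (simp only: ordered_kernel_def diff_self mult_zero_right)
  qed
  from integral_eq_zero_AE[OF this]
  show "\<bar>\<integral>z. a (fst z) * b (snd z) * (ordered_kernel F K e z - ordered_kernel F L e z) \<partial>square2\<bar> <= 0"
   by (simp only: abs_zero order_refl)
 qed (simp, rule ordered_kernel_measurable[OF K(1)], rule ordered_kernel_bounds[OF K(2)],
   rule ordered_kernel_measurable[OF L(1)], rule ordered_kernel_bounds[OF L(2)])
 then show ?thesis by (simp add: kernel_density_def)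
qed

text \<open>The choice of representative is immaterial because the density does not see null sets.\<close>

definition orderon_density :: "ordered_graph => (point \<times> point => real) => real" where
 "orderon_density F W = kernel_density F (SOME K. kernel_version W K)"

lemma orderon_density_eq: "kernel_version W K ==> orderon_density F W = kernel_density F K"
 unfolding orderon_density_def by (rule kernel_density_unique[OF someI[of "kernel_version W"]])

lemma orderon_density_continuous: "cut_shift_continuous (orderon_density F)"
 unfolding cut_shift_continuous_def
proof (intro ballI allI impI)
 fix W and eps :: real assume W: "W \<in> orderons" and eps: "eps > 0"
 define C where "C = fact (num_vertices F) * (real (num_vertices F))\<^sup>2 + 1"
 have C: "C \<ge> 1" by (simp add: C_def)
 obtain m where m: "4 * C / eps < real m" using reals_Archimedean2 by blast
 have m1: "1 <= m" using m C eps by (cases m) (auto simp: divide_less_0_iff zero_less_divide_iff not_less)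
 define \<delta> where "\<delta> = eps / (2 * C * (real m + 5))"
 have \<delta>: "\<delta> > 0" using C eps by (simp add: \<delta>_def)
 show "\<exists>\<delta>>0. \<forall>U\<in>orderons. cut_shift_dist W U < \<delta> \<longrightarrow> \<bar>orderon_density F W - orderon_density F U\<bar> < eps"
 proof (intro exI[of _ \<delta>] conjI \<delta> ballI impI)
  fix U assume U: "U \<in> orderons" and d: "cut_shift_dist W U < \<delta>"
  obtain K L where KL: "kernel_version W K" "kernel_version U L" using orderon_kernel_version W U by metis
  obtain f where f: "f \<in> mp_bijections" and sc: "shift f + cut_norm (%(u, v). W (u, v) - U (f u, f v)) < \<delta>"
   using cut_shift_dist_less_witness[OF W U d] by blast
  let ?c = "cut_norm (%(u, v). W (u, v) - U (f u, f v))"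
  have s0: "0 <= shift f" and c0: "0 <= ?c" using shift_nonneg(1)[OF f] cut_norm_nonneg[OF KL f] by auto
  have b: "4 * shift f + (real m + 1) * ?c + 2 / real m <= (real m + 5) * \<delta> + 2 / real m"
  proof -
   have "4 * shift f <= 4 * \<delta>" "(real m + 1) * ?c <= (real m + 1) * \<delta>"
    using sc s0 c0 by (auto intro: mult_left_mono)
   then show ?thesis by (simp add: algebra_simps)
  qed
  have "\<bar>orderon_density F W - orderon_density F U\<bar> <= (C - 1) * (4 * shift f + (real m + 1) * ?c + 2 / real m)"
   using kernel_density_diff_le[OF KL f m1, of F] by (simp add: orderon_density_eq[OF KL(1)] orderon_density_eq[OF KL(2)] C_def)
  also have "... <= C * ((real m + 5) * \<delta> + 2 / real m)"
   by (rule mult_mono) (use b C s0 c0 in auto)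
  also have "... = C * ((real m + 5) * \<delta>) + 2 * C / real m" by (simp add: algebra_simps)
  also have "C * ((real m + 5) * \<delta>) = eps / 2"
  proof -
   have "a * (b * (eps / (2 * a * b))) = eps / 2" if "a > 0" "b > 0" for a b :: real using that by simp
   from this[of C "real m + 5"] C show ?thesis unfolding \<delta>_def by simp
  qed
  also have "2 * C / real m < eps / 2"
  proof -
   have "4 * C < real m * eps" using m eps by (simp add: field_simps)
   then show ?thesis using m1 by (simp add: field_simps)
  qed
  finally show "\<bar>orderon_density F W - orderon_density F U\<bar> < eps" by simp
 qed
qed

lemma measure_vertical_strip:
 fixes A :: "real set"
 assumes A: "A \<in> sets borel" "A \<subseteq> {0..1}"
 shows "{u \<in> space square. fst u \<in> A} \<in> sets square" "measure square {u \<in> space square. fst u \<in> A} = measure lborel A"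
proof -
 have eq: "{u \<in> space square. fst u \<in> A} = A \<times> {0..1}" using A(2) by (auto simp: unit_square_def)
 have b: "A \<times> {0..1} \<in> sets (lborel :: point measure)"
 proof -
  have "A \<times> {0..1} \<in> sets ((lborel :: real measure) \<Otimes>\<^sub>M (lborel :: real measure))" using A by (intro pair_measureI) auto
  then show ?thesis by (simp only: lborel_prod)
 qed
 have sub: "A \<times> {0..1} \<subseteq> unit_square" using A by (auto simp: unit_square_def)
 show "{u \<in> space square. fst u \<in> A} \<in> sets square" unfolding eq using b sub by (auto simp: sets_square_iff)
 have "emeasure square (A \<times> {0..1}) = emeasure lebesgue (A \<times> {0..1 :: real})"
  by (rule emeasure_restrict_space) (use sub in auto)
 also have "... = emeasure lborel (A \<times> {0..1 :: real})" using b by simp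
 also have "... = emeasure ((lborel :: real measure) \<Otimes>\<^sub>M (lborel :: real measure)) (A \<times> {0..1})" by (simp only: lborel_prod)
 also have "... = emeasure lborel A * emeasure lborel {0..1 :: real}"
  by (rule lborel.emeasure_pair_measure_Times) (use A in auto)
 finally show "measure square {u \<in> space square. fst u \<in> A} = measure lborel A"
  unfolding eq by (simp add: measure_def)
qed

lemma quant_range: "1 <= n ==> 0 <= x ==> x <= 1 ==> quant n x \<in> {1..n}"
proof -
 assume n: "1 <= n" and x: "0 <= x" "x <= 1"
 show "quant n x \<in> {1..n}"
 proof (cases "x > 0")
  case True
  then have "0 < real n * x" "real n * x <= real n" using n x by (auto simp: mult_left_le)
  then have "0 < \<lceil>real n * x\<rceil>" "\<lceil>real n * x\<rceil> <= int n" by (simp_all add: ceiling_le_iff)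
  then have "1 <= nat \<lceil>real n * x\<rceil>" "nat \<lceil>real n * x\<rceil> <= n" by linarith+
  then show ?thesis using True by (simp add: quant_def del: ceiling_le_iff)
 qed (use n in \<open>auto simp: quant_def\<close>)
qed

lemma quant_eq_iff:
 assumes n: "1 <= n" and v: "v \<in> {1..n}" and x: "0 <= x"
 shows "quant n x = v \<longleftrightarrow> x \<in> (if v = 1 then {0..1 / real n} else {(real v - 1) / real n<..real v / real n})"
proof (cases "x > 0")
 case True
 have "quant n x = v \<longleftrightarrow> \<lceil>real n * x\<rceil> = int v" using True n v by (auto simp: quant_def)
 also have "... \<longleftrightarrow> real v - 1 < real n * x & real n * x <= real v" by (auto simp: ceiling_eq_iff)
 also have "... \<longleftrightarrow> (real v - 1) / real n < x & x <= real v / real n" using n by (auto simp: field_simps)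
 finally show ?thesis using True n by auto
next
 case False
 then have "x = 0" using x by simp
 then show ?thesis using n v by (auto simp: quant_def divide_less_0_iff)
qed

lemma measure_quant_column:
 assumes n: "1 <= n" and v: "v \<in> {1..n}"
 shows "{u \<in> space square. quant n (fst u) = v} \<in> sets square"
  "measure square {u \<in> space square. quant n (fst u) = v} = 1 / real n"
proof -
 define A where "A = (if v = 1 then {0..1 / real n} else {(real v - 1) / real n<..real v / real n})"
 have vn: "real v / real n <= 1" "1 / real n <= 1" using n v by (auto simp: field_simps)
 have "0 <= (real v - 1) / real n" using v n by simp
 then have A: "A \<in> sets borel" "A \<subseteq> {0..1}"
  using vn unfolding A_def by (auto split: if_splits)
 have eq: "{u \<in> space square. quant n (fst u) = v} = {u \<in> space square. fst u \<in> A}"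
 proof (rule Collect_cong)
  fix u
  show "u \<in> space square & quant n (fst u) = v \<longleftrightarrow> u \<in> space square & fst u \<in> A"
  proof (cases "u \<in> space square")
   case True
   then have "0 <= fst u" by (auto simp: unit_square_def)
   from quant_eq_iff[OF n v this] show ?thesis unfolding A_def by simp
  qed simp
 qed
 have "measure lborel A = 1 / real n"
  using n v by (auto simp: A_def diff_divide_distrib divide_right_mono)
 then show "{u \<in> space square. quant n (fst u) = v} \<in> sets square"
  "measure square {u \<in> space square. quant n (fst u) = v} = 1 / real n"
  unfolding eq using measure_vertical_strip[OF A] by simp_all
qed

lemma quant_measurable: "1 <= n ==> (%u. quant n (fst u)) \<in> measurable square (count_space UNIV)"
proof (rule measurable_count_space_eq2_countable[THEN iffD2], intro conjI ballI)
 fix v assume n: "1 <= n"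
 show "(%u. quant n (fst u)) -` {v} \<inter> space square \<in> sets square"
 proof (cases "v \<in> {1..n}")
  case True
  have "(%u. quant n (fst u)) -` {v} \<inter> space square = {u \<in> space square. quant n (fst u) = v}" by auto
  then show ?thesis using measure_quant_column(1)[OF n True] by simp
 next
  case False
  then have "(%u. quant n (fst u)) -` {v} \<inter> space square = {}"
   using quant_range[OF n] by (auto simp: unit_square_def)
  then show ?thesis by simp
 qed
qed auto

lemma quant_pair_measurable:
 fixes phi :: "nat => nat => real"
 assumes "1 <= n"
 shows "(%z. phi (quant n (fst (fst z))) (quant n (fst (snd z)))) \<in> borel_measurable square2"
proof -
 have q1: "(%z. quant n (fst (fst z))) \<in> measurable square2 (count_space UNIV)"
  by (rule measurable_compose[OF measurable_fst quant_measurable[OF assms]])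
 have q2: "(%z. quant n (fst (snd z))) \<in> measurable square2 (count_space UNIV)"
  by (rule measurable_compose[OF measurable_snd quant_measurable[OF assms]])
 have "(%z. phi i (quant n (fst (snd z)))) \<in> borel_measurable square2" for i
  by (rule measurable_compose[OF q2]) simp
 from measurable_compose_countable[OF this q1] show ?thesis .
qed

definition graph_kernel :: "ordered_graph => point \<times> point => real" where
 "graph_kernel G z = of_bool (adj G (quant (num_vertices G) (fst (fst z))) (quant (num_vertices G) (fst (snd z))))"

lemma graph_kernel_measurable: "graph_kernel G \<in> borel_measurable square2"
 unfolding graph_kernel_def by (rule quant_pair_measurable[OF num_vertices_ge_1])

lemma graph_orderon_eq: "z \<in> unit_square \<times> unit_square ==> graph_orderon G z = graph_kernel G z"
 by (cases z) (auto simp: graph_orderon_def graph_kernel_def)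

lemma graph_kernel_version: "kernel_version (graph_orderon G) (graph_kernel G)"
 unfolding kernel_version_def
proof (intro conjI allI)
 show "AE z in square2. graph_orderon G z = graph_kernel G z"
  by (rule AE_I2) (use graph_orderon_eq in \<open>simp add: space_square2\<close>)
qed (simp_all add: graph_kernel_measurable, simp_all add: graph_kernel_def)

lemma graph_orderon_orderon: "graph_orderon G \<in> orderons"
 unfolding orderons_def
proof (intro CollectI conjI ballI)
 show "graph_orderon G \<in> unit_square \<times> unit_square \<rightarrow>\<^sub>E {0..1}"
  by (rule PiE_I) (auto simp: graph_orderon_def)
 have "graph_kernel G \<in> borel_measurable hypercube" by (rule measurable_hypercube[OF graph_kernel_measurable])
 then show "graph_orderon G \<in> borel_measurable hypercube"
  by (rule measurable_cong[THEN iffD1, rotated]) (rule graph_orderon_eq[symmetric], simp)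
 show "graph_orderon G (u, v) = graph_orderon G (v, u)" if "u \<in> unit_square" "v \<in> unit_square" for u v
  using that by (simp add: graph_orderon_eq graph_kernel_def adj_sym)
qed

lemma integral_PiM_quant:
 fixes \<Phi> :: "(nat => nat) => real"
 assumes n: "1 <= n" and I: "finite I"
  and \<Phi>: "!!y y'. (!!i. i \<in> I ==> y i = y' i) ==> \<Phi> y = \<Phi> y'"
 shows "(\<integral>x. \<Phi> (%i. quant n (fst (x i))) \<partial>PiM I (%_. square)) = (\<Sum>y\<in>PiE I (%_. {1..n}). \<Phi> y) / real n ^ card I"
proof -
 let ?M = "PiM I (%_::nat. square)" and ?Y = "PiE I (%_::nat. {1..n})"
 let ?C = "%v. {u \<in> space square. quant n (fst u) = v}"
 have fY: "finite ?Y" by (intro finite_PiE I) simp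
 have yC: "?C (y i) \<in> sets square" "measure square (?C (y i)) = 1 / real n" if "y \<in> ?Y" "i \<in> I" for y i
  using measure_quant_column[OF n, of "y i"] PiE_mem[OF that] by auto
 have ii: "integrable square (indicator (?C (y i)) :: point => real)" if "y \<in> ?Y" "i \<in> I" for y i
  by (rule square.integrable_const_bound[of _ 1]) (use yC[OF that] in \<open>auto intro: borel_measurable_indicator\<close>)
 have ip: "integrable ?M (%x. \<Prod>i\<in>I. indicator (?C (y i)) (x i) :: real)" if "y \<in> ?Y" for y
  by (rule PiM_square.product_integrable_prod[OF I ii[OF that]])
 have eq: "\<Phi> (%i. quant n (fst (x i))) = (\<Sum>y\<in>?Y. \<Phi> y * (\<Prod>i\<in>I. indicator (?C (y i)) (x i)))"
  if x: "x \<in> space ?M" for x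
 proof -
  define y0 where "y0 = (\<lambda>i\<in>I. quant n (fst (x i)))"
  have xs: "x i \<in> space square" if "i \<in> I" for i using x that by (auto simp: space_PiM PiE_iff)
  have y0: "y0 \<in> ?Y" unfolding y0_def
  proof (rule restrict_PiE_iff[THEN iffD2], rule ballI)
   fix i assume "i \<in> I"
   from xs[OF this] have "0 <= fst (x i)" "fst (x i) <= 1" by (auto simp: unit_square_def)
   then show "quant n (fst (x i)) \<in> {1..n}" by (rule quant_range[OF n])
  qed
  have ind: "(\<Prod>i\<in>I. indicator (?C (y i)) (x i)) = (of_bool (y = y0) :: real)" if y: "y \<in> ?Y" for y
  proof (cases "y = y0")
   case True
   then show ?thesis using xs by (auto simp: y0_def indicator_def intro!: prod.neutral)
  next
   case False
   then obtain i where i: "i \<in> I" "y i ~= y0 i" using PiE_ext[OF y y0] by blast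
   then have "indicator (?C (y i)) (x i) = (0 :: real)" by (auto simp: y0_def indicator_def)
   then show ?thesis using False i(1) I by (auto intro: prod_zero)
  qed
  have "(\<Sum>y\<in>?Y. \<Phi> y * (\<Prod>i\<in>I. indicator (?C (y i)) (x i))) = (\<Sum>y\<in>?Y. \<Phi> y * of_bool (y = y0))"
   by (intro sum.cong refl) (simp only: ind)
  also have "... = \<Phi> y0" using fY y0 by (simp add: of_bool_def if_distrib cong: if_cong)
  also have "\<Phi> y0 = \<Phi> (%i. quant n (fst (x i)))" by (rule \<Phi>) (simp add: y0_def)
  finally show ?thesis ..
 qed
 have "(\<integral>x. \<Phi> (%i. quant n (fst (x i))) \<partial>?M) = (\<integral>x. (\<Sum>y\<in>?Y. \<Phi> y * (\<Prod>i\<in>I. indicator (?C (y i)) (x i))) \<partial>?M)"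
  by (rule Bochner_Integration.integral_cong[OF refl eq])
 also have "... = (\<Sum>y\<in>?Y. \<integral>x. \<Phi> y * (\<Prod>i\<in>I. indicator (?C (y i)) (x i)) \<partial>?M)"
  by (rule Bochner_Integration.integral_sum) (rule integrable_mult_right, rule ip)
 also have "... = (\<Sum>y\<in>?Y. \<Phi> y * (1 / real n ^ card I))"
 proof (intro sum.cong refl)
  fix y assume y: "y \<in> ?Y"
  have "(\<integral>x. (\<Prod>i\<in>I. indicator (?C (y i)) (x i) :: real) \<partial>?M) = (\<Prod>i\<in>I. integral\<^sup>L square (indicator (?C (y i))))"
   by (rule PiM_square.product_integral_prod[OF I ii[OF y]])
  also have "... = (\<Prod>i\<in>I. 1 / real n)"
  proof (intro prod.cong refl)
   fix i assume i: "i \<in> I"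
   have "?C (y i) \<inter> space square = ?C (y i)" by blast
   then show "integral\<^sup>L square (indicator (?C (y i))) = 1 / real n"
    using Bochner_Integration.integral_indicator[of square "?C (y i)"] yC(2)[OF y i] by (simp only:)
  qed
  finally show "(\<integral>x. \<Phi> y * (\<Prod>i\<in>I. indicator (?C (y i)) (x i)) \<partial>?M) = \<Phi> y * (1 / real n ^ card I)"
   by (simp add: power_one_over)
 qed
 finally show ?thesis by (simp add: sum_divide_distrib)
qed

lemma card_increasing_embeddings:
 fixes F G
 defines "k \<equiv> num_vertices F" and "n \<equiv> num_vertices G"
 shows "card {y \<in> PiE {1..k} (%_. {1..n}). \<forall>p\<in>{1..k}. \<forall>q\<in>{1..k}. p < q \<longrightarrow> y p < y q & adj F p q = adj G (y p) (y q)}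
  = card {S \<in> subsets_of_card {1..n} k. induced G S = F}" (is "card ?Y = card ?S")
proof -
 have k1: "1 <= k" using num_vertices_ge_1 by (simp add: k_def)
 have sl: "sorted_list_of_set (y ` {1..k}) = map y [1..<Suc k]" "card (y ` {1..k}) = k"
  if inc: "!!p q. p \<in> {1..k} ==> q \<in> {1..k} ==> p < q ==> y p < y q" for y :: "nat => nat"
 proof -
  have "sorted_wrt (<) (map y [1..<Suc k])"
   unfolding sorted_wrt_map by (rule sorted_wrt_mono_rel[OF _ sorted_wrt_upt]) (use inc in auto)
  then have "sorted (map y [1..<Suc k])" "distinct (map y [1..<Suc k])"
   by (auto simp: strict_sorted_iff)
  then have "sorted_list_of_set (set (map y [1..<Suc k])) = map y [1..<Suc k]"
   by (rule sorted_list_of_set.idem_if_sorted_distinct)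
  moreover have "set (map y [1..<Suc k]) = y ` {1..k}" by auto
  ultimately show s: "sorted_list_of_set (y ` {1..k}) = map y [1..<Suc k]" by (simp only:)
  show "card (y ` {1..k}) = k" using arg_cong[OF s, of length] by simp
 qed
 have nth: "map y [1..<Suc k] ! (i - 1) = y i" if "i \<in> {1..k}" for y :: "nat => nat" and i
  using that by (auto simp: nth_append simp del: upt_Suc)
 have "bij_betw (%y. y ` {1..k}) ?Y ?S"
 proof (rule bij_betw_imageI)
  show "inj_on (%y. y ` {1..k}) ?Y"
  proof (rule inj_onI)
   fix y y' assume y: "y \<in> ?Y" and y': "y' \<in> ?Y" and e: "y ` {1..k} = y' ` {1..k}"
   have "map y [1..<Suc k] = map y' [1..<Suc k]" using sl(1)[of y] sl(1)[of y'] y y' e by auto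
   then have "y i = y' i" if "i \<in> {1..k}" for i using nth[OF that, of y] nth[OF that, of y'] by metis
   then show "y = y'" using y y' by (intro PiE_ext[of y _ _ y']) auto
  qed
  show "(%y. y ` {1..k}) ` ?Y = ?S"
  proof (intro equalityI subsetI)
   fix S assume "S \<in> (%y. y ` {1..k}) ` ?Y"
   then obtain y where y: "y \<in> ?Y" and S: "S = y ` {1..k}" by blast
   have inc: "!!p q. p \<in> {1..k} ==> q \<in> {1..k} ==> p < q ==> y p < y q" using y by auto
   have cS: "card S = k" and fS: "finite S" "S ~= {}" using sl(2)[OF inc] S k1 by auto
   have Ssub: "S \<subseteq> {1..n}" using y S by (auto simp: PiE_iff)
   have "adj (induced G S) i j = adj F i j" for i j
   proof (cases "i \<in> {1..k} & j \<in> {1..k}")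
    case True
    have "adj (induced G S) i j = adj G (sorted_list_of_set S ! (i - 1)) (sorted_list_of_set S ! (j - 1))"
     by (rule adj_induced[OF fS]) (use True cS in auto)
    also have "sorted_list_of_set S = map y [1..<Suc k]" unfolding S by (rule sl(1)[OF inc])
    also have "adj G (map y [1..<Suc k] ! (i - 1)) (map y [1..<Suc k] ! (j - 1)) = adj G (y i) (y j)"
     using True by (simp only: nth)
    also have "... = adj F i j"
     using y True adj_sym[of G "y i" "y j"] adj_sym[of F i j] adj_irrefl[of G "y i"] adj_irrefl[of F i]
     by (cases i j rule: linorder_cases) auto
    finally show ?thesis .
   next
    case False
    then show ?thesis
     using adj_False_outside[of i F j] adj_False_outside[of i "induced G S" j] num_vertices_induced[OF fS, of G] cS
     by (auto simp: k_def)
   qed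
   then have "induced G S = F"
    by (intro ordered_graph_eqI) (use num_vertices_induced[OF fS, of G] cS in \<open>auto simp: k_def\<close>)
   then show "S \<in> ?S" using Ssub cS by (simp add: subsets_of_card_def)
  next
   fix S assume "S \<in> ?S"
   then have S: "S \<subseteq> {1..n}" "card S = k" and F: "induced G S = F" by (auto simp: subsets_of_card_def)
   have fS: "finite S" "S ~= {}" using S k1 by (auto intro: finite_subset)
   define y where "y = (\<lambda>i\<in>{1..k}. sorted_list_of_set S ! (i - 1))"
   have len: "length (sorted_list_of_set S) = k" using S by simp
   have mem: "sorted_list_of_set S ! (i - 1) \<in> S" if "i \<in> {1..k}" for i
   proof -
    have "i - 1 < length (sorted_list_of_set S)" using len that by (simp only: atLeastAtMost_iff) linarith
    from nth_mem[OF this] show ?thesis using fS(1) by simp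
   qed
   have inc: "y p < y q" if "p \<in> {1..k}" "q \<in> {1..k}" "p < q" for p q
    using that len sorted_wrt_nth_less[OF strict_sorted_list_of_set, of "p - 1" "q - 1" S] by (auto simp: y_def)
   have ad: "adj F p q = adj G (y p) (y q)" if "p \<in> {1..k}" "q \<in> {1..k}" for p q
    using adj_induced[OF fS, of p q G] that S(2) F by (simp add: y_def)
   have "y \<in> ?Y" using inc ad mem S by (auto simp: y_def)
   moreover have "y ` {1..k} = S"
   proof (rule card_subset_eq[OF fS(1)])
    show "y ` {1..k} \<subseteq> S" using mem by (auto simp: y_def)
    show "card (y ` {1..k}) = card S" using sl(2)[OF inc] S by simp
   qed
   ultimately show "S \<in> (%y. y ` {1..k}) ` ?Y" by blast
  qed
 qed
 then show ?thesis by (rule bij_betw_same_card)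
qed

lemma density_increasing_embeddings:
 fixes F G
 defines "k \<equiv> num_vertices F" and "n \<equiv> num_vertices G"
 shows "\<bar>subgraph_density F G - fact k * real (card {S \<in> subsets_of_card {1..n} k. induced G S = F}) / real n ^ k\<bar> <= real k ^ 2 / real n"
proof -
 let ?V = "{1..n}"
 have V: "finite ?V" "?V ~= {}" using num_vertices_ge_1[of G] by (auto simp: n_def)
 have "(\<Sum>xs\<in>distinct_tuples ?V k. of_bool (matches F G xs)) = (\<Sum>xs\<in>distinct_tuples ?V k. of_bool (induced G (set xs) = F) :: real)"
  by (intro sum.cong refl) (auto simp: distinct_tuples_def tuples_def matches_distinct_iff k_def)
 also have "... = fact k * (\<Sum>S\<in>subsets_of_card ?V k. of_bool (induced G S = F))"
  by (rule sum_distinct_tuples_set[OF V(1)])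
 also have "(\<Sum>S\<in>subsets_of_card ?V k. of_bool (induced G S = F) :: real) = real (card {S \<in> subsets_of_card ?V k. induced G S = F})"
  by (simp add: finite_subsets_of_card Int_def)
 finally show ?thesis
  using tuple_avg_distinct[OF V, of k "%xs. of_bool (matches F G xs)"]
  unfolding subgraph_density_tuple_avg k_def[symmetric] n_def[symmetric] by simp
qed

text \<open>The integral of an ordered product over step functions counts strictly increasing vertex tuples, apart from tuples meeting a column twice.\<close>

lemma kernel_density_graph:
 "\<bar>kernel_density F (graph_kernel G) - subgraph_density F G\<bar>
   <= (fact (num_vertices F) * 2 + 1) * (real (num_vertices F))\<^sup>2 / real (num_vertices G)"
proof -
 let ?k = "num_vertices F" and ?n = "num_vertices G"
 have n: "1 <= ?n" by (rule num_vertices_ge_1)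
 define q where "q u = quant ?n (fst u)" for u :: point
 define phi where "phi e v w = (of_bool (v < w) * (if adj F (fst e) (snd e) then of_bool (adj G v w) else 1 - of_bool (adj G v w)) :: real)"
  for e :: "nat \<times> nat" and v w
 define N where "N e z = phi e (q (fst z)) (q (snd z))" for e z
 have Nm: "N e \<in> borel_measurable square2" for e
  unfolding N_def q_def by (rule quant_pair_measurable[OF n])
 have N01: "0 <= N e z & N e z <= 1" for e z unfolding N_def phi_def by auto
 have gk: "graph_kernel G z = of_bool (adj G (q (fst z)) (q (snd z)))" for z by (simp only: graph_kernel_def q_def)
 have gk01: "0 <= graph_kernel G z & graph_kernel G z <= 1" for z by (simp add: graph_kernel_def)
 have "\<bar>pair_product {1..?k} (ordered_kernel F (graph_kernel G)) - pair_product {1..?k} N\<bar> <= (real (card {1..?k}))\<^sup>2 * (2 * (1 / real ?n))"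
 proof (rule counting_lemma)
  fix e and a b :: "point => real"
  assume a: "a \<in> borel_measurable square" "!!u. 0 <= a u & a u <= 1"
   and b: "b \<in> borel_measurable square" "!!u. 0 <= b u & b u <= 1"
  have ab: "0 <= a (fst z) * b (snd z) & a (fst z) * b (snd z) <= 1" for z
   using a(2)[of "fst z"] b(2)[of "snd z"] by (simp add: mult_le_one)
  show "\<bar>\<integral>z. a (fst z) * b (snd z) * (ordered_kernel F (graph_kernel G) e z - N e z) \<partial>square2\<bar> <= 2 * (1 / real ?n)"
  proof (rule abs_integral_band_le)
   show "(%z. a (fst z) * b (snd z) * (ordered_kernel F (graph_kernel G) e z - N e z)) \<in> borel_measurable square2"
    by (rule weighted_measurable[OF borel_measurable_diff[OF ordered_kernel_measurable[OF graph_kernel_measurable] Nm] a(1) b(1)])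
   fix z assume "z \<in> space square2"
   then have z: "fst z \<in> unit_square" "snd z \<in> unit_square" by (auto simp: space_square2)
   define x y where "x = fst (fst z)" and "y = fst (snd z)"
   have xy: "0 <= x" "x <= 1" "0 <= y" "y <= 1" using z by (auto simp: x_def y_def unit_square_def)
   have mono: "quant ?n s <= quant ?n t" if "s <= t" "0 <= s" "t <= 1" for s t
   proof (cases "s > 0")
    case True
    have "\<lceil>real ?n * s\<rceil> <= \<lceil>real ?n * t\<rceil>" using that by (intro ceiling_mono mult_left_mono) auto
    moreover have "t > 0" using True that by simp
    ultimately show ?thesis using True unfolding quant_def by (simp only: if_True nat_mono)
   next
    case False
    then have "quant ?n s = 1" by (simp add: quant_def)
    moreover have "1 <= quant ?n t" using quant_range[OF n, of t] that by auto
    ultimately show ?thesis by simp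
   qed
   have close: "\<bar>x - y\<bar> <= 1 / real ?n" if "quant ?n x = quant ?n y"
   proof -
    have r: "quant ?n x \<in> {1..?n}" using quant_range[OF n] xy by blast
    have "(real (quant ?n x) - 1) / real ?n <= t & t <= real (quant ?n x) / real ?n" if "0 <= t" "quant ?n t = quant ?n x" for t
     using quant_eq_iff[OF n r that(1)] that(2) by (auto split: if_splits)
    from this[OF xy(1) refl] this[OF xy(3) that[symmetric]] show ?thesis
     unfolding diff_divide_distrib by linarith
   qed
   show "\<bar>a (fst z) * b (snd z) * (ordered_kernel F (graph_kernel G) e z - N e z)\<bar> <= of_bool (\<bar>fst (fst z) - fst (snd z)\<bar> <= 1 / real ?n)"
   proof (cases "\<bar>x - y\<bar> <= 1 / real ?n")
    case True
    have "\<bar>ordered_kernel F (graph_kernel G) e z - N e z\<bar> <= 1"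
     using ordered_kernel_bounds[where K = "graph_kernel G" and F = F and e = e and z = z, OF gk01] N01[of e z] by linarith
    then show ?thesis using mult_abs_le_1[of "a (fst z) * b (snd z)" "ordered_kernel F (graph_kernel G) e z - N e z"] ab[of z] True
     by (simp add: x_def y_def)
   next
    case False
    then have ne: "quant ?n x ~= quant ?n y" using close by blast
    have "(x < y) = (quant ?n x < quant ?n y)"
     using mono[of x y] mono[of y x] ne xy by (cases x y rule: linorder_cases) auto
    then have "before z = of_bool (q (fst z) < q (snd z))" by (simp add: q_def x_def y_def)
    then have "ordered_kernel F (graph_kernel G) e z - N e z = 0"
     by (simp add: ordered_kernel_def N_def phi_def gk)
    then show ?thesis by simp
   qed
  qed simp
 qed (simp, rule ordered_kernel_measurable[OF graph_kernel_measurable], rule ordered_kernel_bounds[OF gk01], rule Nm, rule N01)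
 then have 1: "\<bar>pair_product {1..?k} (ordered_kernel F (graph_kernel G)) - pair_product {1..?k} N\<bar> <= 2 * (real ?k)\<^sup>2 / real ?n"
  by (simp add: mult.commute)
 let ?P = "{(p, q). p \<in> {1..?k} & q \<in> {1..?k} & p < q}"
 define \<Phi> where "\<Phi> y = (\<Prod>e\<in>?P. phi e (y (fst e)) (y (snd e)))" for y
 have fP: "finite ?P" by (rule finite_subset[of _ "{1..?k} \<times> {1..?k}"]) auto
 have "pair_product {1..?k} N = (\<integral>x. \<Phi> (%i. quant ?n (fst (x i))) \<partial>PiM {1..?k} (%_. square))"
  unfolding pair_product_def \<Phi>_def N_def q_def fst_conv snd_conv by (rule refl)
 also have "... = (\<Sum>y\<in>PiE {1..?k} (%_. {1..?n}). \<Phi> y) / real ?n ^ card {1..?k}"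
  by (rule integral_PiM_quant[OF n]) (auto simp: \<Phi>_def intro!: prod.cong)
 also have "(\<Sum>y\<in>PiE {1..?k} (%_. {1..?n}). \<Phi> y) =
   (\<Sum>y\<in>PiE {1..?k} (%_. {1..?n}). of_bool (\<forall>p\<in>{1..?k}. \<forall>q\<in>{1..?k}. p < q \<longrightarrow> y p < y q & adj F p q = adj G (y p) (y q)))"
 proof (intro sum.cong refl)
  fix y :: "nat => nat"
  show "\<Phi> y = of_bool (\<forall>p\<in>{1..?k}. \<forall>q\<in>{1..?k}. p < q \<longrightarrow> y p < y q & adj F p q = adj G (y p) (y q))"
  proof (cases "\<forall>p\<in>{1..?k}. \<forall>q\<in>{1..?k}. p < q \<longrightarrow> y p < y q & adj F p q = adj G (y p) (y q)")
   case True
   then have "\<Phi> y = 1" unfolding \<Phi>_def by (intro prod.neutral) (auto simp: phi_def)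
   then show ?thesis using True by simp
  next
   case False
   then obtain p q where pq: "p \<in> {1..?k}" "q \<in> {1..?k}" "p < q" "\<not> (y p < y q & adj F p q = adj G (y p) (y q))" by blast
   then have "phi (p, q) (y p) (y q) = 0" by (auto simp: phi_def)
   then have "\<Phi> y = 0" unfolding \<Phi>_def by (intro prod_zero fP bexI[of _ "(p, q)"]) (use pq in auto)
   then show ?thesis using False by simp
  qed
 qed
 also have "... = real (card {y \<in> PiE {1..?k} (%_. {1..?n}). \<forall>p\<in>{1..?k}. \<forall>q\<in>{1..?k}. p < q \<longrightarrow> y p < y q & adj F p q = adj G (y p) (y q)})"
 proof -
  have "(\<Sum>y\<in>A. of_bool (Q y)) = real (card {y \<in> A. Q y})" if "finite A" for A :: "(nat => nat) set" and Q
   using that by (simp add: Int_def)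
  then show ?thesis by (simp only: finite_PiE finite_atLeastAtMost)
 qed
 finally have "pair_product {1..?k} N = real (card {S \<in> subsets_of_card {1..?n} ?k. induced G S = F}) / real ?n ^ ?k"
  unfolding card_increasing_embeddings by simp
 then have "\<bar>subgraph_density F G - fact ?k * pair_product {1..?k} N\<bar> <= (real ?k)\<^sup>2 / real ?n"
  using density_increasing_embeddings[of F G] by simp
 moreover have "\<bar>kernel_density F (graph_kernel G) - fact ?k * pair_product {1..?k} N\<bar> <= fact ?k * (2 * (real ?k)\<^sup>2 / real ?n)"
  using mult_left_mono[OF 1, of "fact ?k"] unfolding kernel_density_def right_diff_distrib[symmetric] abs_mult by simp
 ultimately have "\<bar>kernel_density F (graph_kernel G) - subgraph_density F G\<bar> <= fact ?k * (2 * (real ?k)\<^sup>2 / real ?n) + (real ?k)\<^sup>2 / real ?n" by linarith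
 also have "... = (fact ?k * 2 + 1) * (real ?k)\<^sup>2 / real ?n" by (simp add: add_divide_distrib distrib_right)
 finally show ?thesis .
qed

lemma cut_shift_continuous_Lipschitz2:
 assumes f: "cut_shift_continuous f" and g: "cut_shift_continuous g"
  and h: "!!x y x' y'. \<bar>h x y - h x' y'\<bar> <= C * (\<bar>x - x'\<bar> + \<bar>y - y'\<bar> :: real)" and C: "C > 0"
 shows "cut_shift_continuous (%W. h (f W) (g W))"
 unfolding cut_shift_continuous_def
proof (intro ballI allI impI)
 fix W and eps :: real assume W: "W \<in> orderons" and eps: "eps > 0"
 then have e: "eps / (2 * C) > 0" using C by simp
 obtain d1 where d1: "d1 > 0" "!!U. U \<in> orderons ==> cut_shift_dist W U < d1 ==> \<bar>f W - f U\<bar> < eps / (2 * C)"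
  using f W e unfolding cut_shift_continuous_def by meson
 obtain d2 where d2: "d2 > 0" "!!U. U \<in> orderons ==> cut_shift_dist W U < d2 ==> \<bar>g W - g U\<bar> < eps / (2 * C)"
  using g W e unfolding cut_shift_continuous_def by meson
 show "\<exists>\<delta>>0. \<forall>U\<in>orderons. cut_shift_dist W U < \<delta> \<longrightarrow> \<bar>h (f W) (g W) - h (f U) (g U)\<bar> < eps"
 proof (intro exI[of _ "min d1 d2"] conjI ballI impI)
  fix U assume "U \<in> orderons" "cut_shift_dist W U < min d1 d2"
  then have "\<bar>f W - f U\<bar> < eps / (2 * C)" "\<bar>g W - g U\<bar> < eps / (2 * C)" using d1 d2 by auto
  then have "\<bar>f W - f U\<bar> + \<bar>g W - g U\<bar> < eps / C" by (simp add: field_simps)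
  then have "C * (\<bar>f W - f U\<bar> + \<bar>g W - g U\<bar>) < eps" using C by (simp add: field_simps)
  then show "\<bar>h (f W) (g W) - h (f U) (g U)\<bar> < eps" using h[of "f W" "g W" "f U" "g U"] by linarith
 qed (use d1 d2 in simp)
qed

lemma cut_shift_continuous_const: "cut_shift_continuous (%_. c)"
 by (auto simp: cut_shift_continuous_def intro: exI[of _ 1])

lemma cut_shift_continuous_add:
 assumes "cut_shift_continuous f" "cut_shift_continuous g"
 shows "cut_shift_continuous (%W. f W + g W)"
 by (rule cut_shift_continuous_Lipschitz2[OF assms, of "(+)" 1]) auto

lemma cut_shift_continuous_cmult:
 assumes "cut_shift_continuous f"
 shows "cut_shift_continuous (%W. c * f W)"
proof (rule cut_shift_continuous_Lipschitz2[OF assms assms, of "%x y. c * x" "\<bar>c\<bar> + 1"])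
 fix x y x' y' :: real
 have "\<bar>c * x - c * x'\<bar> = \<bar>c\<bar> * \<bar>x - x'\<bar>" by (simp add: right_diff_distrib[symmetric] abs_mult)
 also have "... <= (\<bar>c\<bar> + 1) * (\<bar>x - x'\<bar> + \<bar>y - y'\<bar>)" by (intro mult_mono) auto
 finally show "\<bar>c * x - c * x'\<bar> <= (\<bar>c\<bar> + 1) * (\<bar>x - x'\<bar> + \<bar>y - y'\<bar>)" .
qed auto

lemma cut_shift_continuous_sum:
 assumes "!!i. i \<in> A ==> cut_shift_continuous (f i)"
 shows "cut_shift_continuous (%W. \<Sum>i\<in>A. f i W)"
 using assms by (induction A rule: infinite_finite_induct) (auto intro: cut_shift_continuous_add cut_shift_continuous_const)

lemma cut_shift_continuous_uniform_limit:
 assumes S: "!!M. cut_shift_continuous (S M)"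
  and lim: "!!eps. eps > 0 ==> \<exists>M. \<forall>W\<in>orderons. \<bar>g W - S M W\<bar> < eps"
 shows "cut_shift_continuous g"
 unfolding cut_shift_continuous_def
proof (intro ballI allI impI)
 fix W and eps :: real assume W: "W \<in> orderons" and eps: "eps > 0"
 obtain M where M: "!!U. U \<in> orderons ==> \<bar>g U - S M U\<bar> < eps / 3" using lim[of "eps / 3"] eps by auto
 obtain \<delta> where d: "\<delta> > 0" "!!U. U \<in> orderons ==> cut_shift_dist W U < \<delta> ==> \<bar>S M W - S M U\<bar> < eps / 3"
  using S[of M] W eps unfolding cut_shift_continuous_def by (metis zero_less_divide_iff zero_less_numeral)
 show "\<exists>\<delta>>0. \<forall>U\<in>orderons. cut_shift_dist W U < \<delta> \<longrightarrow> \<bar>g W - g U\<bar> < eps"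
 proof (intro exI[of _ \<delta>] conjI d(1) ballI impI)
  fix U assume U: "U \<in> orderons" "cut_shift_dist W U < \<delta>"
  show "\<bar>g W - g U\<bar> < eps" using M[OF W] M[OF U(1)] d(2)[OF U] by linarith
 qed
qed

text \<open>Linear combinations of densities approximate the parameter uniformly on large graphs. They are continuous on all orderons, but need not converge there; truncating successive differences to geometric size forces uniform convergence without changing the values at large graphs.\<close>

lemma estimable_imp_continuous_extension:
 assumes est: "naturally_estimable f" and B: "!!G. \<bar>f G\<bar> <= B"
 shows "\<exists>fhat. cut_shift_continuous fhat & (\<forall>eps>0. \<exists>k. \<forall>G. num_vertices G \<ge> k \<longrightarrow> \<bar>fhat (graph_orderon G) - f G\<bar> <= eps)"
proof -
 have B0: "B \<ge> 0" using B abs_ge_zero order_trans by blast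
 have "\<exists>a N. cut_shift_continuous a & (\<forall>G. N <= num_vertices G \<longrightarrow> \<bar>a (graph_orderon G) - f G\<bar> <= (1/2) ^ m)" for m :: nat
 proof -
  define eps :: real where "eps = (1/2) ^ m / 2"
  have eps: "eps > 0" by (simp add: eps_def)
  obtain k n0 where k: "!!G. n0 <= num_vertices G ==> \<bar>f G - (\<Sum>F | num_vertices F = k. f F * subgraph_density F G)\<bar> <= eps"
   using estimable_density_approx[OF est B eps] by metis
  define a where "a W = (\<Sum>F | num_vertices F = k. f F * orderon_density F W)" for W
  define C where "C = real (card {F. num_vertices F = k}) * (B * ((fact k * 2 + 1) * (real k)\<^sup>2))"
  have "cut_shift_continuous a" unfolding a_def
   by (intro cut_shift_continuous_sum cut_shift_continuous_cmult orderon_density_continuous)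
  moreover obtain N where N: "C / eps <= real N" using real_arch_simple by blast
  have "\<bar>a (graph_orderon G) - f G\<bar> <= (1/2) ^ m" if G: "max n0 N <= num_vertices G" for G
  proof -
   have "\<bar>a (graph_orderon G) - (\<Sum>F | num_vertices F = k. f F * subgraph_density F G)\<bar>
     = \<bar>\<Sum>F | num_vertices F = k. f F * (kernel_density F (graph_kernel G) - subgraph_density F G)\<bar>"
    unfolding a_def orderon_density_eq[OF graph_kernel_version] by (simp add: sum_subtractf right_diff_distrib)
   also have "... <= (\<Sum>F | num_vertices F = k. B * ((fact k * 2 + 1) * (real k)\<^sup>2 / real (num_vertices G)))"
   proof (rule order_trans[OF sum_abs], rule sum_mono)
    fix F assume "F \<in> {F. num_vertices F = k}"
    then have "\<bar>kernel_density F (graph_kernel G) - subgraph_density F G\<bar> <= (fact k * 2 + 1) * (real k)\<^sup>2 / real (num_vertices G)"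
     using kernel_density_graph[of F G] by simp
    then show "\<bar>f F * (kernel_density F (graph_kernel G) - subgraph_density F G)\<bar> <= B * ((fact k * 2 + 1) * (real k)\<^sup>2 / real (num_vertices G))"
     unfolding abs_mult by (intro mult_mono B) (use B0 in auto)
   qed
   also have "... = C / real (num_vertices G)" by (simp add: C_def)
   also have "... <= eps"
   proof -
    have "C / eps <= real (num_vertices G)" using N G by linarith
    then show ?thesis using eps num_vertices_ge_1[of G] by (simp add: field_simps)
   qed
   finally have "\<bar>a (graph_orderon G) - (\<Sum>F | num_vertices F = k. f F * subgraph_density F G)\<bar> <= eps" .
   moreover have "n0 <= num_vertices G" using G by simp
   moreover have "eps + eps = (1/2) ^ m" by (simp add: eps_def)
   ultimately show ?thesis using k[of G] by linarith
  qed
  ultimately show ?thesis by blast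
 qed
 then obtain a N where a: "!!m. cut_shift_continuous (a m)"
  and aN: "!!m G. N m <= num_vertices G ==> \<bar>a m (graph_orderon G) - f G\<bar> <= (1/2) ^ m" by metis
 define cl where "cl m x = max (- (2 * (1/2) ^ m)) (min (2 * (1/2) ^ m) x)" for m :: nat and x :: real
 define b where "b m W = cl m (a (Suc m) W - a m W)" for m W
 have cl_le: "\<bar>cl m x\<bar> <= 2 * (1/2) ^ m" for m x
 proof -
  have "0 <= 2 * (1/2 :: real) ^ m" by simp
  then show ?thesis unfolding cl_def by linarith
 qed
 have bc: "cut_shift_continuous (b m)" for m
  unfolding b_def
 proof (rule cut_shift_continuous_Lipschitz2[OF a a, of "%x y. cl m (x - y)" 1])
  fix x y x' y' :: real
  show "\<bar>cl m (x - y) - cl m (x' - y')\<bar> <= 1 * (\<bar>x - x'\<bar> + \<bar>y - y'\<bar>)"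
  proof -
   have "\<bar>max (- c) (min c u) - max (- c) (min c v)\<bar> <= \<bar>u - v\<bar>" for c u v :: real
    by (simp add: max_def min_def abs_if)
   then have "\<bar>cl m (x - y) - cl m (x' - y')\<bar> <= \<bar>(x - y) - (x' - y')\<bar>" unfolding cl_def by blast
   also have "... <= 1 * (\<bar>x - x'\<bar> + \<bar>y - y'\<bar>)" unfolding mult_1 by linarith
   finally show ?thesis .
  qed
 qed simp
 have sm: "summable (%m. b m W)" for W
  by (rule summable_comparison_test'[of "%m. 2 * (1/2) ^ m" 0])
   (use cl_le in \<open>auto simp: b_def intro!: summable_mult summable_geometric\<close>)
 define g where "g W = a 0 W + (\<Sum>m. b m W)" for W
 define S where "S M W = a 0 W + (\<Sum>m<M. b m W)" for M W
 have Sc: "cut_shift_continuous (S M)" for M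
  unfolding S_def by (intro cut_shift_continuous_add a cut_shift_continuous_sum bc)
 have tail: "\<bar>g W - S M W\<bar> <= 4 * (1/2) ^ M" for M W
 proof -
  have "g W - S M W = (\<Sum>m. b (m + M) W)"
   unfolding g_def S_def using suminf_split_initial_segment[OF sm, of W M] by simp
  also have "\<bar>...\<bar> <= (\<Sum>m. 2 * (1/2) ^ M * (1/2) ^ m)"
  proof (rule order_trans[OF summable_rabs])
   have le: "\<bar>b (m + M) W\<bar> <= 2 * (1/2) ^ M * (1/2) ^ m" for m
    using cl_le[of "m + M"] by (simp add: b_def power_add mult.commute mult.left_commute)
   show s: "summable (%m. \<bar>b (m + M) W\<bar>)"
    by (rule summable_comparison_test'[of "%m. 2 * (1/2) ^ M * (1/2) ^ m" 0])
     (use le in \<open>auto intro!: summable_mult summable_geometric\<close>)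
   show "(\<Sum>m. \<bar>b (m + M) W\<bar>) <= (\<Sum>m. 2 * (1/2) ^ M * (1/2) ^ m)"
    by (rule suminf_le[OF le s]) (intro summable_mult summable_geometric, simp)
  qed
  also have "... = 2 * (1/2) ^ M * (\<Sum>m. (1/2) ^ m)" by (rule suminf_mult) (simp add: summable_geometric)
  also have "... = 4 * (1/2) ^ M" by (simp add: suminf_geometric)
  finally show ?thesis .
 qed
 have small: "\<exists>M. 5 * (1/2) ^ M < eps" if "eps > 0" for eps :: real
  using real_arch_pow_inv[of "eps / 5" "1/2"] that by (auto simp: field_simps)
 have "cut_shift_continuous g"
 proof (rule cut_shift_continuous_uniform_limit[OF Sc])
  fix eps :: real assume "eps > 0"
  then obtain M where "5 * (1/2) ^ M < eps" using small by blast
  then have "\<bar>g W - S M W\<bar> < eps" for W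
  proof -
   have "4 * (1/2) ^ M <= 5 * (1/2 :: real) ^ M" by simp
   then show ?thesis using tail[of W M] \<open>5 * (1/2) ^ M < eps\<close> by linarith
  qed
  then show "\<exists>M. \<forall>W\<in>orderons. \<bar>g W - S M W\<bar> < eps" by blast
 qed
 moreover have "\<exists>k. \<forall>G. num_vertices G \<ge> k \<longrightarrow> \<bar>g (graph_orderon G) - f G\<bar> <= eps" if eps: "eps > 0" for eps
 proof -
  obtain M where M: "5 * (1/2) ^ M < eps" using small[OF eps] by blast
  have "\<bar>g (graph_orderon G) - f G\<bar> <= eps" if G: "Max (N ` {..M}) <= num_vertices G" for G
  proof -
   have NG: "N m <= num_vertices G" if "m <= M" for m
    using Max_ge[of "N ` {..M}" "N m"] that G by auto
   have "S m (graph_orderon G) = a m (graph_orderon G)" if "m <= M" for m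
    using that
   proof (induction m)
    case 0 then show ?case by (simp add: S_def)
   next
    case (Suc m)
    have "\<bar>a (Suc m) (graph_orderon G) - f G\<bar> <= (1/2) ^ Suc m" "\<bar>a m (graph_orderon G) - f G\<bar> <= (1/2) ^ m"
     by (rule aN, rule NG, use Suc.prems in simp)+
    moreover have "(1/2 :: real) ^ Suc m <= (1/2) ^ m" by simp
    ultimately have "\<bar>a (Suc m) (graph_orderon G) - a m (graph_orderon G)\<bar> <= 2 * (1/2) ^ m" by linarith
    then have "b m (graph_orderon G) = a (Suc m) (graph_orderon G) - a m (graph_orderon G)"
     by (auto simp: b_def cl_def)
    then show ?case using Suc by (simp add: S_def)
   qed
   then have "\<bar>g (graph_orderon G) - a M (graph_orderon G)\<bar> <= 4 * (1/2) ^ M" using tail[of "graph_orderon G" M] by simp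
   moreover have "\<bar>a M (graph_orderon G) - f G\<bar> <= (1/2) ^ M" using aN NG by blast
   ultimately show ?thesis using M by linarith
  qed
  then show ?thesis by blast
 qed
 ultimately show ?thesis by blast
qed

section \<open>Weak regularity with nested labels\<close>

text \<open>The step value of the conditional expectation on a pair of classes; division by zero gives \<open>0\<close> on empty classes.\<close>

definition class_avg :: "'a set => ('a => 'a => real) => ('a => nat) => nat => nat => real" where
 "class_avg V G L i j = (\<Sum>u | u \<in> V & L u = i. \<Sum>v | v \<in> V & L v = j. G u v) /
   (real (card {u \<in> V. L u = i}) * real (card {v \<in> V. L v = j}))"

text \<open>The normalized density of four-cycles, equal to the fourth power of a Schatten norm; it dominates the cut norm and is a tuple average, hence stable under sampling.\<close>

definition four_cycle :: "'a set => ('a => 'a => real) => real" where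
 "four_cycle V X = (\<Sum>v\<in>V. \<Sum>v'\<in>V. (\<Sum>u\<in>V. X u v * X u v')\<^sup>2) / real (card V) ^ 4"

lemma class_avg_bounds:
 assumes "!!u v. 0 <= G u v & G u v <= 1"
 shows "0 <= class_avg V G L i j & class_avg V G L i j <= 1"
proof -
 let ?A = "{u \<in> V. L u = i}" and ?B = "{v \<in> V. L v = j}"
 have "(\<Sum>u\<in>?A. \<Sum>v\<in>?B. G u v) <= (\<Sum>u\<in>?A. \<Sum>v\<in>?B. 1)"
  by (intro sum_mono) (use assms in auto)
 then have "(\<Sum>u\<in>?A. \<Sum>v\<in>?B. G u v) <= real (card ?A) * real (card ?B)" by simp
 moreover have "0 <= (\<Sum>u\<in>?A. \<Sum>v\<in>?B. G u v)" by (intro sum_nonneg) (use assms in auto)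
 ultimately show ?thesis unfolding class_avg_def
  by (cases "real (card ?A) * real (card ?B) = 0") (auto simp: divide_le_eq_1)
qed

lemma sum_by_classes:
 fixes f :: "'a => 'a => real"
 assumes V: "finite V"
 shows "(\<Sum>u\<in>V. \<Sum>v\<in>V. f u v) = (\<Sum>i\<in>L ` V. \<Sum>j\<in>L ` V. \<Sum>u | u \<in> V & L u = i. \<Sum>v | v \<in> V & L v = j. f u v)"
proof -
 have 1: "(\<Sum>v\<in>V. g v) = (\<Sum>j\<in>L ` V. \<Sum>v | v \<in> V & L v = j. g v)" for g :: "'a => real"
  by (rule sum.group[symmetric]) (use V in auto)
 have "(\<Sum>u\<in>V. \<Sum>v\<in>V. f u v) = (\<Sum>i\<in>L ` V. \<Sum>u | u \<in> V & L u = i. \<Sum>j\<in>L ` V. \<Sum>v | v \<in> V & L v = j. f u v)"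
  by (subst 1, subst 1) (rule refl)
 also have "... = (\<Sum>i\<in>L ` V. \<Sum>j\<in>L ` V. \<Sum>u | u \<in> V & L u = i. \<Sum>v | v \<in> V & L v = j. f u v)"
  by (intro sum.cong refl sum.swap)
 finally show ?thesis .
qed

lemma class_avg_projection:
 assumes V: "finite V"
 shows "(\<Sum>u\<in>V. \<Sum>v\<in>V. G u v * phi (L u) (L v)) = (\<Sum>u\<in>V. \<Sum>v\<in>V. class_avg V G L (L u) (L v) * phi (L u) (L v))"
proof -
 have *: "(\<Sum>u | u \<in> V & L u = i. \<Sum>v | v \<in> V & L v = j. G u v * phi (L u) (L v)) =
   (\<Sum>u | u \<in> V & L u = i. \<Sum>v | v \<in> V & L v = j. class_avg V G L (L u) (L v) * phi (L u) (L v))"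
  if ij: "i \<in> L ` V" "j \<in> L ` V" for i j
 proof -
  let ?A = "{u. u \<in> V & L u = i}" and ?B = "{v. v \<in> V & L v = j}"
  have c: "card ?A ~= 0" "card ?B ~= 0" using ij V by auto
  have "(\<Sum>u\<in>?A. \<Sum>v\<in>?B. G u v * phi (L u) (L v)) = (\<Sum>u\<in>?A. \<Sum>v\<in>?B. G u v) * phi i j"
   by (simp add: sum_distrib_right)
  also have "(\<Sum>u\<in>?A. \<Sum>v\<in>?B. G u v) = real (card ?A) * real (card ?B) * class_avg V G L i j"
   using c by (simp add: class_avg_def)
  also have "... * phi i j = (\<Sum>u\<in>?A. \<Sum>v\<in>?B. class_avg V G L (L u) (L v) * phi (L u) (L v))"
   by simp
  finally show ?thesis .
 qed
 have "(\<Sum>i\<in>L ` V. \<Sum>j\<in>L ` V. \<Sum>u | u \<in> V & L u = i. \<Sum>v | v \<in> V & L v = j. G u v * phi (L u) (L v)) =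
   (\<Sum>i\<in>L ` V. \<Sum>j\<in>L ` V. \<Sum>u | u \<in> V & L u = i. \<Sum>v | v \<in> V & L v = j. class_avg V G L (L u) (L v) * phi (L u) (L v))"
 proof (rule sum.cong[OF refl], rule sum.cong[OF refl])
  fix i j assume ij: "i \<in> L ` V" "j \<in> L ` V"
  show "(\<Sum>u | u \<in> V & L u = i. \<Sum>v | v \<in> V & L v = j. G u v * phi (L u) (L v)) =
   (\<Sum>u | u \<in> V & L u = i. \<Sum>v | v \<in> V & L v = j. class_avg V G L (L u) (L v) * phi (L u) (L v))"
   by (rule *[OF ij])
 qed
 then show ?thesis by (simp only: sum_by_classes[OF V, where L = L])
qed

lemma class_avg_energy_diff:
 assumes V: "finite V" and ref: "!!u. L' u div 4 = L u"
 shows "(\<Sum>u\<in>V. \<Sum>v\<in>V. (class_avg V G L' (L' u) (L' v) - class_avg V G L (L u) (L v))\<^sup>2) =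
  (\<Sum>u\<in>V. \<Sum>v\<in>V. (class_avg V G L' (L' u) (L' v))\<^sup>2) - (\<Sum>u\<in>V. \<Sum>v\<in>V. (class_avg V G L (L u) (L v))\<^sup>2)"
proof -
 have "(\<Sum>u\<in>V. \<Sum>v\<in>V. class_avg V G L' (L' u) (L' v) * class_avg V G L (L u) (L v))
   = (\<Sum>u\<in>V. \<Sum>v\<in>V. G u v * class_avg V G L (L u) (L v))"
  using class_avg_projection[OF V, where L = L' and phi = "%i j. class_avg V G L (i div 4) (j div 4)" and G = G] by (simp add: ref)
 also have "... = (\<Sum>u\<in>V. \<Sum>v\<in>V. (class_avg V G L (L u) (L v))\<^sup>2)"
  using class_avg_projection[OF V, where L = L and phi = "class_avg V G L" and G = G] by (simp add: power2_eq_square)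
 finally have "(\<Sum>u\<in>V. \<Sum>v\<in>V. class_avg V G L' (L' u) (L' v) * class_avg V G L (L u) (L v)) = (\<Sum>u\<in>V. \<Sum>v\<in>V. (class_avg V G L (L u) (L v))\<^sup>2)" .
 then show ?thesis
  by (simp add: power2_diff sum.distrib sum_subtractf mult.assoc sum_distrib_left[symmetric])
qed

text \<open>Conditional expectations onto a coarser and a finer partition: the projection of the finer average is the coarser one.\<close>

lemma refinement_product:
 fixes L :: "nat => 'a => nat"
 assumes V: "finite V" and ref: "!!r u. L (Suc r) u div 4 = L r u" and rs: "r <= s"
 shows "(\<Sum>u\<in>V. \<Sum>v\<in>V. class_avg V G (L r) (L r u) (L r v) * class_avg V G (L s) (L s u) (L s v))
   = (\<Sum>u\<in>V. \<Sum>v\<in>V. (class_avg V G (L r) (L r u) (L r v))\<^sup>2)"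
proof -
 have d: "L s u div 4 ^ (s - r) = L r u" for u
  using rs
 proof (induction s rule: dec_induct)
  case (step s)
  have "L (Suc s) u div 4 ^ (Suc s - r) = (L (Suc s) u div 4) div 4 ^ (s - r)"
   using step.hyps by (simp add: Suc_diff_le div_mult2_eq)
  then show ?case using step.IH ref by simp
 qed simp
 have "(\<Sum>u\<in>V. \<Sum>v\<in>V. class_avg V G (L s) (L s u) (L s v) * class_avg V G (L r) (L r u) (L r v))
   = (\<Sum>u\<in>V. \<Sum>v\<in>V. G u v * class_avg V G (L r) (L r u) (L r v))"
  using class_avg_projection[OF V, where L = "L s" and phi = "%i j. class_avg V G (L r) (i div 4 ^ (s - r)) (j div 4 ^ (s - r))" and G = G]
  by (simp add: d)
 also have "... = (\<Sum>u\<in>V. \<Sum>v\<in>V. (class_avg V G (L r) (L r u) (L r v))\<^sup>2)"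
  using class_avg_projection[OF V, where L = "L r" and phi = "class_avg V G (L r)" and G = G] by (simp add: power2_eq_square)
 finally show ?thesis by (simp add: mult.commute)
qed

lemma sum2_Cauchy_Schwarz:
 fixes f g :: "'a => 'a => real"
 shows "(\<Sum>u\<in>V. \<Sum>v\<in>V. f u v * g u v)\<^sup>2 <= (\<Sum>u\<in>V. \<Sum>v\<in>V. (f u v)\<^sup>2) * (\<Sum>u\<in>V. \<Sum>v\<in>V. (g u v)\<^sup>2)"
 using Cauchy_Schwarz_ineq_sum[of "%(u, v). f u v" "%(u, v). g u v" "V \<times> V"]
 by (simp add: sum.cartesian_product case_prod_beta)

lemma four_cycle_expand:
 "four_cycle V X * real (card V) ^ 4 = (\<Sum>u'\<in>V. \<Sum>v'\<in>V. X u' v' * (\<Sum>u\<in>V. \<Sum>v\<in>V. X u v * (X u v' * X u' v)))" if "finite V"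
proof (cases "card V = 0")
 case False
 have "four_cycle V X * real (card V) ^ 4 = (\<Sum>v\<in>V. \<Sum>v'\<in>V. \<Sum>u'\<in>V. \<Sum>u\<in>V. (X u' v * X u' v') * (X u v * X u v'))"
  using False by (simp add: four_cycle_def power2_eq_square sum_product)
 also have "... = (\<Sum>v'\<in>V. \<Sum>v\<in>V. \<Sum>u'\<in>V. \<Sum>u\<in>V. (X u' v * X u' v') * (X u v * X u v'))" by (rule sum.swap)
 also have "... = (\<Sum>v'\<in>V. \<Sum>u'\<in>V. \<Sum>v\<in>V. \<Sum>u\<in>V. (X u' v * X u' v') * (X u v * X u v'))" by (intro sum.cong refl sum.swap)
 also have "... = (\<Sum>u'\<in>V. \<Sum>v'\<in>V. \<Sum>v\<in>V. \<Sum>u\<in>V. (X u' v * X u' v') * (X u v * X u v'))" by (rule sum.swap)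
 also have "... = (\<Sum>u'\<in>V. \<Sum>v'\<in>V. \<Sum>u\<in>V. \<Sum>v\<in>V. (X u' v * X u' v') * (X u v * X u v'))" by (intro sum.cong refl sum.swap)
 also have "... = (\<Sum>u'\<in>V. \<Sum>v'\<in>V. X u' v' * (\<Sum>u\<in>V. \<Sum>v\<in>V. X u v * (X u v' * X u' v)))"
  by (simp add: sum_distrib_left mult_ac)
 finally show ?thesis .
qed (use that in auto)

lemma four_cycle_nonneg: "0 <= four_cycle V X"
 unfolding four_cycle_def by (intro divide_nonneg_nonneg sum_nonneg) auto

lemma energy_increment:
 fixes A :: "'a => 'a => bool" and L :: "'a => nat"
 defines "G \<equiv> %u v. of_bool (A u v)"
 assumes V: "finite V" "V ~= {}" and sym: "!!u v. A u v = A v u"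
 obtains L' where "!!u. L' u div 4 = L u"
  "(four_cycle V (%u v. G u v - class_avg V G L (L u) (L v)))\<^sup>2 * (real (card V))\<^sup>2 \<le>
   (\<Sum>u\<in>V. \<Sum>v\<in>V. (class_avg V G L' (L' u) (L' v))\<^sup>2) - (\<Sum>u\<in>V. \<Sum>v\<in>V. (class_avg V G L (L u) (L v))\<^sup>2)"
proof -
 let ?n = "real (card V)"
 have n: "?n > 0" using V by (simp add: card_gt_0_iff)
 have G01: "0 <= G u v & G u v <= 1" for u v by (simp add: G_def)
 have c01: "0 <= class_avg V G M i j & class_avg V G M i j <= 1" for M i j by (rule class_avg_bounds[OF G01])
 define X where "X u v = G u v - class_avg V G L (L u) (L v)" for u v
 have X1: "\<bar>X u v\<bar> <= 1" for u v using G01[of u v] c01[of L "L u" "L v"] by (auto simp: X_def abs_le_iff)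
 define I where "I z z' = (\<Sum>u\<in>V. \<Sum>v\<in>V. X u v * (X u z' * X z v))" for z z'
 obtain z z' where z: "z \<in> V" "z' \<in> V" and max: "!!u v. u \<in> V ==> v \<in> V ==> \<bar>I u v\<bar> <= \<bar>I z z'\<bar>"
 proof -
  have fin: "finite ((%(u, v). \<bar>I u v\<bar>) ` (V \<times> V))" "(%(u, v). \<bar>I u v\<bar>) ` (V \<times> V) ~= {}" using V by auto
  from Max_in[OF fin] obtain z z' where "z \<in> V" "z' \<in> V" "Max ((%(u, v). \<bar>I u v\<bar>) ` (V \<times> V)) = \<bar>I z z'\<bar>" by auto
  moreover have "\<bar>I u v\<bar> <= Max ((%(u, v). \<bar>I u v\<bar>) ` (V \<times> V))" if "u \<in> V" "v \<in> V" for u v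
   by (rule Max_ge[OF fin(1)]) (use that in auto)
  ultimately show ?thesis using that by metis
 qed
 have "four_cycle V X * ?n ^ 4 = (\<Sum>u\<in>V. \<Sum>v\<in>V. X u v * I u v)"
  unfolding I_def by (rule four_cycle_expand[OF V(1)])
 also have "... <= (\<Sum>u\<in>V. \<Sum>v\<in>V. \<bar>I z z'\<bar>)"
 proof (intro sum_mono)
  fix u v assume "u \<in> V" "v \<in> V"
  then have "\<bar>X u v\<bar> * \<bar>I u v\<bar> <= 1 * \<bar>I z z'\<bar>" by (intro mult_mono X1 max) auto
  then show "X u v * I u v <= \<bar>I z z'\<bar>" using abs_le_D1[of "X u v * I u v"] by (simp add: abs_mult)
 qed
 also have "... = ?n\<^sup>2 * \<bar>I z z'\<bar>" by (simp add: power2_eq_square)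
 finally have "four_cycle V X * ?n ^ 4 <= ?n\<^sup>2 * \<bar>I z z'\<bar>" .
 moreover have "?n ^ 4 = ?n\<^sup>2 * ?n\<^sup>2" by (simp only: power_add[symmetric]) simp
 ultimately have "?n\<^sup>2 * (four_cycle V X * ?n\<^sup>2) <= ?n\<^sup>2 * \<bar>I z z'\<bar>" by (simp only: mult.left_commute)
 then have c4: "four_cycle V X * ?n\<^sup>2 <= \<bar>I z z'\<bar>" by (rule mult_left_le_imp_le) (use n in simp)
 define L' where "L' u = 4 * L u + (2 * of_bool (A u z) + of_bool (A u z'))" for u
 have small: "2 * of_bool (A u z) + of_bool (A u z') < (4 :: nat)" for u by auto
 have ref: "L' u div 4 = L u" for u unfolding L'_def using small[of u] by simp
 have b0: "odd (L' u) \<longleftrightarrow> A u z'" for u by (simp add: L'_def)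
 have b1: "odd (L' u div 2) \<longleftrightarrow> A u z" for u by (auto simp: L'_def)
 define phi where "phi i j = (of_bool (odd i) - class_avg V G L (i div 4) (L z')) * (of_bool (odd (j div 2)) - class_avg V G L (L z) (j div 4))"
  for i j :: nat
 have phi: "X u z' * X z v = phi (L' u) (L' v)" for u v
  using sym[of z v] by (simp add: phi_def X_def b0 b1 ref G_def)
 have phi1: "(phi (L' u) (L' v))\<^sup>2 <= 1" for u v
 proof -
  have "\<bar>X u z'\<bar> * \<bar>X z v\<bar> <= 1 * 1" by (intro mult_mono X1) auto
  then have "\<bar>phi (L' u) (L' v)\<bar> <= 1" by (simp add: phi[symmetric] abs_mult)
  then show ?thesis by (simp add: abs_square_le_1)
 qed
 let ?d = "%u v. class_avg V G L' (L' u) (L' v) - class_avg V G L (L u) (L v)"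
 have "I z z' = (\<Sum>u\<in>V. \<Sum>v\<in>V. X u v * phi (L' u) (L' v))" unfolding I_def phi by (rule refl)
 also have "... = (\<Sum>u\<in>V. \<Sum>v\<in>V. G u v * phi (L' u) (L' v)) - (\<Sum>u\<in>V. \<Sum>v\<in>V. class_avg V G L (L u) (L v) * phi (L' u) (L' v))"
  by (simp only: X_def left_diff_distrib sum_subtractf)
 also have "... = (\<Sum>u\<in>V. \<Sum>v\<in>V. ?d u v * phi (L' u) (L' v))"
  unfolding class_avg_projection[OF V(1), where L = L' and phi = phi and G = G] by (simp only: left_diff_distrib sum_subtractf)
 finally have "I z z' = (\<Sum>u\<in>V. \<Sum>v\<in>V. ?d u v * phi (L' u) (L' v))" .
 then have "(I z z')\<^sup>2 <= (\<Sum>u\<in>V. \<Sum>v\<in>V. (?d u v)\<^sup>2) * (\<Sum>u\<in>V. \<Sum>v\<in>V. (phi (L' u) (L' v))\<^sup>2)"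
  by (simp only: sum2_Cauchy_Schwarz)
 also have "... <= (\<Sum>u\<in>V. \<Sum>v\<in>V. (?d u v)\<^sup>2) * (\<Sum>u\<in>V. \<Sum>v\<in>V. 1)"
  by (intro mult_left_mono sum_mono phi1 sum_nonneg) auto
 also have "... = ?n\<^sup>2 * (\<Sum>u\<in>V. \<Sum>v\<in>V. (?d u v)\<^sup>2)" by (simp add: power2_eq_square)
 finally have "(I z z')\<^sup>2 <= ?n\<^sup>2 * (\<Sum>u\<in>V. \<Sum>v\<in>V. (?d u v)\<^sup>2)" .
 moreover have "(four_cycle V X * ?n\<^sup>2)\<^sup>2 <= (I z z')\<^sup>2"
  using power_mono[OF c4, of 2] four_cycle_nonneg[of V X] by simp
 moreover have "(four_cycle V X * ?n\<^sup>2)\<^sup>2 = ?n\<^sup>2 * ((four_cycle V X)\<^sup>2 * ?n\<^sup>2)"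
  by (simp only: power2_eq_square mult_ac)
 ultimately have "?n\<^sup>2 * ((four_cycle V X)\<^sup>2 * ?n\<^sup>2) <= ?n\<^sup>2 * (\<Sum>u\<in>V. \<Sum>v\<in>V. (?d u v)\<^sup>2)" by linarith
 then have "(four_cycle V X)\<^sup>2 * ?n\<^sup>2 <= (\<Sum>u\<in>V. \<Sum>v\<in>V. (?d u v)\<^sup>2)" by (rule mult_left_le_imp_le) (use n in simp)
 then show ?thesis unfolding class_avg_energy_diff[OF V(1) ref] X_def by (rule that[OF ref])
qed

text \<open>If the deviation from the step average has many four-cycles, then it correlates with a product of two sets (columns of the graph), and splitting every class into four by those sets raises the mean square of the averages. The mean square is at most \<open>1\<close>, which bounds the sum of the squares of the defects over all levels.\<close>

lemma weak_regularity_labels: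
 fixes A :: "'a => 'a => bool"
 defines "G \<equiv> %u v. of_bool (A u v)"
 assumes V: "finite V" "V ~= {}" and sym: "!!u v. A u v = A v u"
 obtains L :: "nat => 'a => nat" where "!!r u. L (Suc r) u div 4 = L r u" "!!r u. L r u < 4 ^ r"
  "!!R. (\<Sum>r<R. (four_cycle V (%u v. G u v - class_avg V G (L r) (L r u) (L r v)))\<^sup>2) <= 1"
proof -
 define c where "c L = four_cycle V (%u v. G u v - class_avg V G L (L u) (L v))" for L :: "'a => nat"
 define q where "q L = (\<Sum>u\<in>V. \<Sum>v\<in>V. (class_avg V G L (L u) (L v))\<^sup>2)" for L :: "'a => nat"
 have step: "\<exists>L'. (\<forall>u. L' u div 4 = L u) & (c L)\<^sup>2 * (real (card V))\<^sup>2 <= q L' - q L" for L :: "'a => nat"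
 proof -
  show ?thesis
  proof (rule energy_increment[where A = A and L = L, OF V sym])
   fix L' assume ref: "!!u. L' u div 4 = L u" and inc: "(four_cycle V (%u v. of_bool (A u v) - class_avg V (%u v. of_bool (A u v)) L (L u) (L v)))\<^sup>2 * (real (card V))\<^sup>2
    <= (\<Sum>u\<in>V. \<Sum>v\<in>V. (class_avg V (%u v. of_bool (A u v)) L' (L' u) (L' v))\<^sup>2)
     - (\<Sum>u\<in>V. \<Sum>v\<in>V. (class_avg V (%u v. of_bool (A u v)) L (L u) (L v))\<^sup>2)"
   show ?thesis by (intro exI[of _ L'] conjI allI ref) (unfold c_def q_def G_def, rule inc)
  qed
 qed
 define next_label where "next_label L = (SOME L'. (\<forall>u. L' u div 4 = L u) & (c L)\<^sup>2 * (real (card V))\<^sup>2 <= q L' - q L)" for L :: "'a => nat"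
 define L where "L r = (next_label ^^ r) (%_. 0)" for r
 have L: "(\<forall>u. L (Suc r) u div 4 = L r u) & (c (L r))\<^sup>2 * (real (card V))\<^sup>2 <= q (L (Suc r)) - q (L r)" for r
 proof -
  have "L (Suc r) = next_label (L r)" by (simp add: L_def)
  show ?thesis unfolding \<open>L (Suc r) = next_label (L r)\<close> next_label_def by (rule someI_ex[OF step])
 qed
 have lt: "L r u < 4 ^ r" for r u
 proof (induction r)
  case (Suc r)
  then have "L (Suc r) u div 4 < 4 ^ r" using L by metis
  then show ?case by (simp add: div_less_iff_less_mult mult.commute)
 qed (simp add: L_def)
 have "(\<Sum>r<R. (c (L r))\<^sup>2) * (real (card V))\<^sup>2 <= q (L R) - q (L 0)" for R
 proof (induction R)
  case (Suc R) then show ?case using L[of R] by (simp add: distrib_right)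
 qed simp
 moreover have "q M <= (real (card V))\<^sup>2" for M
 proof -
  have "0 <= class_avg V G M i j & class_avg V G M i j <= 1" for i j by (rule class_avg_bounds) (simp add: G_def)
  then have "q M <= (\<Sum>u\<in>V. \<Sum>v\<in>V. 1)" unfolding q_def by (intro sum_mono) (auto intro: power_le_one)
  then show ?thesis by (simp add: power2_eq_square)
 qed
 moreover have "0 <= q M" for M unfolding q_def by (intro sum_nonneg) auto
 ultimately have "(\<Sum>r<R. (c (L r))\<^sup>2) * (real (card V))\<^sup>2 <= 1 * (real (card V))\<^sup>2" for R
 proof -
  note 1 = \<open>!!R. (\<Sum>r<R. (c (L r))\<^sup>2) * (real (card V))\<^sup>2 <= q (L R) - q (L 0)\<close>[of R]
   and 2 = \<open>!!M. q M <= (real (card V))\<^sup>2\<close>[of "L R"] and 3 = \<open>!!M. 0 <= q M\<close>[of "L 0"]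
  show ?thesis unfolding mult_1 using 1 2 3 by linarith
 qed
 then have "(\<Sum>r<R. (c (L r))\<^sup>2) <= 1" for R
  using V by (simp add: card_gt_0_iff)
 then show ?thesis using that[of L] L lt unfolding c_def by blast
qed

text \<open>Two applications of the Cauchy-Schwarz inequality.\<close>

lemma weighted_sum_le_four_cycle:
 fixes Y :: "'a => 'a => real"
 assumes V: "finite V" and s: "!!u. u \<in> V ==> 0 <= s u & s u <= 1" and t: "!!u. u \<in> V ==> 0 <= t u & t u <= 1"
 shows "(\<Sum>u\<in>V. \<Sum>v\<in>V. s u * t v * Y u v) ^ 4 <= real (card V) ^ 8 * four_cycle V Y"
proof (cases "V = {}")
 case False
 let ?n = "real (card V)"
 have n: "?n > 0" using V False by (simp add: card_gt_0_iff)
 define R where "R u = (\<Sum>v\<in>V. t v * Y u v)" for u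
 have "(\<Sum>u\<in>V. \<Sum>v\<in>V. s u * t v * Y u v)\<^sup>2 = (\<Sum>u\<in>V. s u * R u)\<^sup>2" by (simp add: R_def sum_distrib_left mult.assoc)
 also have "... <= (\<Sum>u\<in>V. (s u)\<^sup>2) * (\<Sum>u\<in>V. (R u)\<^sup>2)" by (rule Cauchy_Schwarz_ineq_sum)
 also have "... <= (\<Sum>u\<in>V. 1) * (\<Sum>u\<in>V. (R u)\<^sup>2)"
  by (intro mult_right_mono sum_mono sum_nonneg) (use s in \<open>auto intro: power_le_one\<close>)
 finally have 1: "(\<Sum>u\<in>V. \<Sum>v\<in>V. s u * t v * Y u v)\<^sup>2 <= ?n * (\<Sum>u\<in>V. (R u)\<^sup>2)" by simp
 have "(\<Sum>u\<in>V. (R u)\<^sup>2) = (\<Sum>u\<in>V. \<Sum>v\<in>V. \<Sum>v'\<in>V. (t v * Y u v) * (t v' * Y u v'))"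
  by (simp add: R_def power2_eq_square sum_product)
 also have "... = (\<Sum>v\<in>V. \<Sum>u\<in>V. \<Sum>v'\<in>V. (t v * Y u v) * (t v' * Y u v'))" by (rule sum.swap)
 also have "... = (\<Sum>v\<in>V. \<Sum>v'\<in>V. \<Sum>u\<in>V. (t v * Y u v) * (t v' * Y u v'))" by (intro sum.cong refl sum.swap)
 also have "... = (\<Sum>v\<in>V. \<Sum>v'\<in>V. (t v * t v') * (\<Sum>u\<in>V. Y u v * Y u v'))" by (simp add: sum_distrib_left mult_ac)
 finally have "(\<Sum>u\<in>V. (R u)\<^sup>2)\<^sup>2 = (\<Sum>v\<in>V. \<Sum>v'\<in>V. (t v * t v') * (\<Sum>u\<in>V. Y u v * Y u v'))\<^sup>2" by simp
 also have "... <= (\<Sum>v\<in>V. \<Sum>v'\<in>V. (t v * t v')\<^sup>2) * (\<Sum>v\<in>V. \<Sum>v'\<in>V. (\<Sum>u\<in>V. Y u v * Y u v')\<^sup>2)" by (rule sum2_Cauchy_Schwarz)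
 also have "... <= (\<Sum>v\<in>V. \<Sum>v'\<in>V. 1) * (\<Sum>v\<in>V. \<Sum>v'\<in>V. (\<Sum>u\<in>V. Y u v * Y u v')\<^sup>2)"
  by (intro mult_right_mono sum_mono sum_nonneg) (use t in \<open>auto intro!: power_le_one mult_le_one\<close>)
 also have "... = ?n\<^sup>2 * (?n ^ 4 * four_cycle V Y)" using n by (simp add: four_cycle_def power2_eq_square)
 finally have 2: "(\<Sum>u\<in>V. (R u)\<^sup>2)\<^sup>2 <= ?n\<^sup>2 * (?n ^ 4 * four_cycle V Y)" .
 have "(\<Sum>u\<in>V. \<Sum>v\<in>V. s u * t v * Y u v) ^ 4 = ((\<Sum>u\<in>V. \<Sum>v\<in>V. s u * t v * Y u v)\<^sup>2)\<^sup>2" by simp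
 also have "... <= (?n * (\<Sum>u\<in>V. (R u)\<^sup>2))\<^sup>2" by (rule power_mono[OF 1]) simp
 also have "... = ?n\<^sup>2 * (\<Sum>u\<in>V. (R u)\<^sup>2)\<^sup>2" by (simp add: power_mult_distrib)
 also have "... <= ?n\<^sup>2 * (?n\<^sup>2 * (?n ^ 4 * four_cycle V Y))" by (rule mult_left_mono[OF 2]) simp
 also have "... = ?n ^ 8 * four_cycle V Y" by (simp add: power_add[symmetric] mult.assoc[symmetric])
 finally show ?thesis .
qed (simp add: four_cycle_def)

lemma sum_tuples_4:
 "(\<Sum>xs\<in>tuples V 4. g xs) = (\<Sum>a\<in>V. \<Sum>b\<in>V. \<Sum>c\<in>V. \<Sum>d\<in>V. g [a, b, c, d])"
 by (simp add: numeral_eq_Suc sum_tuples_Suc tuples_0)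

lemma four_cycle_tuple_avg:
 "four_cycle V X = tuple_avg V 4 (%xs. X (xs ! 2) (xs ! 0) * X (xs ! 2) (xs ! 1) * (X (xs ! 3) (xs ! 0) * X (xs ! 3) (xs ! 1)))"
 unfolding four_cycle_def tuple_avg_def sum_tuples_4 by (simp add: power2_eq_square sum_product)

section \<open>Limits of nested averages and dyadic densities\<close>

context prob_space
begin

lemma abs_integral_le_sqrt:
 fixes d :: "'a => real"
 assumes d: "d \<in> borel_measurable M" "!!x. \<bar>d x\<bar> <= 1"
 shows "(\<integral>x. \<bar>d x\<bar> \<partial>M) <= sqrt (\<integral>x. (d x)\<^sup>2 \<partial>M)"
proof -
 define m where "m = (\<integral>x. \<bar>d x\<bar> \<partial>M)"
 have i1: "integrable M (%x. \<bar>d x\<bar>)" by (rule integrable_const_bound[of _ 1]) (use d in auto)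
 have i2: "integrable M (%x. (d x)\<^sup>2)"
  by (rule integrable_const_bound[of _ 1]) (use d in \<open>auto simp: abs_square_le_1\<close>)
 have "0 <= (\<integral>x. (\<bar>d x\<bar> - m)\<^sup>2 \<partial>M)" by (rule integral_nonneg_AE) simp
 also have "(\<integral>x. (\<bar>d x\<bar> - m)\<^sup>2 \<partial>M) = (\<integral>x. ((d x)\<^sup>2 - 2 * m * \<bar>d x\<bar>) + m\<^sup>2 \<partial>M)"
  by (intro Bochner_Integration.integral_cong refl) (simp add: power2_diff)
 also have "... = (\<integral>x. (d x)\<^sup>2 \<partial>M) - 2 * m * m + m\<^sup>2"
  using i1 i2 by (simp add: prob_space m_def)
 finally have "m\<^sup>2 <= (\<integral>x. (d x)\<^sup>2 \<partial>M)" by (simp add: power2_eq_square)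
 then show ?thesis unfolding m_def by (rule real_le_rsqrt)
qed

text \<open>The norms increase by orthogonality and are bounded, so the sequence is Cauchy in mean square; a rapidly convergent subsequence supplies a limit defined everywhere.\<close>

lemma nested_averages_converge:
 fixes h :: "nat => 'a => real"
 assumes hm: "!!r. h r \<in> borel_measurable M" and h01: "!!r x. 0 <= h r x & h r x <= 1"
  and proj: "!!r s. r <= s ==> (\<integral>x. h r x * h s x \<partial>M) = (\<integral>x. (h r x)\<^sup>2 \<partial>M)"
 obtains g where "g \<in> borel_measurable M" "!!x. 0 <= g x & g x <= 1" "(%r. \<integral>x. \<bar>h r x - g x\<bar> \<partial>M) \<longlonglongrightarrow> 0"
proof -
 define e where "e r = (\<integral>x. (h r x)\<^sup>2 \<partial>M)" for r
 have i2: "integrable M (%x. h r x * h s x)" for r s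
 proof (rule integrable_const_bound[of _ 1])
  have "h r x * h s x <= 1" "0 <= h r x * h s x" for x using h01[of r x] h01[of s x] by (auto intro: mult_le_one)
  then show "AE x in M. norm (h r x * h s x) <= 1" by simp
 qed (use hm in simp)
 have i2': "integrable M (%x. (h r x)\<^sup>2)" for r using i2[of r r] by (simp add: power2_eq_square)
 have d1: "\<bar>h s x - h r x\<bar> <= 1" for s r x using h01[of s x] h01[of r x] by linarith
 have sq: "(\<integral>x. (h s x - h r x)\<^sup>2 \<partial>M) = e s - e r" if "r <= s" for r s
 proof -
  have "(\<integral>x. (h s x - h r x)\<^sup>2 \<partial>M) = (\<integral>x. ((h s x)\<^sup>2 + (h r x)\<^sup>2) - 2 * (h r x * h s x) \<partial>M)"
   by (intro Bochner_Integration.integral_cong refl) (simp add: power2_diff mult.commute)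
  also have "... = e s + e r - 2 * (\<integral>x. h r x * h s x \<partial>M)"
   using i2[of r s] i2'[of r] i2'[of s] by (simp add: e_def)
  finally show ?thesis using proj[OF that] by (simp add: e_def)
 qed
 have l1: "(\<integral>x. \<bar>h s x - h r x\<bar> \<partial>M) <= sqrt (e s - e r)" if "r <= s" for r s
  using abs_integral_le_sqrt[of "%x. h s x - h r x"] hm d1 sq[OF that] by simp
 have inc: "e r <= e s" if "r <= s" for r s
 proof -
  have "0 <= (\<integral>x. (h s x - h r x)\<^sup>2 \<partial>M)" by (rule integral_nonneg_AE) simp
  then show ?thesis using sq[OF that] by simp
 qed
 have e1: "e r <= 1" for r
 proof -
  have "e r <= (\<integral>x. 1 \<partial>M)" unfolding e_def
   by (rule integral_mono[OF i2']) (use h01 in \<open>auto intro: power_le_one\<close>)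
  then show ?thesis by (simp add: prob_space)
 qed
 have "incseq e" using inc by (simp add: incseq_def)
 then obtain E where E: "e \<longlonglongrightarrow> E" "!!r. e r <= E" using incseq_convergent[of e 1] e1 by blast
 have "\<exists>R. \<forall>r\<ge>R. E - e r <= (1/4) ^ j" for j :: nat
 proof -
  have "\<forall>\<^sub>F r in sequentially. E - (1/4) ^ j < e r" using E(1) by (intro order_tendstoD(1)[of e E]) auto
  then obtain N where "!!n. N <= n ==> E - (1/4) ^ j < e n" unfolding eventually_sequentially by blast
  then have "E - e n <= (1/4) ^ j" if "N <= n" for n
   using \<open>!!n. N <= n ==> E - (1/4) ^ j < e n\<close>[OF that] by linarith
  then show ?thesis by blast
 qed
 then obtain R where R: "!!j r. R j <= r ==> E - e r <= (1/4) ^ j" by metis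
 define \<rho> where "\<rho> j = (\<Sum>i\<le>j. R i)" for j
 have \<rho>: "R j <= \<rho> j" "\<rho> j <= \<rho> (Suc j)" for j
  unfolding \<rho>_def by (auto intro: member_le_sum)
 have small: "(\<integral>x. \<bar>h (\<rho> (Suc j)) x - h (\<rho> j) x\<bar> \<partial>M) <= (1/2) ^ j" for j
 proof -
  have "(\<integral>x. \<bar>h (\<rho> (Suc j)) x - h (\<rho> j) x\<bar> \<partial>M) <= sqrt (e (\<rho> (Suc j)) - e (\<rho> j))" by (rule l1[OF \<rho>(2)])
  also have "... <= sqrt ((1/4) ^ j)" using R[OF \<rho>(1), of j] E(2)[of "\<rho> (Suc j)"] by (intro real_sqrt_le_mono) linarith
  also have "... = (1/2) ^ j" by (simp add: real_sqrt_power real_sqrt_divide)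
  finally show ?thesis .
 qed
 define D where "D j x = \<bar>h (\<rho> (Suc j)) x - h (\<rho> j) x\<bar>" for j x
 have Dm: "D j \<in> borel_measurable M" for j unfolding D_def using hm by simp
 have Di: "integrable M (D j)" for j
  by (rule integrable_const_bound[of _ 1]) (use d1 Dm in \<open>auto simp: D_def\<close>)
 have "(\<integral>\<^sup>+x. (\<Sum>j. ennreal (D j x)) \<partial>M) = (\<Sum>j. \<integral>\<^sup>+x. ennreal (D j x) \<partial>M)"
  by (rule nn_integral_suminf) (use Dm in simp)
 also have "... <= (\<Sum>j. ennreal ((1/2) ^ j))"
 proof (intro suminf_le)
  fix j
  have "(\<integral>\<^sup>+x. ennreal (D j x) \<partial>M) = ennreal (integral\<^sup>L M (D j))"
   by (rule nn_integral_eq_integral[OF Di]) (simp add: D_def)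
  also have "... <= ennreal ((1/2) ^ j)" using small[of j] unfolding D_def by (rule ennreal_leI)
  finally show "(\<integral>\<^sup>+x. ennreal (D j x) \<partial>M) <= ennreal ((1/2) ^ j)" .
 qed auto
 also have "... = ennreal (\<Sum>j. (1/2) ^ j)" by (rule suminf_ennreal2) (auto simp: summable_geometric)
 also have "... < \<infinity>" by simp
 finally have "(\<integral>\<^sup>+x. (\<Sum>j. ennreal (D j x)) \<partial>M) ~= \<infinity>" by simp
 then have "AE x in M. (\<Sum>j. ennreal (D j x)) ~= \<infinity>"
  by (intro nn_integral_PInf_AE) (use Dm in auto)
 then have aes: "AE x in M. convergent (%j. h (\<rho> j) x)"
 proof eventually_elim
  case (elim x)
  have "summable (%j. D j x)" by (rule summable_suminf_not_top) (use elim in \<open>auto simp: D_def\<close>)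
  then have "summable (%j. h (\<rho> (Suc j)) x - h (\<rho> j) x)" unfolding D_def by (rule summable_rabs_cancel)
  then have "convergent (%n. \<Sum>j<n. h (\<rho> (Suc j)) x - h (\<rho> j) x)" by (simp add: summable_iff_convergent)
  moreover have "(%n. \<Sum>j<n. h (\<rho> (Suc j)) x - h (\<rho> j) x) = (%n. h (\<rho> n) x - h (\<rho> 0) x)"
   by (rule ext) (rule sum_lessThan_telescope)
  ultimately have "convergent (%n. h (\<rho> n) x - h (\<rho> 0) x)" by simp
  then have "convergent (%n. (h (\<rho> n) x - h (\<rho> 0) x) + h (\<rho> 0) x)" by (intro convergent_add convergent_const)
  then show ?case by simp
 qed
 define g where "g x = max 0 (min 1 (lim (%j. h (\<rho> j) x)))" for x
 have gm: "g \<in> borel_measurable M"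
  unfolding g_def by (intro borel_measurable_max borel_measurable_min borel_measurable_const borel_measurable_lim_metric hm)
 have g01: "0 <= g x & g x <= 1" for x by (simp add: g_def)
 have aeg: "AE x in M. (%j. h (\<rho> j) x) \<longlonglongrightarrow> g x"
  using aes
 proof eventually_elim
  case (elim x)
  then have l: "(%j. h (\<rho> j) x) \<longlonglongrightarrow> lim (%j. h (\<rho> j) x)" by (simp add: convergent_LIMSEQ_iff)
  have "0 <= lim (%j. h (\<rho> j) x)" "lim (%j. h (\<rho> j) x) <= 1"
   using h01 LIMSEQ_le_const[OF l, of 0] LIMSEQ_le_const2[OF l, of 1] by blast+
  then show ?case using l by (simp add: g_def)
 qed
 have hg1: "\<bar>h r x - g x\<bar> <= 1" for r x using h01[of r x] g01[of x] by linarith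
 have ihg: "integrable M (%x. \<bar>h r x - g x\<bar>)" for r
  by (rule integrable_const_bound[of _ 1]) (use hg1 hm gm in auto)
 have sub: "(%j. \<integral>x. \<bar>h (\<rho> j) x - g x\<bar> \<partial>M) \<longlonglongrightarrow> (\<integral>x. 0 \<partial>M)"
 proof (rule integral_dominated_convergence[where w = "%_. 1"])
  show "AE x in M. (%j. \<bar>h (\<rho> j) x - g x\<bar>) \<longlonglongrightarrow> 0"
   using aeg by eventually_elim (simp add: LIM_zero tendsto_rabs_zero)
 qed (use hm gm hg1 in auto)
 have "(%r. \<integral>x. \<bar>h r x - g x\<bar> \<partial>M) \<longlonglongrightarrow> 0"
 proof (rule LIMSEQ_I)
  fix eps :: real assume eps: "0 < eps"
  obtain j0 where "(1/4 :: real) ^ j0 < (eps/2)\<^sup>2" using real_arch_pow_inv[of "(eps/2)\<^sup>2" "1/4"] eps by auto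
  obtain J where J: "!!j. J <= j ==> (\<integral>x. \<bar>h (\<rho> j) x - g x\<bar> \<partial>M) < eps / 2"
  proof -
   have "\<forall>\<^sub>F j in sequentially. (\<integral>x. \<bar>h (\<rho> j) x - g x\<bar> \<partial>M) < eps / 2"
    using sub eps by (intro order_tendstoD(2)[where y = "\<integral>x. 0 \<partial>M"]) auto
   then show ?thesis using that by (auto simp: eventually_sequentially)
  qed
  define j where "j = max J j0"
  have mono\<rho>: "R j0 <= \<rho> j"
  proof -
   have "\<rho> j0 <= \<rho> j" by (rule lift_Suc_mono_le[of \<rho>, OF \<rho>(2)]) (simp add: j_def)
   then show ?thesis using \<rho>(1)[of j0] by linarith
  qed
  show "\<exists>R0. \<forall>r\<ge>R0. norm ((\<integral>x. \<bar>h r x - g x\<bar> \<partial>M) - 0) < eps"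
  proof (intro exI[of _ "\<rho> j"] allI impI)
   fix r assume r: "\<rho> j <= r"
   have "(\<integral>x. \<bar>h r x - g x\<bar> \<partial>M) <= (\<integral>x. \<bar>h r x - h (\<rho> j) x\<bar> + \<bar>h (\<rho> j) x - g x\<bar> \<partial>M)"
   proof (rule integral_mono[OF ihg])
    show "integrable M (%x. \<bar>h r x - h (\<rho> j) x\<bar> + \<bar>h (\<rho> j) x - g x\<bar>)"
     by (intro Bochner_Integration.integrable_add ihg integrable_const_bound[of _ 1]) (use d1 hm in auto)
   qed linarith
   also have "... = (\<integral>x. \<bar>h r x - h (\<rho> j) x\<bar> \<partial>M) + (\<integral>x. \<bar>h (\<rho> j) x - g x\<bar> \<partial>M)"
    by (intro Bochner_Integration.integral_add ihg integrable_const_bound[of _ 1]) (use d1 hm in auto)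
   also have "... < sqrt (e r - e (\<rho> j)) + eps / 2" using l1[OF r] J[of j] by (simp add: j_def add_le_less_mono)
   also have "sqrt (e r - e (\<rho> j)) <= eps / 2"
   proof (rule real_le_lsqrt)
    show "e r - e (\<rho> j) <= (eps / 2)\<^sup>2" using R[OF mono\<rho>] E(2)[of r] \<open>(1/4 :: real) ^ j0 < (eps/2)\<^sup>2\<close> by linarith
   qed (use eps in simp)
   finally have "(\<integral>x. \<bar>h r x - g x\<bar> \<partial>M) < eps" by simp
   moreover have "0 <= (\<integral>x. \<bar>h r x - g x\<bar> \<partial>M)" by (rule integral_nonneg_AE) simp
   ultimately show "norm ((\<integral>x. \<bar>h r x - g x\<bar> \<partial>M) - 0) < eps" by simp
  qed
 qed
 with gm g01 that show ?thesis by blast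
qed

lemma AE_le_of_L1_limits:
 fixes a b :: "nat => 'a => real"
 assumes m: "!!r. a r \<in> borel_measurable M" "!!r. b r \<in> borel_measurable M" "f \<in> borel_measurable M" "g \<in> borel_measurable M"
  and bd: "!!r x. \<bar>a r x - f x\<bar> <= 1" "!!r x. \<bar>b r x - g x\<bar> <= 1"
  and le: "!!r x. x \<in> space M ==> a r x <= b r x"
  and lim: "(%r. \<integral>x. \<bar>a r x - f x\<bar> \<partial>M) \<longlonglongrightarrow> 0" "(%r. \<integral>x. \<bar>b r x - g x\<bar> \<partial>M) \<longlonglongrightarrow> 0"
 shows "AE x in M. f x <= g x"
proof -
 have ia: "integrable M (%x. \<bar>a r x - f x\<bar>)" and ib: "integrable M (%x. \<bar>b r x - g x\<bar>)" for r
  by (rule integrable_const_bound[of _ 1]; use m bd in auto)+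
 have pt: "max 0 (f x - g x) <= \<bar>a r x - f x\<bar> + \<bar>b r x - g x\<bar>" if "x \<in> space M" for r x
  using le[OF that, of r] by linarith
 have ifg: "integrable M (%x. max 0 (f x - g x))"
 proof (rule Bochner_Integration.integrable_bound[OF Bochner_Integration.integrable_add[OF ia[of 0] ib[of 0]]])
  show "(%x. max 0 (f x - g x)) \<in> borel_measurable M" using m by simp
  show "AE x in M. norm (max 0 (f x - g x)) <= norm (\<bar>a 0 x - f x\<bar> + \<bar>b 0 x - g x\<bar>)"
   by (rule AE_I2) (use pt[of _ 0] in fastforce)
 qed
 have "(\<integral>x. max 0 (f x - g x) \<partial>M) <= (\<integral>x. \<bar>a r x - f x\<bar> \<partial>M) + (\<integral>x. \<bar>b r x - g x\<bar> \<partial>M)" for r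
  unfolding Bochner_Integration.integral_add[OF ia ib, symmetric]
  by (intro integral_mono ifg Bochner_Integration.integrable_add ia ib pt)
 then have "(\<integral>x. max 0 (f x - g x) \<partial>M) <= 0"
  using LIMSEQ_le_const[OF tendsto_add[OF lim]] by fastforce
 moreover have "0 <= (\<integral>x. max 0 (f x - g x) \<partial>M)" by (rule integral_nonneg_AE) simp
 ultimately have "(\<integral>x. max 0 (f x - g x) \<partial>M) = 0" by linarith
 then have "AE x in M. max 0 (f x - g x) = 0"
  by (subst (asm) integral_nonneg_eq_0_iff_AE[OF ifg]) auto
 then show ?thesis by eventually_elim (simp add: max_def split: if_splits)
qed

end

abbreviation unit_interval :: "real measure" where "unit_interval \<equiv> restrict_space lborel {0..<1}"

interpretation unit_interval: prob_space unit_interval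
 by (rule prob_spaceI) (simp add: emeasure_restrict_space)

lemma measure_unit_interval:
 assumes "0 <= a" "a <= b" "b <= 1"
 shows "{x \<in> space unit_interval. a <= x & x < b} \<in> sets unit_interval"
  "measure unit_interval {x \<in> space unit_interval. a <= x & x < b} = b - a"
proof -
 have eq: "{x \<in> space unit_interval. a <= x & x < b} = {a..<b}" using assms by (auto simp: space_restrict_space)
 show "{x \<in> space unit_interval. a <= x & x < b} \<in> sets unit_interval"
  unfolding eq using assms by (subst sets_restrict_space_iff) auto
 show "measure unit_interval {x \<in> space unit_interval. a <= x & x < b} = b - a"
  unfolding eq using assms by (subst measure_restrict_space) auto
qed

lemma nat_floor_eq_iff:
 assumes "0 < n" "0 <= x"
 shows "nat \<lfloor>real n * x\<rfloor> = p \<longleftrightarrow> real p / real n <= x & x < (real p + 1) / real n"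
proof -
 have "0 <= \<lfloor>real n * x\<rfloor>" using assms by simp
 then have "nat \<lfloor>real n * x\<rfloor> = p \<longleftrightarrow> \<lfloor>real n * x\<rfloor> = int p" by auto
 also have "... \<longleftrightarrow> real p <= real n * x & real n * x < real p + 1" by (simp add: floor_eq_iff)
 also have "... \<longleftrightarrow> real p / real n <= x & x < (real p + 1) / real n" using assms by (auto simp: field_simps)
 finally show ?thesis .
qed

lemma nat_floor_less:
 assumes "0 < n" "0 <= x" "x < 1"
 shows "nat \<lfloor>real n * x\<rfloor> < n"
proof -
 have "real n * x < real n" using assms by simp
 then have "\<lfloor>real n * x\<rfloor> < int n" by (simp add: floor_less_iff)
 then show ?thesis using assms by linarith
qed

lemma nat_floor_measurable: "(%x. nat \<lfloor>real n * x\<rfloor>) \<in> measurable unit_interval (count_space UNIV)"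
 by (rule measurable_restrict_space1) measurable

lemma integral_step_function:
 fixes f :: "nat => real"
 assumes n: "0 < n"
 shows "(\<integral>x. f (nat \<lfloor>real n * x\<rfloor>) \<partial>unit_interval) = (\<Sum>p<n. f p) / real n"
proof -
 let ?I = "%p. {x \<in> space unit_interval. real p / real n <= x & x < (real p + 1) / real n}"
 have I: "?I p \<in> sets unit_interval" "measure unit_interval (?I p) = 1 / real n" if "p < n" for p
 proof -
  have b: "0 <= real p / real n" "real p / real n <= (real p + 1) / real n" "(real p + 1) / real n <= 1"
   using that by (auto simp: divide_right_mono field_simps)
  show "?I p \<in> sets unit_interval" "measure unit_interval (?I p) = 1 / real n"
   using measure_unit_interval[OF b] by (simp_all add: diff_divide_distrib[symmetric])
 qed
 have "(\<integral>x. f (nat \<lfloor>real n * x\<rfloor>) \<partial>unit_interval) = (\<integral>x. (\<Sum>p<n. f p * indicator (?I p) x) \<partial>unit_interval)"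
 proof (rule Bochner_Integration.integral_cong[OF refl])
  fix x assume x: "x \<in> space unit_interval"
  then have x01: "0 <= x" "x < 1" by (auto simp: space_restrict_space)
  have "(\<Sum>p<n. f p * indicator (?I p) x) = (\<Sum>p<n. if p = nat \<lfloor>real n * x\<rfloor> then f p else 0)"
  proof (intro sum.cong refl)
   fix p
   show "f p * indicator (?I p) x = (if p = nat \<lfloor>real n * x\<rfloor> then f p else 0)"
   proof (cases "p = nat \<lfloor>real n * x\<rfloor>")
    case True
    then have "x \<in> ?I p" using nat_floor_eq_iff[OF n x01(1), of p] x by blast
    then show ?thesis unfolding if_P[OF True] by (simp only: indicator_simps mult_1_right)
   next
    case False
    then have "x \<notin> ?I p" using nat_floor_eq_iff[OF n x01(1), of p] by blast
    then have "indicator (?I p) x = (0 :: real)" by (rule indicator_simps(2))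
    then show ?thesis unfolding if_not_P[OF False] by (simp only: mult_zero_right)
   qed
  qed
  also have "... = f (nat \<lfloor>real n * x\<rfloor>)" using nat_floor_less[OF n x01] by simp
  finally show "f (nat \<lfloor>real n * x\<rfloor>) = (\<Sum>p<n. f p * indicator (?I p) x)" ..
 qed
 also have "... = (\<Sum>p<n. \<integral>x. f p * indicator (?I p) x \<partial>unit_interval)"
  by (rule Bochner_Integration.integral_sum)
   (use I in \<open>auto intro!: integrable_mult_right unit_interval.integrable_const_bound[of _ 1]\<close>)
 also have "... = (\<Sum>p<n. f p * (1 / real n))"
 proof (intro sum.cong refl)
  fix p assume "p \<in> {..<n}"
  then have p: "p < n" by simp
  have "integral\<^sup>L unit_interval (indicator (?I p)) = measure unit_interval (?I p \<inter> space unit_interval)"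
   by (rule Bochner_Integration.integral_indicator)
  also have "?I p \<inter> space unit_interval = ?I p" by blast
  finally show "(\<integral>x. f p * indicator (?I p) x \<partial>unit_interval) = f p * (1 / real n)" using I(2)[OF p] by simp
 qed
 finally show ?thesis by (simp add: sum_divide_distrib)
qed

definition dyadic_quotient :: "(real => real) => nat => nat => real" where
 "dyadic_quotient F q p = 2 ^ q * (F (real (Suc p) / 2 ^ q) - F (real p / 2 ^ q))"

definition dyadic_slope :: "(real => real) => nat => real => real" where
 "dyadic_slope F q x = dyadic_quotient F q (nat \<lfloor>real (2 ^ q) * x\<rfloor>)"

text \<open>Only values at dyadic points matter, which are the points where limits of cumulative counts are known to exist.\<close>

definition dyadic_contraction :: "(real => real) => bool" where
 "dyadic_contraction F \<longleftrightarrow> F 0 = 0 & (\<forall>q p. p < 2 ^ q \<longrightarrow> 0 <= dyadic_quotient F q p & dyadic_quotient F q p <= 1)"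

lemma sum_dyadic_quotient_block:
 assumes "q <= s"
 shows "(\<Sum>t\<in>{p * 2 ^ (s - q)..<p * 2 ^ (s - q) + 2 ^ (s - q)}. dyadic_quotient F s t) / 2 ^ s = dyadic_quotient F q p / 2 ^ q"
proof -
 let ?m = "2 ^ (s - q) :: nat"
 have pw: "(2 :: real) ^ s = 2 ^ q * real ?m" using assms by (simp add: power_add[symmetric])
 have "(\<Sum>t\<in>{p * ?m..<p * ?m + ?m}. dyadic_quotient F s t) / 2 ^ s = (\<Sum>t\<in>{p * ?m..<p * ?m + ?m}. F (real (Suc t) / 2 ^ s) - F (real t / 2 ^ s))"
  unfolding dyadic_quotient_def sum_distrib_left[symmetric] by simp
 also have "... = F (real (p * ?m + ?m) / 2 ^ s) - F (real (p * ?m) / 2 ^ s)"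
  by (rule sum_Suc_diff') simp
 also have "real (p * ?m + ?m) / 2 ^ s = real (Suc p) / 2 ^ q" by (simp add: pw field_simps)
 also have "real (p * ?m) / 2 ^ s = real p / 2 ^ q" by (simp add: pw field_simps)
 finally show ?thesis by (simp add: dyadic_quotient_def)
qed

lemma nat_floor_refine:
 assumes "q <= s" "0 <= x"
 shows "nat \<lfloor>real (2 ^ q) * x\<rfloor> = nat \<lfloor>real (2 ^ s) * x\<rfloor> div 2 ^ (s - q)"
proof -
 have pw: "real (2 ^ s) = real (2 ^ q) * real (2 ^ (s - q))" using assms(1) by (simp add: power_add[symmetric])
 have e: "real (2 ^ q) * x = real (2 ^ s) * x / real_of_int (2 ^ (s - q))" unfolding pw by simp
 have "\<lfloor>real (2 ^ q) * x\<rfloor> = \<lfloor>real (2 ^ s) * x\<rfloor> div 2 ^ (s - q)"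
  unfolding e by (rule floor_divide_real_eq_div) simp
 then show ?thesis using assms(2) by (simp add: nat_div_distrib nat_power_eq)
qed

lemma sum_dyadic_refine:
 fixes f :: "nat => real"
 assumes "q <= s"
 shows "(\<Sum>t<2 ^ s. f (t div 2 ^ (s - q)) * dyadic_quotient F s t) / 2 ^ s = (\<Sum>p<2 ^ q. f p * dyadic_quotient F q p) / 2 ^ q"
proof -
 let ?m = "2 ^ (s - q) :: nat"
 have ms: "(2 :: nat) ^ q * ?m = 2 ^ s" using assms by (simp add: power_add[symmetric])
 have "(\<Sum>t<2 ^ s. f (t div ?m) * dyadic_quotient F s t) = (\<Sum>p<2 ^ q. \<Sum>t\<in>{p * ?m..<p * ?m + ?m}. f (t div ?m) * dyadic_quotient F s t)"
  using sum.nat_group[of "%t. f (t div ?m) * dyadic_quotient F s t" ?m "2 ^ q"] by (simp add: ms)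
 also have "... = (\<Sum>p<2 ^ q. f p * (\<Sum>t\<in>{p * ?m..<p * ?m + ?m}. dyadic_quotient F s t))"
  unfolding sum_distrib_left
 proof (intro sum.cong refl)
  fix p t assume "t \<in> {p * ?m..<p * ?m + ?m}"
  then have "t div ?m = p" by (intro div_nat_eqI) (auto simp: mult.commute)
  then show "f (t div ?m) * dyadic_quotient F s t = f p * dyadic_quotient F s t" by simp
 qed
 finally have "(\<Sum>t<2 ^ s. f (t div ?m) * dyadic_quotient F s t) / 2 ^ s
   = (\<Sum>p<2 ^ q. f p * ((\<Sum>t\<in>{p * ?m..<p * ?m + ?m}. dyadic_quotient F s t) / 2 ^ s))"
  by (simp only:) (subst sum_divide_distrib, simp only: times_divide_eq_right)
 then show ?thesis unfolding sum_dyadic_quotient_block[OF assms] by (simp add: sum_divide_distrib)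
qed

lemma dyadic_slope_integral:
 fixes f :: "nat => real"
 assumes "q <= s"
 shows "(\<integral>x. f (nat \<lfloor>real (2 ^ q) * x\<rfloor>) * dyadic_slope F s x \<partial>unit_interval) = (\<Sum>p<2 ^ q. f p * dyadic_quotient F q p) / 2 ^ q"
proof -
 have "(\<integral>x. f (nat \<lfloor>real (2 ^ q) * x\<rfloor>) * dyadic_slope F s x \<partial>unit_interval)
   = (\<integral>x. (%t. f (t div 2 ^ (s - q)) * dyadic_quotient F s t) (nat \<lfloor>real (2 ^ s) * x\<rfloor>) \<partial>unit_interval)"
 proof (rule Bochner_Integration.integral_cong[OF refl])
  fix x assume "x \<in> space unit_interval"
  then have "0 <= x" by (simp add: space_restrict_space)
  from nat_floor_refine[OF assms this] show "f (nat \<lfloor>real (2 ^ q) * x\<rfloor>) * dyadic_slope F s x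
   = f (nat \<lfloor>real (2 ^ s) * x\<rfloor> div 2 ^ (s - q)) * dyadic_quotient F s (nat \<lfloor>real (2 ^ s) * x\<rfloor>)"
   by (simp only: dyadic_slope_def)
 qed
 also have "... = (\<Sum>t<2 ^ s. f (t div 2 ^ (s - q)) * dyadic_quotient F s t) / real (2 ^ s)"
  by (rule integral_step_function) simp
 finally show ?thesis using sum_dyadic_refine[OF assms, of f F] by simp
qed

lemma dyadic_slope_bounds:
 assumes "dyadic_contraction F" "x \<in> space unit_interval"
 shows "0 <= dyadic_slope F q x & dyadic_slope F q x <= 1"
proof -
 have "nat \<lfloor>real (2 ^ q) * x\<rfloor> < 2 ^ q" by (rule nat_floor_less) (use assms(2) in \<open>auto simp: space_restrict_space\<close>)
 then show ?thesis using assms(1) by (simp add: dyadic_slope_def dyadic_contraction_def)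
qed

lemma dyadic_slope_measurable: "dyadic_slope F q \<in> borel_measurable unit_interval"
 unfolding dyadic_slope_def by (rule measurable_compose[OF nat_floor_measurable]) simp

definition is_dyadic_density :: "(real => real) => (real => real) => bool" where
 "is_dyadic_density F h \<longleftrightarrow> h \<in> borel_measurable borel & (\<forall>x. 0 <= h x & h x <= 1) &
   (%q. \<integral>x. \<bar>dyadic_slope F q x - h x\<bar> \<partial>unit_interval) \<longlonglongrightarrow> 0"

text \<open>The difference quotients on dyadic intervals form a martingale, that is, they are nested averages.\<close>

lemma dyadic_density_exists:
 assumes F: "dyadic_contraction F"
 shows "\<exists>h. is_dyadic_density F h"
proof -
 define s where "s q x = max 0 (min 1 (dyadic_slope F q x))" for q x
 have sm: "s q \<in> borel_measurable unit_interval" for q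
  unfolding s_def by (intro borel_measurable_max borel_measurable_min borel_measurable_const dyadic_slope_measurable)
 have s: "s q x = dyadic_slope F q x" if "x \<in> space unit_interval" for q x
  using dyadic_slope_bounds[OF F that, of q] by (simp add: s_def)
 have proj: "(\<integral>x. s q x * s t x \<partial>unit_interval) = (\<integral>x. (s q x)\<^sup>2 \<partial>unit_interval)" if "q <= t" for q t
 proof -
  have "(\<integral>x. s q x * s t x \<partial>unit_interval) = (\<integral>x. dyadic_quotient F q (nat \<lfloor>real (2 ^ q) * x\<rfloor>) * dyadic_slope F t x \<partial>unit_interval)"
  proof (rule Bochner_Integration.integral_cong[OF refl])
   fix x assume "x \<in> space unit_interval"
   show "s q x * s t x = dyadic_quotient F q (nat \<lfloor>real (2 ^ q) * x\<rfloor>) * dyadic_slope F t x"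
    unfolding s[OF \<open>x \<in> space unit_interval\<close>] dyadic_slope_def by (rule refl)
  qed
  also have "... = (\<Sum>p<2 ^ q. dyadic_quotient F q p * dyadic_quotient F q p) / 2 ^ q"
   by (rule dyadic_slope_integral[OF that])
  also have "... = (\<integral>x. dyadic_quotient F q (nat \<lfloor>real (2 ^ q) * x\<rfloor>) * dyadic_slope F q x \<partial>unit_interval)"
   by (rule dyadic_slope_integral[OF order_refl, symmetric])
  also have "... = (\<integral>x. (s q x)\<^sup>2 \<partial>unit_interval)"
  proof (rule Bochner_Integration.integral_cong[OF refl])
   fix x assume "x \<in> space unit_interval"
   show "dyadic_quotient F q (nat \<lfloor>real (2 ^ q) * x\<rfloor>) * dyadic_slope F q x = (s q x)\<^sup>2"
    unfolding s[OF \<open>x \<in> space unit_interval\<close>] dyadic_slope_def power2_eq_square by (rule refl)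
  qed
  finally show ?thesis .
 qed
 have s01: "0 <= s q x & s q x <= 1" for q x by (simp add: s_def)
 obtain g where g: "g \<in> borel_measurable unit_interval" "!!x. 0 <= g x & g x <= 1"
  and lim: "(%q. \<integral>x. \<bar>s q x - g x\<bar> \<partial>unit_interval) \<longlonglongrightarrow> 0"
  by (rule unit_interval.nested_averages_converge[where h = s], rule sm, rule s01, erule proj, rule that)
 define h where "h x = indicator {0..<1} x * g x" for x
 have "(%x. indicator {0..<1} x *\<^sub>R g x) \<in> borel_measurable lborel"
  by (rule borel_measurable_restrict_space_iff[THEN iffD1, OF _ g(1)]) simp
 then have "h \<in> borel_measurable borel" by (simp add: h_def[abs_def])
 moreover have "0 <= h x & h x <= 1" for x using g(2)[of x] by (simp add: h_def indicator_def)
 moreover have "(\<integral>x. \<bar>dyadic_slope F q x - h x\<bar> \<partial>unit_interval) = (\<integral>x. \<bar>s q x - g x\<bar> \<partial>unit_interval)" for q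
 proof (rule Bochner_Integration.integral_cong[OF refl])
  fix x assume x: "x \<in> space unit_interval"
  then have "h x = g x" by (simp add: h_def space_restrict_space)
  then show "\<bar>dyadic_slope F q x - h x\<bar> = \<bar>s q x - g x\<bar>" by (simp only: s[OF x])
 qed
 ultimately show ?thesis using lim unfolding is_dyadic_density_def by (intro exI[of _ h]) (simp only: simp_thms)
qed

lemma dyadic_density_integral:
 assumes h: "is_dyadic_density F h" and F: "dyadic_contraction F" and P: "P <= 2 ^ q"
 shows "(\<integral>x. indicator {..<real P / 2 ^ q} x * h x \<partial>unit_interval) = F (real P / 2 ^ q)"
proof -
 have hm: "h \<in> borel_measurable unit_interval"
  using h by (auto simp: is_dyadic_density_def intro: measurable_restrict_space1)
 have h01: "0 <= h x & h x <= 1" for x using h by (auto simp: is_dyadic_density_def)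
 have lim: "(%s. \<integral>x. \<bar>dyadic_slope F s x - h x\<bar> \<partial>unit_interval) \<longlonglongrightarrow> 0" using h by (auto simp: is_dyadic_density_def)
 let ?i = "indicator {..<real P / 2 ^ q} :: real => real"
 have im: "?i \<in> borel_measurable unit_interval" by (rule measurable_restrict_space1) simp
 have ii: "integrable unit_interval (%x. ?i x * h x)"
 proof (rule unit_interval.integrable_const_bound[of _ 1])
  show "AE x in unit_interval. norm (?i x * h x) <= 1"
   by (rule AE_I2) (use h01 in \<open>simp add: indicator_def\<close>)
 qed (rule borel_measurable_times[OF im hm])
 have isl: "integrable unit_interval (%x. ?i x * dyadic_slope F s x)" for s
 proof (rule unit_interval.integrable_const_bound[of _ 1])
  show "AE x in unit_interval. norm (?i x * dyadic_slope F s x) <= 1"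
  proof (rule AE_I2)
   fix x assume "x \<in> space unit_interval"
   from dyadic_slope_bounds[OF F this, of s] show "norm (?i x * dyadic_slope F s x) <= 1" by (simp add: indicator_def)
  qed
 qed (rule borel_measurable_times[OF im dyadic_slope_measurable])
 have id: "integrable unit_interval (%x. \<bar>dyadic_slope F s x - h x\<bar>)" for s
 proof (rule unit_interval.integrable_const_bound[of _ 1])
  show "AE x in unit_interval. norm \<bar>dyadic_slope F s x - h x\<bar> <= 1"
  proof (rule AE_I2)
   fix x assume "x \<in> space unit_interval"
   from dyadic_slope_bounds[OF F this, of s] h01[of x] show "norm \<bar>dyadic_slope F s x - h x\<bar> <= 1"
    unfolding real_norm_def abs_idempotent by linarith
  qed
 qed (intro borel_measurable_abs borel_measurable_diff dyadic_slope_measurable hm)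
 have val: "(\<integral>x. ?i x * dyadic_slope F s x \<partial>unit_interval) = F (real P / 2 ^ q)" if "q <= s" for s
 proof -
  have "(\<integral>x. ?i x * dyadic_slope F s x \<partial>unit_interval) = (\<integral>x. of_bool (nat \<lfloor>real (2 ^ q) * x\<rfloor> < P) * dyadic_slope F s x \<partial>unit_interval)"
  proof (rule Bochner_Integration.integral_cong[OF refl])
   fix x assume "x \<in> space unit_interval"
   then have "0 <= x" by (simp add: space_restrict_space)
   then have "nat \<lfloor>real (2 ^ q) * x\<rfloor> < P \<longleftrightarrow> real (2 ^ q) * x < real P" by (simp add: nat_less_iff floor_less_iff)
   also have "... \<longleftrightarrow> x < real P / 2 ^ q" by (simp add: field_simps)
   finally show "?i x * dyadic_slope F s x = of_bool (nat \<lfloor>real (2 ^ q) * x\<rfloor> < P) * dyadic_slope F s x" by (simp add: indicator_def)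
  qed
  also have "... = (\<Sum>p<2 ^ q. of_bool (p < P) * dyadic_quotient F q p) / 2 ^ q" by (rule dyadic_slope_integral[OF that])
  also have "(\<Sum>p<2 ^ q. of_bool (p < P) * dyadic_quotient F q p) = (\<Sum>p<P. dyadic_quotient F q p)"
   by (rule sum.mono_neutral_cong_right) (use P in auto)
  also have "... / 2 ^ q = (\<Sum>p<P. F (real (Suc p) / 2 ^ q) - F (real p / 2 ^ q))"
   unfolding dyadic_quotient_def sum_distrib_left[symmetric] by simp
  also have "... = F (real P / 2 ^ q) - F (real 0 / 2 ^ q)" by (rule sum_lessThan_telescope)
  finally show ?thesis using F by (simp add: dyadic_contraction_def)
 qed
 have "\<bar>(\<integral>x. ?i x * h x \<partial>unit_interval) - F (real P / 2 ^ q)\<bar> <= (\<integral>x. \<bar>dyadic_slope F s x - h x\<bar> \<partial>unit_interval)" if "q <= s" for s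
 proof -
  have "\<bar>(\<integral>x. ?i x * h x \<partial>unit_interval) - F (real P / 2 ^ q)\<bar> = \<bar>\<integral>x. ?i x * h x - ?i x * dyadic_slope F s x \<partial>unit_interval\<bar>"
   unfolding val[OF that, symmetric] by (simp only: Bochner_Integration.integral_diff[OF ii isl])
  also have "... <= (\<integral>x. \<bar>dyadic_slope F s x - h x\<bar> \<partial>unit_interval)"
   by (rule order_trans[OF integral_abs_bound])
    (intro integral_mono integrable_abs Bochner_Integration.integrable_diff ii isl id, auto simp: indicator_def)
  finally show ?thesis .
 qed
 then have "\<bar>(\<integral>x. ?i x * h x \<partial>unit_interval) - F (real P / 2 ^ q)\<bar> <= 0"
  using LIMSEQ_le_const[OF lim] by blast
 then show ?thesis by simp
qed

lemma dyadic_density_mono: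
 assumes h: "is_dyadic_density F h" "is_dyadic_density F' h'" and F: "dyadic_contraction F" "dyadic_contraction F'"
  and le: "!!q p. p < 2 ^ q ==> dyadic_quotient F q p <= dyadic_quotient F' q p"
 shows "AE x in unit_interval. h x <= h' x"
proof -
 define c where "c G q x = max 0 (min 1 (dyadic_slope G q x))" for G q x
 have cm: "c G q \<in> borel_measurable unit_interval" for G q
  unfolding c_def by (intro borel_measurable_max borel_measurable_min borel_measurable_const dyadic_slope_measurable)
 have hm: "h \<in> borel_measurable unit_interval" "h' \<in> borel_measurable unit_interval"
  using h by (auto simp: is_dyadic_density_def intro: measurable_restrict_space1)
 have h01: "0 <= h x & h x <= 1" "0 <= h' x & h' x <= 1" for x using h by (auto simp: is_dyadic_density_def)
 have ceq: "(\<integral>x. \<bar>c G q x - k x\<bar> \<partial>unit_interval) = (\<integral>x. \<bar>dyadic_slope G q x - k x\<bar> \<partial>unit_interval)" if "dyadic_contraction G" for G q k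
 proof (rule Bochner_Integration.integral_cong[OF refl])
  fix x assume "x \<in> space unit_interval"
  from dyadic_slope_bounds[OF that this, of q] show "\<bar>c G q x - k x\<bar> = \<bar>dyadic_slope G q x - k x\<bar>" by (simp add: c_def)
 qed
 show ?thesis
 proof (rule unit_interval.AE_le_of_L1_limits[OF cm cm hm])
  have c01: "0 <= c G q x & c G q x <= 1" for G q x by (simp add: c_def)
  show "\<bar>c F q x - h x\<bar> <= 1" "\<bar>c F' q x - h' x\<bar> <= 1" for q x
   using c01[of F q x] c01[of F' q x] h01[of x] by linarith+
  show "c F q x <= c F' q x" if "x \<in> space unit_interval" for q x
  proof -
   have "nat \<lfloor>real (2 ^ q) * x\<rfloor> < 2 ^ q" by (rule nat_floor_less) (use that in \<open>auto simp: space_restrict_space\<close>)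
   from le[OF this] show ?thesis unfolding c_def dyadic_slope_def by (intro max.mono min.mono order_refl)
  qed
  show "(%q. \<integral>x. \<bar>c F q x - h x\<bar> \<partial>unit_interval) \<longlonglongrightarrow> 0" "(%q. \<integral>x. \<bar>c F' q x - h' x\<bar> \<partial>unit_interval) \<longlonglongrightarrow> 0"
   using h unfolding ceq[OF F(1)] ceq[OF F(2)] is_dyadic_density_def by blast+
 qed
qed

section \<open>Rearranging the square to match labels\<close>

text \<open>Match greedily within each label; what remains unmatched is the surplus of each label.\<close>

lemma label_matching_bijection:
 fixes alpha \<beta> :: "'c => nat"
 assumes C: "finite C" and lab: "!!c. c \<in> C ==> alpha c < p" "!!c. c \<in> C ==> \<beta> c < p"
 obtains \<pi> where "bij_betw \<pi> C C"
  "real (card {c \<in> C. alpha c ~= \<beta> (\<pi> c)}) <= (\<Sum>i<p. \<bar>real (card {c \<in> C. alpha c = i}) - real (card {c \<in> C. \<beta> c = i})\<bar>)"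
proof -
 let ?A = "%i. {c \<in> C. alpha c = i}" and ?B = "%i. {c \<in> C. \<beta> c = i}"
 let ?m = "%i. min (card (?A i)) (card (?B i))"
 have "\<forall>i. \<exists>X. X \<subseteq> ?A i & card X = ?m i" by (meson min.cobounded1 obtain_subset_with_card_n)
 then obtain X where X: "!!i. X i \<subseteq> ?A i" "!!i. card (X i) = ?m i" by metis
 have "\<forall>i. \<exists>Y. Y \<subseteq> ?B i & card Y = ?m i" by (meson min.cobounded2 obtain_subset_with_card_n)
 then obtain Y where Y: "!!i. Y i \<subseteq> ?B i" "!!i. card (Y i) = ?m i" by metis
 have fX: "finite (X i)" and fY: "finite (Y i)" for i
  using X(1)[of i] Y(1)[of i] C by (auto intro: finite_subset)
 have "\<forall>i. \<exists>g. bij_betw g (X i) (Y i)" using finite_same_card_bij[OF fX fY] X(2) Y(2) by simp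
 then obtain g where g: "!!i. bij_betw (g i) (X i) (Y i)" by metis
 let ?X = "\<Union>i<p. X i" and ?Y = "\<Union>i<p. Y i"
 define \<pi>0 where "\<pi>0 c = g (alpha c) c" for c
 have b0: "bij_betw \<pi>0 ?X ?Y"
 proof (rule bij_betw_UNION_disjoint)
  show "disjoint_family_on Y {..<p}" using Y(1) unfolding disjoint_family_on_def by blast
  fix i assume "i \<in> {..<p}"
  have "\<pi>0 c = g i c" if "c \<in> X i" for c using that X(1) by (auto simp: \<pi>0_def)
  then show "bij_betw \<pi>0 (X i) (Y i)" using g[of i] bij_betw_cong by blast
 qed
 have XC: "?X \<subseteq> C" and YC: "?Y \<subseteq> C" using X(1) Y(1) by blast+
 have "card (C - ?X) = card (C - ?Y)"
  using bij_betw_same_card[OF b0] C XC YC by (simp add: card_Diff_subset finite_subset)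
 then obtain h where h: "bij_betw h (C - ?X) (C - ?Y)" using finite_same_card_bij[of "C - ?X" "C - ?Y"] C by auto
 define \<pi> where "\<pi> c = (if c \<in> ?X then \<pi>0 c else h c)" for c
 have "bij_betw \<pi> (?X \<union> (C - ?X)) (?Y \<union> (C - ?Y))"
  unfolding \<pi>_def by (rule bij_betw_disjoint_Un[OF b0 h]) auto
 then have b: "bij_betw \<pi> C C" using XC YC by (simp add: Un_absorb1)
 have "{c \<in> C. alpha c ~= \<beta> (\<pi> c)} \<subseteq> (\<Union>i<p. ?A i - X i)"
 proof
  fix c assume c: "c \<in> {c \<in> C. alpha c ~= \<beta> (\<pi> c)}"
  have "c \<notin> X (alpha c)"
  proof
   assume cx: "c \<in> X (alpha c)"
   then have "c \<in> ?X" using c lab(1) by blast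
   then have "\<pi> c = g (alpha c) c" by (simp add: \<pi>_def \<pi>0_def)
   then have "\<pi> c \<in> Y (alpha c)" using g[of "alpha c"] cx by (auto simp: bij_betw_def)
   then show False using Y(1)[of "alpha c"] c by auto
  qed
  then show "c \<in> (\<Union>i<p. ?A i - X i)" using c lab(1) by auto
 qed
 then have "card {c \<in> C. alpha c ~= \<beta> (\<pi> c)} <= card (\<Union>i<p. ?A i - X i)"
  by (rule card_mono[rotated]) (use C in auto)
 also have "... <= (\<Sum>i<p. card (?A i - X i))" by (rule card_UN_le) simp
 finally have "real (card {c \<in> C. alpha c ~= \<beta> (\<pi> c)}) <= real (\<Sum>i<p. card (?A i - X i))" by (rule of_nat_mono)
 also have "... = (\<Sum>i<p. real (card (?A i - X i)))" by simp
 also have "... <= (\<Sum>i<p. \<bar>real (card (?A i)) - real (card (?B i))\<bar>)"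
 proof (rule sum_mono)
  fix i
  have "card (?A i - X i) = card (?A i) - ?m i" using X fX by (simp add: card_Diff_subset)
  then show "real (card (?A i - X i)) <= \<bar>real (card (?A i)) - real (card (?B i))\<bar>" by linarith
 qed
 finally show ?thesis using b that by blast
qed

lemma strip_label_matching_bijection:
 fixes alpha \<beta> s :: "'c => nat"
 assumes C: "finite C" and lab: "!!c. c \<in> C ==> alpha c < p" "!!c. c \<in> C ==> \<beta> c < p" and s: "!!c. c \<in> C ==> s c < q"
 obtains \<pi> where "bij_betw \<pi> C C" "!!c. c \<in> C ==> s (\<pi> c) = s c"
  "real (card {c \<in> C. alpha c ~= \<beta> (\<pi> c)}) \<le>
   (\<Sum>z\<in>{..<q} \<times> {..<p}. \<bar>real (card {c \<in> C. (s c, alpha c) = z}) - real (card {c \<in> C. (s c, \<beta> c) = z})\<bar>)"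
proof -
 let ?C = "%k. {c \<in> C. s c = k}"
 define good where "good k \<pi> \<longleftrightarrow> bij_betw \<pi> (?C k) (?C k) & real (card {c \<in> ?C k. alpha c ~= \<beta> (\<pi> c)}) \<le>
   (\<Sum>i<p. \<bar>real (card {c \<in> ?C k. alpha c = i}) - real (card {c \<in> ?C k. \<beta> c = i})\<bar>)" for k \<pi>
 have ex: "\<exists>\<pi>. good k \<pi>" for k
 proof (rule label_matching_bijection[of "?C k" alpha p \<beta>])
  show "finite (?C k)" using C by simp
  show "alpha c < p" "\<beta> c < p" if "c \<in> ?C k" for c using lab that by auto
  fix \<pi> assume "bij_betw \<pi> (?C k) (?C k)" and "real (card {c \<in> ?C k. alpha c ~= \<beta> (\<pi> c)}) \<le>
   (\<Sum>i<p. \<bar>real (card {c \<in> ?C k. alpha c = i}) - real (card {c \<in> ?C k. \<beta> c = i})\<bar>)"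
  then have "good k \<pi>" unfolding good_def by (rule conjI)
  then show "\<exists>\<pi>. good k \<pi>" by (rule exI[of "good k"])
 qed
 define \<pi> where "\<pi> k = (SOME \<pi>. good k \<pi>)" for k
 have g: "good k (\<pi> k)" for k unfolding \<pi>_def by (rule someI_ex[OF ex])
 have \<pi>: "bij_betw (\<pi> k) (?C k) (?C k)" for k using g[of k] unfolding good_def by (rule conjunct1)
 have mis: "real (card {c \<in> ?C k. alpha c ~= \<beta> (\<pi> k c)}) \<le>
   (\<Sum>i<p. \<bar>real (card {c \<in> ?C k. alpha c = i}) - real (card {c \<in> ?C k. \<beta> c = i})\<bar>)" for k
  using g[of k] unfolding good_def by (rule conjunct2)
 define \<rho> where "\<rho> c = \<pi> (s c) c" for c
 have \<rho>: "\<rho> c \<in> C" "s (\<rho> c) = s c" if "c \<in> C" for c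
  using \<pi>[of "s c"] that by (auto simp: \<rho>_def bij_betw_def)
 have inj: "inj_on \<rho> C"
 proof (rule inj_onI)
  fix c d assume cd: "c \<in> C" "d \<in> C" "\<rho> c = \<rho> d"
  then have "s c = s d" using \<rho>(2) by metis
  then show "c = d" using \<pi>[of "s c"] cd by (auto simp: \<rho>_def bij_betw_def inj_on_def)
 qed
 have sub: "\<rho> ` C \<subseteq> C" using \<rho>(1) by (rule image_subsetI)
 have bijr: "bij_betw \<rho> C C"
  unfolding bij_betw_def by (intro conjI inj endo_inj_surj[OF C sub inj])
 have e: "{c \<in> C. alpha c ~= \<beta> (\<rho> c)} = (\<Union>k\<in>{..<q}. {c \<in> ?C k. alpha c ~= \<beta> (\<pi> k c)})"
  using s by (auto simp: \<rho>_def)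
 have "card {c \<in> C. alpha c ~= \<beta> (\<rho> c)} <= (\<Sum>k<q. card {c \<in> ?C k. alpha c ~= \<beta> (\<pi> k c)})"
  unfolding e by (rule card_UN_le[OF finite_lessThan])
 then have "real (card {c \<in> C. alpha c ~= \<beta> (\<rho> c)}) <= real (\<Sum>k<q. card {c \<in> ?C k. alpha c ~= \<beta> (\<pi> k c)})"
  by (rule of_nat_mono)
 also have "... = (\<Sum>k<q. real (card {c \<in> ?C k. alpha c ~= \<beta> (\<pi> k c)}))" by (rule of_nat_sum)
 also have "... <= (\<Sum>k<q. \<Sum>i<p. \<bar>real (card {c \<in> ?C k. alpha c = i}) - real (card {c \<in> ?C k. \<beta> c = i})\<bar>)"
  by (intro sum_mono mis)
 also have "... = (\<Sum>z\<in>{..<q} \<times> {..<p}. \<bar>real (card {c \<in> C. (s c, alpha c) = z}) - real (card {c \<in> C. (s c, \<beta> c) = z})\<bar>)"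
  unfolding sum.cartesian_product
 proof (rule sum.cong[OF refl])
  fix z assume "z \<in> {..<q} \<times> {..<p}"
  have eq: "{c \<in> ?C (fst z). \<gamma> c = snd z} = {c \<in> C. (s c, \<gamma> c) = z}" for \<gamma> :: "'c => nat"
   by (cases z) auto
  show "(case z of (k, i) => \<bar>real (card {c \<in> ?C k. alpha c = i}) - real (card {c \<in> ?C k. \<beta> c = i})\<bar>) =
    \<bar>real (card {c \<in> C. (s c, alpha c) = z}) - real (card {c \<in> C. (s c, \<beta> c) = z})\<bar>"
   unfolding eq[symmetric] case_prod_unfold by (rule refl)
 qed
 finally have mm: "real (card {c \<in> C. alpha c ~= \<beta> (\<rho> c)}) \<le>
  (\<Sum>z\<in>{..<q} \<times> {..<p}. \<bar>real (card {c \<in> C. (s c, alpha c) = z}) - real (card {c \<in> C. (s c, \<beta> c) = z})\<bar>)" .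
 show ?thesis
 proof (rule that)
  show "bij_betw \<rho> C C" by (rule bijr)
  show "s (\<rho> c) = s c" if "c \<in> C" for c by (rule \<rho>(2)[OF that])
  show "real (card {c \<in> C. alpha c ~= \<beta> (\<rho> c)}) \<le>
  (\<Sum>z\<in>{..<q} \<times> {..<p}. \<bar>real (card {c \<in> C. (s c, alpha c) = z}) - real (card {c \<in> C. (s c, \<beta> c) = z})\<bar>)" by (rule mm)
 qed
qed

definition open_square :: "point set" where "open_square = {0..<1} \<times> {0..<1}"

definition grid_cell :: "nat => point => nat \<times> nat" where
 "grid_cell n u = (nat \<lfloor>real n * fst u\<rfloor>, nat \<lfloor>real n * snd u\<rfloor>)"

abbreviation grid :: "nat => (nat \<times> nat) set" where "grid n \<equiv> {..<n} \<times> {..<n}"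

definition cell_box :: "nat => nat \<times> nat => point set" where
 "cell_box n c = {real (fst c) / real n..<(real (fst c) + 1) / real n} \<times> {real (snd c) / real n..<(real (snd c) + 1) / real n}"

lemma floor_cell_iff:
 assumes "0 < n" "0 <= x"
 shows "nat \<lfloor>real n * x\<rfloor> = p \<longleftrightarrow> real p / real n <= x & x < (real p + 1) / real n"
proof -
 have "0 <= \<lfloor>real n * x\<rfloor>" using assms by simp
 then have "nat \<lfloor>real n * x\<rfloor> = p \<longleftrightarrow> \<lfloor>real n * x\<rfloor> = int p" by auto
 also have "... \<longleftrightarrow> real p <= real n * x & real n * x < real p + 1" by (simp add: floor_eq_iff)
 also have "... \<longleftrightarrow> real p / real n <= x & x < (real p + 1) / real n" using assms by (auto simp: field_simps)
 finally show ?thesis .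
qed

lemma mem_cell_box_iff: "0 < n ==> u \<in> open_square ==> u \<in> cell_box n c \<longleftrightarrow> grid_cell n u = c"
 by (cases u; cases c) (auto simp: cell_box_def grid_cell_def open_square_def floor_cell_iff)

lemma cell_box_subset: "c \<in> grid n ==> cell_box n c \<subseteq> open_square"
proof -
 assume c: "c \<in> grid n"
 have 1: "(real k + 1) / real n <= 1" if "k < n" for k using that by (simp add: divide_le_eq_1)
 have 2: "0 <= x & x < 1" if "real k / real n <= x" "x < (real k + 1) / real n" "k < n" for k x
 proof -
  have "0 <= real k / real n" by simp
  then show ?thesis using that(1,2) 1[OF that(3)] by linarith
 qed
 show ?thesis using 2[where k = "fst c"] 2[where k = "snd c"] c
  by (auto simp: cell_box_def open_square_def)
qed

lemma grid_cell_in_grid: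
 assumes "0 < n" "u \<in> open_square"
 shows "grid_cell n u \<in> grid n"
proof -
 have 1: "nat \<lfloor>real n * x\<rfloor> < n" if "0 <= x" "x < 1" for x
 proof -
  have "real n * x < real n" using assms that by simp
  then have "\<lfloor>real n * x\<rfloor> < int n" by (simp add: floor_less_iff)
  then show ?thesis using assms that by linarith
 qed
 show ?thesis using assms(2) 1[of "fst u"] 1[of "snd u"] by (auto simp: grid_cell_def open_square_def)
qed

lemma cell_box_sets: "cell_box n c \<in> sets lebesgue"
proof -
 have "cell_box n c \<in> sets (lborel \<Otimes>\<^sub>M (lborel :: real measure))" unfolding cell_box_def by (intro pair_measureI) auto
 then have "cell_box n c \<in> sets lborel" by (simp only: lborel_prod)
 then show ?thesis by (rule sets_completionI_sets)
qed

lemma emeasure_cell_box: "0 < n ==> emeasure lebesgue (cell_box n c) = ennreal (1 / (real n)\<^sup>2)"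
proof -
 assume n: "0 < n"
 have b: "cell_box n c \<in> sets (lborel \<Otimes>\<^sub>M (lborel :: real measure))" unfolding cell_box_def by (intro pair_measureI) auto
 have w: "emeasure lborel {real k / real n..<(real k + 1) / real n} = ennreal (1 / real n)" for k
  by (subst emeasure_lborel_Ico) (simp_all add: divide_right_mono diff_divide_distrib[symmetric])
 have "cell_box n c \<in> sets lborel" using b by (simp only: lborel_prod)
 then have "emeasure lebesgue (cell_box n c) = emeasure (lborel \<Otimes>\<^sub>M (lborel :: real measure)) (cell_box n c)"
  by (simp add: lborel_prod)
 also have "... = ennreal (1 / real n) * ennreal (1 / real n)"
  unfolding cell_box_def by (subst lborel.emeasure_pair_measure_Times) (simp_all only: w, auto)
 also have "... = ennreal (1 / (real n)\<^sup>2)" by (simp add: ennreal_mult[symmetric] power2_eq_square)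
 finally show ?thesis .
qed

lemma open_square_sets: "open_square \<in> sets square"
proof -
 have "open_square \<in> sets (lborel \<Otimes>\<^sub>M (lborel :: real measure))" unfolding open_square_def by (intro pair_measureI) auto
 then have "open_square \<in> sets lborel" by (simp only: lborel_prod)
 then have "open_square \<in> sets lebesgue" by (rule sets_completionI_sets)
 moreover have "open_square \<subseteq> unit_square" by (auto simp: open_square_def unit_square_def)
 ultimately show ?thesis by (simp only: sets_square_iff)
qed

lemma measure_open_square: "measure square open_square = 1" "AE u in square. u \<in> open_square"
proof -
 have b: "open_square \<in> sets (lborel \<Otimes>\<^sub>M (lborel :: real measure))" unfolding open_square_def by (intro pair_measureI) auto
 have l: "open_square \<in> sets lborel" using b by (simp only: lborel_prod)
 have "open_square \<subseteq> unit_square" by (auto simp: open_square_def unit_square_def)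
 then have "emeasure square open_square = emeasure lebesgue open_square"
  by (intro emeasure_restrict_space) auto
 also have "... = emeasure (lborel \<Otimes>\<^sub>M (lborel :: real measure)) open_square" using l by (simp add: lborel_prod)
 also have "... = 1" unfolding open_square_def by (subst lborel.emeasure_pair_measure_Times) auto
 finally show m: "measure square open_square = 1" by (simp add: measure_def)
 show "AE u in square. u \<in> open_square"
  using square.prob_eq_1[OF open_square_sets] m by simp
qed

lemma measure_cells:
 assumes n: "0 < n"
 shows "{u \<in> open_square. P (grid_cell n u)} \<in> sets square"
  "measure square {u \<in> open_square. P (grid_cell n u)} = real (card {c \<in> grid n. P c}) / (real n)\<^sup>2"
proof -
 let ?D = "{c \<in> grid n. P c}"
 have eq: "{u \<in> open_square. P (grid_cell n u)} = (\<Union>c\<in>?D. cell_box n c)"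
 proof (intro equalityI subsetI)
  fix u assume u: "u \<in> {u \<in> open_square. P (grid_cell n u)}"
  then have uo: "u \<in> open_square" and uP: "P (grid_cell n u)" by simp_all
  have "u \<in> cell_box n (grid_cell n u)" by (rule mem_cell_box_iff[OF n uo, THEN iffD2]) (rule refl)
  moreover have "grid_cell n u \<in> ?D" using grid_cell_in_grid[OF n uo] uP by simp
  ultimately show "u \<in> (\<Union>c\<in>?D. cell_box n c)" by (rule UN_I[rotated])
 next
  fix u assume "u \<in> (\<Union>c\<in>?D. cell_box n c)"
  then obtain c where c: "c \<in> ?D" "u \<in> cell_box n c" by (rule UN_E)
  have cg: "c \<in> grid n" "P c" using c(1) by simp_all
  have uo: "u \<in> open_square" by (rule subsetD[OF cell_box_subset[OF cg(1)] c(2)])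
  have "grid_cell n u = c" by (rule mem_cell_box_iff[OF n uo, THEN iffD1]) (rule c(2))
  then show "u \<in> {u \<in> open_square. P (grid_cell n u)}" using uo cg(2) by simp
 qed
 have os: "open_square \<subseteq> unit_square" by (auto simp: open_square_def unit_square_def)
 have sets: "cell_box n c \<in> sets square" if "c \<in> ?D" for c
 proof -
  have "c \<in> grid n" using that by simp
  then have "cell_box n c \<subseteq> unit_square" using os by (rule order_trans[OF cell_box_subset])
  then show ?thesis by (simp add: sets_square_iff cell_box_sets)
 qed
 have f: "finite ?D" by simp
 have disj: "disjoint_family_on (cell_box n) ?D"
  unfolding disjoint_family_on_def
 proof (intro ballI impI)
  fix c d assume cd: "c \<in> ?D" "d \<in> ?D" "c ~= d"
  show "cell_box n c \<inter> cell_box n d = {}"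
  proof (rule ccontr)
   assume "cell_box n c \<inter> cell_box n d ~= {}"
   then obtain u where u: "u \<in> cell_box n c" "u \<in> cell_box n d" by blast
   have "c \<in> grid n" using cd(1) by simp
   then have uo: "u \<in> open_square" using subsetD[OF cell_box_subset u(1)] by simp
   show False using u cd(3) mem_cell_box_iff[OF n uo] by simp
  qed
 qed
 show "{u \<in> open_square. P (grid_cell n u)} \<in> sets square" unfolding eq using f sets by (rule sets.finite_UN)
 have one: "measure square (cell_box n c) = 1 / (real n)\<^sup>2" if "c \<in> ?D" for c
 proof -
  have "emeasure square (cell_box n c) = emeasure lebesgue (cell_box n c)"
   by (rule emeasure_restrict_space) (use sets[OF that] in \<open>auto simp: sets_square_iff\<close>)
  then show ?thesis unfolding measure_def emeasure_cell_box[OF n] by simp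
 qed
 have "measure square (\<Union>c\<in>?D. cell_box n c) = (\<Sum>c\<in>?D. measure square (cell_box n c))"
  by (rule square.finite_measure_finite_Union[OF f image_subsetI[OF sets] disj])
 also have "... = (\<Sum>c\<in>?D. 1 / (real n)\<^sup>2)" by (rule sum.cong[OF refl one])
 finally show "measure square {u \<in> open_square. P (grid_cell n u)} = real (card ?D) / (real n)\<^sup>2" unfolding eq by simp
qed

definition cell_shift :: "nat => (nat \<times> nat => nat \<times> nat) => nat \<times> nat => point" where
 "cell_shift n \<pi> c = ((real (fst (\<pi> c)) - real (fst c)) / real n, (real (snd (\<pi> c)) - real (snd c)) / real n)"

text \<open>Translates the cells of a grid according to a permutation of the cells.\<close>

definition grid_map :: "nat => (nat \<times> nat => nat \<times> nat) => point => point" where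
 "grid_map n \<pi> u = (if u \<in> open_square then u + cell_shift n \<pi> (grid_cell n u) else u)"

lemma cell_shift_box: "u + cell_shift n \<pi> c \<in> cell_box n (\<pi> c) \<longleftrightarrow> u \<in> cell_box n c"
proof -
 have 1: "b / m <= x + (b - c) / m \<longleftrightarrow> c / m <= x" "x + (b - c) / m < (b + 1) / m \<longleftrightarrow> x < (c + 1) / m" for b c x m :: real
  by (simp_all add: diff_divide_distrib add_divide_distrib, linarith+)
 show ?thesis
  unfolding cell_box_def cell_shift_def mem_Times_iff atLeastLessThan_iff fst_add snd_add fst_conv snd_conv 1 by (rule refl)
qed

lemma own_cell: "0 < n ==> u \<in> open_square ==> u \<in> cell_box n (grid_cell n u)"
 by (simp add: mem_cell_box_iff)

lemma cell_boxD:
 assumes "0 < n" "c \<in> grid n" "u \<in> cell_box n c"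
 shows "u \<in> open_square" "grid_cell n u = c"
proof -
 show o: "u \<in> open_square" by (rule subsetD[OF cell_box_subset[OF assms(2)] assms(3)])
 show "grid_cell n u = c" using mem_cell_box_iff[OF assms(1) o, of c] assms(3) by simp
qed

lemma grid_map_cell:
 assumes n: "0 < n" and \<pi>: "bij_betw \<pi> (grid n) (grid n)" and u: "u \<in> open_square"
 shows "grid_map n \<pi> u \<in> open_square" "grid_cell n (grid_map n \<pi> u) = \<pi> (grid_cell n u)"
proof -
 let ?c = "grid_cell n u"
 have "u + cell_shift n \<pi> ?c \<in> cell_box n (\<pi> ?c)" unfolding cell_shift_box by (rule own_cell[OF n u])
 then have b: "grid_map n \<pi> u \<in> cell_box n (\<pi> ?c)" unfolding grid_map_def using u by (simp only: if_True)
 have pc: "\<pi> ?c \<in> grid n" using \<pi> grid_cell_in_grid[OF n u] by (rule bij_betwE[THEN bspec])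
 show "grid_map n \<pi> u \<in> open_square" by (rule cell_boxD(1)[OF n pc b])
 show "grid_cell n (grid_map n \<pi> u) = \<pi> ?c" by (rule cell_boxD(2)[OF n pc b])
qed

lemma grid_map_inverse:
 assumes n: "0 < n" and \<pi>: "bij_betw \<pi> (grid n) (grid n)"
 shows "grid_map n (inv_into (grid n) \<pi>) (grid_map n \<pi> u) = u"
proof (cases "u \<in> open_square")
 case True
 have c: "grid_cell n u \<in> grid n" by (rule grid_cell_in_grid[OF n True])
 have i: "inv_into (grid n) \<pi> (\<pi> (grid_cell n u)) = grid_cell n u"
  using \<pi> c by (intro inv_into_f_f) (simp_all only: bij_betw_def)
 define v where "v = grid_map n \<pi> u"
 have v: "v \<in> open_square" "grid_cell n v = \<pi> (grid_cell n u)" unfolding v_def by (rule grid_map_cell[OF n \<pi> True])+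
 have 1: "grid_map n (inv_into (grid n) \<pi>) v = v + cell_shift n (inv_into (grid n) \<pi>) (\<pi> (grid_cell n u))"
  unfolding grid_map_def v(2) using v(1) by (simp only: if_True)
 have 2: "v = u + cell_shift n \<pi> (grid_cell n u)" unfolding v_def grid_map_def using True by (simp only: if_True)
 have "u + cell_shift n \<pi> (grid_cell n u) + cell_shift n (inv_into (grid n) \<pi>) (\<pi> (grid_cell n u)) = u"
  unfolding cell_shift_def i by (cases u) (simp add: diff_divide_distrib)
 then have "v + cell_shift n (inv_into (grid n) \<pi>) (\<pi> (grid_cell n u)) = u" unfolding 2[symmetric] .
 then show ?thesis unfolding v_def[symmetric] 1 .
next
 case False
 then show ?thesis unfolding grid_map_def by (simp only: if_False)
qed

text \<open>The upper and right edges of the square are kept apart so that the half-open cells partition the rest.\<close>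

lemma emeasure_split_cells:
 assumes n: "0 < n" and B: "B \<in> sets lebesgue"
 shows "emeasure lebesgue B = emeasure lebesgue (B - open_square) + (\<Sum>c\<in>grid n. emeasure lebesgue (B \<inter> cell_box n c))"
proof -
 have os: "open_square \<in> sets lebesgue" using open_square_sets by (simp add: sets_square_iff)
 have s: "B \<inter> cell_box n c \<in> sets lebesgue" for c using B cell_box_sets by (rule sets.Int)
 have disj: "disjoint_family_on (%c. B \<inter> cell_box n c) (grid n)"
  unfolding disjoint_family_on_def
 proof (intro ballI impI)
  fix c d assume cd: "c \<in> grid n" "d \<in> grid n" "c ~= d"
  show "(B \<inter> cell_box n c) \<inter> (B \<inter> cell_box n d) = {}"
  proof (rule ccontr)
   assume "(B \<inter> cell_box n c) \<inter> (B \<inter> cell_box n d) ~= {}"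
   then obtain u where u: "u \<in> cell_box n c" "u \<in> cell_box n d" by blast
   show False using cell_boxD(2)[OF n cd(1) u(1)] cell_boxD(2)[OF n cd(2) u(2)] cd(3) by simp
  qed
 qed
 have un: "(\<Union>c\<in>grid n. B \<inter> cell_box n c) = B \<inter> open_square"
 proof (intro equalityI subsetI)
  fix u assume "u \<in> (\<Union>c\<in>grid n. B \<inter> cell_box n c)"
  then obtain c where "c \<in> grid n" "u \<in> B" "u \<in> cell_box n c" by blast
  then show "u \<in> B \<inter> open_square" using cell_boxD(1)[OF n] by simp
 next
  fix u assume u: "u \<in> B \<inter> open_square"
  then have "u \<in> B \<inter> cell_box n (grid_cell n u)" using own_cell[OF n] by simp
  moreover have "grid_cell n u \<in> grid n" using u by (intro grid_cell_in_grid[OF n]) simp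
  ultimately show "u \<in> (\<Union>c\<in>grid n. B \<inter> cell_box n c)" by (rule UN_I[rotated])
 qed
 have "(\<Sum>c\<in>grid n. emeasure lebesgue (B \<inter> cell_box n c)) = emeasure lebesgue (\<Union>c\<in>grid n. B \<inter> cell_box n c)"
  by (rule sum_emeasure[OF image_subsetI[OF s] disj]) simp
 also have "... = emeasure lebesgue (B \<inter> open_square)" unfolding un ..
 finally have e: "(\<Sum>c\<in>grid n. emeasure lebesgue (B \<inter> cell_box n c)) = emeasure lebesgue (B \<inter> open_square)" .
 have "emeasure lebesgue (B - open_square) + emeasure lebesgue (B \<inter> open_square) = emeasure lebesgue ((B - open_square) \<union> (B \<inter> open_square))"
  by (rule plus_emeasure) (use B os in auto)
 also have "(B - open_square) \<union> (B \<inter> open_square) = B" by blast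
 finally show ?thesis unfolding e ..
qed

lemma grid_map_measure_preserving:
 assumes n: "0 < n" and \<pi>: "bij_betw \<pi> (grid n) (grid n)"
 shows "measure_preserving_map square (grid_map n \<pi>)"
proof -
 let ?f = "grid_map n \<pi>"
 have os: "open_square \<subseteq> unit_square" by (auto simp: open_square_def unit_square_def)
 have out: "?f u = u" if "u \<notin> open_square" for u using that unfolding grid_map_def by (simp only: if_False)
 have maps: "?f u \<in> unit_square" if "u \<in> unit_square" for u
 proof (cases "u \<in> open_square")
  case True
  show ?thesis by (rule subsetD[OF os grid_map_cell(1)[OF n \<pi> True]])
 next
  case False
  show ?thesis unfolding out[OF False] by (rule that)
 qed
 have main: "?f -` A \<inter> space square \<in> sets square & emeasure square (?f -` A \<inter> space square) = emeasure square A"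
  if A: "A \<in> sets square" for A
 proof -
  have Al: "A \<in> sets lebesgue" "A \<subseteq> unit_square" using A by (simp_all add: sets_square_iff)
  have rest: "A - open_square \<in> sets lebesgue" using sets.Diff[OF A open_square_sets] by (simp add: sets_square_iff)
  define B where "B = ?f -` A \<inter> space square"
  define P where "P c = (%u. - cell_shift n \<pi> c + u) ` (A \<inter> cell_box n (\<pi> c))" for c
  have P_iff: "u \<in> P c \<longleftrightarrow> u \<in> cell_box n c & u + cell_shift n \<pi> c \<in> A" for u c
  proof
   assume "u \<in> P c"
   then obtain v where v: "v \<in> A \<inter> cell_box n (\<pi> c)" "u = - cell_shift n \<pi> c + v" unfolding P_def by (rule imageE)
   then have "v = u + cell_shift n \<pi> c" by simp
   then show "u \<in> cell_box n c & u + cell_shift n \<pi> c \<in> A" using v(1) cell_shift_box[of u n \<pi> c] by simp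
  next
   assume u: "u \<in> cell_box n c & u + cell_shift n \<pi> c \<in> A"
   have "u + cell_shift n \<pi> c \<in> A \<inter> cell_box n (\<pi> c)" using u cell_shift_box[of u n \<pi> c] by simp
   moreover have "u = - cell_shift n \<pi> c + (u + cell_shift n \<pi> c)" by simp
   ultimately show "u \<in> P c" unfolding P_def by (rule image_eqI[rotated])
  qed
  have P_sets: "P c \<in> sets lebesgue" for c unfolding P_def
   by (rule lebesgue_sets_translation) (rule sets.Int[OF Al(1) cell_box_sets])
  have P_meas: "emeasure lebesgue (P c) = emeasure lebesgue (A \<inter> cell_box n (\<pi> c))" for c
   using emeasure_lebesgue_affine[of 1 "- cell_shift n \<pi> c" "A \<inter> cell_box n (\<pi> c)"] unfolding P_def by simp
  have B_cell: "B \<inter> cell_box n c = P c" if c: "c \<in> grid n" for c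
  proof (rule set_eqI)
   fix u
   show "u \<in> B \<inter> cell_box n c \<longleftrightarrow> u \<in> P c"
   proof (cases "u \<in> cell_box n c")
    case True
    have u: "u \<in> open_square" "grid_cell n u = c" by (rule cell_boxD[OF n c True])+
    have "?f u = u + cell_shift n \<pi> c" unfolding grid_map_def u(2) using u(1) by (simp only: if_True)
    then show ?thesis using True subsetD[OF os u(1)] unfolding P_iff B_def by simp
   qed (simp add: P_iff)
  qed
  have B_out: "B - open_square = A - open_square"
  proof (rule set_eqI)
   fix u
   show "u \<in> B - open_square \<longleftrightarrow> u \<in> A - open_square"
    by (cases "u \<in> open_square") (use Al(2) in \<open>auto simp: B_def out\<close>)
  qed
  have B_eq: "B = (A - open_square) \<union> (\<Union>c\<in>grid n. P c)"
  proof (rule set_eqI)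
   fix u
   show "u \<in> B \<longleftrightarrow> u \<in> (A - open_square) \<union> (\<Union>c\<in>grid n. P c)"
   proof (cases "u \<in> open_square")
    case False
    have "u \<notin> P c" if "c \<in> grid n" for c
     using cell_boxD(1)[OF n that, of u] False unfolding P_iff by auto
    then have "u \<notin> (\<Union>c\<in>grid n. P c)" by (rule_tac notI) (erule UN_E, simp)
    then show ?thesis using B_out False by blast
   next
    case True
    have g: "grid_cell n u \<in> grid n" by (rule grid_cell_in_grid[OF n True])
    have own: "u \<in> cell_box n (grid_cell n u)" by (rule own_cell[OF n True])
    have 1: "u \<in> P (grid_cell n u) \<longleftrightarrow> u \<in> B" unfolding B_cell[OF g, symmetric] using own by simp
    have 2: "u \<in> B" if "c \<in> grid n" "u \<in> P c" for c
    proof -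
     have "u \<in> B \<inter> cell_box n c" unfolding B_cell[OF that(1)] by (rule that(2))
     then show ?thesis by (rule IntD1)
    qed
    show ?thesis
    proof
     assume "u \<in> B"
     then have "u \<in> P (grid_cell n u)" using 1 by simp
     with g have "u \<in> (\<Union>c\<in>grid n. P c)" by (rule UN_I)
     then show "u \<in> (A - open_square) \<union> (\<Union>c\<in>grid n. P c)" by (rule UnI2)
    next
     assume "u \<in> (A - open_square) \<union> (\<Union>c\<in>grid n. P c)"
     then have "u \<in> (\<Union>c\<in>grid n. P c)" using True by simp
     then show "u \<in> B" by (rule UN_E) (rule 2)
    qed
   qed
  qed
  have B_sets: "B \<in> sets lebesgue" unfolding B_eq
   by (rule sets.Un[OF rest sets.finite_UN]) (simp, rule P_sets)
  have "emeasure lebesgue B = emeasure lebesgue (A - open_square) + (\<Sum>c\<in>grid n. emeasure lebesgue (B \<inter> cell_box n c))"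
   unfolding B_out[symmetric] by (rule emeasure_split_cells[OF n B_sets])
  also have "(\<Sum>c\<in>grid n. emeasure lebesgue (B \<inter> cell_box n c)) = (\<Sum>c\<in>grid n. emeasure lebesgue (A \<inter> cell_box n (\<pi> c)))"
   by (rule sum.cong[OF refl]) (simp only: B_cell P_meas)
  also have "... = (\<Sum>c\<in>grid n. emeasure lebesgue (A \<inter> cell_box n c))"
   by (rule sum.reindex_bij_betw[OF \<pi>])
  also have "emeasure lebesgue (A - open_square) + ... = emeasure lebesgue A"
   by (rule emeasure_split_cells[OF n Al(1), symmetric])
  finally have e: "emeasure lebesgue B = emeasure lebesgue A" .
  have st: "B \<in> sets square" using B_sets by (simp add: sets_square_iff B_def)
  have "emeasure square X = emeasure lebesgue X" if "X \<in> sets square" for X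
   by (rule emeasure_restrict_space) (use that in \<open>auto simp: sets_square_iff\<close>)
  then have "emeasure square B = emeasure square A" using st A e by simp
  then show ?thesis using st unfolding B_def by blast
 qed
 have "?f \<in> measurable square square"
 proof (rule measurableI)
  show "?f u \<in> space square" if "u \<in> space square" for u using maps that by simp
  show "?f -` A \<inter> space square \<in> sets square" if "A \<in> sets square" for A using main[OF that] by (rule conjunct1)
 qed
 moreover have "\<forall>A\<in>sets square. emeasure square (?f -` A \<inter> space square) = emeasure square A"
  using main by (intro ballI) (rule conjunct2)
 ultimately show ?thesis unfolding measure_preserving_map_def by (rule conjI)
qed

lemma grid_map_mp_bijection:
 assumes n: "0 < n" and \<pi>: "bij_betw \<pi> (grid n) (grid n)"
 shows "grid_map n \<pi> \<in> mp_bijections"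
proof -
 let ?f = "grid_map n \<pi>" and ?g = "grid_map n (inv_into (grid n) \<pi>)"
 have \<pi>': "bij_betw (inv_into (grid n) \<pi>) (grid n) (grid n)" by (rule bij_betw_inv_into[OF \<pi>])
 have os: "open_square \<subseteq> unit_square" by (auto simp: open_square_def unit_square_def)
 have maps: "grid_map n \<rho> u \<in> unit_square" if u: "u \<in> unit_square" and r: "bij_betw \<rho> (grid n) (grid n)" for u \<rho>
 proof (cases "u \<in> open_square")
  case True
  show ?thesis by (rule subsetD[OF os grid_map_cell(1)[OF n r True]])
 next
  case False
  then have "grid_map n \<rho> u = u" unfolding grid_map_def by (simp only: if_False)
  then show ?thesis using u by (simp only:)
 qed
 have gf: "?g (?f u) = u" for u by (rule grid_map_inverse[OF n \<pi>])
 have fg: "?f (?g u) = u" for u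
 proof -
  have eq: "grid_map n (inv_into (grid n) (inv_into (grid n) \<pi>)) v = ?f v" for v
  proof (cases "v \<in> open_square")
   case True
   have "inv_into (grid n) (inv_into (grid n) \<pi>) (grid_cell n v) = \<pi> (grid_cell n v)"
    by (rule inv_into_inv_into_eq[OF \<pi> grid_cell_in_grid[OF n True]])
   then show ?thesis unfolding grid_map_def cell_shift_def by (simp only:)
  next
   case False
   then show ?thesis unfolding grid_map_def by (simp only: if_False)
  qed
  show ?thesis using grid_map_inverse[OF n \<pi>', of u] unfolding eq .
 qed
 have bij: "bij_betw ?f unit_square unit_square"
 proof (rule bij_betw_byWitness[where f' = ?g])
  show "\<forall>a\<in>unit_square. ?g (?f a) = a" using gf by (intro ballI)
  show "\<forall>a\<in>unit_square. ?f (?g a) = a" using fg by (intro ballI)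
  show "?f ` unit_square \<subseteq> unit_square" by (rule image_subsetI) (rule maps[OF _ \<pi>])
  show "?g ` unit_square \<subseteq> unit_square" by (rule image_subsetI) (rule maps[OF _ \<pi>'])
 qed
 have inv: "inv_into unit_square ?f u = ?g u" if "u \<in> unit_square" for u
  using bij_betw_inv_into_left[OF bij maps[OF that \<pi>']] unfolding fg .
 have mg: "measure_preserving_map square ?g" by (rule grid_map_measure_preserving[OF n \<pi>'])
 have "measure_preserving_map square (inv_into unit_square ?f)"
  unfolding measure_preserving_map_def
 proof (intro conjI ballI)
  show "inv_into unit_square ?f \<in> measurable square square"
  proof (rule measurable_cong[THEN iffD2])
   show "inv_into unit_square ?f w = ?g w" if "w \<in> space square" for w using that by (intro inv) simp
   show "?g \<in> measurable square square" using mg unfolding measure_preserving_map_def by (rule conjunct1)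
  qed
  fix A assume A: "A \<in> sets square"
  have "inv_into unit_square ?f -` A \<inter> space square = ?g -` A \<inter> space square"
  proof (rule set_eqI)
   fix u show "u \<in> inv_into unit_square ?f -` A \<inter> space square \<longleftrightarrow> u \<in> ?g -` A \<inter> space square"
    using inv[of u] by (cases "u \<in> unit_square") simp_all
  qed
  moreover have "emeasure square (?g -` A \<inter> space square) = emeasure square A"
   using mg[unfolded measure_preserving_map_def, THEN conjunct2] A by (rule bspec)
  ultimately show "emeasure square (inv_into unit_square ?f -` A \<inter> space square) = emeasure square A" by (simp only:)
 qed
 then show ?thesis unfolding mp_bijections_def
  using bij grid_map_measure_preserving[OF n \<pi>] by (intro CollectI conjI)
qed

section \<open>Transport of labelled squares\<close>

lemma measure_diff_le_exceptional:
 assumes "A \<in> sets square" "B \<in> sets square" "D \<in> sets square" "A \<subseteq> B \<union> D" "B \<subseteq> A \<union> D"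
 shows "\<bar>measure square A - measure square B\<bar> <= measure square D"
proof -
 have "measure square A <= measure square (B \<union> D)" "measure square B <= measure square (A \<union> D)"
  using assms by (auto intro!: square.finite_measure_mono)
 moreover have "measure square (B \<union> D) <= measure square B + measure square D"
  "measure square (A \<union> D) <= measure square A + measure square D"
  using assms by (auto intro!: measure_Un_le)
 ultimately show ?thesis by linarith
qed

lemma open_square_subset: "open_square \<subseteq> unit_square"
 by (auto simp: open_square_def unit_square_def)

lemma cell_diameter:
 assumes n: "0 < n" and u: "u \<in> cell_box n c" and v: "v \<in> cell_box n c"
 shows "dist u v <= 2 / real n"
proof -
 have "\<bar>fst u - fst v\<bar> <= (real (fst c) + 1) / real n - real (fst c) / real n"
  "\<bar>snd u - snd v\<bar> <= (real (snd c) + 1) / real n - real (snd c) / real n"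
  using u v unfolding cell_box_def mem_Times_iff atLeastLessThan_iff fst_conv snd_conv by linarith+
 then have 1: "dist (fst u) (fst v) <= 1 / real n" "dist (snd u) (snd v) <= 1 / real n"
  by (simp_all add: dist_real_def add_divide_distrib)
 have "dist u v <= \<bar>dist (fst u) (fst v)\<bar> + \<bar>dist (snd u) (snd v)\<bar>"
  unfolding dist_prod_def by (rule sqrt_sum_squares_le_sum_abs)
 also have "... <= 1 / real n + 1 / real n" using 1 by (intro add_mono) simp_all
 finally show ?thesis by simp
qed

text \<open>Compact subsets of the level sets have positive mutual distance, so that a cell of small diameter meets at most one of them.\<close>

lemma grid_approximation:
 fixes phi :: "point => nat" and p :: nat
 assumes meas: "phi \<in> measurable square (count_space UNIV)" and lt: "!!u. u \<in> unit_square ==> phi u < p" and e: "0 < eps"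
 shows "\<exists>N. \<forall>n\<ge>N. 0 < n \<longrightarrow> (\<exists>alpha. (\<forall>c. alpha c < p) & measure square {u \<in> open_square. phi u ~= alpha (grid_cell n u)} <= eps)"
proof -
 have "(0, 0) \<in> unit_square" by (simp add: unit_square_def)
 from lt[OF this] have p: "0 < p" by linarith
 define A where "A i = {u \<in> open_square. phi u = i}" for i
 have A: "A i \<in> sets square" for i
 proof -
  have "phi -` {i} \<inter> space square \<in> sets square" using meas by (rule measurable_sets) simp
  then have "open_square \<inter> (phi -` {i} \<inter> space square) \<in> sets square" by (rule sets.Int[OF open_square_sets])
  also have "open_square \<inter> (phi -` {i} \<inter> space square) = A i" using open_square_subset by (auto simp: A_def)
  finally show ?thesis .
 qed
 have "\<exists>K. closed K & K \<subseteq> A i & measure square (A i - K) <= eps / p" for i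
 proof -
  have "A i \<in> sets lebesgue" "A i \<subseteq> unit_square" using A[of i] by (simp_all add: sets_square_iff)
  moreover have "0 < eps / p" using e p by simp
  ultimately obtain K where K: "closed K" "K \<subseteq> A i" "A i - K \<in> lmeasurable" "emeasure lebesgue (A i - K) < ennreal (eps / p)"
   using sets_lebesgue_inner_closed by metis
  have "emeasure square (A i - K) = emeasure lebesgue (A i - K)"
   by (rule emeasure_restrict_space) (use \<open>A i \<subseteq> unit_square\<close> in \<open>auto simp: sets_square_iff\<close>)
  then have "measure square (A i - K) <= eps / p"
   using K(4) e by (simp add: measure_def enn2real_leI)
  then show ?thesis using K by blast
 qed
 then have "\<exists>K. \<forall>i. closed (K i) & K i \<subseteq> A i & measure square (A i - K i) <= eps / p" by (intro choice allI)
 then obtain K where K: "\<forall>i. closed (K i) & K i \<subseteq> A i & measure square (A i - K i) <= eps / p" by (rule exE)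
 have Kc: "closed (K i)" and KA: "K i \<subseteq> A i" and Km: "measure square (A i - K i) <= eps / p" for i
  using K[THEN spec, of i] by blast+
 have bo: "bounded (K i)" for i
 proof -
  have "bounded ({0..1} \<times> {0..1} :: point set)" by (intro bounded_Times bounded_closed_interval)
  then show ?thesis by (rule bounded_subset) (use KA[of i] in \<open>auto simp: A_def open_square_def\<close>)
 qed
 have sep: "eventually (%n. \<forall>x\<in>K i. \<forall>y\<in>K j. 2 / real n < dist x y) sequentially" if "i ~= j" for i j
 proof -
  have "K i \<inter> K j = {}" using KA[of i] KA[of j] that by (auto simp: A_def)
  moreover have "compact (K i)" using Kc bo by (simp add: compact_eq_bounded_closed)
  ultimately obtain d where d: "0 < d" "\<forall>x\<in>K i. \<forall>y\<in>K j. d <= dist x y"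
   using separate_compact_closed[of "K i" "K j"] Kc by blast
  have "(%n. 2 / real n) \<longlonglongrightarrow> 0" by real_asymp
  then have "eventually (%n. 2 / real n < d) sequentially" using d(1) by (rule order_tendstoD(2))
  then show ?thesis by (rule eventually_mono) (use d(2) in force)
 qed
 have "eventually (%n. \<forall>z\<in>{z \<in> {..<p} \<times> {..<p}. fst z ~= snd z}. \<forall>x\<in>K (fst z). \<forall>y\<in>K (snd z). 2 / real n < dist x y) sequentially"
  by (rule eventually_ball_finite) (use sep in auto)
 then obtain N where N: "\<forall>n\<ge>N. \<forall>z\<in>{z \<in> {..<p} \<times> {..<p}. fst z ~= snd z}. \<forall>x\<in>K (fst z). \<forall>y\<in>K (snd z). 2 / real n < dist x y"
  unfolding eventually_sequentially by (rule exE)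
 have Nd: "2 / real n < dist x y" if "n \<ge> N" "i < p" "j < p" "i ~= j" "x \<in> K i" "y \<in> K j" for n i j x y
 proof -
  have "(i, j) \<in> {z \<in> {..<p} \<times> {..<p}. fst z ~= snd z}" using that by simp
  from bspec[OF N[THEN spec, THEN mp, OF that(1)] this] show ?thesis using that(5,6) by simp
 qed
 show ?thesis
 proof (intro exI allI impI)
  fix n assume n: "N <= n" "0 < n"
  (* Cells meeting none of the compact sets get the default label 0. *)
 define hit where "hit c i \<longleftrightarrow> i < p & K i \<inter> cell_box n c ~= {}" for c i
  define alpha where "alpha c = (if \<exists>i. hit c i then SOME i. hit c i else 0)" for c
  have ap: "alpha c < p" for c
  proof (cases "\<exists>i. hit c i")
   case True
   then have "hit c (alpha c)" unfolding alpha_def using someI_ex[OF True] by simp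
   then show ?thesis by (simp add: hit_def)
  qed (simp add: alpha_def p)
  have au: "alpha (grid_cell n u) = i" if u: "u \<in> K i" and i: "i < p" for u i
  proof -
   let ?c = "grid_cell n u"
   have uo: "u \<in> open_square" using KA[of i] u by (auto simp: A_def)
   have own: "u \<in> cell_box n ?c" by (rule own_cell[OF n(2) uo])
   then have "hit ?c i" using u i unfolding hit_def by blast
   then have ex: "\<exists>i. hit ?c i" by (rule exI)
   then have h: "hit ?c (alpha ?c)" unfolding alpha_def using someI_ex[OF ex] by simp
   show ?thesis
   proof (rule ccontr)
    assume ne: "alpha ?c ~= i"
    obtain v where v: "v \<in> K (alpha ?c)" "v \<in> cell_box n ?c" using h unfolding hit_def by blast
    have "2 / real n < dist v u" using Nd[OF n(1) ap i ne v(1) u] .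
    moreover have "dist v u <= 2 / real n" by (rule cell_diameter[OF n(2) v(2) own])
    ultimately show False by simp
   qed
  qed
  have sub: "{u \<in> open_square. phi u ~= alpha (grid_cell n u)} \<subseteq> (\<Union>i\<in>{..<p}. A i - K i)"
  proof
   fix u assume u: "u \<in> {u \<in> open_square. phi u ~= alpha (grid_cell n u)}"
   then have uo: "u \<in> open_square" and ne: "phi u ~= alpha (grid_cell n u)" by simp_all
   have l: "phi u < p" using open_square_subset uo by (intro lt) (rule subsetD)
   have "u \<notin> K (phi u)" using au[of u "phi u"] l ne by auto
   then have "u \<in> A (phi u) - K (phi u)" using uo by (simp add: A_def)
   then show "u \<in> (\<Union>i\<in>{..<p}. A i - K i)" using l by (intro UN_I[of "phi u"]) simp_all
  qed
  have s: "A i - K i \<in> sets square" for i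
  proof -
   have "A i \<in> sets lebesgue" "A i \<subseteq> unit_square" using A[of i] by (simp_all add: sets_square_iff)
   moreover have "K i \<in> sets lebesgue" using Kc[of i] by (simp add: borel_closed)
   ultimately show ?thesis unfolding sets_square_iff by (intro conjI sets.Diff) auto
  qed
  have "measure square {u \<in> open_square. phi u ~= alpha (grid_cell n u)} <= measure square (\<Union>i\<in>{..<p}. A i - K i)"
   by (rule square.finite_measure_mono[OF sub]) (intro sets.finite_UN s finite_lessThan)
  also have "... <= (\<Sum>i\<in>{..<p}. measure square (A i - K i))"
   by (rule square.finite_measure_subadditive_finite) (use s in auto)
  also have "... <= (\<Sum>i\<in>{..<p}. eps / p)" by (rule sum_mono) (rule Km)
  also have "... = eps" using p by simp
  finally show "(\<forall>c. alpha c < p) & measure square {u \<in> open_square. phi u ~= alpha (grid_cell n u)} <= eps" using ap by blast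
 qed
qed

text \<open>The mass of a label within a vertical strip of width \<open>1/q\<close>.\<close>

definition label_mass :: "nat => (point => nat) => nat \<times> nat => real" where
 "label_mass q phi z = measure square {u \<in> open_square. (nat \<lfloor>real q * fst u\<rfloor>, phi u) = z}"

lemma strip_of_cell:
 assumes "0 < m" "u \<in> open_square"
 shows "fst (grid_cell (q * m) u) div m = nat \<lfloor>real q * fst u\<rfloor>"
proof -
 have "\<lfloor>real q * fst u\<rfloor> = \<lfloor>(real (q * m) * fst u) / real_of_int (int m)\<rfloor>" using assms by simp
 also have "... = \<lfloor>real (q * m) * fst u\<rfloor> div int m" by (rule floor_divide_real_eq_div) simp
 finally have "\<lfloor>real q * fst u\<rfloor> = \<lfloor>real (q * m) * fst u\<rfloor> div int m" .
 moreover have "0 <= fst u" using assms(2) by (auto simp: open_square_def)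
 ultimately show ?thesis by (simp add: grid_cell_def nat_div_distrib)
qed

text \<open>After approximating both labellings by constants on the cells of a fine grid, the cells in each vertical strip are permuted so as to match labels. Points stay in their strip, so the shift is at most the width \<open>1/q\<close>.\<close>

lemma label_transport:
 fixes phi psi :: "point => nat"
 assumes m1: "phi \<in> measurable square (count_space UNIV)" and l1: "!!u. u \<in> unit_square ==> phi u < p"
  and m2: "psi \<in> measurable square (count_space UNIV)" and l2: "!!u. u \<in> unit_square ==> psi u < p"
  and q: "0 < q" and e: "0 < eps"
 obtains f where "f \<in> mp_bijections" "!!u. u \<in> unit_square ==> \<bar>fst u - fst (f u)\<bar> <= 1 / q"
  "measure square {u \<in> unit_square. phi u ~= psi (f u)} <= (\<Sum>z\<in>{..<q} \<times> {..<p}. \<bar>label_mass q phi z - label_mass q psi z\<bar>) + eps"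
proof -
 (* Two exceptional sets, and two approximations of each of the q p masses. *)
 define eps' where "eps' = eps / (2 + 2 * real (q * p))"
 have "0 <= real (q * p)" by (rule of_nat_0_le_iff)
 then have d: "0 < 2 + 2 * real (q * p)" by linarith
 have e': "0 < eps'" unfolding eps'_def by (rule divide_pos_pos[OF e d])
 have ee: "eps' * (2 + 2 * real (q * p)) = eps" unfolding eps'_def using d by (metis less_irrefl nonzero_eq_divide_eq)
 obtain N1 where N1: "\<forall>n\<ge>N1. 0 < n \<longrightarrow> (\<exists>alpha. (\<forall>c. alpha c < p) & measure square {u \<in> open_square. phi u ~= alpha (grid_cell n u)} <= eps')"
  using grid_approximation[OF m1 l1 e'] by (rule exE)
 obtain N2 where N2: "\<forall>n\<ge>N2. 0 < n \<longrightarrow> (\<exists>alpha. (\<forall>c. alpha c < p) & measure square {u \<in> open_square. psi u ~= alpha (grid_cell n u)} <= eps')"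
  using grid_approximation[OF m2 l2 e'] by (rule exE)
 (* The grid size is a multiple of q, so that every cell lies in one strip. *)
 define m where "m = Suc (max N1 N2)"
 define n where "n = q * m"
 have m: "0 < m" and n: "0 < n" using q by (simp_all add: m_def n_def)
 have "m <= n" using q by (simp add: n_def)
 then have nN: "N1 <= n" "N2 <= n" by (auto simp: m_def)
 obtain alpha where a: "\<forall>c. alpha c < p" and am: "measure square {u \<in> open_square. phi u ~= alpha (grid_cell n u)} <= eps'"
  using N1[THEN spec, THEN mp, OF nN(1), THEN mp, OF n] by (elim exE conjE)
 obtain \<beta> where b: "\<forall>c. \<beta> c < p" and bm: "measure square {u \<in> open_square. psi u ~= \<beta> (grid_cell n u)} <= eps'"
  using N2[THEN spec, THEN mp, OF nN(2), THEN mp, OF n] by (elim exE conjE)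
 define s where "s c = fst c div m" for c :: "nat \<times> nat"
 have s: "s c < q" if "c \<in> grid n" for c
  using that unfolding s_def n_def by (auto simp: less_mult_imp_div_less)
 obtain \<pi> where \<pi>: "bij_betw \<pi> (grid n) (grid n)" and s\<pi>: "!!c. c \<in> grid n ==> s (\<pi> c) = s c"
  and mis: "real (card {c \<in> grid n. alpha c ~= \<beta> (\<pi> c)}) \<le>
   (\<Sum>z\<in>{..<q} \<times> {..<p}. \<bar>real (card {c \<in> grid n. (s c, alpha c) = z}) - real (card {c \<in> grid n. (s c, \<beta> c) = z})\<bar>)"
  by (rule strip_label_matching_bijection[of "grid n" alpha p \<beta> s q]) (simp, simp add: a, simp add: b, erule s, rule that)
 define f where "f = grid_map n \<pi>"
 have f: "f \<in> mp_bijections" unfolding f_def by (rule grid_map_mp_bijection[OF n \<pi>])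
 have strip: "s (grid_cell n u) = nat \<lfloor>real q * fst u\<rfloor>" if "u \<in> open_square" for u
  unfolding s_def n_def by (rule strip_of_cell[OF m that])
 have fo: "f u \<in> open_square" and fc: "grid_cell n (f u) = \<pi> (grid_cell n u)" if "u \<in> open_square" for u
  unfolding f_def by (rule grid_map_cell[OF n \<pi> that])+
 have sh: "\<bar>fst u - fst (f u)\<bar> <= 1 / q" if u: "u \<in> unit_square" for u
 proof (cases "u \<in> open_square")
  case True
  define k where "k = nat \<lfloor>real q * fst u\<rfloor>"
  have k': "nat \<lfloor>real q * fst (f u)\<rfloor> = k"
   unfolding strip[OF fo[OF True], symmetric] fc[OF True] s\<pi>[OF grid_cell_in_grid[OF n True]] strip[OF True] k_def ..
  have "0 <= fst u" "0 <= fst (f u)" using True fo[OF True] by (auto simp: open_square_def)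
  then have "real k / real q <= fst u & fst u < (real k + 1) / real q" "real k / real q <= fst (f u) & fst (f u) < (real k + 1) / real q"
   using floor_cell_iff[OF q, of "fst u" k] floor_cell_iff[OF q, of "fst (f u)" k] k' k_def by simp_all
  then show ?thesis by (simp add: add_divide_distrib abs_le_iff)
 next
  case False
  then have "f u = u" unfolding f_def grid_map_def by (simp only: if_False)
  then show ?thesis by simp
 qed
 have mc: "measurable square (count_space UNIV) = measurable square (count_space (UNIV :: nat set))" ..
 have set_pair: "{u \<in> open_square. P (grid_cell n u) (\<gamma> u)} \<in> sets square"
  if g: "\<gamma> \<in> measurable square (count_space UNIV)" for \<gamma> :: "point => nat" and P
 proof -
  have gc: "{u \<in> open_square. grid_cell n u = c} \<in> sets square" for c by (rule measure_cells(1)[OF n])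
  have gg: "\<gamma> -` {i. P c i} \<inter> space square \<in> sets square" for c using g by (rule measurable_sets) simp
  have "(\<Union>c\<in>grid n. {u \<in> open_square. grid_cell n u = c} \<inter> (\<gamma> -` {i. P c i} \<inter> space square)) \<in> sets square"
   by (intro sets.finite_UN sets.Int gc gg) simp
  also have "(\<Union>c\<in>grid n. {u \<in> open_square. grid_cell n u = c} \<inter> (\<gamma> -` {i. P c i} \<inter> space square)) = {u \<in> open_square. P (grid_cell n u) (\<gamma> u)}" (is "?L = ?R")
  proof (rule set_eqI)
   fix u show "u \<in> ?L \<longleftrightarrow> u \<in> ?R"
    using grid_cell_in_grid[OF n, of u] open_square_subset by auto
  qed
  finally show ?thesis .
 qed
 define D1 where "D1 = {u \<in> open_square. phi u ~= alpha (grid_cell n u)}"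
 define D2 where "D2 = {u \<in> open_square. psi u ~= \<beta> (grid_cell n u)}"
 define D3 where "D3 = {u \<in> open_square. alpha (grid_cell n u) ~= \<beta> (\<pi> (grid_cell n u))}"
 have D: "D1 \<in> sets square" "D2 \<in> sets square"
  unfolding D1_def D2_def using set_pair[OF m1, of "%c i. i ~= alpha c"] set_pair[OF m2, of "%c i. i ~= \<beta> c"] by simp_all
 have D3: "D3 \<in> sets square" "measure square D3 = real (card {c \<in> grid n. alpha c ~= \<beta> (\<pi> c)}) / (real n)\<^sup>2"
  unfolding D3_def by (rule measure_cells[OF n])+
 have mass: "\<bar>label_mass q \<gamma> z - real (card {c \<in> grid n. (s c, \<delta> c) = z}) / (real n)\<^sup>2\<bar> <= eps'"
  if g: "\<gamma> \<in> measurable square (count_space UNIV)" and d: "measure square {u \<in> open_square. \<gamma> u ~= \<delta> (grid_cell n u)} <= eps'"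
  for \<gamma> :: "point => nat" and \<delta> z
 proof -
  let ?A = "{u \<in> open_square. (nat \<lfloor>real q * fst u\<rfloor>, \<gamma> u) = z}" and ?B = "{u \<in> open_square. (s (grid_cell n u), \<delta> (grid_cell n u)) = z}"
  let ?D = "{u \<in> open_square. \<gamma> u ~= \<delta> (grid_cell n u)}"
  have Aeq: "?A = {u \<in> open_square. (s (grid_cell n u), \<gamma> u) = z}" by (rule Collect_cong) (use strip in auto)
  have As: "?A \<in> sets square" unfolding Aeq by (rule set_pair[OF g])
  have "\<bar>measure square ?A - measure square ?B\<bar> <= measure square ?D"
  proof (rule measure_diff_le_exceptional[OF As])
   show "?B \<in> sets square" by (rule measure_cells(1)[OF n])
   show "?D \<in> sets square" by (rule set_pair[OF g])
   show "?A \<subseteq> ?B \<union> ?D" "?B \<subseteq> ?A \<union> ?D" unfolding Aeq by auto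
  qed
  also have "measure square ?B = real (card {c \<in> grid n. (s c, \<delta> c) = z}) / (real n)\<^sup>2" by (rule measure_cells(2)[OF n])
  finally show ?thesis using d unfolding label_mass_def by linarith
 qed
 have fm: "f \<in> measurable square square" and fp: "!!A. A \<in> sets square ==> emeasure square (f -` A \<inter> space square) = emeasure square A"
  using grid_map_measure_preserving[OF n \<pi>] unfolding f_def measure_preserving_map_def by auto
 define D4 where "D4 = f -` D2 \<inter> space square"
 have D4: "D4 \<in> sets square" unfolding D4_def using fm D(2) by (rule measurable_sets)
 have D4m: "measure square D4 = measure square D2" unfolding D4_def measure_def using fp[OF D(2)] by simp
 define D0 where "D0 = unit_square - open_square"
 have D0: "D0 \<in> sets square" unfolding D0_def using sets.compl_sets[OF open_square_sets] by simp
 have D0m: "measure square D0 = 0"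
  unfolding D0_def using square.prob_compl[OF open_square_sets] measure_open_square(1) by simp
 have cover: "{u \<in> unit_square. phi u ~= psi (f u)} \<subseteq> D0 \<union> (D1 \<union> (D3 \<union> D4))"
 proof
  fix u assume u: "u \<in> {u \<in> unit_square. phi u ~= psi (f u)}"
  show "u \<in> D0 \<union> (D1 \<union> (D3 \<union> D4))"
  proof (cases "u \<in> open_square")
   case True
   have "phi u ~= alpha (grid_cell n u) \<or> alpha (grid_cell n u) ~= \<beta> (\<pi> (grid_cell n u)) \<or> psi (f u) ~= \<beta> (grid_cell n (f u))"
    using u unfolding fc[OF True] by auto
   then show ?thesis using True fo[OF True] u unfolding D1_def D3_def D4_def D2_def by auto
  qed (use u in \<open>auto simp: D0_def\<close>)
 qed
 have "measure square {u \<in> unit_square. phi u ~= psi (f u)} <= measure square (D0 \<union> (D1 \<union> (D3 \<union> D4)))"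
  by (rule square.finite_measure_mono[OF cover]) (intro sets.Un D0 D D3 D4)
 also have "... <= measure square D0 + (measure square D1 + (measure square D3 + measure square D4))"
  by (intro order_trans[OF measure_Un_le] add_mono order_refl sets.Un D0 D D3 D4)
 also have "... <= 2 * eps' + measure square D3"
  using am bm unfolding D0m D4m D1_def[symmetric] D2_def[symmetric] by linarith
 also have "measure square D3 <= (\<Sum>z\<in>{..<q} \<times> {..<p}. \<bar>label_mass q phi z - label_mass q psi z\<bar> + 2 * eps')"
 proof -
  have "measure square D3 <= (\<Sum>z\<in>{..<q} \<times> {..<p}. \<bar>real (card {c \<in> grid n. (s c, alpha c) = z}) - real (card {c \<in> grid n. (s c, \<beta> c) = z})\<bar>) / (real n)\<^sup>2"
   unfolding D3(2) using mis by (rule divide_right_mono) simp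
  also have "... = (\<Sum>z\<in>{..<q} \<times> {..<p}. \<bar>real (card {c \<in> grid n. (s c, alpha c) = z}) - real (card {c \<in> grid n. (s c, \<beta> c) = z})\<bar> / (real n)\<^sup>2)"
   by (rule sum_divide_distrib)
  also have "... <= (\<Sum>z\<in>{..<q} \<times> {..<p}. \<bar>label_mass q phi z - label_mass q psi z\<bar> + 2 * eps')"
  proof (rule sum_mono)
   fix z
   let ?a = "real (card {c \<in> grid n. (s c, alpha c) = z})" and ?b = "real (card {c \<in> grid n. (s c, \<beta> c) = z})"
   have "\<bar>?a - ?b\<bar> / (real n)\<^sup>2 = \<bar>?a / (real n)\<^sup>2 - ?b / (real n)\<^sup>2\<bar>"
    by (simp add: diff_divide_distrib[symmetric])
   then show "\<bar>?a - ?b\<bar> / (real n)\<^sup>2 <= \<bar>label_mass q phi z - label_mass q psi z\<bar> + 2 * eps'"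
    using mass[OF m1 am, of z] mass[OF m2 bm, of z] by linarith
  qed
  finally show ?thesis .
 qed
 also have "(\<Sum>z\<in>{..<q} \<times> {..<p}. \<bar>label_mass q phi z - label_mass q psi z\<bar> + 2 * eps')
   = (\<Sum>z\<in>{..<q} \<times> {..<p}. \<bar>label_mass q phi z - label_mass q psi z\<bar>) + real (q * p) * (2 * eps')"
  by (simp add: sum.distrib card_cartesian_product)
 finally have "measure square {u \<in> unit_square. phi u ~= psi (f u)} <= (\<Sum>z\<in>{..<q} \<times> {..<p}. \<bar>label_mass q phi z - label_mass q psi z\<bar>) + eps' * (2 + 2 * real (q * p))"
  by (simp only: distrib_left) (simp only: mult_ac add_ac)
 then show ?thesis unfolding ee using f sh by (intro that)
qed

section \<open>Nested labels with prescribed distribution\<close>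

text \<open>The properties inherited by limits of the cumulative counts of labels that are nested by division by \<open>4\<close>.\<close>

definition cumulative_limit :: "(nat => nat => real => real) => bool" where
 "cumulative_limit F \<longleftrightarrow> (\<forall>r i. dyadic_contraction (F r i)) &
   (\<forall>r i q p. p < 2 ^ q \<longrightarrow> dyadic_quotient (F r i) q p <= dyadic_quotient (F r (Suc i)) q p) &
   (\<forall>r q p. p <= 2 ^ q \<longrightarrow> F r 0 (real p / 2 ^ q) = 0 & F r (4 ^ r) (real p / 2 ^ q) = real p / 2 ^ q) &
   (\<forall>r i. F (Suc r) (4 * i) = F r i)"

lemma constant_quotient_density:
 fixes c :: real
 assumes "!!q p. p < 2 ^ q ==> dyadic_quotient F q p = c" "0 <= c" "c <= 1"
 shows "is_dyadic_density F (%_. c)"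
proof -
 have "(\<integral>x. \<bar>dyadic_slope F s x - c\<bar> \<partial>unit_interval) = (\<integral>x. 0 \<partial>unit_interval)" for s
 proof (rule Bochner_Integration.integral_cong[OF refl])
  fix x assume "x \<in> space unit_interval"
  then have x: "0 <= x" "x < 1" by (simp_all add: space_restrict_space)
  have "real (2 ^ s) * x < 2 ^ s" using x by simp
  then have "\<lfloor>real (2 ^ s) * x\<rfloor> < 2 ^ s" by (simp add: floor_less_iff)
  then have "nat \<lfloor>real (2 ^ s) * x\<rfloor> < 2 ^ s" using x by (simp add: nat_less_iff)
  from assms(1)[OF this] show "\<bar>dyadic_slope F s x - c\<bar> = 0" by (simp add: dyadic_slope_def)
 qed
 then show ?thesis unfolding is_dyadic_density_def using assms(2,3) by simp
qed

text \<open>Fubini for the region below a graph.\<close>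

lemma measure_under_graph:
 assumes h: "h \<in> borel_measurable borel" "!!x. 0 <= h x & h x <= (1::real)" and B: "B \<in> sets (borel :: real measure)"
 shows "{u \<in> open_square. fst u \<in> B & snd u < h (fst u)} \<in> sets square"
  "measure square {u \<in> open_square. fst u \<in> B & snd u < h (fst u)} = (\<integral>x. indicator B x * h x \<partial>unit_interval)"
proof -
 let ?A = "{u \<in> open_square. fst u \<in> B & snd u < h (fst u)}"
 let ?P = "lborel \<Otimes>\<^sub>M (lborel :: real measure)"
 have e: "?A = {u \<in> space ?P. fst u \<in> {0..<1} \<inter> B & snd u \<in> {0..<1} & snd u < h (fst u)}"
  by (auto simp: open_square_def space_pair_measure)
 have hm: "(%u. h (fst u)) \<in> borel_measurable ?P"
  by (rule measurable_compose[OF measurable_fst]) (use h in simp)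
 have Bs: "{0..<1} \<inter> B \<in> sets lborel" using B by simp
 have A: "?A \<in> sets ?P"
 proof -
  have 1: "{u \<in> space ?P. fst u \<in> {0..<1} \<inter> B} \<in> sets ?P"
   using measurable_sets[OF measurable_fst Bs, of "lborel :: real measure"] by (simp add: vimage_def Int_def conj_commute)
  have 2: "{u \<in> space ?P. snd u \<in> {0..<1}} \<in> sets ?P"
  proof -
   have "{0..<1} \<in> sets (lborel :: real measure)" by simp
   from measurable_sets[OF measurable_snd[of lborel lborel] this]
   show ?thesis by (simp add: vimage_def Int_def conj_commute)
  qed
  have 3: "{u \<in> space ?P. snd u < h (fst u)} \<in> sets ?P" by (rule borel_measurable_less[OF _ hm]) simp
  have "?A = {u \<in> space ?P. fst u \<in> {0..<1} \<inter> B} \<inter> ({u \<in> space ?P. snd u \<in> {0..<1}} \<inter> {u \<in> space ?P. snd u < h (fst u)})"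
   unfolding e by auto
  then show ?thesis using 1 2 3 by (simp only:) (intro sets.Int)
 qed
 then have Al: "?A \<in> sets lborel" by (simp only: lborel_prod)
 then have "?A \<in> sets lebesgue" by (rule sets_completionI_sets)
 then show As: "?A \<in> sets square" unfolding sets_square_iff by (auto simp: open_square_def unit_square_def)
 have sect: "emeasure lborel (Pair x -` ?A) = ennreal (indicator ({0..<1} \<inter> B) x * h x)" for x
 proof (cases "x \<in> {0..<1} \<inter> B")
  case True
  then have e: "Pair x -` ?A = {0..<h x}" using h(2)[of x] by (auto simp: open_square_def)
  show ?thesis unfolding e using True h(2)[of x] by simp
 next
  case False
  then have e: "Pair x -` ?A = {}" by (auto simp: open_square_def)
  show ?thesis unfolding e using False by simp
 qed
 have im: "(%x. indicator ({0..<1} \<inter> B) x * h x) \<in> borel_measurable lborel" using h(1) Bs by measurable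
 have ii: "integrable lborel (%x. indicator ({0..<1} \<inter> B) x * h x)"
 proof (rule Bochner_Integration.integrable_bound)
  show "integrable lborel (indicator {0..<1} :: real => real)" by (rule integrable_real_indicator) simp_all
  show "AE x in lborel. norm (indicator ({0..<1} \<inter> B) x * h x) <= norm (indicator {0..<1} x :: real)"
   using h(2) by (intro AE_I2) (auto simp: indicator_def)
 qed (rule im)
 have "emeasure square ?A = emeasure lebesgue ?A" using As by (intro emeasure_restrict_space) (auto simp: sets_square_iff)
 also have "... = emeasure ?P ?A" using Al by (simp add: lborel_prod)
 also have "... = (\<integral>\<^sup>+x. emeasure lborel (Pair x -` ?A) \<partial>lborel)" by (rule lborel.emeasure_pair_measure_alt[OF A])
 also have "... = (\<integral>\<^sup>+x. ennreal (indicator ({0..<1} \<inter> B) x * h x) \<partial>lborel)" unfolding sect ..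
 also have "... = ennreal (\<integral>x. indicator ({0..<1} \<inter> B) x * h x \<partial>lborel)"
  by (rule nn_integral_eq_integral[OF ii]) (use h(2) in \<open>auto intro!: AE_I2\<close>)
 finally have "measure square ?A = (\<integral>x. indicator ({0..<1} \<inter> B) x * h x \<partial>lborel)"
  using h(2) by (simp add: measure_def integral_nonneg_AE)
 also have "... = (\<integral>x. indicator {0..<1} x *\<^sub>R (indicator B x * h x) \<partial>lborel)"
  by (rule Bochner_Integration.integral_cong[OF refl]) (auto simp: indicator_def)
 also have "... = (\<integral>x. indicator B x * h x \<partial>unit_interval)"
  by (rule integral_restrict_space[symmetric]) simp
 finally show "measure square ?A = (\<integral>x. indicator B x * h x \<partial>unit_interval)" .
qed

text \<open>Inverse transform: the cumulative densities at the first coordinate cut the vertical line into intervals, and the label is the index of the interval of the second coordinate. Taking the densities as functions of the distribution alone makes the labels nested exactly, not just almost everywhere.\<close>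

lemma nested_labels_exist:
 assumes F: "cumulative_limit F"
 obtains psi :: "nat => point => nat" where
  "!!r. psi r \<in> measurable square (count_space UNIV)" "!!r u. psi r u < 4 ^ r" "!!r u. psi (Suc r) u div 4 = psi r u"
  "!!r i q p. i <= 4 ^ r ==> p <= 2 ^ q ==>
   measure square {u \<in> open_square. fst u < real p / 2 ^ q & psi r u < i} = F r i (real p / 2 ^ q)"
proof -
 have dc: "dyadic_contraction (F r i)" for r i using F unfolding cumulative_limit_def by blast
 have mono: "dyadic_quotient (F r i) q p <= dyadic_quotient (F r (Suc i)) q p" if "p < 2 ^ q" for r i q p
  using F that unfolding cumulative_limit_def by blast
 have F0: "F r 0 (real p / 2 ^ q) = 0" and F1: "F r (4 ^ r) (real p / 2 ^ q) = real p / 2 ^ q" if "p <= 2 ^ q" for r q p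
  using F that unfolding cumulative_limit_def by blast+
 have F4: "F (Suc r) (4 * i) = F r i" for r i using F unfolding cumulative_limit_def by blast
 define H where "H r i = (SOME h. is_dyadic_density (F r i) h)" for r i
 have H: "is_dyadic_density (F r i) (H r i)" for r i
 proof -
  have "\<exists>h. is_dyadic_density (F r i) h" by (rule dyadic_density_exists[OF dc])
  then show ?thesis unfolding H_def by (rule someI_ex)
 qed
 have Hm: "H r i \<in> borel_measurable borel" and H01: "0 <= H r i x & H r i x <= 1" for r i x
  using H[of r i] unfolding is_dyadic_density_def by auto
 have H4: "H (Suc r) (4 * i) = H r i" for r i unfolding H_def F4 ..
 (* Almost everywhere the densities of a level are monotone from 0 to 1. *)
 define good where "good x \<longleftrightarrow> (\<forall>r. H r 0 x <= 0 & 1 <= H r (4 ^ r) x & (\<forall>i. H r i x <= H r (Suc i) x))" for x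
 have d0: "is_dyadic_density (F r 0) (%_. 0)" for r
  by (rule constant_quotient_density) (simp_all only: dyadic_quotient_def F0 less_imp_le_nat Suc_leI, simp_all)
 have d1: "is_dyadic_density (F r (4 ^ r)) (%_. 1)" for r
  by (rule constant_quotient_density) (simp_all only: dyadic_quotient_def F1 less_imp_le_nat Suc_leI, simp_all add: diff_divide_distrib[symmetric])
 have ae: "AE x in unit_interval. good x"
  unfolding good_def AE_all_countable
 proof (intro allI AE_conjI)
  fix r
  show "AE x in unit_interval. H r 0 x <= 0" by (rule dyadic_density_mono[OF H d0 dc dc order_refl])
  show "AE x in unit_interval. 1 <= H r (4 ^ r) x" by (rule dyadic_density_mono[OF d1 H dc dc order_refl])
  show "AE x in unit_interval. \<forall>i. H r i x <= H r (Suc i) x" unfolding AE_all_countable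
   by (intro allI) (rule dyadic_density_mono[OF H H dc dc mono])
 qed
 have gm: "Measurable.pred borel good"
 proof -
  note Hm[measurable]
  show ?thesis unfolding good_def by measurable
 qed
 define D where "D = {u \<in> open_square. good (fst u)}"
 have gB: "{x. good x} \<in> sets borel" using gm by (simp add: pred_def)
 have D: "D \<in> sets square" and D1: "measure square D = 1"
 proof -
  have e: "{u \<in> open_square. fst u \<in> {x. good x} & snd u < (%_. 1) (fst u)} = D" by (auto simp: D_def open_square_def)
  note m = measure_under_graph[of "%_. 1 :: real" "{x. good x}", unfolded e]
  show "D \<in> sets square" using m(1) gB by simp
  have "measure square D = (\<integral>x. indicator {x. good x} x * 1 \<partial>unit_interval)" using m(2) gB by simp
  also have "... = (\<integral>x. 1 \<partial>unit_interval)"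
   by (rule integral_cong_AE) (use ae gB in \<open>auto intro!: borel_measurable_indicator measurable_restrict_space1\<close>)
  finally show "measure square D = 1" by (simp only: lebesgue_integral_const unit_interval.prob_space) simp
 qed
 define psi where "psi r u = (if u \<in> D then LEAST j. snd u < H r (Suc j) (fst u) else 0)" for r u
 have iff: "psi r u < i \<longleftrightarrow> snd u < H r i (fst u)" if u: "u \<in> D" and i: "i <= 4 ^ r" for r u i
 proof -
  have g: "good (fst u)" and uo: "u \<in> open_square" using u by (simp_all add: D_def)
  have b: "0 <= snd u" "snd u < 1" using uo by (auto simp: open_square_def)
  have mon: "H r j (fst u) <= H r k (fst u)" if "j <= k" for j k
   using that by (rule lift_Suc_mono_le[of "%i. H r i (fst u)", rotated]) (use g in \<open>simp add: good_def\<close>)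
  have top: "1 <= H r (4 ^ r) (fst u)" and bot: "H r 0 (fst u) <= 0" using g by (simp_all add: good_def)
  have "0 < (4::nat) ^ r" by simp
  then obtain m where m: "4 ^ r = Suc m" by (cases "(4::nat) ^ r") auto
  have ex: "snd u < H r (Suc m) (fst u)" using top b unfolding m by simp
  have L: "snd u < H r (Suc (psi r u)) (fst u)" using LeastI[of "%j. snd u < H r (Suc j) (fst u)", OF ex] u by (simp add: psi_def)
  show ?thesis
  proof
   assume "psi r u < i"
   then show "snd u < H r i (fst u)" using mon[of "Suc (psi r u)" i] L by simp
  next
   assume s: "snd u < H r i (fst u)"
   show "psi r u < i"
   proof (cases i)
    case 0
    then show ?thesis using s bot b by simp
   next
    case (Suc j)
    have "psi r u <= j" using s u unfolding psi_def Suc by (simp add: Least_le)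
    then show ?thesis using Suc by simp
   qed
  qed
 qed
 have lt: "psi r u < 4 ^ r" for r u
 proof (cases "u \<in> D")
  case True
  then have "good (fst u)" "snd u < 1" by (auto simp: D_def open_square_def)
  then have "snd u < H r (4 ^ r) (fst u)" unfolding good_def by (meson less_le_trans)
  then show ?thesis using iff[OF True, of "4 ^ r" r] by simp
 qed (simp add: psi_def)
 have nest: "psi (Suc r) u div 4 = psi r u" for r u
 proof (cases "u \<in> D")
  case True
  have "psi (Suc r) u div 4 < i \<longleftrightarrow> psi r u < i" if "i <= 4 ^ r" for i
  proof -
   have "psi (Suc r) u div 4 < i \<longleftrightarrow> psi (Suc r) u < 4 * i" by linarith
   also have "... \<longleftrightarrow> snd u < H r i (fst u)" using iff[OF True, of "4 * i" "Suc r"] that H4[of r i] by simp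
   also have "... \<longleftrightarrow> psi r u < i" using iff[OF True that] by simp
   finally show ?thesis .
  qed
  then have *: "psi (Suc r) u div 4 < i \<longleftrightarrow> psi r u < i" if "i <= 4 ^ r" for i using that .
  have l1: "Suc (psi r u) <= 4 ^ r" using lt[of r u] by simp
  have l2: "Suc (psi (Suc r) u div 4) <= 4 ^ r" using lt[of "Suc r" u] by simp
  show ?thesis using *[OF l1] *[OF l2] by simp
 qed (simp add: psi_def)
 have aeD: "AE u in square. u \<in> D" using D1 D by (intro square.AE_prob_1) 
 have Di: "{u \<in> D. psi r u < i} \<in> sets square" if "i <= 4 ^ r" for r i
 proof -
  have "{u \<in> D. psi r u < i} = D \<inter> {u \<in> open_square. fst u \<in> UNIV & snd u < H r i (fst u)}"
   using iff[OF _ that] by (auto simp: D_def)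
  then show ?thesis using sets.Int[OF D measure_under_graph(1)[OF Hm H01, of UNIV r i]] by simp
 qed
 have ms: "psi r \<in> measurable square (count_space UNIV)" for r
  unfolding measurable_count_space_eq2_countable
 proof (intro conjI ballI)
  fix a :: nat
  have d: "{u \<in> D. psi r u = a} \<in> sets square"
  proof (cases "a < 4 ^ r")
   case True
   have "{u \<in> D. psi r u = a} = {u \<in> D. psi r u < Suc a} - {u \<in> D. psi r u < a}" by auto
   then show ?thesis using sets.Diff[OF Di[of "Suc a" r] Di[of a r]] True by simp
  next
   case False
   then have "{u \<in> D. psi r u = a} = {}" using lt[of r] by auto
   then show ?thesis by (simp only: sets.empty_sets)
  qed
  have "psi r -` {a} \<inter> space square = {u \<in> D. psi r u = a} \<union> (if a = 0 then space square - D else {})"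
  proof (rule set_eqI)
   have z: "psi r u = 0" if "u \<notin> D" for u using that by (simp only: psi_def if_False)
   have DU: "D \<subseteq> unit_square" using sets.sets_into_space[OF D] by simp
   fix u
   show "u \<in> psi r -` {a} \<inter> space square \<longleftrightarrow> u \<in> {u \<in> D. psi r u = a} \<union> (if a = 0 then space square - D else {})"
    by (cases "u \<in> D") (use z[of u] DU in auto)
  qed
  also have "... \<in> sets square" using d D by (intro sets.Un) auto
  finally show "psi r -` {a} \<inter> space square \<in> sets square" .
 qed simp
 have cum: "measure square {u \<in> open_square. fst u < real p / 2 ^ q & psi r u < i} = F r i (real p / 2 ^ q)"
  if i: "i <= 4 ^ r" and p: "p <= 2 ^ q" for r i q p
 proof -
  let ?x = "real p / 2 ^ q"
  have Bs: "{..<?x} \<in> sets borel" by simp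
  have "measure square {u \<in> open_square. fst u < ?x & psi r u < i} = measure square {u \<in> open_square. fst u \<in> {..<?x} & snd u < H r i (fst u)}"
  proof (rule square.finite_measure_eq_AE)
   show "AE u in square. (u \<in> {u \<in> open_square. fst u < ?x & psi r u < i}) = (u \<in> {u \<in> open_square. fst u \<in> {..<?x} & snd u < H r i (fst u)})"
    using aeD
   proof (rule AE_mp, intro AE_I2 impI)
    fix u assume "u \<in> D"
    then show "(u \<in> {u \<in> open_square. fst u < ?x & psi r u < i}) = (u \<in> {u \<in> open_square. fst u \<in> {..<?x} & snd u < H r i (fst u)})"
     using iff[OF _ i, of u] by simp
   qed
   show "{u \<in> open_square. fst u \<in> {..<?x} & snd u < H r i (fst u)} \<in> sets square" by (rule measure_under_graph(1)[OF Hm H01 Bs])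
   have "psi r -` {..<i} \<inter> space square \<in> sets square" using ms by (rule measurable_sets) simp
   moreover have "{u \<in> open_square. fst u \<in> {..<?x} & snd u < (%_. 1) (fst u)} \<in> sets square"
    by (rule measure_under_graph(1)[OF _ _ Bs]) simp_all
   ultimately have "{u \<in> open_square. fst u \<in> {..<?x} & snd u < (%_. 1) (fst u)} \<inter> (psi r -` {..<i} \<inter> space square) \<in> sets square" by (rule sets.Int[rotated])
   also have "{u \<in> open_square. fst u \<in> {..<?x} & snd u < (%_. 1) (fst u)} \<inter> (psi r -` {..<i} \<inter> space square) = {u \<in> open_square. fst u < ?x & psi r u < i}"
    by (auto simp: open_square_def unit_square_def)
   finally show "{u \<in> open_square. fst u < ?x & psi r u < i} \<in> sets square" .
  qed
  also have "... = (\<integral>x. indicator {..<?x} x * H r i x \<partial>unit_interval)" by (rule measure_under_graph(2)[OF Hm H01 Bs])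
  also have "... = F r i ?x" by (rule dyadic_density_integral[OF H dc p])
  finally show ?thesis .
 qed
 show ?thesis by (rule that[OF ms lt nest cum])
qed

section \<open>Cut distance between label-matched kernels\<close>

lemma integral_indicator_pair:
 assumes A: "A \<in> sets square" and B: "B \<in> sets square"
 shows "(\<integral>z. indicator A (fst z) * indicator B (snd z) \<partial>square2) = measure square A * measure square B"
  "integrable square2 (%z. indicator A (fst z) * indicator B (snd z) :: real)"
proof -
 have AB: "A \<times> B \<in> sets square2" using A B by (rule pair_measureI)
 have e: "(%z. indicator A (fst z) * indicator B (snd z) :: real) = indicator (A \<times> B)"
  by (rule ext) (auto simp: indicator_def mem_Times_iff)
 have "emeasure square2 (A \<times> B) = emeasure square A * emeasure square B" by (rule square.emeasure_pair_measure_Times[OF A B])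
 then have "measure square2 (A \<times> B) = measure square A * measure square B" by (simp add: measure_def enn2real_mult)
 then show "(\<integral>z. indicator A (fst z) * indicator B (snd z) \<partial>square2) = measure square A * measure square B"
  unfolding e using sets.sets_into_space[OF AB] by (simp add: Int_absorb2)
 show "integrable square2 (%z. indicator A (fst z) * indicator B (snd z) :: real)"
  unfolding e using AB by (intro integrable_real_indicator) (simp_all add: square2.emeasure_finite less_top[symmetric])
qed

lemma label_pair_measurable:
 fixes g :: "nat => nat => real"
 assumes "\<kappa> \<in> measurable square (count_space UNIV)" "\<kappa>' \<in> measurable square (count_space UNIV)"
 shows "(%z. g (\<kappa> (fst z)) (\<kappa>' (snd z))) \<in> borel_measurable square2"
proof -
 have "(%z. (\<kappa> (fst z), \<kappa>' (snd z))) \<in> measurable square2 (count_space UNIV \<Otimes>\<^sub>M count_space UNIV)"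
  by (intro measurable_Pair measurable_compose[OF measurable_fst assms(1)] measurable_compose[OF measurable_snd assms(2)])
 then have m: "(%z. (\<kappa> (fst z), \<kappa>' (snd z))) \<in> measurable square2 (count_space (UNIV :: (nat \<times> nat) set))"
  by (simp add: pair_measure_countable)
 have "(%x. g (fst x) (snd x)) \<in> borel_measurable (count_space (UNIV :: (nat \<times> nat) set))" by simp
 from measurable_compose[OF m this] show ?thesis by (simp only: fst_conv snd_conv)
qed

lemma integral_square2_labels:
 fixes g :: "nat => nat => real" and \<kappa> :: "point => nat"
 assumes k: "\<kappa> \<in> measurable square (count_space UNIV)" and I: "finite I" "!!u. u \<in> unit_square ==> \<kappa> u \<in> I"
  and S: "S \<in> sets square" and T: "T \<in> sets square"
 shows "(\<integral>z. indicator S (fst z) * indicator T (snd z) * g (\<kappa> (fst z)) (\<kappa> (snd z)) \<partial>square2)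
  = (\<Sum>i\<in>I. \<Sum>j\<in>I. g i j * (measure square {u \<in> S. \<kappa> u = i} * measure square {u \<in> T. \<kappa> u = j}))"
proof -
 let ?A = "%S i. {u \<in> S. \<kappa> u = i}"
 have A: "?A X i \<in> sets square" if X: "X \<in> sets square" for X i
 proof -
  have "\<kappa> -` {i} \<inter> space square \<in> sets square" using k by (rule measurable_sets) simp
  then have "X \<inter> (\<kappa> -` {i} \<inter> space square) \<in> sets square" by (rule sets.Int[OF X])
  also have "X \<inter> (\<kappa> -` {i} \<inter> space square) = ?A X i" using sets.sets_into_space[OF X] by auto
  finally show ?thesis .
 qed
 have "(\<integral>z. indicator S (fst z) * indicator T (snd z) * g (\<kappa> (fst z)) (\<kappa> (snd z)) \<partial>square2)
  = (\<integral>z. (\<Sum>i\<in>I. \<Sum>j\<in>I. g i j * (indicator (?A S i) (fst z) * indicator (?A T j) (snd z))) \<partial>square2)"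
 proof (rule Bochner_Integration.integral_cong[OF refl])
  fix z assume "z \<in> space square2"
  then have z: "fst z \<in> unit_square" "snd z \<in> unit_square" by (simp_all add: space_square2 mem_Times_iff)
  have "(\<Sum>j\<in>I. g i j * (indicator (?A S i) (fst z) * indicator (?A T j) (snd z)))
    = g i (\<kappa> (snd z)) * (indicator (?A S i) (fst z) * indicator T (snd z) :: real)" for i
  proof -
   have "(\<Sum>j\<in>I. g i j * (indicator (?A S i) (fst z) * indicator (?A T j) (snd z))) = (\<Sum>j\<in>I. if j = \<kappa> (snd z) then g i j * (indicator (?A S i) (fst z) * indicator T (snd z)) else 0 :: real)"
    by (rule sum.cong[OF refl]) (auto simp: indicator_def)
   then show ?thesis using I z by (simp add: sum.delta)
  qed
  then have "(\<Sum>i\<in>I. \<Sum>j\<in>I. g i j * (indicator (?A S i) (fst z) * indicator (?A T j) (snd z)))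
    = (\<Sum>i\<in>I. if i = \<kappa> (fst z) then g i (\<kappa> (snd z)) * (indicator S (fst z) * indicator T (snd z)) else 0 :: real)"
   by (intro sum.cong[OF refl]) (auto simp: indicator_def)
  then show "indicator S (fst z) * indicator T (snd z) * g (\<kappa> (fst z)) (\<kappa> (snd z))
   = (\<Sum>i\<in>I. \<Sum>j\<in>I. g i j * (indicator (?A S i) (fst z) * indicator (?A T j) (snd z)))"
   using I z by (simp add: sum.delta mult.commute)
 qed
 also have "... = (\<Sum>i\<in>I. \<integral>z. (\<Sum>j\<in>I. g i j * (indicator (?A S i) (fst z) * indicator (?A T j) (snd z))) \<partial>square2)"
  by (rule Bochner_Integration.integral_sum) (intro Bochner_Integration.integrable_sum integrable_mult_right integral_indicator_pair(2) A S T)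
 also have "... = (\<Sum>i\<in>I. \<Sum>j\<in>I. \<integral>z. g i j * (indicator (?A S i) (fst z) * indicator (?A T j) (snd z)) \<partial>square2)"
  by (intro sum.cong[OF refl] Bochner_Integration.integral_sum integrable_mult_right integral_indicator_pair(2) A S T)
 also have "... = (\<Sum>i\<in>I. \<Sum>j\<in>I. g i j * (measure square (?A S i) * measure square (?A T j)))"
  by (intro sum.cong[OF refl]) (simp only: integral_mult_right_zero integral_indicator_pair(1)[OF A[OF S] A[OF T]])
 finally show ?thesis .
qed

text \<open>Four errors add up: the limit kernel against its step function, the step values against those of the graph, the points with mismatched labels, and the graph against its step function, where the four-cycle density controls the cut norm.\<close>

lemma cut_norm_le_matched_labels:
 fixes psi :: "point => nat" and lb :: "nat => nat" and w w' :: "nat => nat => real" and G :: ordered_graph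
 defines "N \<equiv> num_vertices G"
 assumes W: "kernel_version W KW" and f: "f \<in> mp_bijections"
  and psi: "psi \<in> measurable square (count_space UNIV)" "!!u. psi u < p"
  and w: "!!i j. 0 <= w i j & w i j <= 1" "!!i j. 0 <= w' i j & w' i j <= 1"
  and close: "!!i j. i < p ==> j < p ==> \<bar>w i j - w' i j\<bar> <= \<eta>"
  and bad: "measure square {u \<in> unit_square. psi u ~= lb (quant N (fst (f u)))} <= b"
  and fc: "four_cycle {1..N} (%u v. of_bool (adj G u v) - w' (lb u) (lb v)) <= \<delta> ^ 4" "0 <= \<delta>"
 shows "cut_norm (%(u, v). W (u, v) - graph_orderon G (f u, f v)) \<le>
  (\<integral>z. \<bar>w (psi (fst z)) (psi (snd z)) - KW z\<bar> \<partial>square2) + \<eta> + 2 * b + \<delta>"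
proof -
 have N: "1 <= N" unfolding N_def by (rule num_vertices_ge_1)
 define \<kappa> where "\<kappa> u = quant N (fst (f u))" for u
 have km: "\<kappa> \<in> measurable square (count_space UNIV)"
  unfolding \<kappa>_def by (rule measurable_compose[OF mp_bijection_measurable[OF f] quant_measurable[OF N]])
 have fU: "f u \<in> unit_square" if "u \<in> unit_square" for u
  using f that unfolding mp_bijections_def bij_betw_def by auto
 have kr: "\<kappa> u \<in> {1..N}" if "u \<in> unit_square" for u
  using fU[OF that] unfolding \<kappa>_def by (intro quant_range[OF N]) (auto simp: unit_square_def)
 define mu where "mu u = lb (\<kappa> u)" for u
 have lm: "mu \<in> measurable square (count_space UNIV)"
  unfolding mu_def by (rule measurable_compose[OF km]) simp
 define A where "A i j = (of_bool (adj G i j) :: real)" for i j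
 define K1 where "K1 z = KW z - w (psi (fst z)) (psi (snd z))" for z
 define K2 where "K2 z = w (psi (fst z)) (psi (snd z)) - w' (psi (fst z)) (psi (snd z))" for z
 define K3 where "K3 z = w' (psi (fst z)) (psi (snd z)) - w' (mu (fst z)) (mu (snd z))" for z
 define Y where "Y i j = A i j - w' (lb i) (lb j)" for i j
 define K4 where "K4 z = Y (\<kappa> (fst z)) (\<kappa> (snd z))" for z
 define K where "K z = K1 z + K2 z + K3 z - K4 z" for z
 note KW = kernel_versionD[OF W]
 have meas: "K1 \<in> borel_measurable square2" "K2 \<in> borel_measurable square2" "K3 \<in> borel_measurable square2" "K4 \<in> borel_measurable square2"
  unfolding K1_def K2_def K3_def K4_def
  by (intro borel_measurable_diff KW(1) label_pair_measurable psi(1) lm km)+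
 have bd: "\<bar>K1 z\<bar> <= 1" "\<bar>K2 z\<bar> <= \<eta>" "\<bar>K3 z\<bar> <= 1" "\<bar>K4 z\<bar> <= 1" for z
 proof -
  show "\<bar>K1 z\<bar> <= 1" using KW(2)[of z] w(1)[of "psi (fst z)" "psi (snd z)"] unfolding K1_def by linarith
  show "\<bar>K2 z\<bar> <= \<eta>" unfolding K2_def by (rule close[OF psi(2) psi(2)])
  show "\<bar>K3 z\<bar> <= 1" using w(2)[of "psi (fst z)" "psi (snd z)"] w(2)[of "mu (fst z)" "mu (snd z)"] unfolding K3_def by linarith
  have "0 <= A (\<kappa> (fst z)) (\<kappa> (snd z)) & A (\<kappa> (fst z)) (\<kappa> (snd z)) <= 1" by (simp add: A_def)
  then show "\<bar>K4 z\<bar> <= 1" using w(2)[of "lb (\<kappa> (fst z))" "lb (\<kappa> (snd z))"] unfolding K4_def Y_def by linarith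
 qed
 have Km: "K \<in> borel_measurable square2" unfolding K_def by (intro borel_measurable_add borel_measurable_diff meas)
 have gk: "kernel_version (%(u, v). graph_orderon G (f u, f v)) (%z. graph_kernel G (f (fst z), f (snd z)))"
  by (rule kernel_version_pullback[OF graph_kernel_version f])
 have ae: "AE z in square2. (%(u, v). W (u, v) - graph_orderon G (f u, f v)) z = K z"
  using KW(3) kernel_versionD(3)[OF gk]
 proof (rule AE_mp[OF _ AE_mp[OF _ AE_I2]], intro impI)
  fix z assume 1: "W z = KW z" and 2: "(%(u, v). graph_orderon G (f u, f v)) z = graph_kernel G (f (fst z), f (snd z))"
  have "graph_kernel G (f (fst z), f (snd z)) = A (\<kappa> (fst z)) (\<kappa> (snd z))"
   by (simp add: graph_kernel_def A_def \<kappa>_def N_def)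
  then show "(%(u, v). W (u, v) - graph_orderon G (f u, f v)) z = K z"
   using 1 2 by (simp add: case_prod_unfold K_def K1_def K2_def K3_def K4_def Y_def mu_def)
 qed
 define D where "D = {u \<in> unit_square. psi u ~= mu u}"
 have D: "D \<in> sets square" "measure square D <= b"
 proof -
  have "{u \<in> space square. psi u = mu u} \<in> sets square"
  proof -
   have "psi -` {i} \<inter> space square \<inter> (mu -` {i} \<inter> space square) \<in> sets square" for i
    by (rule sets.Int; rule measurable_sets[OF psi(1)] measurable_sets[OF lm]; simp)
   then have "(\<Union>i\<in>{..<p}. psi -` {i} \<inter> space square \<inter> (mu -` {i} \<inter> space square)) \<in> sets square"
    by (intro sets.finite_UN) simp_all
   also have "(\<Union>i\<in>{..<p}. psi -` {i} \<inter> space square \<inter> (mu -` {i} \<inter> space square)) = {u \<in> space square. psi u = mu u}"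
   proof (rule set_eqI)
    fix u show "u \<in> (\<Union>i\<in>{..<p}. psi -` {i} \<inter> space square \<inter> (mu -` {i} \<inter> space square)) \<longleftrightarrow> u \<in> {u \<in> space square. psi u = mu u}"
     using psi(2)[of u] by auto
   qed
   finally show ?thesis .
  qed
  then have "space square - {u \<in> space square. psi u = mu u} \<in> sets square" by (rule sets.compl_sets)
  also have "space square - {u \<in> space square. psi u = mu u} = D" by (auto simp: D_def)
  finally show "D \<in> sets square" .
  show "measure square D <= b" using bad unfolding D_def mu_def \<kappa>_def .
 qed
 have U: "unit_square \<in> sets square" "measure square unit_square = 1"
  using sets.top[of square] square.prob_space by simp_all
 show ?thesis
 proof (rule cut_norm_least[OF Km ae])
  fix S T assume S: "S \<in> sets square" and T: "T \<in> sets square"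
  let ?a = "%z. indicator S (fst z) * indicator T (snd z) :: real"
  have a01: "0 <= ?a z & ?a z <= 1" for z by (simp add: indicator_def)
  have am: "(%z. ?a z * X z) \<in> borel_measurable square2" if "X \<in> borel_measurable square2" for X
   by (rule weighted_measurable[OF that]) (use S T in auto)
  have ab: "\<bar>?a z * X\<bar> <= \<bar>X\<bar>" for z X using a01[of z] by (simp add: abs_mult mult_left_le_one_le)
  have i1: "integrable square2 (%z. ?a z * K1 z)" "integrable square2 (%z. ?a z * K3 z)" "integrable square2 (%z. ?a z * K4 z)"
   by (rule abs_integral_square2_le(1)[OF am[OF meas(1)] order_trans[OF ab bd(1)]],
     rule abs_integral_square2_le(1)[OF am[OF meas(3)] order_trans[OF ab bd(3)]],
     rule abs_integral_square2_le(1)[OF am[OF meas(4)] order_trans[OF ab bd(4)]])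
  have i2: "integrable square2 (%z. ?a z * K2 z)" and n2: "\<bar>\<integral>z. ?a z * K2 z \<partial>square2\<bar> <= \<eta>"
   by (rule abs_integral_square2_le[OF am[OF meas(2)] order_trans[OF ab bd(2)]])+
  have n1: "\<bar>\<integral>z. ?a z * K1 z \<partial>square2\<bar> <= (\<integral>z. \<bar>w (psi (fst z)) (psi (snd z)) - KW z\<bar> \<partial>square2)"
  proof -
   have "\<bar>\<integral>z. ?a z * K1 z \<partial>square2\<bar> <= (\<integral>z. \<bar>?a z * K1 z\<bar> \<partial>square2)" by (rule integral_abs_bound)
   also have "... <= (\<integral>z. \<bar>K1 z\<bar> \<partial>square2)"
    by (intro integral_mono integrable_abs i1 abs_integral_square2_le(1)[OF meas(1) bd(1)] ab)
   also have "(%z. \<bar>K1 z\<bar>) = (%z. \<bar>w (psi (fst z)) (psi (snd z)) - KW z\<bar>)" unfolding K1_def by (simp add: abs_minus_commute)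
   finally show ?thesis .
  qed
  have n3: "\<bar>\<integral>z. ?a z * K3 z \<partial>square2\<bar> <= 2 * b"
  proof -
   let ?m = "%z. indicator D (fst z) * indicator unit_square (snd z) + indicator unit_square (fst z) * indicator D (snd z) :: real"
   have "\<bar>\<integral>z. ?a z * K3 z \<partial>square2\<bar> <= (\<integral>z. \<bar>?a z * K3 z\<bar> \<partial>square2)" by (rule integral_abs_bound)
   also have "... <= (\<integral>z. ?m z \<partial>square2)"
   proof (rule integral_mono)
    show "integrable square2 (%z. \<bar>?a z * K3 z\<bar>)" by (intro integrable_abs i1)
    show "integrable square2 ?m" by (intro Bochner_Integration.integrable_add integral_indicator_pair(2) D U)
    fix z assume "z \<in> space square2"
    then have z: "fst z \<in> unit_square" "snd z \<in> unit_square" by (simp_all add: space_square2 mem_Times_iff)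
    have "\<bar>K3 z\<bar> <= ?m z"
    proof (cases "fst z \<in> D \<or> snd z \<in> D")
     case True
     then have "1 <= ?m z" using z by (auto simp: indicator_def)
     then show ?thesis using bd(3)[of z] by linarith
    next
     case False
     then have "K3 z = 0" using z by (simp add: K3_def D_def)
     then show ?thesis by simp
    qed
    then show "\<bar>?a z * K3 z\<bar> <= ?m z" using ab[of z "K3 z"] by linarith
   qed
   also have "... = measure square D + measure square D"
    by (subst Bochner_Integration.integral_add) (intro integral_indicator_pair(2) D U, intro integral_indicator_pair(2) D U,
      simp only: integral_indicator_pair(1)[OF D(1) U(1)] integral_indicator_pair(1)[OF U(1) D(1)] U(2) mult_1_left mult_1_right)
   finally show ?thesis using D(2) by linarith
  qed
  have n4: "\<bar>\<integral>z. ?a z * K4 z \<partial>square2\<bar> <= \<delta>"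
  proof -
   define s where "s X i = real N * measure square {u \<in> X. \<kappa> u = i}" for X i
   have s01: "0 <= s X i & s X i <= 1" if X: "X \<in> sets square" and i: "i \<in> {1..N}" for X i
   proof
    show "0 <= s X i" by (simp add: s_def)
    have kk: "\<kappa> -` {i} \<inter> space square \<in> sets square" using km by (rule measurable_sets) simp
    have ks: "\<kappa> -` {i} \<inter> space square = f -` {u \<in> space square. quant N (fst u) = i} \<inter> space square"
     using fU by (auto simp: \<kappa>_def)
    have "emeasure square (f -` {u \<in> space square. quant N (fst u) = i} \<inter> space square) = emeasure square {u \<in> space square. quant N (fst u) = i}"
     using f measure_quant_column(1)[OF N i] unfolding mp_bijections_def measure_preserving_map_def by blast
    then have "measure square (\<kappa> -` {i} \<inter> space square) = 1 / real N"
     unfolding ks measure_def using measure_quant_column(2)[OF N i] by (simp add: measure_def)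
    moreover have "measure square {u \<in> X. \<kappa> u = i} <= measure square (\<kappa> -` {i} \<inter> space square)"
     using sets.sets_into_space[OF X] by (intro square.finite_measure_mono[OF _ kk]) auto
    ultimately have "measure square {u \<in> X. \<kappa> u = i} <= 1 / real N" by (simp only:)
    then have "real N * measure square {u \<in> X. \<kappa> u = i} <= real N * (1 / real N)" by (rule mult_left_mono) simp
    then show "s X i <= 1" using N by (simp add: s_def)
   qed
   define J where "J = (\<integral>z. ?a z * K4 z \<partial>square2)"
   have "J = (\<Sum>i\<in>{1..N}. \<Sum>j\<in>{1..N}. Y i j * (measure square {u \<in> S. \<kappa> u = i} * measure square {u \<in> T. \<kappa> u = j}))"
    unfolding J_def K4_def by (rule integral_square2_labels[OF km _ kr S T]) simp
   then have "(real N)\<^sup>2 * J = (\<Sum>i\<in>{1..N}. \<Sum>j\<in>{1..N}. s S i * s T j * Y i j)"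
    unfolding s_def by (simp only: sum_distrib_left power2_eq_square) (simp only: mult_ac)
   then have "((real N)\<^sup>2 * J) ^ 4 <= real (card {1..N}) ^ 8 * four_cycle {1..N} Y"
    using weighted_sum_le_four_cycle[of "{1..N}" "s S" "s T" Y] s01[OF S] s01[OF T] by simp
   also have "... <= real N ^ 8 * \<delta> ^ 4" using fc(1) unfolding Y_def A_def by (simp add: mult_left_mono)
   finally have "real N ^ 8 * J ^ 4 <= real N ^ 8 * \<delta> ^ 4" by (simp add: power_mult_distrib power_mult[symmetric])
   then have "J ^ 4 <= \<delta> ^ 4" using N by (simp add: mult_le_cancel_left_pos)
   then have "\<bar>J\<bar> ^ 4 <= \<delta> ^ 4" by (simp add: power_even_abs)
   then have "\<bar>J\<bar> <= \<delta>" using fc(2) by (meson abs_ge_zero not_le power_strict_mono zero_less_numeral)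
   then show ?thesis unfolding J_def .
  qed
  have "(\<integral>z. ?a z * K z \<partial>square2) = (\<integral>z. (?a z * K1 z + ?a z * K2 z + ?a z * K3 z) - ?a z * K4 z \<partial>square2)"
   by (rule Bochner_Integration.integral_cong[OF refl]) (simp add: K_def algebra_simps)
  also have "... = (\<integral>z. ?a z * K1 z \<partial>square2) + (\<integral>z. ?a z * K2 z \<partial>square2) + (\<integral>z. ?a z * K3 z \<partial>square2) - (\<integral>z. ?a z * K4 z \<partial>square2)"
   by (simp only: Bochner_Integration.integral_diff Bochner_Integration.integral_add Bochner_Integration.integrable_add i1 i2)
  finally show "\<bar>\<integral>z. ?a z * K z \<partial>square2\<bar> <= (\<integral>z. \<bar>w (psi (fst z)) (psi (snd z)) - KW z\<bar> \<partial>square2) + \<eta> + 2 * b + \<delta>"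
   using n1 n2 n3 n4 by linarith
 qed
qed


text \<open>Inclusion and exclusion in both coordinates.\<close>

lemma label_mass_cumulative:
 assumes m: "phi \<in> measurable square (count_space UNIV)" and q: "0 < q"
 defines "C \<equiv> %k i. measure square {u \<in> open_square. fst u < real k / real q & phi u < i}"
 shows "label_mass q phi (k, i) = C (Suc k) (Suc i) - C k (Suc i) - C (Suc k) i + C k i"
proof -
 let ?S = "%k i. {u \<in> open_square. fst u < real k / real q & phi u < i}"
 have S: "?S k i \<in> sets square" for k i
 proof -
  have s1: "phi -` {..<i} \<inter> space square \<in> sets square" using m by (rule measurable_sets) simp
  have s2: "fst -` {..<real k / real q} \<inter> space square \<in> sets square" using fst_measurable_square(1) by (rule measurable_sets) simp
  have "open_square \<inter> ((fst -` {..<real k / real q} \<inter> space square) \<inter> (phi -` {..<i} \<inter> space square)) \<in> sets square"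
   by (rule sets.Int[OF open_square_sets sets.Int[OF s2 s1]])
  also have "open_square \<inter> ((fst -` {..<real k / real q} \<inter> space square) \<inter> (phi -` {..<i} \<inter> space square)) = ?S k i"
   using open_square_subset by auto
  finally show ?thesis .
 qed
 have le: "real k / real q <= real (Suc k) / real q" by (simp add: divide_right_mono)
 have "label_mass q phi (k, i) = measure square ((?S (Suc k) (Suc i) - ?S k (Suc i)) - (?S (Suc k) i - ?S k i))"
  unfolding label_mass_def
 proof (rule arg_cong[where f = "measure square"], rule set_eqI)
  fix u
  show "u \<in> {u \<in> open_square. (nat \<lfloor>real q * fst u\<rfloor>, phi u) = (k, i)} \<longleftrightarrow> u \<in> (?S (Suc k) (Suc i) - ?S k (Suc i)) - (?S (Suc k) i - ?S k i)"
  proof (cases "u \<in> open_square")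
   case True
   then have "0 <= fst u" by (auto simp: open_square_def)
   from floor_cell_iff[OF q this, of k] show ?thesis using True by (auto simp: less_Suc_eq add.commute)
  qed simp
 qed
 also have "... = measure square (?S (Suc k) (Suc i) - ?S k (Suc i)) - measure square (?S (Suc k) i - ?S k i)"
  by (rule square.finite_measure_Diff) (intro sets.Diff S, intro sets.Diff S, use le in auto)
 also have "measure square (?S (Suc k) (Suc i) - ?S k (Suc i)) = C (Suc k) (Suc i) - C k (Suc i)"
  unfolding C_def by (rule square.finite_measure_Diff[OF S S]) (use le in auto)
 also have "measure square (?S (Suc k) i - ?S k i) = C (Suc k) i - C k i"
  unfolding C_def by (rule square.finite_measure_Diff[OF S S]) (use le in auto)
 finally show ?thesis by simp
qed

text \<open>The vertex columns are intervals of length \<open>1/N\<close>, so the region left of \<open>x\<close> cuts at most one of them.\<close>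

lemma cumulative_column_count:
 fixes lb :: "nat => nat" and x :: real
 assumes N: "1 <= N" and x: "0 <= x" "x <= 1"
 shows "\<bar>measure square {u \<in> open_square. fst u < x & lb (quant N (fst u)) < i} -
   real (card {v \<in> {1..N}. real v <= x * real N & lb v < i}) / real N\<bar> <= 1 / real N"
proof -
 let ?col = "%v. {u \<in> space square. quant N (fst u) = v}"
 let ?V = "{v \<in> {1..N}. real v <= x * real N & lb v < i}"
 let ?A = "{u \<in> open_square. fst u < x & lb (quant N (fst u)) < i}"
 let ?B = "\<Union>v\<in>?V. ?col v"
 note qm = quant_measurable[OF N]
 have col: "?col v \<in> sets square" for v
 proof -
  have "(%u. quant N (fst u)) -` {v} \<inter> space square \<in> sets square" using qm by (rule measurable_sets) simp
  then show ?thesis by (simp add: vimage_def Int_def conj_commute)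
 qed
 have B: "?B \<in> sets square" by (intro sets.finite_UN col) simp
 have Bm: "measure square ?B = real (card ?V) / real N"
 proof -
  have "measure square ?B = (\<Sum>v\<in>?V. measure square (?col v))"
   by (rule square.finite_measure_finite_Union) (use col in \<open>auto simp: disjoint_family_on_def\<close>)
  also have "... = (\<Sum>v\<in>?V. 1 / real N)" by (rule sum.cong[OF refl]) (rule measure_quant_column(2)[OF N], simp)
  finally show ?thesis by simp
 qed
 have A: "?A \<in> sets square"
 proof -
  have s1: "(%u. quant N (fst u)) -` {v. lb v < i} \<inter> space square \<in> sets square" using qm by (rule measurable_sets) simp
  have s2: "fst -` {..<x} \<inter> space square \<in> sets square" using fst_measurable_square(1) by (rule measurable_sets) simp
  have "open_square \<inter> ((fst -` {..<x} \<inter> space square) \<inter> ((%u. quant N (fst u)) -` {v. lb v < i} \<inter> space square)) \<in> sets square"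
   by (rule sets.Int[OF open_square_sets sets.Int[OF s2 s1]])
  also have "open_square \<inter> ((fst -` {..<x} \<inter> space square) \<inter> ((%u. quant N (fst u)) -` {v. lb v < i} \<inter> space square)) = ?A"
   using open_square_subset by auto
  finally show ?thesis .
 qed
 let ?v0 = "nat \<lfloor>x * real N\<rfloor> + 1"
 let ?Z = "{u \<in> space square. fst u \<in> {0, x}} \<union> (unit_square - open_square)"
 have Zx: "{u \<in> space square. fst u \<in> {0, x}} \<in> sets square" "measure square {u \<in> space square. fst u \<in> {0, x}} = 0"
  using measure_vertical_strip[of "{0, x}"] x by (simp_all add: measure_def emeasure_lborel_countable)
 have Zo: "unit_square - open_square \<in> sets square" "measure square (unit_square - open_square) = 0"
  using sets.compl_sets[OF open_square_sets] square.prob_compl[OF open_square_sets] measure_open_square(1) by simp_all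
 have c0: "measure square (?col ?v0) <= 1 / real N"
 proof (cases "?v0 \<in> {1..N}")
  case True
  from measure_quant_column(2)[OF N True] show ?thesis by simp
 next
  case False
  have "?col ?v0 = {}"
  proof (rule ccontr)
   assume "?col ?v0 ~= {}"
   then obtain u where u: "u \<in> unit_square" "quant N (fst u) = ?v0" by auto
   then have "quant N (fst u) \<in> {1..N}" by (intro quant_range[OF N]) (auto simp: unit_square_def)
   then show False using False u(2) by simp
  qed
  then show ?thesis by (simp only: measure_empty) simp
 qed
 have qv: "real v - 1 < real N * fst u & real N * fst u <= real v" if "0 < fst u" "quant N (fst u) = v" for u :: point and v
 proof -
  have "v = nat \<lceil>real N * fst u\<rceil>" using that by (simp add: quant_def)
  moreover have "0 < real N * fst u" using that N by simp
  ultimately show ?thesis by linarith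
 qed
 have "\<bar>measure square ?A - measure square ?B\<bar> <= measure square (?Z \<union> ?col ?v0)"
 proof (rule measure_diff_le_exceptional[OF A B])
  show "?Z \<union> ?col ?v0 \<in> sets square" by (intro sets.Un Zx Zo col)
  show "?A \<subseteq> ?B \<union> (?Z \<union> ?col ?v0)"
  proof
   fix u assume u: "u \<in> ?A"
   then have uo: "u \<in> open_square" and ux: "fst u < x" and ul: "lb (quant N (fst u)) < i" by simp_all
   have us: "u \<in> unit_square" using uo open_square_subset by blast
   define v where "v = quant N (fst u)"
   have v: "v \<in> {1..N}" unfolding v_def using us by (intro quant_range[OF N]) (auto simp: unit_square_def)
   show "u \<in> ?B \<union> (?Z \<union> ?col ?v0)"
   proof (cases "fst u = 0")
    case False
    then have "0 < fst u" using us by (auto simp: unit_square_def)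
    from qv[OF this v_def[symmetric]] have b: "real v - 1 < real N * fst u" ..
    have "real N * fst u < real N * x" using ux N by simp
    then have b2: "real v - 1 < x * real N" using b by (simp add: mult.commute)
    show ?thesis
    proof (cases "real v <= x * real N")
     case True
     then have "v \<in> ?V" using v ul by (simp add: v_def)
     moreover have "u \<in> ?col v" using us by (simp add: v_def)
     ultimately show ?thesis by blast
    next
     case False
     then have "\<lfloor>x * real N\<rfloor> = int v - 1" using b2 by (simp add: floor_eq_iff)
     then have "v = ?v0" using v by auto
     then have "u \<in> ?col ?v0" using us v_def by simp
     then show ?thesis by blast
    qed
   qed (use us in auto)
  qed
  show "?B \<subseteq> ?A \<union> (?Z \<union> ?col ?v0)"
  proof
   fix u assume "u \<in> ?B"
   then obtain v where v: "v \<in> ?V" "u \<in> ?col v" by blast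
   then have us: "u \<in> unit_square" "quant N (fst u) = v" by simp_all
   show "u \<in> ?A \<union> (?Z \<union> ?col ?v0)"
   proof (cases "u \<in> open_square & 0 < fst u & fst u ~= x")
    case True
    then have "real N * fst u <= real v" using qv[OF _ us(2)] by blast
    also have "... <= real N * x" using v(1) by (simp add: mult.commute)
    finally have "fst u <= x" using N by simp
    then have "u \<in> ?A" using True v(1) us(2) by simp
    then show ?thesis by blast
   next
    case False
    have "0 <= fst u" using us(1) by (auto simp: unit_square_def)
    then show ?thesis using False us(1) by auto
   qed
  qed
 qed
 also have "... <= measure square ?Z + measure square (?col ?v0)" by (intro measure_Un_le sets.Un Zx Zo col)
 also have "measure square ?Z <= measure square {u \<in> space square. fst u \<in> {0, x}} + measure square (unit_square - open_square)"
  by (intro measure_Un_le Zx Zo)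
 finally show ?thesis unfolding Bm Zx(2) Zo(2) using c0 by linarith
qed

lemma cut_shift_dist_bounds:
 assumes W: "W \<in> orderons" and U: "U \<in> orderons"
 shows "0 <= cut_shift_dist W U"
  "f \<in> mp_bijections ==> cut_shift_dist W U <= shift f + cut_norm (%(u, v). W (u, v) - U (f u, f v))"
proof -
 obtain K where K: "kernel_version W K" by (rule orderon_kernel_version[OF W])
 obtain L where L: "kernel_version U L" by (rule orderon_kernel_version[OF U])
 have nn: "0 <= shift f + cut_norm (%(u, v). W (u, v) - U (f u, f v))" if "f \<in> mp_bijections" for f
  using shift_nonneg(1)[OF that] cut_norm_nonneg[OF K L that] by linarith
 have "mp_bijections ~= {}" using id_mp_bijection by blast
 then show "0 <= cut_shift_dist W U" unfolding cut_shift_dist_def by (rule cINF_greatest) (rule nn)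
 show "f \<in> mp_bijections ==> cut_shift_dist W U <= shift f + cut_norm (%(u, v). W (u, v) - U (f u, f v))"
  unfolding cut_shift_dist_def by (rule cINF_lower) (auto intro!: bdd_belowI2[of _ 0] nn)
qed

text \<open>First a level with small regularity defect, then a narrow strip width are fixed; for these finitely many quantities convergence makes the matching of labels almost perfect.\<close>

lemma labelled_graphs_converge:
 fixes H :: "nat => ordered_graph" and lb :: "nat => nat => nat => nat" and w :: "nat => nat => nat => real" and wn :: "nat => nat => nat => nat => real"
 defines "N \<equiv> %n. num_vertices (H n)"
 assumes W: "W \<in> orderons" "kernel_version W KW"
  and psi: "!!r. psi r \<in> measurable square (count_space UNIV)" "!!r u. psi r u < 4 ^ r"
  and big: "filterlim N at_top sequentially"
  and lab: "!!n r v. lb n r v < 4 ^ r"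
  and w01: "!!r i j. 0 <= w r i j & w r i j <= 1" "!!n r i j. 0 <= wn n r i j & wn n r i j <= 1"
  and wlim: "!!r i j. (%n. wn n r i j) \<longlonglongrightarrow> w r i j"
  and cum: "!!r i q p. i <= 4 ^ r ==> p <= 2 ^ q ==>
   (%n. real (card {v \<in> {1..N n}. real v <= real p / 2 ^ q * real (N n) & lb n r v < i}) / real (N n))
    \<longlonglongrightarrow> measure square {u \<in> open_square. fst u < real p / 2 ^ q & psi r u < i}"
  and L1: "(%r. \<integral>z. \<bar>w r (psi r (fst z)) (psi r (snd z)) - KW z\<bar> \<partial>square2) \<longlonglongrightarrow> 0"
  and fc: "!!r. (%n. four_cycle {1..N n} (%u v. of_bool (adj (H n) u v) - wn n r (lb n r u) (lb n r v))) \<longlonglongrightarrow> s r"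
  and s0: "s \<longlonglongrightarrow> 0"
 shows "(%n. cut_shift_dist W (graph_orderon (H n))) \<longlonglongrightarrow> 0"
proof (rule LIMSEQ_I)
 fix eps :: real assume e: "0 < eps"
 define \<eta> where "\<eta> = eps / 8"
 have h: "0 < \<eta>" using e by (simp add: \<eta>_def)
 have "eventually (%r. (\<integral>z. \<bar>w r (psi r (fst z)) (psi r (snd z)) - KW z\<bar> \<partial>square2) < \<eta> & s r < \<eta> ^ 4) sequentially"
  using h by (intro eventually_conj order_tendstoD(2)[OF L1] order_tendstoD(2)[OF s0]) simp_all
 then obtain r where r1: "(\<integral>z. \<bar>w r (psi r (fst z)) (psi r (snd z)) - KW z\<bar> \<partial>square2) < \<eta>" and r2: "s r < \<eta> ^ 4"
  unfolding eventually_sequentially by blast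
 have "(%t. 1 / 2 ^ t :: real) \<longlonglongrightarrow> 0" by real_asymp
 then have "eventually (%t. 1 / 2 ^ t < \<eta>) sequentially" using h by (rule order_tendstoD(2))
 then obtain t where t: "1 / 2 ^ t < \<eta>" unfolding eventually_sequentially by blast
 define q :: nat where "q = 2 ^ t"
 have q: "0 < q" "1 / real q < \<eta>" using t by (simp_all add: q_def)
 define p :: nat where "p = 4 ^ r"
 define phi where "phi n u = lb n r (quant (N n) (fst u))" for n and u :: point
 have N1: "1 <= N n" for n unfolding N_def by (rule num_vertices_ge_1)
 have phim: "phi n \<in> measurable square (count_space UNIV)" for n
  unfolding phi_def by (rule measurable_compose[OF quant_measurable[OF N1]]) simp
 have invN: "(%n. 1 / real (N n)) \<longlonglongrightarrow> 0"
 proof -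
  have "filterlim (%n. real (N n)) at_top sequentially" by (rule filterlim_compose[OF filterlim_real_sequentially big])
  from tendsto_inverse_0_at_top[OF this] show ?thesis by (simp add: inverse_eq_divide)
 qed
 have Clim: "(%n. measure square {u \<in> open_square. fst u < real k / real q & phi n u < i}) \<longlonglongrightarrow> measure square {u \<in> open_square. fst u < real k / real q & psi r u < i}"
  if k: "k <= q" and i: "i <= p" for k i
 proof -
  let ?x = "real k / real q"
  let ?c = "%n. real (card {v \<in> {1..N n}. real v <= ?x * real (N n) & lb n r v < i}) / real (N n)"
  have x: "0 <= ?x" "?x <= 1" using k q by simp_all
  have c: "?c \<longlonglongrightarrow> measure square {u \<in> open_square. fst u < ?x & psi r u < i}"
   using cum[of i r k t] k i by (simp add: q_def p_def)
  have "(%n. measure square {u \<in> open_square. fst u < ?x & phi n u < i} - ?c n) \<longlonglongrightarrow> 0"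
   by (rule Lim_null_comparison[OF _ invN], rule always_eventually)
    (use cumulative_column_count[OF N1 x] in \<open>simp add: phi_def\<close>)
  from tendsto_add[OF this c] show ?thesis by simp
 qed
 have mlim: "(%n. label_mass q (phi n) z) \<longlonglongrightarrow> label_mass q (psi r) z" if "z \<in> {..<q} \<times> {..<p}" for z
 proof -
  obtain k i where zk: "z = (k, i)" by (cases z)
  then have z: "z = (k, i)" "k < q" "i < p" using that by simp_all
  show ?thesis unfolding z(1) label_mass_cumulative[OF phim q(1)] label_mass_cumulative[OF psi(1) q(1)]
   by (intro tendsto_add tendsto_diff Clim) (use z in auto)
 qed
 have "(%n. \<Sum>z\<in>{..<q} \<times> {..<p}. \<bar>label_mass q (psi r) z - label_mass q (phi n) z\<bar>) \<longlonglongrightarrow> (\<Sum>z\<in>{..<q} \<times> {..<p}. \<bar>label_mass q (psi r) z - label_mass q (psi r) z\<bar>)"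
  by (intro tendsto_sum tendsto_rabs tendsto_diff tendsto_const mlim)
 then have "(%n. \<Sum>z\<in>{..<q} \<times> {..<p}. \<bar>label_mass q (psi r) z - label_mass q (phi n) z\<bar>) \<longlonglongrightarrow> 0" by simp
 then have e1: "eventually (%n. (\<Sum>z\<in>{..<q} \<times> {..<p}. \<bar>label_mass q (psi r) z - label_mass q (phi n) z\<bar>) < \<eta> / 2) sequentially"
  by (rule order_tendstoD(2)) (simp add: h)
 have e2: "eventually (%n. \<forall>z\<in>{..<p} \<times> {..<p}. \<bar>w r (fst z) (snd z) - wn n r (fst z) (snd z)\<bar> < \<eta>) sequentially"
 proof (rule eventually_ball_finite)
  show "\<forall>z\<in>{..<p} \<times> {..<p}. eventually (%n. \<bar>w r (fst z) (snd z) - wn n r (fst z) (snd z)\<bar> < \<eta>) sequentially"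
  proof
   fix z
   have "(%n. \<bar>w r (fst z) (snd z) - wn n r (fst z) (snd z)\<bar>) \<longlonglongrightarrow> \<bar>w r (fst z) (snd z) - w r (fst z) (snd z)\<bar>"
    by (intro tendsto_rabs tendsto_diff tendsto_const wlim)
   then show "eventually (%n. \<bar>w r (fst z) (snd z) - wn n r (fst z) (snd z)\<bar> < \<eta>) sequentially"
    using h by (intro order_tendstoD(2)) simp_all
  qed
 qed simp
 have e3: "eventually (%n. four_cycle {1..N n} (%u v. of_bool (adj (H n) u v) - wn n r (lb n r u) (lb n r v)) < \<eta> ^ 4) sequentially"
  by (rule order_tendstoD(2)[OF fc r2])
 have "eventually (%n. norm (cut_shift_dist W (graph_orderon (H n)) - 0) < eps) sequentially"
  using e1 e2 e3
 proof eventually_elim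
  case (elim n)
  obtain f where f: "f \<in> mp_bijections" "!!u. u \<in> unit_square ==> \<bar>fst u - fst (f u)\<bar> <= 1 / q"
   and fb: "measure square {u \<in> unit_square. psi r u ~= phi n (f u)} <= (\<Sum>z\<in>{..<q} \<times> {..<p}. \<bar>label_mass q (psi r) z - label_mass q (phi n) z\<bar>) + \<eta> / 2"
  proof (rule label_transport[of "psi r" p "phi n" q "\<eta> / 2"])
   show "psi r \<in> measurable square (count_space UNIV)" by (rule psi(1))
   show "phi n \<in> measurable square (count_space UNIV)" by (rule phim)
   show "psi r u < p" "phi n u < p" for u using psi(2)[of r u] lab by (simp_all add: p_def phi_def)
   show "0 < q" "0 < \<eta> / 2" using q h by simp_all
  qed (rule that)
  have sh: "shift f <= \<eta>" unfolding shift_def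
  proof (rule cSUP_least)
   show "unit_square ~= {}" by (auto simp: unit_square_def)
   fix u assume "u \<in> unit_square"
   from f(2)[OF this] q(2) show "\<bar>fst u - fst (f u)\<bar> <= \<eta>" by linarith
  qed
  have "cut_norm (%(u, v). W (u, v) - graph_orderon (H n) (f u, f v)) \<le>
   (\<integral>z. \<bar>w r (psi r (fst z)) (psi r (snd z)) - KW z\<bar> \<partial>square2) + \<eta> + 2 * \<eta> + \<eta>"
  proof (rule cut_norm_le_matched_labels[where lb = "lb n r" and w' = "wn n r" and p = p, OF W(2) f(1) psi(1)])
   show "psi r u < p" for u using psi(2) by (simp add: p_def)
   show "\<bar>w r i j - wn n r i j\<bar> <= \<eta>" if "i < p" "j < p" for i j
    using bspec[OF elim(2), of "(i, j)"] that by simp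
   show "measure square {u \<in> unit_square. psi r u ~= lb n r (quant (num_vertices (H n)) (fst (f u)))} <= \<eta>"
    using fb elim(1) unfolding phi_def N_def by linarith
   show "four_cycle {1..num_vertices (H n)} (%u v. of_bool (adj (H n) u v) - wn n r (lb n r u) (lb n r v)) <= \<eta> ^ 4"
    using elim(3) unfolding N_def by linarith
  qed (use w01 h in auto)
  then have "shift f + cut_norm (%(u, v). W (u, v) - graph_orderon (H n) (f u, f v)) < eps"
   using sh r1 h unfolding \<eta>_def by linarith
  then have "cut_shift_dist W (graph_orderon (H n)) < eps"
   using cut_shift_dist_bounds(2)[OF W(1) graph_orderon_orderon f(1)] by (rule le_less_trans[rotated])
  then show ?case using cut_shift_dist_bounds(1)[OF W(1) graph_orderon_orderon, of "H n"] by simp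
 qed
 then show "\<exists>no. \<forall>n\<ge>no. norm (cut_shift_dist W (graph_orderon (H n)) - 0) < eps" unfolding eventually_sequentially .
qed

section \<open>The limit orderon of a sequence of labelled graphs\<close>

lemma refined_label:
 fixes L :: "nat => 'a => nat"
 assumes "!!r u. L (Suc r) u div 4 = L r u" "r <= s"
 shows "L s u div 4 ^ (s - r) = L r u"
 using assms(2)
proof (induction s rule: dec_induct)
 case (step s)
 have "L (Suc s) u div 4 ^ (Suc s - r) = (L (Suc s) u div 4) div 4 ^ (s - r)"
  using step.hyps by (simp add: Suc_diff_le div_mult2_eq)
 then show ?case using step.IH assms(1) by simp
qed simp

text \<open>The step functions are nested averages in the limit. Symmetrizing the limit kernel gives an orderon and does not increase the distance, because the step functions are symmetric.\<close>

lemma limit_orderon_exists: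
 fixes psi :: "nat => point => nat" and w :: "nat => nat => nat => real"
 defines "\<mu> \<equiv> %r i. measure square {u \<in> unit_square. psi r u = i}"
 assumes psi: "!!r. psi r \<in> measurable square (count_space UNIV)" "!!r u. psi r u < 4 ^ r" "!!r u. psi (Suc r) u div 4 = psi r u"
  and w: "!!r i j. 0 <= w r i j & w r i j <= 1" "!!r i j. w r i j = w r j i"
  and proj: "!!r s. r <= s ==>
   (\<Sum>i<4 ^ s. \<Sum>j<4 ^ s. (w r (i div 4 ^ (s - r)) (j div 4 ^ (s - r)) * w s i j) * (\<mu> s i * \<mu> s j)) =
   (\<Sum>i<4 ^ s. \<Sum>j<4 ^ s. (w r (i div 4 ^ (s - r)) (j div 4 ^ (s - r)))\<^sup>2 * (\<mu> s i * \<mu> s j))"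
 obtains W KW where "W \<in> orderons" "kernel_version W KW"
  "(%r. \<integral>z. \<bar>w r (psi r (fst z)) (psi r (snd z)) - KW z\<bar> \<partial>square2) \<longlonglongrightarrow> 0"
proof -
 let ?W = "%r z. w r (psi r (fst z)) (psi r (snd z))"
 have U: "unit_square \<in> sets square" using sets.top[of square] by simp
 have fin: "(\<integral>z. g (psi s (fst z)) (psi s (snd z)) \<partial>square2) = (\<Sum>i<4 ^ s. \<Sum>j<4 ^ s. g i j * (\<mu> s i * \<mu> s j))" for g s
 proof -
  have "(\<integral>z. g (psi s (fst z)) (psi s (snd z)) \<partial>square2) =
    (\<integral>z. indicator unit_square (fst z) * indicator unit_square (snd z) * g (psi s (fst z)) (psi s (snd z)) \<partial>square2)"
   by (rule Bochner_Integration.integral_cong[OF refl]) (auto simp: space_square2)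
  also have "... = (\<Sum>i<4 ^ s. \<Sum>j<4 ^ s. g i j * (\<mu> s i * \<mu> s j))"
   unfolding \<mu>_def by (rule integral_square2_labels[OF psi(1) _ _ U U]) (simp_all add: psi(2))
  finally show ?thesis .
 qed
 have Wm: "?W r \<in> borel_measurable square2" for r by (rule label_pair_measurable[OF psi(1) psi(1)])
 have W01: "0 <= ?W r z & ?W r z <= 1" for r z by (rule w(1))
 have pr: "(\<integral>z. ?W r z * ?W s z \<partial>square2) = (\<integral>z. (?W r z)\<^sup>2 \<partial>square2)" if rs: "r <= s" for r s
  using proj[OF rs] unfolding fin[of "%i j. w r (i div 4 ^ (s - r)) (j div 4 ^ (s - r)) * w s i j" s, symmetric]
   fin[of "%i j. (w r (i div 4 ^ (s - r)) (j div 4 ^ (s - r)))\<^sup>2" s, symmetric]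
   refined_label[of psi, OF psi(3) rs] .
 obtain g where g: "g \<in> borel_measurable square2" and g01: "!!z. 0 <= g z & g z <= 1"
  and gl: "(%r. \<integral>z. \<bar>?W r z - g z\<bar> \<partial>square2) \<longlonglongrightarrow> 0"
  by (rule square2.nested_averages_converge[where h = ?W], rule Wm, rule W01, erule pr, rule that)
 define g' where "g' z = g (snd z, fst z)" for z
 have g'm: "g' \<in> borel_measurable square2"
  using measurable_pair_swap[OF g] unfolding g'_def case_prod_unfold .
 define KW where "KW z = (g z + g' z) / 2" for z
 have KWm: "KW \<in> borel_measurable square2" unfolding KW_def using g g'm by simp
 have KW01: "0 <= KW z & KW z <= 1" for z using g01[of z] g01[of "(snd z, fst z)"] unfolding KW_def g'_def by auto
 define W where "W z = (if z \<in> unit_square \<times> unit_square then KW z else undefined)" for z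
 have WK: "kernel_version W KW"
  unfolding kernel_version_def using KWm KW01 by (intro conjI allI AE_I2) (simp_all add: space_square2 W_def)
 have Wo: "W \<in> orderons"
  unfolding orderons_def
 proof (intro CollectI conjI ballI)
  show "W \<in> unit_square \<times> unit_square \<rightarrow>\<^sub>E {0..1}" using KW01 by (auto simp: W_def PiE_iff extensional_def)
  show "W \<in> borel_measurable hypercube"
   by (rule measurable_cong[THEN iffD2, OF _ measurable_hypercube[OF KWm]]) (simp add: W_def)
  show "W (u, v) = W (v, u)" if "u \<in> unit_square" "v \<in> unit_square" for u v
   using that by (simp add: W_def KW_def g'_def)
 qed
 have lim: "(%r. \<integral>z. \<bar>?W r z - KW z\<bar> \<partial>square2) \<longlonglongrightarrow> 0"
 proof (rule Lim_null_comparison[OF always_eventually gl], rule allI)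
  fix r
  define h where "h z = \<bar>?W r z - g z\<bar>" for z
  define h' where "h' z = h (snd z, fst z)" for z
  have hm: "h \<in> borel_measurable square2" unfolding h_def using Wm[of r] g by simp
  have h'm: "h' \<in> borel_measurable square2" using measurable_pair_swap[OF hm] unfolding h'_def case_prod_unfold .
  have hb: "\<bar>h z\<bar> <= 1" for z using W01[of r z] g01[of z] unfolding h_def by linarith
  have hi: "integrable square2 h" by (rule abs_integral_square2_le(1)[OF hm hb])
  have h'i: "integrable square2 h'" by (rule abs_integral_square2_le(1)[OF h'm]) (unfold h'_def, rule hb)
  have sw: "integral\<^sup>L square2 h' = integral\<^sup>L square2 h"
   using square2.integral_product_swap[OF hm] unfolding h'_def case_prod_unfold .
  have km: "(%z. \<bar>?W r z - KW z\<bar>) \<in> borel_measurable square2" using Wm[of r] KWm by simp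
  have kb: "\<bar>\<bar>?W r z - KW z\<bar>\<bar> <= 1" for z using W01[of r z] KW01[of z] by linarith
  have "(\<integral>z. \<bar>?W r z - KW z\<bar> \<partial>square2) <= (\<integral>z. (h z + h' z) / 2 \<partial>square2)"
  proof (rule integral_mono)
   show "integrable square2 (%z. \<bar>?W r z - KW z\<bar>)" by (rule abs_integral_square2_le(1)[OF km kb])
   show "integrable square2 (%z. (h z + h' z) / 2)" using hi h'i by simp
   fix z
   have "?W r (snd z, fst z) = ?W r z" by (simp add: w(2)[of r "psi r (snd z)"])
   moreover have "\<bar>a - (b + c) / 2\<bar> <= (\<bar>a - b\<bar> + \<bar>a - c\<bar>) / 2" for a b c :: real
   proof -
    have "a - (b + c) / 2 = ((a - b) + (a - c)) / 2" by (simp add: diff_divide_distrib add_divide_distrib)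
    then have "\<bar>a - (b + c) / 2\<bar> = \<bar>(a - b) + (a - c)\<bar> / 2" by (simp only: abs_divide abs_numeral)
    also have "... <= (\<bar>a - b\<bar> + \<bar>a - c\<bar>) / 2" by (rule divide_right_mono[OF abs_triangle_ineq]) simp
    finally show ?thesis .
   qed
   ultimately show "\<bar>?W r z - KW z\<bar> <= (h z + h' z) / 2" unfolding h'_def h_def KW_def g'_def by simp
  qed
  also have "... = integral\<^sup>L square2 h" using hi h'i sw by simp
  finally have "(\<integral>z. \<bar>?W r z - KW z\<bar> \<partial>square2) <= (\<integral>z. \<bar>?W r z - g z\<bar> \<partial>square2)" unfolding h_def .
  then show "norm (\<integral>z. \<bar>?W r z - KW z\<bar> \<partial>square2) <= (\<integral>z. \<bar>?W r z - g z\<bar> \<partial>square2)"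
   by (simp add: integral_nonneg_AE)
 qed
 show ?thesis by (rule that[OF Wo WK lim])
qed

lemma sum_over_labels:
 fixes L :: "'a => nat" and g :: "nat => nat => real"
 assumes V: "finite V" and L: "!!v. v \<in> V ==> L v < p"
 shows "(\<Sum>u\<in>V. \<Sum>v\<in>V. g (L u) (L v)) = (\<Sum>i<p. \<Sum>j<p. g i j * (real (card {v \<in> V. L v = i}) * real (card {v \<in> V. L v = j})))"
proof -
 have one: "(\<Sum>v\<in>V. h (L v)) = (\<Sum>i<p. h i * real (card {v \<in> V. L v = i}))" for h :: "nat => real"
 proof -
  have "(\<Sum>v\<in>V. h (L v)) = (\<Sum>i<p. \<Sum>v | v \<in> V & L v = i. h (L v))"
   by (rule sum.group[symmetric]) (use V L in auto)
  also have "... = (\<Sum>i<p. h i * real (card {v \<in> V. L v = i}))" by (rule sum.cong[OF refl]) simp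
  finally show ?thesis .
 qed
 have "(\<Sum>u\<in>V. \<Sum>v\<in>V. g (L u) (L v)) = (\<Sum>u\<in>V. \<Sum>j<p. g (L u) j * real (card {v \<in> V. L v = j}))"
  by (intro sum.cong[OF refl] one)
 also have "... = (\<Sum>i<p. (\<Sum>j<p. g i j * real (card {v \<in> V. L v = j})) * real (card {v \<in> V. L v = i}))"
  by (rule one)
 also have "... = (\<Sum>i<p. \<Sum>j<p. g i j * (real (card {v \<in> V. L v = i}) * real (card {v \<in> V. L v = j})))"
  unfolding sum_distrib_right by (intro sum.cong[OF refl]) simp
 finally show ?thesis .
qed

lemma class_avg_commute:
 assumes "!!u v. G u v = G v u"
 shows "class_avg V G L i j = class_avg V G L j i"
proof -
 have "(\<Sum>u | u \<in> V & L u = i. \<Sum>v | v \<in> V & L v = j. G u v) = (\<Sum>u | u \<in> V & L u = j. \<Sum>v | v \<in> V & L v = i. G u v)"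
  by (subst sum.swap) (intro sum.cong[OF refl], rule assms)
 then show ?thesis unfolding class_avg_def by (simp only: mult.commute)
qed

lemma four_cycle_reindex:
 assumes h: "bij_betw h A B"
 shows "four_cycle A (%u v. X (h u) (h v)) = four_cycle B X"
proof -
 have s: "(\<Sum>u\<in>A. g (h u)) = (\<Sum>u\<in>B. g u)" for g :: "_ => real" by (rule sum.reindex_bij_betw[OF h])
 have c: "card A = card B" by (rule bij_betw_same_card[OF h])
 have "(\<Sum>v\<in>A. \<Sum>v'\<in>A. (\<Sum>u\<in>A. X (h u) (h v) * X (h u) (h v'))\<^sup>2) = (\<Sum>v\<in>A. \<Sum>v'\<in>A. (\<Sum>u\<in>B. X u (h v) * X u (h v'))\<^sup>2)"
  by (intro sum.cong[OF refl] arg_cong[where f = "%x. x\<^sup>2"] s)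
 also have "... = (\<Sum>v\<in>A. \<Sum>v'\<in>B. (\<Sum>u\<in>B. X u (h v) * X u v')\<^sup>2)"
  by (intro sum.cong[OF refl] s[of "%v'. (\<Sum>u\<in>B. X u (h _) * X u v')\<^sup>2"])
 also have "... = (\<Sum>v\<in>B. \<Sum>v'\<in>B. (\<Sum>u\<in>B. X u v * X u v')\<^sup>2)" by (rule s)
 finally show ?thesis unfolding four_cycle_def c by simp
qed

lemma tuple_avg_1: "tuple_avg V 1 (%xs. g (xs ! 0)) = (\<Sum>v\<in>V. g v) / real (card V)"
proof -
 have "bij_betw (%v. [v]) V (tuples V 1)"
  by (rule bij_betwI[where g = "%xs. xs ! 0"]) (auto simp: tuples_def length_Suc_conv)
 from sum.reindex_bij_betw[OF this, of "%xs. g (xs ! 0)"] show ?thesis unfolding tuple_avg_def by simp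
qed

text \<open>In a sample, position is measured by rank instead of by the original vertex. Both orders agree, so the two counts differ by at most the discrepancy of the number of sampled vertices in an initial segment.\<close>

lemma rank_count_close:
 fixes x :: real and P :: "nat => bool"
 assumes S: "finite S" "S ~= {}" and x: "0 <= x" "x <= 1" and y: "0 <= y"
 defines "k \<equiv> card S"
 shows "\<bar>real (card {a \<in> {1..k}. real a <= x * real k & P (sorted_list_of_set S ! (a - 1))}) / real k
   - real (card {v \<in> S. real v <= y & P v}) / real k\<bar>
  <= \<bar>real (card {v \<in> S. real v <= y}) / real k - x\<bar> + 1 / real k"
proof -
 define s where "s a = sorted_list_of_set S ! (a - 1)" for a
 have k: "0 < k" using S by (simp add: k_def card_gt_0_iff)
 have len: "length (sorted_list_of_set S) = k" by (simp add: k_def)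
 have bij: "bij_betw s {1..k} S"
 proof -
  have "bij_betw (%i. sorted_list_of_set S ! i) {..<k} S"
   using bij_betw_nth[of "sorted_list_of_set S" "{..<k}" S] S len by simp
  moreover have "bij_betw (%a. a - 1) {1..k} {..<k}"
   by (rule bij_betwI[where g = Suc]) auto
  ultimately show ?thesis using bij_betw_trans[of "%a. a - 1" "{1..k}" "{..<k}"] unfolding s_def comp_def by blast
 qed
 have smono: "s a < s b" if "a \<in> {1..k}" "b \<in> {1..k}" "a < b" for a b
  using that sorted_wrt_nth_less[OF strict_sorted_list_of_set[of S], of "a - 1" "b - 1"] len unfolding s_def by simp
 define m where "m = card {v \<in> S. real v <= y}"
 have low: "s a <= y \<longleftrightarrow> a <= m" if a: "a \<in> {1..k}" for a
 proof -
  have sS: "s b \<in> S" if "b \<in> {1..k}" for b using bij that by (auto simp: bij_betw_def)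
  have inj: "inj_on s X" if "X \<subseteq> {1..k}" for X using bij that by (auto simp: bij_betw_def intro: inj_on_subset)
  have fin: "finite {v \<in> S. real v <= y}" using S by simp
  show ?thesis
  proof
   assume h: "s a <= y"
   have "s ` {1..a} \<subseteq> {v \<in> S. real v <= y}"
   proof (rule image_subsetI)
    fix b assume b: "b \<in> {1..a}"
    then have bk: "b \<in> {1..k}" using a by auto
    have "s b <= s a" using smono[OF bk a] b by (cases "b = a") auto
    then show "s b \<in> {v \<in> S. real v <= y}" using h sS[OF bk] by simp
   qed
   then have "card (s ` {1..a}) <= m" unfolding m_def by (rule card_mono[OF fin])
   moreover have "card (s ` {1..a}) = a" using card_image[OF inj, of "{1..a}"] a by simp
   ultimately show "a <= m" by simp
  next
   assume am: "a <= m"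
   show "s a <= y"
   proof (rule ccontr)
    assume n: "\<not> s a <= y"
    have "{v \<in> S. real v <= y} \<subseteq> s ` {1..<a}"
    proof
     fix v assume v: "v \<in> {v \<in> S. real v <= y}"
     then obtain b where b: "b \<in> {1..k}" "v = s b" using bij by (auto simp: bij_betw_def)
     have "b < a"
     proof (rule ccontr)
      assume "\<not> b < a"
      then have "s a <= s b" using smono[OF a b(1)] by (cases "b = a") auto
      then show False using n v b by simp
     qed
     then show "v \<in> s ` {1..<a}" using b by auto
    qed
    then have "m <= card (s ` {1..<a})" unfolding m_def by (rule card_mono[rotated]) simp
    also have "... <= card {1..<a}" by (rule card_image_le) simp
    finally have "m <= a - 1" by simp
    moreover have "1 <= a" using a by simp
    ultimately show False using am by arith
   qed
  qed
 qed
 let ?A = "{a \<in> {1..k}. real a <= x * real k & P (s a)}" and ?B = "{a \<in> {1..k}. a <= m & P (s a)}"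
 have mB: "card {v \<in> S. real v <= y & P v} = card ?B"
 proof (rule bij_betw_same_card[symmetric, of s])
  have "s ` ?B = {v \<in> S. real v <= y & P v}"
  proof (intro equalityI subsetI)
   fix v assume "v \<in> s ` ?B"
   then obtain a where "a \<in> {1..k}" "a <= m" "P (s a)" "v = s a" by blast
   then show "v \<in> {v \<in> S. real v <= y & P v}" using low[of a] bij by (auto simp: bij_betw_def)
  next
   fix v assume v: "v \<in> {v \<in> S. real v <= y & P v}"
   then obtain b where b: "b \<in> {1..k}" "v = s b" using bij by (auto simp: bij_betw_def)
   then show "v \<in> s ` ?B" using v low[OF b(1)] by auto
  qed
  moreover have "inj_on s ?B" by (rule inj_on_subset[of s "{1..k}"]) (use bij in \<open>auto simp: bij_betw_def\<close>)
  ultimately show "bij_betw s ?B {v \<in> S. real v <= y & P v}" unfolding bij_betw_def by blast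
 qed
 define t where "t = nat \<lfloor>x * real k\<rfloor>"
 have t: "real t <= x * real k" "x * real k < real t + 1" using x k by (simp_all add: t_def)
 have At: "?A = {a \<in> {1..k}. a <= t & P (s a)}"
 proof -
  have "real a <= x * real k \<longleftrightarrow> a <= t" for a using x by (simp add: t_def le_nat_floor le_nat_iff le_floor_iff)
  then show ?thesis by simp
 qed
 have cl: "card {a \<in> {1..k}. a <= c & P (s a)} <= card {a \<in> {1..k}. a <= d & P (s a)} + (c - d)" for c d
 proof -
  have "{a \<in> {1..k}. a <= c & P (s a)} \<subseteq> {a \<in> {1..k}. a <= d & P (s a)} \<union> {d<..c}" by auto
  then have "card {a \<in> {1..k}. a <= c & P (s a)} <= card ({a \<in> {1..k}. a <= d & P (s a)} \<union> {d<..c})" by (rule card_mono[rotated]) simp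
  also have "... <= card {a \<in> {1..k}. a <= d & P (s a)} + card {d<..c}" by (rule card_Un_le)
  finally show ?thesis by simp
 qed
 have "\<bar>real (card ?A) - real (card ?B)\<bar> <= \<bar>real m - x * real k\<bar> + 1"
  using cl[of t m] cl[of m t] t unfolding At by linarith
 then have "\<bar>real (card ?A) - real (card ?B)\<bar> / real k <= (\<bar>real m - x * real k\<bar> + 1) / real k" by (rule divide_right_mono) simp
 also have "(\<bar>real m - x * real k\<bar> + 1) / real k = \<bar>real m / real k - x\<bar> + 1 / real k"
 proof -
  have "\<bar>real m / real k - x\<bar> = \<bar>(real m - x * real k) / real k\<bar>" using k by (simp add: diff_divide_distrib)
  then show ?thesis by (simp add: add_divide_distrib)
 qed
 also have "\<bar>real (card ?A) - real (card ?B)\<bar> / real k = \<bar>real (card ?A) / real k - real (card ?B) / real k\<bar>"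
  by (simp add: diff_divide_distrib[symmetric])
 finally show ?thesis unfolding mB m_def[symmetric] s_def[symmetric] .
qed


text \<open>Cumulative in both position and label, so that limits are monotone in each.\<close>

definition label_count :: "nat => (nat => nat) => nat => real => real" where
 "label_count N L i x = real (card {v \<in> {1..N}. real v <= x * real N & L v < i}) / real N"

lemma label_count_diff:
 assumes xy: "x <= y" and N: "1 <= N"
 shows "label_count N L i y - label_count N L i x = real (card {v \<in> {1..N}. x * real N < real v & real v <= y * real N & L v < i}) / real N"
proof -
 let ?X = "{v \<in> {1..N}. real v <= x * real N & L v < i}" and ?D = "{v \<in> {1..N}. x * real N < real v & real v <= y * real N & L v < i}"
 have m: "x * real N <= y * real N" using xy by (simp add: mult_right_mono)
 have "{v \<in> {1..N}. real v <= y * real N & L v < i} = ?X \<union> ?D"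
 proof -
  have "real v <= y * real N" if "real v <= x * real N" for v using that m by (rule order_trans)
  then show ?thesis by auto
 qed
 moreover have "card (?X \<union> ?D) = card ?X + card ?D" by (rule card_Un_disjoint) auto
 ultimately show ?thesis unfolding label_count_def by (simp add: diff_divide_distrib[symmetric])
qed

lemma label_count_bounds: "0 <= label_count N L i x & label_count N L i x <= 1"
proof -
 have "card {v \<in> {1..N}. real v <= x * real N & L v < i} <= card {1..N}" by (rule card_mono) auto
 then show ?thesis unfolding label_count_def by (cases "N = 0") (simp_all add: divide_le_eq_1)
qed

lemma label_count_all:
 assumes N: "1 <= N" and x: "0 <= x" "x <= 1" and L: "!!v. L v < p"
 shows "\<bar>label_count N L p x - x\<bar> <= 1 / real N"
proof -
 have "{v \<in> {1..N}. real v <= x * real N & L v < p} = {1..nat \<lfloor>x * real N\<rfloor>}"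
 proof -
  have 1: "real v <= x * real N \<longleftrightarrow> v <= nat \<lfloor>x * real N\<rfloor>" for v using x by (simp add: le_nat_floor le_nat_iff le_floor_iff)
  have "x * real N <= real N" using x by (simp add: mult_left_le_one_le)
  then have "nat \<lfloor>x * real N\<rfloor> <= N" by linarith
  then show ?thesis using 1 L by auto
 qed
 then have e: "label_count N L p x = real (nat \<lfloor>x * real N\<rfloor>) / real N" by (simp add: label_count_def)
 have "0 <= x * real N" using x by simp
 then have "\<bar>real (nat \<lfloor>x * real N\<rfloor>) - x * real N\<bar> <= 1" by linarith
 then have "\<bar>real (nat \<lfloor>x * real N\<rfloor>) - x * real N\<bar> / real N <= 1 / real N" by (rule divide_right_mono) simp
 also have "\<bar>real (nat \<lfloor>x * real N\<rfloor>) - x * real N\<bar> / real N = \<bar>(real (nat \<lfloor>x * real N\<rfloor>) - x * real N) / real N\<bar>" by simp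
 also have "(real (nat \<lfloor>x * real N\<rfloor>) - x * real N) / real N = label_count N L p x - x"
  unfolding e using N by (simp add: diff_divide_distrib)
 finally show ?thesis .
qed

lemma label_count_increment_le:
 assumes "0 <= x" "x <= y" and N: "1 <= N"
 shows "label_count N L i y - label_count N L i x <= (y - x) + 1 / real N"
proof -
 have sub: "{v \<in> {1..N}. x * real N < real v & real v <= y * real N & L v < i} \<subseteq> {nat \<lfloor>x * real N\<rfloor><..nat \<lfloor>y * real N\<rfloor>}"
 proof
  fix v assume "v \<in> {v \<in> {1..N}. x * real N < real v & real v <= y * real N & L v < i}"
  then have v: "x * real N < real v" "real v <= y * real N" by simp_all
  have "0 <= x * real N" using assms(1) by simp
  then show "v \<in> {nat \<lfloor>x * real N\<rfloor><..nat \<lfloor>y * real N\<rfloor>}" using v by (simp add: le_nat_floor nat_less_iff floor_less_iff)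
 qed
 have "card {v \<in> {1..N}. x * real N < real v & real v <= y * real N & L v < i} <= nat \<lfloor>y * real N\<rfloor> - nat \<lfloor>x * real N\<rfloor>"
  using card_mono[OF finite_greaterThanAtMost sub] by (simp only: card_greaterThanAtMost)
 moreover have "0 <= x * real N" "x * real N <= y * real N" using assms by (simp_all add: mult_right_mono)
 ultimately have "real (card {v \<in> {1..N}. x * real N < real v & real v <= y * real N & L v < i}) <= (y * real N - x * real N) + 1" by linarith
 then have "real (card {v \<in> {1..N}. x * real N < real v & real v <= y * real N & L v < i}) / real N <= ((y * real N - x * real N) + 1) / real N"
  by (rule divide_right_mono) simp
 also have "... = (y - x) + 1 / real N" using N by (simp add: add_divide_distrib diff_divide_distrib)
 finally show ?thesis unfolding label_count_diff[OF assms(2) N] .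
qed

lemma label_count_increment_mono:
 assumes "x <= y" "1 <= N" "i <= i'"
 shows "label_count N L i y - label_count N L i x <= label_count N L i' y - label_count N L i' x"
 unfolding label_count_diff[OF assms(1,2)]
 using assms(3) by (intro divide_right_mono of_nat_mono card_mono) auto

lemma label_count_zero: "label_count N L i 0 = 0" "label_count N L 0 x = 0"
proof -
 have "{v \<in> {1..N}. real v <= 0 * real N & L v < i} = {}" by auto
 then have "card {v \<in> {1..N}. real v <= 0 * real N & L v < i} = 0" by (simp only: card.empty)
 then show "label_count N L i 0 = 0" unfolding label_count_def by (simp only: of_nat_0 div_0)
 show "label_count N L 0 x = 0" unfolding label_count_def by simp
qed

text \<open>The limits of cumulative label counts prescribe the labels on the square, and the limits of the class averages prescribe the step functions. The orthogonality of class averages passes to the limit.\<close>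

lemma graph_limit_orderon:
 fixes N :: "nat => nat" and A :: "nat => nat => nat => bool" and L :: "nat => nat => nat => nat"
 defines "wn \<equiv> %n r. class_avg {1..N n} (%u v. of_bool (A n u v)) (L n r)"
 assumes big: "filterlim N at_top sequentially" and N1: "!!n. 1 <= N n"
  and sym: "!!n u v. A n u v = A n v u"
  and L: "!!n r u. L n (Suc r) u div 4 = L n r u" "!!n r u. L n r u < 4 ^ r"
  and cv: "!!r i p q. p <= 2 ^ q ==> convergent (%n. label_count (N n) (L n r) i (real p / 2 ^ q))"
  and wl: "!!r i j. (%n. wn n r i j) \<longlonglongrightarrow> w r i j"
 obtains W KW and psi :: "nat => point => nat" where "W \<in> orderons" "kernel_version W KW"
  "!!r. psi r \<in> measurable square (count_space UNIV)" "!!r u. psi r u < 4 ^ r"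
  "!!r i q p. i <= 4 ^ r ==> p <= 2 ^ q ==> (%n. label_count (N n) (L n r) i (real p / 2 ^ q))
    \<longlonglongrightarrow> measure square {u \<in> open_square. fst u < real p / 2 ^ q & psi r u < i}"
  "(%r. \<integral>z. \<bar>w r (psi r (fst z)) (psi r (snd z)) - KW z\<bar> \<partial>square2) \<longlonglongrightarrow> 0"
proof -
 have invN: "(%n. 1 / real (N n)) \<longlonglongrightarrow> 0"
 proof -
  have "filterlim (%n. real (N n)) at_top sequentially" by (rule filterlim_compose[OF filterlim_real_sequentially big])
  from tendsto_inverse_0_at_top[OF this] show ?thesis by (simp add: inverse_eq_divide)
 qed
 define F where "F r i x = lim (%n. label_count (N n) (L n r) i x)" for r i x
 have Fl: "(%n. label_count (N n) (L n r) i (real p / 2 ^ q)) \<longlonglongrightarrow> F r i (real p / 2 ^ q)" if "p <= 2 ^ q" for r i p q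
  unfolding F_def using cv[OF that] by (simp add: convergent_LIMSEQ_iff)
 have F0: "F r i 0 = 0" "F r 0 x = 0" for r i x unfolding F_def label_count_zero by simp_all
 have step: "real p / 2 ^ q <= real (Suc p) / 2 ^ q" "real (Suc p) / 2 ^ q - real p / 2 ^ q = 1 / 2 ^ q" for p q
  by (simp_all add: divide_right_mono diff_divide_distrib[symmetric])
 have incl: "(%n. label_count (N n) (L n r) i (real (Suc p) / 2 ^ q) - label_count (N n) (L n r) i (real p / 2 ^ q))
   \<longlonglongrightarrow> F r i (real (Suc p) / 2 ^ q) - F r i (real p / 2 ^ q)" if "p < 2 ^ q" for r i p q
 proof (intro tendsto_diff Fl)
  show "Suc p <= 2 ^ q" using that by (rule Suc_leI)
  show "p <= 2 ^ q" using that by (rule less_imp_le)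
 qed
 have F: "cumulative_limit F"
  unfolding cumulative_limit_def
 proof (intro conjI allI impI)
  fix r i
  show "dyadic_contraction (F r i)"
   unfolding dyadic_contraction_def
  proof (intro conjI allI impI)
   show "F r i 0 = 0" by (rule F0)
   fix q p :: nat assume p: "p < 2 ^ q"
   have "0 <= F r i (real (Suc p) / 2 ^ q) - F r i (real p / 2 ^ q)"
    by (rule LIMSEQ_le_const[OF incl[OF p]]) (simp only: label_count_diff[OF step(1) N1], simp)
   then show "0 <= dyadic_quotient (F r i) q p" unfolding dyadic_quotient_def by simp
   have up: "(%n. 1 / 2 ^ q + 1 / real (N n)) \<longlonglongrightarrow> 1 / 2 ^ q + 0" by (intro tendsto_add tendsto_const invN)
   have nn: "0 <= real p / 2 ^ q" by simp
   have "F r i (real (Suc p) / 2 ^ q) - F r i (real p / 2 ^ q) <= 1 / 2 ^ q + 0"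
    by (rule LIMSEQ_le[OF incl[OF p] up]) (use label_count_increment_le[OF nn step(1) N1, unfolded step(2)] in blast)
   then have "2 ^ q * (F r i (real (Suc p) / 2 ^ q) - F r i (real p / 2 ^ q)) <= 2 ^ q * (1 / 2 ^ q)" by (intro mult_left_mono) simp_all
   then show "dyadic_quotient (F r i) q p <= 1" unfolding dyadic_quotient_def by simp
  qed
 next
  fix r i q p :: nat assume p: "p < 2 ^ q"
  have "F r i (real (Suc p) / 2 ^ q) - F r i (real p / 2 ^ q) <= F r (Suc i) (real (Suc p) / 2 ^ q) - F r (Suc i) (real p / 2 ^ q)"
   by (rule LIMSEQ_le[OF incl[OF p] incl[OF p]]) (use label_count_increment_mono[OF step(1) N1, of i "Suc i"] in auto)
  then show "dyadic_quotient (F r i) q p <= dyadic_quotient (F r (Suc i)) q p" unfolding dyadic_quotient_def by (rule mult_left_mono) simp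
 next
  fix r q p :: nat assume p: "p <= 2 ^ q"
  show "F r 0 (real p / 2 ^ q) = 0" by (rule F0)
  have "real p <= 2 ^ q" using p by (metis of_nat_le_iff of_nat_numeral of_nat_power)
  then have x: "0 <= real p / 2 ^ q" "real p / 2 ^ q <= 1" by simp_all
  have "(%n. label_count (N n) (L n r) (4 ^ r) (real p / 2 ^ q) - real p / 2 ^ q) \<longlonglongrightarrow> 0"
   by (rule Lim_null_comparison[OF always_eventually invN]) (use label_count_all[OF N1 x L(2)] in simp)
  then have "(%n. label_count (N n) (L n r) (4 ^ r) (real p / 2 ^ q)) \<longlonglongrightarrow> real p / 2 ^ q" by (rule LIM_zero_cancel)
  with Fl[OF p] show "F r (4 ^ r) (real p / 2 ^ q) = real p / 2 ^ q" by (rule LIMSEQ_unique)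
 next
  fix r i
  have "L n (Suc r) v < 4 * i \<longleftrightarrow> L n r v < i" for n v using L(1)[of n r v] by linarith
  then show "F (Suc r) (4 * i) = F r i" unfolding F_def label_count_def by (intro ext) (simp only:)
 qed
 obtain psi where psi: "!!r. psi r \<in> measurable square (count_space UNIV)" "!!r u. psi r u < 4 ^ r" "!!r u. psi (Suc r) u div 4 = psi r u"
  and cum: "!!r i q p. i <= 4 ^ r ==> p <= 2 ^ q ==> measure square {u \<in> open_square. fst u < real p / 2 ^ q & psi r u < i} = F r i (real p / 2 ^ q)"
  by (rule nested_labels_exist[OF F]) (rule that)
 define \<mu> where "\<mu> r i = measure square {u \<in> unit_square. psi r u = i}" for r i
 have mu: "\<mu> r i = F r (Suc i) 1 - F r i 1" if i: "i < 4 ^ r" for r i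
 proof -
  have s: "{u \<in> unit_square. psi r u = i} \<in> sets square"
  proof -
   have "psi r -` {i} \<inter> space square \<in> sets square" using psi(1) by (rule measurable_sets) simp
   then show ?thesis by (simp add: vimage_def Int_def conj_commute)
  qed
  have fl: "nat \<lfloor>real 1 * fst u\<rfloor> = 0" if "u \<in> open_square" for u using that by (auto simp: open_square_def floor_eq_iff)
  have e: "{u \<in> open_square. (nat \<lfloor>real 1 * fst u\<rfloor>, psi r u) = (0, i)} = open_square \<inter> {u \<in> unit_square. psi r u = i}"
   using fl open_square_subset by auto
  have "\<mu> r i = measure square {u \<in> open_square. (nat \<lfloor>real 1 * fst u\<rfloor>, psi r u) = (0, i)}"
   unfolding \<mu>_def e
  proof (rule square.finite_measure_eq_AE[OF _ s sets.Int[OF open_square_sets s]])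
   show "AE u in square. (u \<in> {u \<in> unit_square. psi r u = i}) = (u \<in> open_square \<inter> {u \<in> unit_square. psi r u = i})"
    using measure_open_square(2) by (rule AE_mp) (rule AE_I2, simp)
  qed
  also have "... = label_mass 1 (psi r) (0, i)" unfolding label_mass_def ..
  also have "... = F r (Suc i) 1 - F r i 1"
   unfolding label_mass_cumulative[OF psi(1) zero_less_one]
   using cum[of "Suc i" r 1 0] cum[of "Suc i" r 0 0] cum[of i r 1 0] cum[of i r 0 0] i F0(1) by simp
  finally show ?thesis .
 qed
 have cl: "(%n. real (card {v \<in> {1..N n}. L n r v = i}) / real (N n)) \<longlonglongrightarrow> \<mu> r i" if i: "i < 4 ^ r" for r i
 proof -
  have "real (card {v \<in> {1..N n}. L n r v = i}) / real (N n) = label_count (N n) (L n r) (Suc i) (real 1 / 2 ^ 0) - label_count (N n) (L n r) i (real 1 / 2 ^ 0)" for n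
  proof -
   have e: "label_count (N n) (L n r) j (real 1 / 2 ^ 0) = real (card {v \<in> {1..N n}. L n r v < j}) / real (N n)" for j
    unfolding label_count_def by (rule arg_cong[where f = "%X. real (card X) / real (N n)"]) auto
   have "{v \<in> {1..N n}. L n r v < Suc i} = {v \<in> {1..N n}. L n r v < i} \<union> {v \<in> {1..N n}. L n r v = i}" by auto
   moreover have "card ({v \<in> {1..N n}. L n r v < i} \<union> {v \<in> {1..N n}. L n r v = i}) = card {v \<in> {1..N n}. L n r v < i} + card {v \<in> {1..N n}. L n r v = i}"
    by (rule card_Un_disjoint) auto
   ultimately show ?thesis unfolding e by (simp add: add_divide_distrib)
  qed
  moreover have "(%n. label_count (N n) (L n r) (Suc i) (real 1 / 2 ^ 0) - label_count (N n) (L n r) i (real 1 / 2 ^ 0)) \<longlonglongrightarrow> F r (Suc i) (real 1 / 2 ^ 0) - F r i (real 1 / 2 ^ 0)"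
   by (intro tendsto_diff Fl) simp_all
  ultimately show ?thesis unfolding mu[OF i] by simp
 qed
 have wn01: "0 <= wn n r i j & wn n r i j <= 1" for n r i j unfolding wn_def by (rule class_avg_bounds) simp
 have w01: "0 <= w r i j & w r i j <= 1" for r i j
 proof
  show "0 <= w r i j" by (rule LIMSEQ_le_const[OF wl]) (use wn01 in blast)
  show "w r i j <= 1" by (rule LIMSEQ_le_const2[OF wl]) (use wn01 in blast)
 qed
 have ws: "w r i j = w r j i" for r i j
 proof (rule LIMSEQ_unique[OF wl])
  have "wn n r i j = wn n r j i" for n unfolding wn_def by (rule class_avg_commute) (simp add: sym)
  then show "(%n. wn n r i j) \<longlonglongrightarrow> w r j i" using wl[of r j i] by simp
 qed
 have proj: "(\<Sum>i<4 ^ s. \<Sum>j<4 ^ s. (w r (i div 4 ^ (s - r)) (j div 4 ^ (s - r)) * w s i j) * (\<mu> s i * \<mu> s j)) =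
   (\<Sum>i<4 ^ s. \<Sum>j<4 ^ s. (w r (i div 4 ^ (s - r)) (j div 4 ^ (s - r)))\<^sup>2 * (\<mu> s i * \<mu> s j))" if rs: "r <= s" for r s
 proof -
  let ?d = "%i. i div 4 ^ (s - r)"
  let ?c = "%n i. real (card {v \<in> {1..N n}. L n s v = i})"
  have rl: "?d (L n s u) = L n r u" for n u by (rule refined_label[of "L n", OF L(1) rs])
  have norm: "(\<Sum>i<4 ^ s. \<Sum>j<4 ^ s. g i j * ((?c n i / real (N n)) * (?c n j / real (N n)))) = (\<Sum>u\<in>{1..N n}. \<Sum>v\<in>{1..N n}. g (L n s u) (L n s v)) / (real (N n))\<^sup>2"
   for g n
   unfolding sum_over_labels[of "{1..N n}" "L n s" "4 ^ s" g, OF finite_atLeastAtMost L(2)] sum_divide_distrib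
   by (intro sum.cong[OF refl]) (simp add: power2_eq_square)
  have eq: "(\<Sum>i<4 ^ s. \<Sum>j<4 ^ s. (wn n r (?d i) (?d j) * wn n s i j) * ((?c n i / real (N n)) * (?c n j / real (N n))))
   = (\<Sum>i<4 ^ s. \<Sum>j<4 ^ s. (wn n r (?d i) (?d j))\<^sup>2 * ((?c n i / real (N n)) * (?c n j / real (N n))))" for n
   unfolding norm[of "%i j. wn n r (?d i) (?d j) * wn n s i j"] norm[of "%i j. (wn n r (?d i) (?d j))\<^sup>2"] rl
   unfolding wn_def by (rule arg_cong[where f = "%x. x / (real (N n))\<^sup>2"]) (rule refinement_product[where L = "L n" and V = "{1..N n}" and r = r and s = s, OF finite_atLeastAtMost L(1) rs])
  have l1: "(%n. \<Sum>i<4 ^ s. \<Sum>j<4 ^ s. (wn n r (?d i) (?d j) * wn n s i j) * ((?c n i / real (N n)) * (?c n j / real (N n))))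
   \<longlonglongrightarrow> (\<Sum>i<4 ^ s. \<Sum>j<4 ^ s. (w r (?d i) (?d j) * w s i j) * (\<mu> s i * \<mu> s j))"
   by (intro tendsto_sum tendsto_mult wl cl) simp_all
  have l2: "(%n. \<Sum>i<4 ^ s. \<Sum>j<4 ^ s. (wn n r (?d i) (?d j))\<^sup>2 * ((?c n i / real (N n)) * (?c n j / real (N n))))
   \<longlonglongrightarrow> (\<Sum>i<4 ^ s. \<Sum>j<4 ^ s. (w r (?d i) (?d j))\<^sup>2 * (\<mu> s i * \<mu> s j))"
   by (intro tendsto_sum tendsto_mult tendsto_power wl cl) simp_all
  show ?thesis using l1 unfolding eq by (rule LIMSEQ_unique[OF _ l2])
 qed
 obtain W KW where W: "W \<in> orderons" "kernel_version W KW"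
  and L1: "(%r. \<integral>z. \<bar>w r (psi r (fst z)) (psi r (snd z)) - KW z\<bar> \<partial>square2) \<longlonglongrightarrow> 0"
  by (rule limit_orderon_exists[of psi w, OF psi w01 ws proj[unfolded \<mu>_def]]) (assumption, rule that)
 have cumlim: "(%n. label_count (N n) (L n r) i (real p / 2 ^ q)) \<longlonglongrightarrow> measure square {u \<in> open_square. fst u < real p / 2 ^ q & psi r u < i}"
  if "i <= 4 ^ r" "p <= 2 ^ q" for r i q p unfolding cum[OF that] by (rule Fl[OF that(2)])
 show ?thesis by (rule that[OF W psi(1,2) cumlim L1])
qed



lemma vanishing_if_square_sums_bounded:
 fixes s :: "nat => real"
 assumes "!!R. (\<Sum>r<R. (s r)\<^sup>2) <= 1"
 shows "s \<longlonglongrightarrow> 0"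
proof -
 have "summable (%r. (s r)\<^sup>2)" by (rule summableI_nonneg_bounded[where x = 1]) (use assms in simp_all)
 then have "(%r. (s r)\<^sup>2) \<longlonglongrightarrow> 0" by (rule summable_LIMSEQ_zero)
 then have "(%r. sqrt ((s r)\<^sup>2)) \<longlonglongrightarrow> sqrt 0" by (rule tendsto_real_sqrt)
 then have "(%r. \<bar>s r\<bar>) \<longlonglongrightarrow> 0" by simp
 then show ?thesis by (rule tendsto_rabs_zero_cancel)
qed

lemma tuple_avg_count:
 assumes "finite V"
 shows "tuple_avg V 1 (%xs. of_bool (P (xs ! 0))) = real (card {v \<in> V. P v}) / real (card V)"
proof -
 have "(\<Sum>v\<in>V. of_bool (P v)) = real (card {v \<in> V. P v})" using assms by (simp add: sum_of_bool_eq Int_def)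
 then show ?thesis using tuple_avg_1[of V "%v. of_bool (P v)"] by simp
qed

definition four_cycle_kernel :: "(nat => nat => real) => nat list => real" where
 "four_cycle_kernel X xs = X (xs ! 2) (xs ! 0) * X (xs ! 2) (xs ! 1) * (X (xs ! 3) (xs ! 0) * X (xs ! 3) (xs ! 1))"

lemma four_cycle_kernel_bound:
 assumes "!!u v. \<bar>X u v\<bar> <= 1"
 shows "\<bar>four_cycle_kernel X xs\<bar> <= 1"
proof -
 have m: "\<bar>a * b\<bar> <= 1" if "\<bar>a\<bar> <= 1" "\<bar>b\<bar> <= 1" for a b :: real
  unfolding abs_mult by (rule mult_le_one[OF that(1) abs_ge_zero that(2)])
 show ?thesis unfolding four_cycle_kernel_def by (intro m assms)
qed

lemma continuity_at_limit:
 assumes cont: "cut_shift_continuous fhat" and W: "W \<in> orderons"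
  and approx: "!!eps. 0 < eps ==> \<exists>k. \<forall>G. num_vertices G \<ge> k \<longrightarrow> \<bar>fhat (graph_orderon G) - f G\<bar> <= eps"
  and big: "filterlim (%n. num_vertices (H n)) at_top sequentially"
  and lim: "(%n. cut_shift_dist W (graph_orderon (H n))) \<longlonglongrightarrow> 0"
 shows "(%n. f (H n)) \<longlonglongrightarrow> fhat W"
proof (rule LIMSEQ_I)
 fix eps :: real assume e: "0 < eps"
 then have e2: "0 < eps / 2" by simp
 obtain \<delta> where d: "0 < \<delta>" "\<forall>U\<in>orderons. cut_shift_dist W U < \<delta> \<longrightarrow> \<bar>fhat W - fhat U\<bar> < eps / 2"
  using cont[unfolded cut_shift_continuous_def, THEN bspec, OF W, THEN spec, THEN mp, OF e2] by (elim exE conjE)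
 obtain k where k: "\<forall>G. num_vertices G \<ge> k \<longrightarrow> \<bar>fhat (graph_orderon G) - f G\<bar> <= eps / 2" using approx[OF e2] by (rule exE)
 have "eventually (%n. norm (f (H n) - fhat W) < eps) sequentially"
  using order_tendstoD(2)[OF lim d(1)] filterlim_at_top[THEN iffD1, OF big, THEN spec, of k]
 proof eventually_elim
  case (elim n)
  have "\<bar>fhat W - fhat (graph_orderon (H n))\<bar> < eps / 2" by (rule d(2)[THEN bspec, OF graph_orderon_orderon, THEN mp, OF elim(1)])
  moreover have "\<bar>fhat (graph_orderon (H n)) - f (H n)\<bar> <= eps / 2" by (rule k[THEN spec, THEN mp, OF elim(2)])
  ultimately show ?case unfolding real_norm_def by linarith
 qed
 then show "\<exists>no. \<forall>n\<ge>no. norm (f (H n) - fhat W) < eps" unfolding eventually_sequentially .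
qed

text \<open>A bad sample that is typical for the cumulative label counts and for the four-cycle densities carries the labels of the graph with the same limit data. On a common subsequence graphs and samples therefore converge to the same orderon, and continuity forces their values together.\<close>

lemma continuous_extension_imp_estimable:
 assumes cont: "cut_shift_continuous fhat"
  and approx: "!!eps. 0 < eps ==> \<exists>k. \<forall>G. num_vertices G \<ge> k \<longrightarrow> \<bar>fhat (graph_orderon G) - f G\<bar> <= eps"
 shows "naturally_estimable f"
proof (rule ccontr)
 assume "\<not> naturally_estimable f"
 then obtain eps \<delta> G where e: "eps > 0" and d: "\<delta> > 0" and Gk: "!!k. 1 <= k ==> k <= num_vertices (G k)"
  and Gbad: "!!k. 1 <= k ==> \<delta> <= subset_avg {1..num_vertices (G k)} k (%S. of_bool (\<bar>f (G k) - f (induced (G k) S)\<bar> > eps))"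
  by (rule not_estimable_witness) (rule that)
 let ?N = "%k. num_vertices (G k)"
 define A where "A k u v = (of_bool (adj (G k) u v) :: real)" for k u v
 define regular where "regular k L \<longleftrightarrow> (\<forall>r u. L (Suc r) u div 4 = L r u) & (\<forall>r u. L r u < 4 ^ r) &
  (\<forall>R. (\<Sum>r<R. (four_cycle {1..?N k} (%u v. A k u v - class_avg {1..?N k} (A k) (L r) (L r u) (L r v)))\<^sup>2) <= 1)"
  for k and L :: "nat => nat => nat"
 have ex: "\<exists>L. regular k L" for k
 proof (rule weak_regularity_labels[of "{1..?N k}" "adj (G k)"])
  show "finite {1..?N k}" "{1..?N k} ~= {}" using num_vertices_ge_1[of "G k"] by simp_all
  show "adj (G k) u v = adj (G k) v u" for u v by (rule adj_sym)
  fix L :: "nat => nat => nat"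
  assume 1: "!!r u. L (Suc r) u div 4 = L r u" and 2: "!!r u. L r u < 4 ^ r"
   and 3: "!!R. (\<Sum>r<R. (four_cycle {1..?N k} (%u v. of_bool (adj (G k) u v) - class_avg {1..?N k} (%u v. of_bool (adj (G k) u v)) (L r) (L r u) (L r v)))\<^sup>2) <= 1"
  have "regular k L" unfolding regular_def A_def by (intro conjI allI 1 2 3)
  then show "\<exists>L. regular k L" by (rule exI[of "regular k"])
 qed
 define L where "L k = (SOME L. regular k L)" for k
 have reg: "regular k (L k)" for k unfolding L_def by (rule someI_ex[OF ex])
 have L1: "L k (Suc r) u div 4 = L k r u" and L2: "L k r u < 4 ^ r" for k r u using reg[of k] unfolding regular_def by simp_all
 define wk where "wk k r = class_avg {1..?N k} (A k) (L k r)" for k r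
 define Y where "Y k r u v = A k u v - wk k r (L k r u) (L k r v)" for k r u v
 define fc where "fc k r = four_cycle {1..?N k} (Y k r)" for k r
 have fcs: "(\<Sum>r<R. (fc k r)\<^sup>2) <= 1" for k R using reg[of k] unfolding regular_def fc_def Y_def wk_def by (elim conjE allE)
 have fc1: "\<bar>fc k r\<bar> <= 1" for k r
 proof -
  have "(fc k r)\<^sup>2 <= (\<Sum>r<Suc r. (fc k r)\<^sup>2)" by (simp add: sum_nonneg)
  then have "(fc k r)\<^sup>2 <= 1\<^sup>2" using fcs[where R = "Suc r"] by (simp only: power_one) (rule order_trans)
  then show ?thesis using abs_le_square_iff[of "fc k r" 1] by simp
 qed
 have wk01: "0 <= wk k r i j & wk k r i j <= 1" for k r i j unfolding wk_def by (rule class_avg_bounds) (simp add: A_def)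
 have Y1: "\<bar>Y k r u v\<bar> <= 1" for k r u v
 proof -
  have "0 <= A k u v & A k u v <= 1" by (simp add: A_def)
  then show ?thesis using wk01[of k r "L k r u" "L k r v"] unfolding Y_def by linarith
 qed
 define kern where "kern k r i x xs = (of_bool (real (xs ! 0) <= x * real (?N k) & L k r (xs ! 0) < i) :: real)"
  for k r i and x :: real and xs :: "nat list"
 (* Statistics of bounded arity whose values on the sample must follow those on the whole graph. *)
 define tests where "tests k t = (case t of (b, r, i, p, q) => if b then kern k r i (real p / 2 ^ q) else four_cycle_kernel (Y k r))"
  for k and t :: "bool \<times> nat \<times> nat \<times> nat \<times> nat"
 obtain S where S: "!!k. 1 <= k ==> S k \<subseteq> {1..?N k} & card (S k) = k & \<bar>f (G k) - f (induced (G k) (S k))\<bar> > eps"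
  and St: "!!j. (%k. tuple_avg (S k) (if fst (from_nat j :: bool \<times> nat \<times> nat \<times> nat \<times> nat) then 1 else 4) (tests k (from_nat j))
   - tuple_avg {1..?N k} (if fst (from_nat j :: bool \<times> nat \<times> nat \<times> nat \<times> nat) then 1 else 4) (tests k (from_nat j))) \<longlonglongrightarrow> 0"
 proof (rule typical_bad_sample[where n = ?N and \<delta> = \<delta> and bad = "%k S. \<bar>f (G k) - f (induced (G k) S)\<bar> > eps"
   and len = "%j. if fst (from_nat j :: bool \<times> nat \<times> nat \<times> nat \<times> nat) then 1 else 4" and g = "%k j. tests k (from_nat j)"])
  show "k <= ?N k" if "1 <= k" for k by (rule Gk[OF that])
  show "\<delta> > 0" by (rule d)
  show "\<delta> <= subset_avg {1..?N k} k (%S. of_bool (\<bar>f (G k) - f (induced (G k) S)\<bar> > eps))" if "1 <= k" for k by (rule Gbad[OF that])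
  fix k j xs
  obtain b r i p q where t: "(from_nat j :: bool \<times> nat \<times> nat \<times> nat \<times> nat) = (b, r, i, p, q)" by (metis surj_pair)
  show "\<bar>tests k (from_nat j) xs\<bar> <= 1"
   unfolding tests_def t using four_cycle_kernel_bound[OF Y1] by (simp add: kern_def)
 qed (rule that)
 have Sf: "finite (S k)" "S k ~= {}" "card (S k) = k" if "1 <= k" for k
  using S[OF that] that by (auto intro: finite_subset)
 have cnt: "(%k. real (card {v \<in> S k. real v <= real p / 2 ^ q * real (?N k) & L k r v < i}) / real (card (S k)) - label_count (?N k) (L k r) i (real p / 2 ^ q)) \<longlonglongrightarrow> 0"
  for r i p q
 proof -
  have "tuple_avg V 1 (kern k r i (real p / 2 ^ q)) = real (card {v \<in> V. real v <= real p / 2 ^ q * real (?N k) & L k r v < i}) / real (card V)" if "finite V" for V k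
   unfolding kern_def by (rule tuple_avg_count[OF that])
  note t = this
  have tg: "tuple_avg {1..?N k} 1 (kern k r i (real p / 2 ^ q)) = label_count (?N k) (L k r) i (real p / 2 ^ q)" for k
   unfolding t[OF finite_atLeastAtMost] label_count_def by simp
  have l: "(%k. tuple_avg (S k) 1 (kern k r i (real p / 2 ^ q)) - label_count (?N k) (L k r) i (real p / 2 ^ q)) \<longlonglongrightarrow> 0"
   using St[of "to_nat (True, r, i, p, q)"] unfolding from_nat_to_nat tests_def by (simp add: tg[unfolded One_nat_def])
  have ev: "eventually (%k. tuple_avg (S k) 1 (kern k r i (real p / 2 ^ q)) - label_count (?N k) (L k r) i (real p / 2 ^ q)
   = real (card {v \<in> S k. real v <= real p / 2 ^ q * real (?N k) & L k r v < i}) / real (card (S k)) - label_count (?N k) (L k r) i (real p / 2 ^ q)) sequentially"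
   using eventually_ge_at_top[of 1] by (rule eventually_mono) (simp only: t[OF Sf(1)])
  show ?thesis by (rule Lim_transform_eventually[OF l ev])
 qed
 have fcl: "(%k. four_cycle (S k) (Y k r) - fc k r) \<longlonglongrightarrow> 0" for r
  using St[of "to_nat (False, r, 0::nat, 0::nat, 0::nat)"] unfolding from_nat_to_nat tests_def fc_def four_cycle_tuple_avg four_cycle_kernel_def[abs_def] by simp
 define c where "c m j = (case (from_nat j :: nat \<times> nat \<times> nat \<times> nat \<times> nat) of (a, r, i, p, q) =>
   if a = 0 then label_count (?N (Suc m)) (L (Suc m) r) i (real p / 2 ^ q) else if a = 1 then wk (Suc m) r i p else fc (Suc m) r)" for m j
 have cb: "\<bar>c m j\<bar> <= 1" for m j
 proof -
  obtain a r i p q where t: "(from_nat j :: nat \<times> nat \<times> nat \<times> nat \<times> nat) = (a, r, i, p, q)" by (metis surj_pair)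
  show ?thesis using label_count_bounds[of "?N (Suc m)" "L (Suc m) r" i "real p / 2 ^ q"] wk01[of "Suc m" r i p] fc1[of "Suc m" r]
   unfolding c_def t by (simp add: abs_le_iff) (smt (verit))?
 qed
 obtain \<sigma> :: "nat => nat" where \<sigma>: "strict_mono \<sigma>" and cc: "!!j. convergent (%n. c (\<sigma> n) j)"
  by (rule diagonal_convergent_subsequence[of c "%_. 1"]) (rule cb, rule that)
 define k where "k n = Suc (\<sigma> n)" for n
 have k1: "1 <= k n" and kn: "n <= k n" for n using seq_suble[OF \<sigma>, of n] by (simp_all add: k_def)
 have kbig: "filterlim k at_top sequentially" by (rule filterlim_at_top_mono[OF filterlim_ident]) (simp add: kn)
 have Nbig: "filterlim (%n. ?N (k n)) at_top sequentially"
  by (rule filterlim_at_top_mono[OF kbig]) (simp add: Gk[OF k1])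
 have c0: "convergent (%n. label_count (?N (k n)) (L (k n) r) i (real p / 2 ^ q))" for r i p q
  using cc[of "to_nat (0::nat, r, i, p, q)"] unfolding c_def from_nat_to_nat k_def by simp
 have c1: "convergent (%n. wk (k n) r i j)" for r i j
  using cc[of "to_nat (1::nat, r, i, j, 0::nat)"] unfolding c_def from_nat_to_nat k_def by simp
 have c2: "convergent (%n. fc (k n) r)" for r
  using cc[of "to_nat (2::nat, r, 0::nat, 0::nat, 0::nat)"] unfolding c_def from_nat_to_nat k_def by simp
 define w where "w r i j = lim (%n. wk (k n) r i j)" for r i j
 define s where "s r = lim (%n. fc (k n) r)" for r
 have wl: "(%n. wk (k n) r i j) \<longlonglongrightarrow> w r i j" for r i j unfolding w_def using c1 by (simp add: convergent_LIMSEQ_iff)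
 have sl: "(%n. fc (k n) r) \<longlonglongrightarrow> s r" for r unfolding s_def using c2 by (simp add: convergent_LIMSEQ_iff)
 have w01: "0 <= w r i j & w r i j <= 1" for r i j
 proof
  show "0 <= w r i j" by (rule LIMSEQ_le_const[OF wl]) (intro exI allI impI conjunct1[OF wk01])
  show "w r i j <= 1" by (rule LIMSEQ_le_const2[OF wl]) (intro exI allI impI conjunct2[OF wk01])
 qed
 have s0: "s \<longlonglongrightarrow> 0"
 proof (rule vanishing_if_square_sums_bounded)
  fix R
  have "(%n. \<Sum>r<R. (fc (k n) r)\<^sup>2) \<longlonglongrightarrow> (\<Sum>r<R. (s r)\<^sup>2)" by (intro tendsto_sum tendsto_power sl)
  then show "(\<Sum>r<R. (s r)\<^sup>2) <= 1" by (rule LIMSEQ_le_const2) (intro exI allI impI fcs)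
 qed
 obtain W KW and psi :: "nat => point => nat" where W: "W \<in> orderons" "kernel_version W KW"
  and psi: "!!r. psi r \<in> measurable square (count_space UNIV)" "!!r u. psi r u < 4 ^ r"
  and cum: "!!r i q p. i <= 4 ^ r ==> p <= 2 ^ q ==> (%n. label_count (?N (k n)) (L (k n) r) i (real p / 2 ^ q))
    \<longlonglongrightarrow> measure square {u \<in> open_square. fst u < real p / 2 ^ q & psi r u < i}"
  and L1lim: "(%r. \<integral>z. \<bar>w r (psi r (fst z)) (psi r (snd z)) - KW z\<bar> \<partial>square2) \<longlonglongrightarrow> 0"
 proof (rule graph_limit_orderon[where N = "%n. ?N (k n)" and A = "%n. adj (G (k n))" and L = "%n. L (k n)" and w = w])
  show "filterlim (%n. ?N (k n)) at_top sequentially" by (rule Nbig)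
  show "1 <= ?N (k n)" for n by (rule num_vertices_ge_1)
  show "adj (G (k n)) u v = adj (G (k n)) v u" for n u v by (rule adj_sym)
  show "L (k n) (Suc r) u div 4 = L (k n) r u" "L (k n) r u < 4 ^ r" for n r u by (rule L1, rule L2)
  show "convergent (%n. label_count (?N (k n)) (L (k n) r) i (real p / 2 ^ q))" for r i p q by (rule c0)
  show "(%n. class_avg {1..?N (k n)} (%u v. of_bool (adj (G (k n)) u v)) (L (k n) r) i j) \<longlonglongrightarrow> w r i j" for r i j
   using wl[of r i j] unfolding wk_def A_def[abs_def] .
 qed (rule that)
 have limG: "(%n. cut_shift_dist W (graph_orderon (G (k n)))) \<longlonglongrightarrow> 0"
 proof (rule labelled_graphs_converge[where H = "%n. G (k n)" and lb = "%n. L (k n)" and w = w and wn = "%n. wk (k n)" and s = s,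
   OF W psi Nbig L2 w01 wk01 wl _ L1lim _ s0])
  show "(%n. real (card {v \<in> {1..?N (k n)}. real v <= real p / 2 ^ q * real (?N (k n)) & L (k n) r v < i}) / real (?N (k n)))
    \<longlonglongrightarrow> measure square {u \<in> open_square. fst u < real p / 2 ^ q & psi r u < i}" if "i <= 4 ^ r" "p <= 2 ^ q" for r i q p
   using cum[OF that] unfolding label_count_def .
  show "(%n. four_cycle {1..?N (k n)} (%u v. of_bool (adj (G (k n)) u v) - wk (k n) r (L (k n) r u) (L (k n) r v))) \<longlonglongrightarrow> s r" for r
   using sl[of r] unfolding fc_def Y_def A_def .
 qed
 define H where "H n = induced (G (k n)) (S (k n))" for n
 note Sk = Sf[OF k1]
 have nH: "num_vertices (H n) = k n" for n unfolding H_def using Sk by (simp add: num_vertices_induced)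
 define pos where "pos n a = sorted_list_of_set (S (k n)) ! (a - 1)" for n a
 have posbij: "bij_betw (pos n) {1..k n} (S (k n))" for n
 proof -
  have "bij_betw (%i. sorted_list_of_set (S (k n)) ! i) {..<k n} (S (k n))"
   by (rule bij_betw_nth) (use Sk[of n] in simp_all)
  moreover have "bij_betw (%a. a - 1) {1..k n} {..<k n}" by (rule bij_betwI[where g = Suc]) auto
  ultimately show ?thesis using bij_betw_trans[of "%a. a - 1" "{1..k n}" "{..<k n}"] unfolding pos_def[abs_def] comp_def by blast
 qed
 have adjH: "adj (H n) a b = adj (G (k n)) (pos n a) (pos n b)" if "a \<in> {1..k n}" "b \<in> {1..k n}" for n a b
  unfolding H_def pos_def using adj_induced[OF Sk(1,2), of a n b "G (k n)"] that Sk(3)[of n] by simp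
 have invk: "(%n. 1 / real (k n)) \<longlonglongrightarrow> 0"
 proof -
  have "filterlim (%n. real (k n)) at_top sequentially" by (rule filterlim_compose[OF filterlim_real_sequentially kbig])
  from tendsto_inverse_0_at_top[OF this] show ?thesis by (simp add: inverse_eq_divide)
 qed
 have scount: "(%n. real (card {v \<in> S (k n). real v <= real p / 2 ^ q * real (?N (k n)) & L (k n) r v < i}) / real (k n) - label_count (?N (k n)) (L (k n) r) i (real p / 2 ^ q)) \<longlonglongrightarrow> 0"
  for r i p q
  using filterlim_compose[OF cnt[of p q r i] kbig] by (simp only: Sk(3))
 have limH: "(%n. cut_shift_dist W (graph_orderon (H n))) \<longlonglongrightarrow> 0"
 proof (rule labelled_graphs_converge[where H = H and lb = "%n r a. L (k n) r (pos n a)" and w = w and wn = "%n. wk (k n)" and s = s,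
   OF W psi _ L2 w01 wk01 wl _ L1lim _ s0])
  show "filterlim (%n. num_vertices (H n)) at_top sequentially" unfolding nH by (rule kbig)
  fix r
  show "(%n. four_cycle {1..num_vertices (H n)} (%a b. of_bool (adj (H n) a b) - wk (k n) r (L (k n) r (pos n a)) (L (k n) r (pos n b)))) \<longlonglongrightarrow> s r"
  proof -
   have "four_cycle {1..k n} (%a b. of_bool (adj (H n) a b) - wk (k n) r (L (k n) r (pos n a)) (L (k n) r (pos n b))) = four_cycle (S (k n)) (Y (k n) r)" for n
   proof -
    have "four_cycle {1..k n} (%a b. of_bool (adj (H n) a b) - wk (k n) r (L (k n) r (pos n a)) (L (k n) r (pos n b)))
     = four_cycle {1..k n} (%a b. Y (k n) r (pos n a) (pos n b))"
     unfolding four_cycle_def Y_def A_def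
     by (rule arg_cong[where f = "%x. x / real (card {1..k n}) ^ 4"]) (intro sum.cong[OF refl] arg_cong[where f = "%x. x\<^sup>2"], simp only: adjH)
    also have "... = four_cycle (S (k n)) (Y (k n) r)" by (rule four_cycle_reindex[OF posbij])
    finally show ?thesis .
   qed
   moreover have "(%n. four_cycle (S (k n)) (Y (k n) r)) \<longlonglongrightarrow> s r"
    using tendsto_add[OF filterlim_compose[OF fcl[of r] kbig] sl[of r]] by simp
   ultimately show ?thesis unfolding nH by simp
  qed
  fix i q p :: nat assume i: "i <= 4 ^ r" and p: "p <= 2 ^ q"
  let ?x = "real p / 2 ^ q"
  have "real p <= 2 ^ q" using p by (metis of_nat_le_iff of_nat_numeral of_nat_power)
  then have x: "0 <= ?x" "?x <= 1" by simp_all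
  define hc where "hc n = real (card {a \<in> {1..k n}. real a <= ?x * real (k n) & L (k n) r (pos n a) < i}) / real (k n)" for n
  define sc where "sc n = real (card {v \<in> S (k n). real v <= ?x * real (?N (k n)) & L (k n) r v < i}) / real (k n)" for n
  define tc where "tc n = real (card {v \<in> S (k n). real v <= ?x * real (?N (k n))}) / real (k n)" for n
  have le: "\<bar>hc n - sc n\<bar> <= \<bar>tc n - ?x\<bar> + 1 / real (k n)" for n
  proof -
   have y: "0 <= ?x * real (?N (k n))" using x by simp
   show ?thesis using rank_count_close[OF Sk(1,2) x y, of n "%v. L (k n) r v < i"] unfolding hc_def sc_def tc_def pos_def Sk(3) .
  qed
  have tl: "tc \<longlonglongrightarrow> ?x"
  proof -
   have "tc n = real (card {v \<in> S (k n). real v <= ?x * real (?N (k n)) & L (k n) r v < 4 ^ r}) / real (k n)" for n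
    unfolding tc_def using L2 by simp
   then have 1: "(%n. tc n - label_count (?N (k n)) (L (k n) r) (4 ^ r) ?x) \<longlonglongrightarrow> 0" using scount[of p q r "4 ^ r"] by simp
   have 2: "(%n. label_count (?N (k n)) (L (k n) r) (4 ^ r) ?x - ?x) \<longlonglongrightarrow> 0"
   proof (rule Lim_null_comparison[OF always_eventually invk], rule allI)
    fix n
    have "\<bar>label_count (?N (k n)) (L (k n) r) (4 ^ r) ?x - ?x\<bar> <= 1 / real (?N (k n))"
     by (rule label_count_all[OF num_vertices_ge_1 x L2])
    also have "... <= 1 / real (k n)" using Gk[OF k1[of n]] k1[of n] by (intro divide_left_mono) simp_all
    finally show "norm (label_count (?N (k n)) (L (k n) r) (4 ^ r) ?x - ?x) <= 1 / real (k n)" by simp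
   qed
   from tendsto_add[OF 1 2] have "(%n. tc n - ?x) \<longlonglongrightarrow> 0" by simp
   then show ?thesis by (rule LIM_zero_cancel)
  qed
  have "(%n. \<bar>tc n - ?x\<bar> + 1 / real (k n)) \<longlonglongrightarrow> \<bar>?x - ?x\<bar> + 0" by (intro tendsto_add tendsto_rabs tendsto_diff tl tendsto_const invk)
  then have z: "(%n. \<bar>tc n - ?x\<bar> + 1 / real (k n)) \<longlonglongrightarrow> 0" by simp
  have 1: "(%n. hc n - sc n) \<longlonglongrightarrow> 0"
   by (rule Lim_null_comparison[OF always_eventually z], rule allI) (simp only: real_norm_def le)
  have "sc \<longlonglongrightarrow> measure square {u \<in> open_square. fst u < ?x & psi r u < i}"
   using tendsto_add[OF scount[of p q r i] cum[OF i p]] unfolding sc_def by simp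
  from tendsto_add[OF 1 this] have "hc \<longlonglongrightarrow> measure square {u \<in> open_square. fst u < ?x & psi r u < i}" by simp
  then show "(%n. real (card {a \<in> {1..num_vertices (H n)}. real a <= ?x * real (num_vertices (H n)) & L (k n) r (pos n a) < i}) / real (num_vertices (H n)))
   \<longlonglongrightarrow> measure square {u \<in> open_square. fst u < ?x & psi r u < i}" unfolding nH hc_def .
 qed
 have "(%n. f (G (k n))) \<longlonglongrightarrow> fhat W" by (rule continuity_at_limit[OF cont W(1) approx Nbig limG])
 moreover have "(%n. f (H n)) \<longlonglongrightarrow> fhat W"
  by (rule continuity_at_limit[OF cont W(1) approx _ limH]) (simp_all only: nH kbig)
 ultimately have "(%n. f (G (k n)) - f (H n)) \<longlonglongrightarrow> fhat W - fhat W" by (rule tendsto_diff)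
 then have "(%n. \<bar>f (G (k n)) - f (H n)\<bar>) \<longlonglongrightarrow> 0" by (simp add: tendsto_rabs_zero)
 then have "eventually (%n. \<bar>f (G (k n)) - f (H n)\<bar> < eps) sequentially" using e by (rule order_tendstoD(2))
 then obtain n where "\<bar>f (G (k n)) - f (H n)\<bar> < eps" unfolding eventually_sequentially by blast
 then show False using S[OF k1[of n]] unfolding H_def by simp
qed

theorem theorem1p10:
  fixes f :: "ordered_graph \<Rightarrow> real"
  assumes "bounded (range f)"
  shows
    "(naturally_estimable f \<longleftrightarrow>
       (\<forall>G :: nat \<Rightarrow> ordered_graph.
          graph_seq_convergent G \<and> filterlim (\<lambda>n. num_vertices (G n)) at_top sequentially \<longrightarrow>
          convergent (\<lambda>n. f (G n))))
     \<and>
     ((\<forall>G :: nat \<Rightarrow> ordered_graph.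
          graph_seq_convergent G \<and> filterlim (\<lambda>n. num_vertices (G n)) at_top sequentially \<longrightarrow>
          convergent (\<lambda>n. f (G n))) \<longleftrightarrow>
       (\<exists>fhat :: (point \<times> point \<Rightarrow> real) \<Rightarrow> real.
          cut_shift_continuous fhat \<and>
          (\<forall>\<epsilon>>0. \<exists>k. \<forall>G. num_vertices G \<ge> k \<longrightarrow> \<bar>fhat (graph_orderon G) - f G\<bar> \<le> \<epsilon>)))"
proof -
  let ?C = "\<forall>G :: nat \<Rightarrow> ordered_graph.
    graph_seq_convergent G \<and> filterlim (\<lambda>n. num_vertices (G n)) at_top sequentially \<longrightarrow> convergent (\<lambda>n. f (G n))"
  let ?X = "\<exists>fhat. cut_shift_continuous fhat \<and>
    (\<forall>\<epsilon>>0. \<exists>k. \<forall>G. num_vertices G \<ge> k \<longrightarrow> \<bar>fhat (graph_orderon G) - f G\<bar> \<le> \<epsilon>)"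
  obtain B where "\<forall>x\<in>range f. norm x \<le> B" using assms unfolding bounded_iff by (rule exE)
  then have B: "\<bar>f G\<bar> \<le> B" for G by simp
  have 12: ?C if "naturally_estimable f"
    using estimable_imp_convergent[OF that B] by (intro allI impI) (elim conjE)
  have 21: "naturally_estimable f" if C: ?C
  proof (rule convergent_imp_estimable)
    fix G assume G: "graph_seq_convergent G"
    then have "filterlim (\<lambda>n. num_vertices (G n)) at_top sequentially" unfolding graph_seq_convergent_def by (rule conjunct1)
    with G show "convergent (\<lambda>n. f (G n))" using C by (intro C[THEN spec, THEN mp] conjI)
  qed
  have 13: ?X if "naturally_estimable f" by (rule estimable_imp_continuous_extension[OF that B])
  have 31: "naturally_estimable f" if ?X
    using that by (elim exE conjE) (rule continuous_extension_imp_estimable, assumption, elim allE impE)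
  show ?thesis
  proof (intro conjI iffI)
    show ?C if "naturally_estimable f" by (rule 12[OF that])
    show "naturally_estimable f" if ?C by (rule 21[OF that])
    show ?X if ?C by (rule 13[OF 21[OF that]])
    show ?C if ?X by (rule 12[OF 31[OF that]])
  qed
qed

end
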